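(* Let $(M,\omega)$ be a compact connected Kähler manifold of complex dimension $n\ge 1$ with $\frac{\omega}{2\pi}$ integral, and let $L$ be a Hermitian holomorphic line bundle on $M$ whose Chern connection has curvature $-i\omega$. For all $f_1,\dots,f_{2n}\in C^\infty(M)$, $$\left\|[T_{f_1}^{(k)},\dots,T_{f_{2n}}^{(k)}]\right\|=O\!\left(\frac1{k^n}\right)\quad\text{as } k\to\infty .$$
   Context: $C^\infty(M)$ is the algebra of smooth complex-valued functions on $M$. "$\frac{\omega}{2\pi}$ integral" means that its cohomology class lies in the image of $H^2(M,\mathbb Z)$. For a positive integer $k$, $H^0(M,L^{\otimes k})$ is the finite-dimensional space of holomorphic sections of $L^{\otimes k}$, with the $L^2$ inner product coming from the Hermitian metric of $L$ and the volume form $\frac{\omega^n}{n!}$; $\Pi_k:L^2(M,L^{\otimes k})\to H^0(M,L^{\otimes k})$ is the orthogonal projection. The Berezin-Toeplitz operator of $f\in C^\infty(M)$ is $T_f^{(k)}\in\mathrm{End}(H^0(M,L^{\otimes k}))$, $T_f^{(k)}s=\Pi_k(fs)$. The generalized commutator of $A_1,\dots,A_{2n}\in\mathrm{End}(V)$ ($V$ a finite-dimensional complex vector space) is $[A_1,\dots,A_{2n}]=\sum_{\sigma\in S_{2n}}\mathrm{sign}(\sigma)A_{\sigma(1)}\cdots A_{\sigma(2n)}$, where $S_{2n}$ is the symmetric group. $\|\cdot\|$ is the operator norm. The $O(1/k^n)$ means: bounded by $C/k^n$ for all sufficiently large $k$, with $C$ independent of $k$ (but allowed to depend on the functions). *)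

theory Defs
  imports "HOL-Analysis.Analysis" "HOL-Library.Landau_Symbols"
begin

section \<open>Smooth and holomorphic functions on open subsets of complex coordinate space\<close>

primrec times_differentiable_on ::
    "nat \<Rightarrow> 'a::real_normed_vector set \<Rightarrow> ('a \<Rightarrow> 'b::real_normed_vector) \<Rightarrow> bool" where
  "times_differentiable_on 0 S f \<longleftrightarrow> continuous_on S f"
| "times_differentiable_on (Suc k) S f \<longleftrightarrow>
     (\<forall>x\<in>S. f differentiable (at x)) \<and>
     (\<forall>v. times_differentiable_on k S (\<lambda>x. frechet_derivative f (at x) v))"

definition smooth_on :: "'a::real_normed_vector set \<Rightarrow> ('a \<Rightarrow> 'b::real_normed_vector) \<Rightarrow> bool" where
  "smooth_on S f \<longleftrightarrow> (\<forall>k. times_differentiable_on k S f)"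

text \<open>Holomorphic in several variables: the real derivative exists and is complex linear.\<close>

definition holo_on :: "(complex ^ 'n::finite) set \<Rightarrow> (complex ^ 'n \<Rightarrow> complex) \<Rightarrow> bool" where
  "holo_on S f \<longleftrightarrow>
     (\<forall>z\<in>S. \<exists>D. (f has_derivative D) (at z) \<and> (\<forall>c v. D (c *s v) = c * D v))"


section \<open>Complex manifolds\<close>

text \<open>The manifold is the whole topological space \<open>'m\<close>; a chart consists of its domain and its
  coordinate map (whose values outside the domain are irrelevant).  The complex dimension is
  \<open>CARD('n)\<close>.\<close>

type_synonym ('m, 'n) chart = "'m set \<times> ('m \<Rightarrow> complex ^ 'n)"

definition chart_inv :: "('m, 'n) chart \<Rightarrow> complex ^ 'n \<Rightarrow> 'm" where
  "chart_inv c = inv_into (fst c) (snd c)"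

definition is_chart :: "('m::topological_space, 'n::finite) chart \<Rightarrow> bool" where
  "is_chart c \<longleftrightarrow> open (fst c) \<and> open (snd c ` fst c) \<and>
     homeomorphism (fst c) (snd c ` fst c) (snd c) (chart_inv c)"

definition transition :: "('m, 'n) chart \<Rightarrow> ('m, 'n) chart \<Rightarrow> complex ^ 'n \<Rightarrow> complex ^ 'n" where
  "transition c d = snd d \<circ> chart_inv c"

definition complex_atlas :: "('m::topological_space, 'n::finite) chart set \<Rightarrow> bool" where
  "complex_atlas A \<longleftrightarrow> (\<forall>c\<in>A. is_chart c) \<and> (\<Union>c\<in>A. fst c) = UNIV \<and>
     (\<forall>c\<in>A. \<forall>d\<in>A. \<forall>j. holo_on (snd c ` (fst c \<inter> fst d)) (\<lambda>z. transition c d z $ j))"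

text \<open>In the following, \<open>W\<close> is always an open subset of the manifold.\<close>

definition smooth_fun ::
    "('m, 'n::finite) chart set \<Rightarrow> 'm set \<Rightarrow> ('m \<Rightarrow> 'b::real_normed_vector) \<Rightarrow> bool" where
  "smooth_fun A W f \<longleftrightarrow> (\<forall>c\<in>A. smooth_on (snd c ` (fst c \<inter> W)) (f \<circ> chart_inv c))"

definition holo_fun ::
    "('m, 'n::finite) chart set \<Rightarrow> 'm set \<Rightarrow> ('m \<Rightarrow> complex) \<Rightarrow> bool" where
  "holo_fun A W f \<longleftrightarrow> (\<forall>c\<in>A. holo_on (snd c ` (fst c \<inter> W)) (f \<circ> chart_inv c))"

definition smooth_functions :: "('m, 'n::finite) chart set \<Rightarrow> ('m \<Rightarrow> complex) set" where
  "smooth_functions A = {f. smooth_fun A UNIV f}"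


section \<open>Differential forms of degree one and two\<close>

text \<open>A tangent vector at \<open>p\<close> is given by a chart \<open>c\<close> around \<open>p\<close> together with its
  coordinate vector in \<open>complex ^ 'n\<close>, regarded as a real vector
  space.  So \<open>\<alpha> c p v\<close> is the value
  of the form \<open>\<alpha>\<close> at \<open>p\<close> on the tangent vector that has coordinates \<open>v\<close> in the chart \<open>c\<close>.\<close>

type_synonym ('m, 'n, 'b) form1 = "('m, 'n) chart \<Rightarrow> 'm \<Rightarrow> complex ^ 'n \<Rightarrow> 'b"
type_synonym ('m, 'n, 'b) form2 =
  "('m, 'n) chart \<Rightarrow> 'm \<Rightarrow> complex ^ 'n \<Rightarrow> complex ^ 'n \<Rightarrow> 'b"

definition change_coords ::
    "('m, 'n::finite) chart \<Rightarrow> ('m, 'n) chart \<Rightarrow> 'm \<Rightarrow> complex ^ 'n \<Rightarrow> complex ^ 'n" where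
  "change_coords c d p = frechet_derivative (transition c d) (at (snd c p))"

definition smooth_form1 ::
    "('m, 'n::finite) chart set \<Rightarrow> 'm set \<Rightarrow> ('m, 'n, 'b::real_normed_vector) form1 \<Rightarrow> bool" where
  "smooth_form1 A W \<alpha> \<longleftrightarrow>
     (\<forall>c\<in>A. \<forall>p\<in>fst c \<inter> W. linear (\<alpha> c p)) \<and>
     (\<forall>c\<in>A. \<forall>d\<in>A. \<forall>p\<in>fst c \<inter> fst d \<inter> W. \<forall>v. \<alpha> c p v = \<alpha> d p (change_coords c d p v)) \<and>
     (\<forall>c\<in>A. \<forall>v. smooth_on (snd c ` (fst c \<inter> W)) (\<lambda>z. \<alpha> c (chart_inv c z) v))"

definition smooth_form2 ::
    "('m, 'n::finite) chart set \<Rightarrow> 'm set \<Rightarrow> ('m, 'n, 'b::real_normed_vector) form2 \<Rightarrow> bool" where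
  "smooth_form2 A W \<eta> \<longleftrightarrow>
     (\<forall>c\<in>A. \<forall>p\<in>fst c \<inter> W. bilinear (\<eta> c p) \<and> (\<forall>u v. \<eta> c p u v = - \<eta> c p v u)) \<and>
     (\<forall>c\<in>A. \<forall>d\<in>A. \<forall>p\<in>fst c \<inter> fst d \<inter> W. \<forall>u v.
        \<eta> c p u v = \<eta> d p (change_coords c d p u) (change_coords c d p v)) \<and>
     (\<forall>c\<in>A. \<forall>u v. smooth_on (snd c ` (fst c \<inter> W)) (\<lambda>z. \<eta> c (chart_inv c z) u v))"

text \<open>Exterior derivatives in coordinates, with constant vector fields plugged in.  The
  normalisation is the one without numerical factors: \<open>dx \<and> dy\<close> is 1 on the standard basis.\<close>

definition ext_d0 ::
    "('m \<Rightarrow> 'b::real_normed_vector) \<Rightarrow> ('m, 'n::finite, 'b) form1" where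
  "ext_d0 f c p v = frechet_derivative (f \<circ> chart_inv c) (at (snd c p)) v"

definition ext_d1 ::
    "('m, 'n::finite, 'b::real_normed_vector) form1 \<Rightarrow> ('m, 'n, 'b) form2" where
  "ext_d1 \<alpha> c p u v =
     frechet_derivative (\<lambda>z. \<alpha> c (chart_inv c z) v) (at (snd c p)) u -
     frechet_derivative (\<lambda>z. \<alpha> c (chart_inv c z) u) (at (snd c p)) v"

definition ext_d2 ::
    "('m, 'n::finite, 'b::real_normed_vector) form2 \<Rightarrow>
     ('m, 'n) chart \<Rightarrow> 'm \<Rightarrow> complex ^ 'n \<Rightarrow> complex ^ 'n \<Rightarrow> complex ^ 'n \<Rightarrow> 'b" where
  "ext_d2 \<eta> c p u v w =
     frechet_derivative (\<lambda>z. \<eta> c (chart_inv c z) v w) (at (snd c p)) u -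
     frechet_derivative (\<lambda>z. \<eta> c (chart_inv c z) u w) (at (snd c p)) v +
     frechet_derivative (\<lambda>z. \<eta> c (chart_inv c z) u v) (at (snd c p)) w"


section \<open>Kaehler manifolds\<close>

text \<open>The complex structure acts on coordinate vectors as multiplication by \<open>\<i>\<close>.  The sign
  convention is that \<open>(u, v) \<mapsto> \<omega> (u, J v)\<close> is the Riemannian metric.  With it, a Hermitian line
  bundle of curvature \<open>-\<i> \<omega>\<close> is positive.\<close>

definition kahler_form ::
    "('m, 'n::finite) chart set \<Rightarrow> ('m, 'n, real) form2 \<Rightarrow> bool" where
  "kahler_form A \<omega> \<longleftrightarrow> smooth_form2 A UNIV \<omega> \<and>
     (\<forall>c\<in>A. \<forall>p\<in>fst c.
        (\<forall>u v w. ext_d2 \<omega> c p u v w = 0) \<and>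
        (\<forall>u v. \<omega> c p (\<i> *s u) (\<i> *s v) = \<omega> c p u v) \<and>
        (\<forall>u. u \<noteq> 0 \<longrightarrow> \<omega> c p u (\<i> *s u) > 0))"

definition compact_connected_kahler_manifold ::
    "('m::t2_space, 'n::finite) chart set \<Rightarrow> ('m, 'n, real) form2 \<Rightarrow> bool" where
  "compact_connected_kahler_manifold A \<omega> \<longleftrightarrow>
     compact (UNIV :: 'm set) \<and> connected (UNIV :: 'm set) \<and> complex_atlas A \<and> kahler_form A \<omega>"

text \<open>The class of a closed real 2-form \<open>\<eta>\<close> lies in the image of \<open>H\<^sup>2(M,\<int>)\<close> in \<open>H\<^sup>2(M,\<real>)\<close>.
  Cohomology is Cech cohomology with constant coefficients.  The Cech-de Rham isomorphism sends
  \<open>[\<eta>]\<close> to the class of \<open>f V W - f U W + f U V\<close>, where \<open>d (\<theta> U) = \<eta>\<close> on \<open>U\<close> and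
  \<open>d (f U V) = \<theta> V - \<theta> U\<close> on \<open>U \<inter> V\<close>.  A coboundary of constants can be absorbed into \<open>f\<close>, so the
  class is integral iff, on some open cover, this cocycle can be made integer-valued.\<close>

definition integral_class ::
    "('m::topological_space, 'n::finite) chart set \<Rightarrow> ('m, 'n, real) form2 \<Rightarrow> bool" where
  "integral_class A \<eta> \<longleftrightarrow> (\<exists>\<U> \<theta> f.
     (\<forall>U\<in>\<U>. open U) \<and> \<Union>\<U> = UNIV \<and>
     (\<forall>U\<in>\<U>. smooth_form1 A U (\<theta> U) \<and>
        (\<forall>c\<in>A. \<forall>p\<in>fst c \<inter> U. \<forall>u v. ext_d1 (\<theta> U) c p u v = \<eta> c p u v)) \<and>
     (\<forall>U\<in>\<U>. \<forall>V\<in>\<U>. smooth_fun A (U \<inter> V) (f U V) \<and>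
        (\<forall>c\<in>A. \<forall>p\<in>fst c \<inter> U \<inter> V. \<forall>v. ext_d0 (f U V) c p v = \<theta> V c p v - \<theta> U c p v)) \<and>
     (\<forall>U\<in>\<U>. \<forall>V\<in>\<U>. \<forall>W\<in>\<U>. \<forall>p\<in>U \<inter> V \<inter> W. f V W p - f U W p + f U V p \<in> \<int>))"

text \<open>The density of \<open>\<omega>\<^sup>n / n!\<close> with respect to Lebesgue measure in the chart \<open>c\<close>, that is, the
  value of this \<open>2n\<close>-form on the positively oriented real basis
  \<open>e\<^sub>1, \<i> e\<^sub>1, \<dots>, e\<^sub>n, \<i> e\<^sub>n\<close>.  The basis is indexed by pairs \<open>(j, t)\<close>, where \<open>(j, False)\<close> stands for
  \<open>e\<^sub>j\<close> and \<open>(j, True)\<close> for \<open>\<i> e\<^sub>j\<close>.  The factor \<open>1 / 2\<^sup>n\<close> belongs to the exterior power.\<close>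

definition real_basis :: "'n::finite \<times> bool \<Rightarrow> complex ^ 'n" where
  "real_basis = (\<lambda>(j, t). axis j (if t then \<i> else 1))"

definition volume_density ::
    "('m, 'n::finite, real) form2 \<Rightarrow> ('m, 'n) chart \<Rightarrow> 'm \<Rightarrow> real" where
  "volume_density \<omega> c p =
     (\<Sum>\<sigma> | \<sigma> permutes (UNIV :: ('n \<times> bool) set).
        of_int (sign \<sigma>) *
        (\<Prod>j\<in>UNIV. \<omega> c p (real_basis (\<sigma> (j, False))) (real_basis (\<sigma> (j, True)))))
     / (2 ^ CARD('n) * fact CARD('n))"

text \<open>The Borel measure of the volume form, characterised by its restrictions to chart domains.\<close>

definition volume_measure ::
    "('m::topological_space, 'n::finite) chart set \<Rightarrow> ('m, 'n, real) form2 \<Rightarrow> 'm measure" where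
  "volume_measure A \<omega> = (THE \<mu>. sets \<mu> = sets borel \<and>
     (\<forall>c\<in>A. \<forall>B\<in>sets borel. B \<subseteq> fst c \<longrightarrow>
        emeasure \<mu> B =
          (\<integral>\<^sup>+ z\<in>snd c ` B. ennreal (volume_density \<omega> c (chart_inv c z)) \<partial>lborel)))"


section \<open>Hermitian holomorphic line bundles\<close>

text \<open>A holomorphic line bundle is given by local frames \<open>e\<^sub>i\<close> over the open sets \<open>lb_dom L i\<close> of a
  cover, related by \<open>e\<^sub>j = g\<^sub>i\<^sub>j e\<^sub>i\<close> with \<open>g\<^sub>i\<^sub>j = lb_trans L i j\<close>.  The cocycle condition makes the
  \<open>g\<^sub>i\<^sub>j\<close> nowhere zero.\<close>

record ('m, 'i) line_bundle =
  lb_dom :: "'i \<Rightarrow> 'm set"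
  lb_trans :: "'i \<Rightarrow> 'i \<Rightarrow> 'm \<Rightarrow> complex"

definition holomorphic_line_bundle ::
    "('m::topological_space, 'n::finite) chart set \<Rightarrow> ('m, 'i) line_bundle \<Rightarrow> bool" where
  "holomorphic_line_bundle A L \<longleftrightarrow>
     (\<forall>i. open (lb_dom L i)) \<and> (\<Union>i. lb_dom L i) = UNIV \<and>
     (\<forall>i j. holo_fun A (lb_dom L i \<inter> lb_dom L j) (lb_trans L i j)) \<and>
     (\<forall>i. \<forall>p\<in>lb_dom L i. lb_trans L i i p = 1) \<and>
     (\<forall>i j k. \<forall>p\<in>lb_dom L i \<inter> lb_dom L j \<inter> lb_dom L k.
        lb_trans L i j p * lb_trans L j k p = lb_trans L i k p)"

text \<open>A Hermitian metric is given by the functions \<open>h\<^sub>i = |e\<^sub>i|\<^sup>2\<close>.\<close>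

definition hermitian_metric ::
    "('m, 'n::finite) chart set \<Rightarrow> ('m, 'i) line_bundle \<Rightarrow> ('i \<Rightarrow> 'm \<Rightarrow> real) \<Rightarrow> bool" where
  "hermitian_metric A L h \<longleftrightarrow>
     (\<forall>i. smooth_fun A (lb_dom L i) (h i)) \<and>
     (\<forall>i. \<forall>p\<in>lb_dom L i. h i p > 0) \<and>
     (\<forall>i j. \<forall>p\<in>lb_dom L i \<inter> lb_dom L j. h j p = (cmod (lb_trans L i j p))\<^sup>2 * h i p)"

text \<open>A connection is given by its connection forms: \<open>\<nabla> e\<^sub>i = \<theta>\<^sub>i e\<^sub>i\<close>.  It follows that
  \<open>\<theta>\<^sub>j = \<theta>\<^sub>i + dg\<^sub>i\<^sub>j / g\<^sub>i\<^sub>j\<close>.\<close>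

definition connection ::
    "('m, 'n::finite) chart set \<Rightarrow> ('m, 'i) line_bundle \<Rightarrow>
     ('i \<Rightarrow> ('m, 'n, complex) form1) \<Rightarrow> bool" where
  "connection A L \<theta> \<longleftrightarrow>
     (\<forall>i. smooth_form1 A (lb_dom L i) (\<theta> i)) \<and>
     (\<forall>i j. \<forall>c\<in>A. \<forall>p\<in>fst c \<inter> lb_dom L i \<inter> lb_dom L j. \<forall>v.
        \<theta> j c p v = \<theta> i c p v + ext_d0 (lb_trans L i j) c p v / lb_trans L i j p)"

text \<open>The Chern connection is the connection compatible with the holomorphic structure (its
  connection forms in the holomorphic frames \<open>e\<^sub>i\<close> are of type \<open>(1,0)\<close>) and with the metric
  (\<open>d|e\<^sub>i|\<^sup>2 = \<langle>\<nabla>e\<^sub>i, e\<^sub>i\<rangle> + \<langle>e\<^sub>i, \<nabla>e\<^sub>i\<rangle>\<close>).\<close>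

definition chern_connection ::
    "('m, 'n::finite) chart set \<Rightarrow> ('m, 'i) line_bundle \<Rightarrow> ('i \<Rightarrow> 'm \<Rightarrow> real) \<Rightarrow>
     ('i \<Rightarrow> ('m, 'n, complex) form1) \<Rightarrow> bool" where
  "chern_connection A L h \<theta> \<longleftrightarrow> connection A L \<theta> \<and>
     (\<forall>i. \<forall>c\<in>A. \<forall>p\<in>fst c \<inter> lb_dom L i. \<forall>v.
        \<theta> i c p (\<i> *s v) = \<i> * \<theta> i c p v \<and>
        of_real (ext_d0 (h i) c p v) = (\<theta> i c p v + cnj (\<theta> i c p v)) * of_real (h i p))"

text \<open>The curvature of a connection on a line bundle is the 2-form \<open>d\<theta>\<^sub>i\<close>.\<close>

definition has_curvature ::
    "('m, 'n::finite) chart set \<Rightarrow> ('m, 'i) line_bundle \<Rightarrow>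
     ('i \<Rightarrow> ('m, 'n, complex) form1) \<Rightarrow> ('m, 'n, complex) form2 \<Rightarrow> bool" where
  "has_curvature A L \<theta> F \<longleftrightarrow>
     (\<forall>i. \<forall>c\<in>A. \<forall>p\<in>fst c \<inter> lb_dom L i. \<forall>u v. ext_d1 (\<theta> i) c p u v = F c p u v)"

text \<open>Tensor powers, with frames \<open>e\<^sub>i \<otimes> \<dots> \<otimes> e\<^sub>i\<close>.\<close>

definition tensor_power :: "('m, 'i) line_bundle \<Rightarrow> nat \<Rightarrow> ('m, 'i) line_bundle" where
  "tensor_power L k = \<lparr>lb_dom = lb_dom L, lb_trans = (\<lambda>i j p. lb_trans L i j p ^ k)\<rparr>"

definition metric_power :: "('i \<Rightarrow> 'm \<Rightarrow> real) \<Rightarrow> nat \<Rightarrow> 'i \<Rightarrow> 'm \<Rightarrow> real" where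
  "metric_power h k = (\<lambda>i p. h i p ^ k)"


section \<open>Sections and Toeplitz operators\<close>

text \<open>A section is given by its coefficients \<open>s\<^sub>i\<close> with respect to the frames \<open>e\<^sub>i\<close>, extended by 0
  outside the domain of \<open>e\<^sub>i\<close> so that equal sections are equal as functions.\<close>

type_synonym ('m, 'i) lb_section = "'i \<Rightarrow> 'm \<Rightarrow> complex"

definition is_section :: "('m, 'i) line_bundle \<Rightarrow> ('m, 'i) lb_section \<Rightarrow> bool" where
  "is_section L s \<longleftrightarrow>
     (\<forall>i j. \<forall>p\<in>lb_dom L i \<inter> lb_dom L j. s i p = lb_trans L i j p * s j p) \<and>
     (\<forall>i. \<forall>p. p \<notin> lb_dom L i \<longrightarrow> s i p = 0)"

definition holomorphic_sections ::
    "('m, 'n::finite) chart set \<Rightarrow> ('m, 'i) line_bundle \<Rightarrow> ('m, 'i) lb_section set" where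
  "holomorphic_sections A L = {s. is_section L s \<and> (\<forall>i. holo_fun A (lb_dom L i) (s i))}"

text \<open>The pointwise Hermitian product; it does not depend on the chosen frame.\<close>

definition fibre_inner ::
    "('m, 'i) line_bundle \<Rightarrow> ('i \<Rightarrow> 'm \<Rightarrow> real) \<Rightarrow>
     ('m, 'i) lb_section \<Rightarrow> ('m, 'i) lb_section \<Rightarrow> 'm \<Rightarrow> complex" where
  "fibre_inner L h s t p =
     (let i = (SOME i. p \<in> lb_dom L i) in of_real (h i p) * s i p * cnj (t i p))"

definition L2_inner ::
    "'m measure \<Rightarrow> ('m, 'i) line_bundle \<Rightarrow> ('i \<Rightarrow> 'm \<Rightarrow> real) \<Rightarrow>
     ('m, 'i) lb_section \<Rightarrow> ('m, 'i) lb_section \<Rightarrow> complex" where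
  "L2_inner \<mu> L h s t = (\<integral>p. fibre_inner L h s t p \<partial>\<mu>)"

definition L2_norm ::
    "'m measure \<Rightarrow> ('m, 'i) line_bundle \<Rightarrow> ('i \<Rightarrow> 'm \<Rightarrow> real) \<Rightarrow> ('m, 'i) lb_section \<Rightarrow> real" where
  "L2_norm \<mu> L h s = sqrt (Re (L2_inner \<mu> L h s s))"

text \<open>The orthogonal projection; its argument \<open>s\<close> is meant to be square-integrable.\<close>

definition holo_projection ::
    "('m, 'n::finite) chart set \<Rightarrow> 'm measure \<Rightarrow> ('m, 'i) line_bundle \<Rightarrow> ('i \<Rightarrow> 'm \<Rightarrow> real) \<Rightarrow>
     ('m, 'i) lb_section \<Rightarrow> ('m, 'i) lb_section" where
  "holo_projection A \<mu> L h s = (THE t. t \<in> holomorphic_sections A L \<and>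
     (\<forall>u\<in>holomorphic_sections A L. L2_inner \<mu> L h (\<lambda>i p. s i p - t i p) u = 0))"

definition toeplitz ::
    "('m, 'n::finite) chart set \<Rightarrow> 'm measure \<Rightarrow> ('m, 'i) line_bundle \<Rightarrow> ('i \<Rightarrow> 'm \<Rightarrow> real) \<Rightarrow>
     ('m \<Rightarrow> complex) \<Rightarrow> ('m, 'i) lb_section \<Rightarrow> ('m, 'i) lb_section" where
  "toeplitz A \<mu> L h f s = holo_projection A \<mu> L h (\<lambda>i p. f p * s i p)"

text \<open>The Berezin-Toeplitz operator of level \<open>k\<close>; only its values on
  \<open>holomorphic_sections A (tensor_power L k)\<close> matter.\<close>

definition berezin_toeplitz ::
    "('m::topological_space, 'n::finite) chart set \<Rightarrow> ('m, 'n, real) form2 \<Rightarrow>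
     ('m, 'i) line_bundle \<Rightarrow> ('i \<Rightarrow> 'm \<Rightarrow> real) \<Rightarrow> nat \<Rightarrow>
     ('m \<Rightarrow> complex) \<Rightarrow> ('m, 'i) lb_section \<Rightarrow> ('m, 'i) lb_section" where
  "berezin_toeplitz A \<omega> L h k =
     toeplitz A (volume_measure A \<omega>) (tensor_power L k) (metric_power h k)"

definition generalized_commutator ::
    "nat \<Rightarrow> (nat \<Rightarrow> ('m, 'i) lb_section \<Rightarrow> ('m, 'i) lb_section) \<Rightarrow>
     ('m, 'i) lb_section \<Rightarrow> ('m, 'i) lb_section" where
  "generalized_commutator m T s = (\<lambda>i p. \<Sum>\<sigma> | \<sigma> permutes {1..m}.
     of_int (sign \<sigma>) * foldr (\<lambda>j. T (\<sigma> j)) [1..<Suc m] s i p)"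

text \<open>The operator norm of an endomorphism of the finite-dimensional space of holomorphic sections,
  where the supremum is finite.  If that space is zero, the value is 0.\<close>

definition L2_operator_norm ::
    "('m, 'n::finite) chart set \<Rightarrow> 'm measure \<Rightarrow> ('m, 'i) line_bundle \<Rightarrow> ('i \<Rightarrow> 'm \<Rightarrow> real) \<Rightarrow>
     (('m, 'i) lb_section \<Rightarrow> ('m, 'i) lb_section) \<Rightarrow> real" where
  "L2_operator_norm A \<mu> L h T =
     (SUP s\<in>{s \<in> holomorphic_sections A L. L2_norm \<mu> L h s \<le> 1}. L2_norm \<mu> L h (T s))"

end

theory Submission
 imports Defs "HOL-Complex_Analysis.Complex_Analysis"
begin

text \<open>Multiplication by a function \<open>f\<close> almost preserves holomorphic sections: the squared distance of
 \<open>f s\<close> from the holomorphic sections is at most \<open>C / k\<close> times the squared norm of \<open>s\<close>.  Indeed, on balls of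
 radius \<open>R / sqrt k\<close> the metric of the \<open>k\<close>-th power is, up to a holomorphic change of frame, comparable
 to a Gaussian weight, and a cut-off Cauchy kernel yields holomorphic approximations there whose error is
 controlled by the antiholomorphic derivative.  Gluing them with bump functions of width \<open>R / sqrt k\<close>
 reduces the antiholomorphic energy by a factor \<open>O(1 / R\<^sup>2)\<close>, and iterating this for a large \<open>R\<close> converges to a
 holomorphic section.  Applied to both sides of \<open>T\<^sub>f T\<^sub>g - T\<^sub>f\<^sub>g\<close>, the distance estimate
 shows that this operator has norm \<open>O(1 / k)\<close>; hence so have the commutators \<open>[T\<^sub>f, T\<^sub>g]\<close>.  Finally \<open>2 ^ n\<close> times
 the generalized commutator is a signed sum of products of \<open>n\<close> such commutators.\<close>

section \<open>Continuously differentiable and holomorphic functions\<close>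

text \<open>At the scale 1 / sqrt k the k-th power of the metric differs from a Gaussian by a
  bounded factor, so the local constants do not depend on k. The obstacle to gluing there is that
  the bump functions have derivatives of size sqrt k; but local approximation gains 1 / k in the
  squared norm, and the two powers of k cancel. Only the factor 1 / R^2 is left. The local constants
  and the overlap numbers do not depend on R either, so R can be fixed before k goes to infinity.
  The price is that the Taylor remainder of the weight must be small on balls of radius proportional
  to R / sqrt k, which only affects how large k has to be. A defect of order 1 / sqrt k for a single
  function is enough because a product of operators involves two defects, of one function and of the
  conjugate of the other. The limiting argument that turns glued sections into a holomorphic one
  also shows that the holomorphic sections are complete, and this is what makes the projection,
  given as a definite description, meaningful. One continuous derivative is the regularity used
  throughout, since the cutoffs are built from the square of the positive part.\<close>

abbreviation fder where "fder f x == frechet_derivative f (at x)"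

abbreviation wint :: "'a::euclidean_space set => ('a => real) => ennreal" where
 "wint S f == \<integral>\<^sup>+z. ennreal (f z) * indicator S z \<partial>lborel"

lemma weighted_measurable:
 fixes f :: "'a::topological_space => real"
 assumes "S \<in> sets borel" "continuous_on S f"
 shows "(%z. ennreal (f z) * indicator S z) \<in> borel_measurable borel"
proof -
 have "(%z. if z \<in> S then f z else 0) \<in> borel_measurable borel"
  by (rule borel_measurable_continuous_on_if) (auto intro: assms)
 then have "(%z. ennreal (if z \<in> S then f z else 0)) \<in> borel_measurable borel" by measurable
 moreover have "(%z. ennreal (f z) * indicator S z) = (%z. ennreal (if z \<in> S then f z else 0))"
  by (auto simp: fun_eq_iff indicator_def)
 ultimately show ?thesis by simp
qed

text \<open>\<open>ennreal\<close> truncates negative values at zero, so only the constant needs a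
  sign.\<close>

lemma wint_mono:
 assumes "T \<in> sets borel" "continuous_on T g" "c \<ge> 0" "S \<subseteq> T" "!!z. z \<in> S ==> f z \<le> c * g z"
 shows "wint S f \<le> ennreal c * wint T g"
proof -
 have "wint S f \<le> (\<integral>\<^sup>+z. ennreal c * (ennreal (g z) * indicator T z) \<partial>lborel)"
  using assms(3,4) ennreal_leI[OF assms(5)]
  by (intro nn_integral_mono) (auto simp: indicator_def ennreal_mult')
 also have "... = ennreal c * wint T g"
  by (rule nn_integral_cmult) (use weighted_measurable[OF assms(1,2)] in simp)
 finally show ?thesis .
qed

text \<open>Differentiability refers to full neighbourhoods of the points, and continuity of the
  derivative is asked for one direction at a time, which is the same thing in finite dimension. This
  is the regularity shared by cutoffs, local holomorphic functions and glued sections.\<close>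

definition C1_on :: "'a::euclidean_space set => ('a => 'b::euclidean_space) => bool" where
 "C1_on S f \<longleftrightarrow> (\<forall>x\<in>S. f differentiable (at x)) \<and>
   (\<forall>v. continuous_on S (%x. fder f x v))"

lemma C1_onI:
 assumes "!!x. x \<in> S ==> (f has_derivative f' x) (at x)"
  and "!!v. continuous_on S (%x. f' x v)"
 shows "C1_on S f"
proof -
 have "fder f x = f' x" if "x \<in> S" for x
  using assms(1)[OF that] frechet_derivative_at by metis
 then show ?thesis
  unfolding C1_on_def
  using assms by (auto simp: differentiable_def cong: continuous_on_cong)
qed

lemma C1_onD:
 assumes "C1_on S f" "x \<in> S"
 shows "(f has_derivative fder f x) (at x)"
 using assms unfolding C1_on_def by (simp add: frechet_derivative_works)

lemma C1_on_deriv_cont: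
 assumes "C1_on S f"
 shows "continuous_on S (%x. fder f x v)"
 using assms unfolding C1_on_def by simp

lemma C1_on_subset: "C1_on S f ==> T \<subseteq> S ==> C1_on T f"
 unfolding C1_on_def by (meson continuous_on_subset subsetD)

lemma C1_on_cont:
 assumes "C1_on S f" shows "continuous_on S f"
 using assms unfolding C1_on_def
 by (meson continuous_at_imp_continuous_on differentiable_imp_continuous_within)

lemma frechet_derivative_cong_open:
 assumes "open S" "x \<in> S" "!!y. y \<in> S ==> f y = g y"
 shows "fder f x = fder g x"
proof -
 have "(f has_derivative D) (at x) \<longleftrightarrow> (g has_derivative D) (at x)" for D
  by (metis assms has_derivative_transform_within_open)
 then show ?thesis unfolding frechet_derivative_def by simp
qed

lemma C1_on_cong:
 assumes "open S" "C1_on S f" "!!y. y \<in> S ==> f y = g y"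
 shows "C1_on S g"
proof (rule C1_onI)
 show "(g has_derivative fder f x) (at x)" if "x \<in> S" for x
  using has_derivative_transform_within_open[OF C1_onD[OF assms(2) that] assms(1) that] assms(3)
  by blast
qed (rule C1_on_deriv_cont[OF assms(2)])

lemma C1_on_local:
 assumes "!!x. x \<in> S ==> \<exists>U. open U \<and> x \<in> U \<and> C1_on (U \<inter> S) f"
 shows "C1_on S f"
proof -
 have "continuous (at x within S) (%x. fder f x v)" if x: "x \<in> S" for x v
 proof -
  obtain U where U: "open U" "x \<in> U" "C1_on (U \<inter> S) f" using assms x by blast
  have "continuous (at x within U \<inter> S) (%x. fder f x v)"
   using C1_on_deriv_cont[OF U(3)] x U(2)
   by (simp add: continuous_on_eq_continuous_within)
  moreover have "at x within (U \<inter> S) = at x within S"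
   by (rule at_within_nhd[OF U(2,1)]) auto
  ultimately show ?thesis by simp
 qed
 moreover have "f differentiable (at x)" if "x \<in> S" for x
  using assms[OF that] that unfolding C1_on_def by blast
 ultimately show ?thesis unfolding C1_on_def continuous_on_eq_continuous_within by blast
qed

lemma has_derivative_euclidean_sum:
 fixes f :: "'a::euclidean_space => 'b::euclidean_space"
 assumes "linear f"
 shows "f v = (\<Sum>b\<in>Basis. (v \<bullet> b) *\<^sub>R f b)"
 by (metis (no_types, lifting) assms euclidean_representation linear_cmul linear_sum sum.cong)

lemma C1_on_linear_deriv:
 assumes "C1_on S f" "x \<in> S"
 shows "linear (fder f x)"
 using C1_onD[OF assms] has_derivative_linear by blast

text \<open>The derivative is expanded in the standard basis, since continuity is given for fixed
  directions while here point and direction vary together.\<close>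

lemma C1_on_deriv_cont2:
 assumes "C1_on S f" "continuous_on T u" "u ` T \<subseteq> S" "continuous_on T w"
 shows "continuous_on T (%x. fder f (u x) (w x))"
proof -
 have "continuous_on T (%x. \<Sum>b\<in>Basis. (w x \<bullet> b) *\<^sub>R fder f (u x) b)"
  using assms
  by (intro continuous_intros continuous_on_compose2[OF C1_on_deriv_cont[OF assms(1)]]) auto
 moreover have "(\<Sum>b\<in>Basis. (w x \<bullet> b) *\<^sub>R fder f (u x) b) = fder f (u x) (w x)"
  if "x \<in> T" for x
  using assms(3) that by (intro has_derivative_euclidean_sum[symmetric] C1_on_linear_deriv[OF assms(1)]) auto
 ultimately show ?thesis by (rule continuous_on_eq)
qed

lemma C1_on_const: "C1_on S (%x. c)"
 by (rule C1_onI[where f'="%_ _. 0"]) auto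

lemma C1_on_linear:
 assumes "bounded_linear f" shows "C1_on S f"
 by (rule C1_onI[where f'="%_. f"]) (auto intro: bounded_linear_imp_has_derivative[OF assms])

lemma C1_on_add:
 assumes "C1_on S f" "C1_on S g" shows "C1_on S (%x. f x + g x)"
 by (rule C1_onI[where f'="%x v. fder f x v + fder g x v"])
   (use assms in \<open>auto intro!: continuous_intros C1_on_deriv_cont derivative_eq_intros dest: C1_onD\<close>)

lemma C1_on_diff:
 assumes "C1_on S f" "C1_on S g" shows "C1_on S (%x. f x - g x)"
 by (rule C1_onI[where f'="%x v. fder f x v - fder g x v"])
   (use assms in \<open>auto intro!: continuous_intros C1_on_deriv_cont derivative_eq_intros dest: C1_onD\<close>)

lemma C1_on_mult:
 fixes f g :: "'a::euclidean_space => 'b::{euclidean_space,real_normed_algebra}"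
 assumes "C1_on S f" "C1_on S g" shows "C1_on S (%x. f x * g x)"
 by (rule C1_onI[where f'="%x v. f x * fder g x v + fder f x v * g x"])
   (use assms in \<open>auto intro!: continuous_intros C1_on_deriv_cont derivative_eq_intros
    C1_on_cont[OF assms(1)] C1_on_cont[OF assms(2)] dest: C1_onD\<close>)

lemma C1_on_sum:
 assumes "!!i. i \<in> I ==> C1_on S (f i)" shows "C1_on S (%x. \<Sum>i\<in>I. f i x)"
 by (rule C1_onI[where f'="%x v. \<Sum>i\<in>I. fder (f i) x v"])
   (use assms in \<open>auto intro!: continuous_intros C1_on_deriv_cont has_derivative_sum dest: C1_onD\<close>)

lemma C1_on_compose:
 assumes "C1_on T f" "C1_on S g" "g ` S \<subseteq> T"
 shows "C1_on S (%x. f (g x))"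
proof (rule C1_onI[where f'="%x v. fder f (g x) (fder g x v)"])
 fix x assume x: "x \<in> S"
 then have "g x \<in> T" using assms by auto
 show "((%x. f (g x)) has_derivative (%v. fder f (g x) (fder g x v))) (at x)"
  using diff_chain_at[OF C1_onD[OF assms(2) x] C1_onD[OF assms(1) \<open>g x \<in> T\<close>]]
  by (simp add: o_def)
next
 show "continuous_on S (%x. fder f (g x) (fder g x v))" for v
  by (intro C1_on_deriv_cont2[OF assms(1) _ assms(3)] C1_on_cont[OF assms(2)]
    C1_on_deriv_cont[OF assms(2)])
qed

lemma C1_on_field:
 fixes f :: "'b::{euclidean_space,real_normed_field} => 'b"
 assumes "!!x. x \<in> S ==> (f has_field_derivative f' x) (at x)" "continuous_on S f'"
 shows "C1_on S f"
 by (rule C1_onI[where f'="%x v. f' x * v"])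
   (use assms in \<open>auto intro!: continuous_intros simp: has_field_derivative_def\<close>)

lemma C1_on_inverse:
 fixes f :: "'a::euclidean_space => 'b::{euclidean_space,real_normed_field}"
 assumes "C1_on S f" "!!x. x \<in> S ==> f x \<noteq> 0" shows "C1_on S (%x. inverse (f x))"
proof -
 have "C1_on (-{0}) (inverse :: 'b => 'b)"
  by (rule C1_on_field[where f'="%x. - (inverse x ^ 2)"])
    (auto intro!: derivative_eq_intros continuous_intros simp: power2_eq_square)
 then show ?thesis
  by (rule C1_on_compose) (use assms in auto)
qed

lemma C1_on_divide:
 fixes f g :: "'a::euclidean_space => 'b::{euclidean_space,real_normed_field}"
 assumes "C1_on S f" "C1_on S g" "!!x. x \<in> S ==> g x \<noteq> 0" shows "C1_on S (%x. f x / g x)"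
 using C1_on_mult[OF assms(1) C1_on_inverse[OF assms(2,3)]] by (simp add: divide_inverse)

lemma C1_on_of_real:
 assumes "C1_on S f" shows "C1_on S (%x. of_real (f x) :: complex)"
 using C1_on_compose[OF C1_on_linear[OF bounded_linear_of_real] assms] by auto

lemma C1_on_vec:
 fixes f :: "'a::euclidean_space => complex ^ 'n::finite"
 assumes "!!i. C1_on S (%x. f x $ i)"
 shows "C1_on S f"
proof (rule C1_onI[where f'="%x v. \<chi> i. fder (%x. f x $ i) x v"])
 fix x assume x: "x \<in> S"
 show "(f has_derivative (%v. \<chi> i. fder (%x. f x $ i) x v)) (at x)"
  apply (subst has_derivative_componentwise_within)
  apply (auto simp: Basis_vec_def inner_axis)
  subgoal for i b
   using has_derivative_inner_left[OF C1_onD[OF assms x], of i b] by simp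
  done
next
 show "continuous_on S (%x. \<chi> i. fder (%x. f x $ i) x v)" for v
  by (intro continuous_on_vec_lambda C1_on_deriv_cont assms)
qed

subsection \<open>The antiholomorphic derivative\<close>

lemma norm_smult_vec: "norm (c *s (v :: complex ^ 'n::finite)) = norm c * norm v"
 unfolding norm_vec_def vector_scalar_mult_def
 by (simp add: norm_mult L2_set_right_distrib)

lemma bounded_linear_smult_vec: "bounded_linear (%v :: complex ^ 'n::finite. c *s v)"
 by (rule bounded_linear_intro[where K="norm c"])
   (auto simp: vec_eq_iff algebra_simps norm_smult_vec)

lemma bounded_linear_smult_vec_left: "bounded_linear (%c. c *s (v :: complex ^ 'n::finite))"
 by (rule bounded_linear_intro[where K="norm v"])
   (auto simp: vec_eq_iff algebra_simps norm_smult_vec)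

lemma smult_complex_split:
 "c *s (v :: complex ^ 'n::finite) = Re c *\<^sub>R v + Im c *\<^sub>R (\<i> *s v)"
 by (auto simp: vec_eq_iff complex_eq_iff)

text \<open>The (0,1)-part of the differential, evaluated on \<open>v\<close>. It is conjugate
  linear in \<open>v\<close>, and on \<open>axis l 1\<close> it is the Wirtinger derivative with
  respect to the conjugate of the l-th coordinate.\<close>

definition dbar :: "(complex ^ 'n::finite => complex) => complex ^ 'n => complex ^ 'n => complex" where
 "dbar f z v = (fder f z v + \<i> * fder f z (\<i> *s v)) / 2"

lemma dbar_eqI:
 assumes "(f has_derivative D) (at z)"
 shows "dbar f z v = (D v + \<i> * D (\<i> *s v)) / 2"
 using assms frechet_derivative_at unfolding dbar_def by metis

lemma complex_linear_of_real_linear: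
 fixes D :: "complex ^ 'n::finite => complex"
 assumes "linear D" "!!v. D (\<i> *s v) = \<i> * D v"
 shows "D (c *s v) = c * D v"
proof -
 have "D (c *s v) = Re c *\<^sub>R D v + Im c *\<^sub>R D (\<i> *s v)"
  by (subst smult_complex_split) (simp add: linear_add[OF assms(1)] linear_cmul[OF assms(1)])
 also have "... = c * D v"
  by (simp add: assms(2) complex_eq_iff)
 finally show ?thesis .
qed

lemma holo_on_iff_dbar:
 "holo_on S f \<longleftrightarrow> (\<forall>z\<in>S. f differentiable (at z) \<and> (\<forall>v. dbar f z v = 0))"
proof safe
 fix z assume "holo_on S f" "z \<in> S"
 then obtain D where D: "(f has_derivative D) (at z)" "!!c v. D (c *s v) = c * D v"
  unfolding holo_on_def by blast
 show "f differentiable (at z)" using D(1) differentiable_def by blast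
 show "dbar f z v = 0" for v
  using D(2) dbar_eqI[OF D(1), of v] by simp
next
 assume *: "\<forall>z\<in>S. f differentiable (at z) \<and> (\<forall>v. dbar f z v = 0)"
 show "holo_on S f"
  unfolding holo_on_def
 proof
  fix z assume "z \<in> S"
  then have d: "(f has_derivative fder f z) (at z)"
   and "!!v. dbar f z v = 0"
   using * by (auto simp: frechet_derivative_works)
  then have "fder f z (\<i> *s v) = \<i> * fder f z v" for v
   using dbar_def[of f z v] by (simp add: add_eq_0_iff complex_eq_iff)
  then show "\<exists>D. (f has_derivative D) (at z) \<and> (\<forall>c v. D (c *s v) = c * D v)"
   using d complex_linear_of_real_linear has_derivative_linear by blast
 qed
qed

lemma holo_on_subset: "holo_on S f ==> T \<subseteq> S ==> holo_on T f"
 unfolding holo_on_def by blast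

lemma dbar_cong_open:
 assumes "open S" "x \<in> S" "!!y. y \<in> S ==> f y = g y"
 shows "dbar f x v = dbar g x v"
 unfolding dbar_def using frechet_derivative_cong_open[OF assms] by simp

lemma holo_on_cong:
 assumes "open S" "holo_on S f" "!!y. y \<in> S ==> f y = g y"
 shows "holo_on S g"
 using assms unfolding holo_on_def by (meson has_derivative_transform_within_open)

lemma dbar_diff:
 assumes "f differentiable (at z)" "g differentiable (at z)"
 shows "dbar (%x. f x - g x) z v = dbar f z v - dbar g z v"
 unfolding dbar_eqI[OF has_derivative_diff[OF assms[unfolded frechet_derivative_works]], of v]
 by (simp add: dbar_def field_simps)

lemma dbar_mult:
 assumes "f differentiable (at z)" "g differentiable (at z)"
 shows "dbar (%x. f x * g x) z v = dbar f z v * g z + f z * dbar g z v"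
 unfolding dbar_eqI[OF has_derivative_mult[OF assms[unfolded frechet_derivative_works]], of v]
 by (simp add: dbar_def field_simps)

lemma dbar_sum:
 assumes "!!i. i \<in> I ==> f i differentiable (at z)"
 shows "dbar (%x. \<Sum>i\<in>I. f i x) z v = (\<Sum>i\<in>I. dbar (f i) z v)"
proof -
 have "((%x. \<Sum>i\<in>I. f i x) has_derivative (%v. \<Sum>i\<in>I. fder (f i) z v)) (at z)"
  using assms by (intro has_derivative_sum) (auto simp: frechet_derivative_works)
 from dbar_eqI[OF this] show ?thesis
  by (simp add: dbar_def sum_divide_distrib[symmetric] sum.distrib sum_distrib_left)
qed

lemma dbar_const [simp]: "dbar (%x. c) z v = 0"
 using dbar_eqI[OF has_derivative_const] by simp

lemma dbar_linear:
 assumes "f differentiable (at z)"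
 shows "dbar f z (u + v) = dbar f z u + dbar f z v"
  and "dbar f z (r *\<^sub>R v) = r *\<^sub>R dbar f z v"
  and "dbar f z (\<i> *s v) = - \<i> * dbar f z v"
proof -
 have l: "linear (fder f z)"
  using assms linear_frechet_derivative by blast
 have e: "\<i> *s (\<i> *s v) = - v" "\<i> *s (r *\<^sub>R v) = r *\<^sub>R (\<i> *s v)" "\<i> *s (u + v) = \<i> *s u + \<i> *s v"
  by (auto simp: vec_eq_iff algebra_simps)
 show "dbar f z (u + v) = dbar f z u + dbar f z v"
    "dbar f z (r *\<^sub>R v) = r *\<^sub>R dbar f z v"
    "dbar f z (\<i> *s v) = - \<i> * dbar f z v"
  by (auto simp: dbar_def linear_add[OF l] linear_cmul[OF l] linear_neg[OF l] e field_simps complex_eq_iff)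
qed

lemma dbar_smult:
 assumes "f differentiable (at z)"
 shows "dbar f z (c *s v) = cnj c * dbar f z v"
 by (subst smult_complex_split, simp only: dbar_linear[OF assms]) (simp add: complex_eq_iff)

lemma dbar_axis_sum:
 fixes f :: "complex ^ 'n::finite => complex"
 assumes "f differentiable (at z)"
 shows "dbar f z v = (\<Sum>l\<in>UNIV. cnj (v $ l) * dbar f z (axis l 1))"
proof -
 have "v = (\<Sum>l\<in>UNIV. (v $ l) *s axis l 1)"
  by (simp add: basis_expansion)
 moreover have "dbar f z (\<Sum>l\<in>I. (v $ l) *s axis l 1) = (\<Sum>l\<in>I. dbar f z ((v $ l) *s axis l 1))"
  if "finite I" for I
  using that dbar_linear(2)[OF assms, of 0 0]
  by (induction rule: finite_induct) (simp_all add: dbar_linear(1)[OF assms])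
 ultimately show ?thesis
  by (metis (no_types, lifting) dbar_smult[OF assms] finite_class.finite_UNIV sum.cong)
qed

lemma C1_on_dbar_cont:
 assumes "C1_on S f" shows "continuous_on S (%z. dbar f z v)"
 unfolding dbar_def by (intro continuous_intros C1_on_deriv_cont[OF assms]) simp

lemma dbar_compose:
 assumes f: "f differentiable (at (T z))" and T: "(T has_derivative DT) (at z)"
  and "DT (\<i> *s v) = \<i> *s DT v"
 shows "dbar (%x. f (T x)) z v = dbar f (T z) (DT v)"
proof -
 have "((%x. f (T x)) has_derivative (%v. fder f (T z) (DT v))) (at z)"
  using diff_chain_at[OF T f[unfolded frechet_derivative_works]] by (simp add: o_def)
 from dbar_eqI[OF this] show ?thesis by (simp add: dbar_def assms(3))
qed

lemma dbar_compose_holo: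
 assumes f: "(f has_field_derivative f') (at (g z))" and g: "g differentiable (at z)" "!!v. dbar g z v = 0"
 shows "dbar (%x. f (g x)) z v = 0"
proof -
 have "((%x. f (g x)) has_derivative (%v. f' * fder g z v)) (at z)"
  using diff_chain_at[OF g(1)[unfolded frechet_derivative_works] f[unfolded has_field_derivative_def]]
  by (simp add: o_def)
 then have "dbar (%x. f (g x)) z v = f' * dbar g z v"
  by (subst dbar_eqI) (auto simp: dbar_def field_simps)
 then show ?thesis using g(2) by simp
qed

lemma holo_on_mult: "holo_on S f ==> holo_on S g ==> holo_on S (%x. f x * g x)"
 by (simp add: holo_on_iff_dbar differentiable_mult dbar_mult)

lemma holo_on_diff: "holo_on S f ==> holo_on S g ==> holo_on S (%x. f x - g x)"
 by (simp add: holo_on_iff_dbar differentiable_diff dbar_diff)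

lemma holo_on_compose_field:
 assumes "holo_on S g" "!!x. x \<in> S ==> (f has_field_derivative f' x) (at (g x))"
 shows "holo_on S (%x. f (g x))"
 unfolding holo_on_iff_dbar
proof safe
 fix z assume z: "z \<in> S"
 have g: "g differentiable (at z)" "!!v. dbar g z v = 0" using assms(1) z by (auto simp: holo_on_iff_dbar)
 show "(%x. f (g x)) differentiable (at z)"
  using differentiable_chain_at[OF g(1)] assms(2)[OF z]
  by (simp add: o_def differentiable_def has_field_derivative_def) blast
 show "dbar (%x. f (g x)) z v = 0" for v
  by (rule dbar_compose_holo[OF assms(2)[OF z] g])
qed

subsection \<open>Cauchy estimates along complex lines\<close>

lemma holo_on_line:
 assumes "holo_on S f" "!!c. c \<in> T ==> z + c *s v \<in> S" "c \<in> T"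
 shows "((%c. f (z + c *s v)) has_field_derivative fder f (z + c *s v) v) (at c)"
proof -
 have "z + c *s v \<in> S" using assms by auto
 then obtain D where D: "(f has_derivative D) (at (z + c *s v))" "!!c v. D (c *s v) = c * D v"
  using assms(1) unfolding holo_on_def by blast
 have "((%c. z + c *s v) has_derivative (%c. c *s v)) (at c)"
  by (auto intro!: derivative_eq_intros bounded_linear_imp_has_derivative[OF bounded_linear_smult_vec_left])
 from diff_chain_at[OF this D(1)] show ?thesis
  unfolding has_field_derivative_def frechet_derivative_at[OF D(1), symmetric] o_def
  by (simp add: D(2) mult_commute_abs)
qed

lemma holo_on_deriv_bound:
 assumes f: "holo_on S f" and "r > 0" and sub: "!!c. norm c \<le> r ==> z + c *s v \<in> S"
  and B: "!!c. norm c \<le> r ==> norm (f (z + c *s v)) \<le> B"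
 shows "norm (fder f z v) \<le> B / r"
proof -
 let ?g = "%c. f (z + c *s v)"
 have d: "(?g has_field_derivative fder f (z + c *s v) v) (at c)" if "c \<in> cball 0 r" for c
  using holo_on_line[OF f, of "cball 0 r" z v c] sub that by auto
 have "norm ((deriv ^^ 1) ?g 0) \<le> (fact 1) * B / r ^ 1"
 proof (rule Cauchy_inequality)
  show "?g holomorphic_on ball 0 r"
   unfolding holomorphic_on_open[OF open_ball] using d by (meson ball_subset_cball subsetD)
  show "continuous_on (cball 0 r) ?g"
   using DERIV_isCont[OF d] by (auto intro!: continuous_at_imp_continuous_on)
 qed (use assms in auto)
 moreover have "deriv ?g 0 = fder f z v"
  using d[of 0] \<open>r > 0\<close> by (simp add: DERIV_imp_deriv)
 ultimately show ?thesis by simp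
qed

lemma holo_on_cont: "holo_on S f ==> continuous_on S f"
 by (meson continuous_at_imp_continuous_on differentiable_imp_continuous_within holo_on_iff_dbar)

text \<open>\<open>holo_on\<close> contains no continuity of the derivative. It comes from Cauchy's
  integral for the derivative along the complex line in direction \<open>v\<close>, over a circle of
  fixed radius; this integral depends continuously on the centre.\<close>

lemma holo_on_imp_C1_on:
 fixes f :: "complex ^ 'n::finite => complex"
 assumes "open S" "holo_on S f" shows "C1_on S f"
 unfolding C1_on_def
proof safe
 show "f differentiable (at x)" if "x \<in> S" for x using assms(2) that by (simp add: holo_on_iff_dbar)
 fix v :: "complex ^ 'n"
 show "continuous_on S (%x. fder f x v)"
  unfolding continuous_on_eq_continuous_at[OF assms(1)]
 proof
  fix x assume "x \<in> S"
  then obtain e where e: "e > 0" "cball x e \<subseteq> S" using assms(1) open_contains_cball by blast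
  define r where "r = e / 2 / (norm v + 1)"
  have n: "norm v + 1 > 0" by (simp add: add_nonneg_pos)
  have r: "r > 0" using n e by (simp add: r_def)
  have "r * norm v \<le> r * (norm v + 1)" using r by (intro mult_left_mono) auto
  also have "... = e / 2" using n r_def by (metis less_irrefl nonzero_eq_divide_eq)
  finally have rv: "r * norm v \<le> e / 2" .
  have in_S: "z + c *s v \<in> S" if "z \<in> ball x (e / 2)" "norm c \<le> r" for z c
  proof -
   have "norm (c *s v) \<le> e / 2"
    using mult_right_mono[OF that(2) norm_ge_zero[of v]] rv by (simp add: norm_smult_vec)
   then have "dist x (z + c *s v) \<le> e"
    using that(1) dist_triangle[of x "z + c *s v" z] by (simp add: dist_norm)
   then show ?thesis using e(2) by auto
  qed
  let ?\<gamma> = "circlepath 0 r"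
  define F where "F z t = f (z + ?\<gamma> t *s v) / (?\<gamma> t)\<^sup>2 * vector_derivative ?\<gamma> (at t)" for z t
  have n\<gamma>: "norm (?\<gamma> t) = r" for t using r by (simp add: circlepath norm_mult)
  let ?A = "ball x (e / 2) \<times> cbox 0 (1 :: real)"
  have c: "continuous_on ?A (%p. ?\<gamma> (snd p))" unfolding circlepath by (intro continuous_intros)
  then have c': "continuous_on ?A (%p. fst p + ?\<gamma> (snd p) *s v)"
   unfolding vector_scalar_mult_def by (intro continuous_intros)
  have n0: "?\<gamma> t \<noteq> 0" for t using n\<gamma>[of t] r by auto
  have "continuous_on ?A (%p. f (fst p + ?\<gamma> (snd p) *s v))"
   by (rule continuous_on_compose2[OF holo_on_cont[OF assms(2)] c']) (use in_S n\<gamma> in auto)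
  then have "continuous_on ?A (%(z, t). F z t)"
   unfolding F_def vector_derivative_circlepath split_beta'
   by (intro continuous_on_mult continuous_on_divide continuous_on_power c) (auto intro!: continuous_intros simp: n0)
  from integral_continuous_on_param[OF this]
  have "continuous_on (ball x (e / 2)) (%z. 1 / (2 * of_real pi * \<i>) * integral {0..1} (F z))"
   by (intro continuous_intros) simp
  moreover have "fder f z v = 1 / (2 * of_real pi * \<i>) * integral {0..1} (F z)" if z: "z \<in> ball x (e / 2)" for z
  proof -
   let ?g = "%c. f (z + c *s v)"
   have d: "(?g has_field_derivative fder f (z + c *s v) v) (at c)" if "c \<in> cball 0 r" for c
    using holo_on_line[OF assms(2), of "cball 0 r" z v c] in_S[OF z] that by auto
   have "continuous_on (cball 0 r) ?g" using DERIV_isCont[OF d] by (auto intro!: continuous_at_imp_continuous_on)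
   moreover have "?g holomorphic_on ball 0 r"
    unfolding holomorphic_on_open[OF open_ball] using d by (meson ball_subset_cball subsetD)
   ultimately have "(?g has_field_derivative 1 / (2 * of_real pi * \<i>) * contour_integral ?\<gamma> (%u. ?g u / (u - 0)\<^sup>2)) (at 0)"
    using r by (intro Cauchy_derivative_integral_circlepath(2)) auto
   from DERIV_unique[OF this d[of 0]] show ?thesis
    using r by (simp add: contour_integral_integral F_def[abs_def])
  qed
  ultimately have "continuous_on (ball x (e / 2)) (%z. fder f z v)" by (metis (no_types, lifting) continuous_on_cong)
  then show "isCont (%x. fder f x v) x" using e(1) by (simp add: continuous_on_eq_continuous_at)
 qed
qed

text \<open>Cauchy estimates on the half ball turn the summable bound for the functions into one for
  the derivatives, so the series may be differentiated term by term; complex linearity passes to the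
  sum.\<close>

lemma holo_on_series:
 fixes f :: "nat => complex ^ 'n::finite => complex"
 assumes d: "d > 0" and f: "!!i. holo_on (ball x d) (f i)" and M: "!!i z. z \<in> ball x d ==> norm (f i z) \<le> M i" "summable M"
 shows "\<exists>D. ((%z. \<Sum>i. f i z) has_derivative D) (at x) \<and> (\<forall>c v. D (c *s v) = c * D v)"
proof -
 let ?B = "ball x (d / 2)"
 have sub: "?B \<subseteq> ball x d" using d by auto
 have D: "(f i has_derivative fder f' y) (at y)" if "y \<in> ball x d" "f' = f i" for i y f'
  using f[of i] that by (simp add: holo_on_iff_dbar frechet_derivative_works)
 have le: "norm (fder (f i) y v) \<le> 2 / d * M i * norm v" if y: "y \<in> ?B" for i y v
 proof (cases "v = 0")
  case True
  then show ?thesis using linear_0[OF has_derivative_linear[OF D[OF subsetD[OF sub y]]]] by simp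
 next
  case False
  have "y + c *s v \<in> ball x d" if "norm c \<le> d / 2 / norm v" for c
   using that False y dist_triangle[of x "y + c *s v" y] by (simp add: dist_norm norm_smult_vec field_simps)
  then have "norm (fder (f i) y v) \<le> M i / (d / 2 / norm v)"
   by (intro holo_on_deriv_bound[OF f]) (use d False M(1) in auto)
  then show ?thesis using d by (simp add: field_simps)
 qed
 \<comment> \<open>Dividing by the length of the direction makes the bound uniform in the direction
   as well, as term-by-term differentiation demands.\<close>
 define F where "F i p = fder (f i) (fst p) (snd p) /\<^sub>R norm (snd p)" for i and p :: "(complex ^ 'n) \<times> (complex ^ 'n)"
 define G where "G y v = norm v *\<^sub>R (\<Sum>i. F i (y, v))" for y v
 have F: "norm v *\<^sub>R F i (y, v) = fder (f i) y v" if "y \<in> ?B" for i y v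
  using le[OF that, of i v] by (cases "v = 0") (auto simp: F_def)
 have F_le: "norm (F i p) \<le> 2 / d * M i" if "p \<in> ?B \<times> UNIV" for i p
  using le[of "fst p" i "snd p"] M(1)[of x i] order_trans[OF norm_ge_zero M(1)[of x i]] d that
  by (cases "snd p = 0") (auto simp: F_def field_simps)
 have sM: "summable (%i. 2 / d * M i)" by (intro summable_mult M(2))
 have U: "uniform_limit (?B \<times> UNIV) (%n p. \<Sum>i<n. F i p) (%p. \<Sum>i. F i p) sequentially"
  by (rule Weierstrass_m_test[OF F_le sM])
 have sums_f: "(%i. f i z) sums (\<Sum>i. f i z)" if "z \<in> ball x d" for z
  by (rule summable_sums[OF summable_comparison_test'[OF M(2)]]) (use M(1)[OF that] in auto)
 have "\<exists>g. \<forall>y\<in>?B. (%i. f i y) sums g y \<and> (g has_derivative G y) (at y within ?B)"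
 proof (rule has_derivative_series[OF convex_ball])
  show "(f i has_derivative fder (f i) y) (at y within ?B)" if "y \<in> ?B" for i y
   by (rule has_derivative_at_withinI[OF D]) (use that sub in auto)
  show "(%i. f i x) sums (\<Sum>i. f i x)" "x \<in> ?B" using sums_f[of x] d by auto
  fix e :: real assume "e > 0"
  from uniform_limitD[OF U this]
  show "\<forall>\<^sub>F n in sequentially. \<forall>y\<in>?B. \<forall>h. norm ((\<Sum>i<n. fder (f i) y h) - G y h) \<le> e * norm h"
  proof eventually_elim
   case (elim n)
   show ?case
   proof (intro ballI allI)
    fix y h assume y: "y \<in> ?B"
    have "(\<Sum>i<n. fder (f i) y h) - G y h = norm h *\<^sub>R ((\<Sum>i<n. F i (y, h)) - (\<Sum>i. F i (y, h)))"
     by (simp add: G_def F[OF y] scaleR_diff_right scaleR_sum_right)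
    moreover have "norm ((\<Sum>i<n. F i (y, h)) - (\<Sum>i. F i (y, h))) \<le> e" using elim y by (auto simp: dist_norm intro: less_imp_le)
    ultimately show "norm ((\<Sum>i<n. fder (f i) y h) - G y h) \<le> e * norm h" by (simp add: mult.commute[of e] mult_left_mono)
   qed
  qed
 qed
 then obtain g where g: "!!y. y \<in> ?B ==> (%i. f i y) sums g y" "!!y. y \<in> ?B ==> (g has_derivative G y) (at y within ?B)" by blast
 have x: "x \<in> ?B" using d by simp
 have "(g has_derivative G x) (at x)" using g(2)[OF x] at_within_open[OF x open_ball] by simp
 then have "((%z. \<Sum>i. f i z) has_derivative G x) (at x)"
  by (rule has_derivative_transform_within_open[OF _ open_ball x]) (use g(1) in \<open>simp add: sums_iff\<close>)
 moreover have "G x (c *s v) = c * G x v" for c v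
 proof -
  have s: "summable (%i. F i (x, u))" for u by (rule summable_comparison_test'[OF sM]) (use F_le x in auto)
  have G: "G x u = (\<Sum>i. fder (f i) x u)" for u
   unfolding G_def using suminf_scaleR_right[OF s, of "norm u" u] by (simp add: F[OF x])
  have "fder (f i) x (c *s v) = c * fder (f i) x v" for i
   using f[of i] d unfolding holo_on_def by (metis centre_in_ball frechet_derivative_at)
  moreover have "summable (%i. fder (f i) x v)"
   using summable_scaleR_right[OF s, of "norm v" v] by (simp add: F[OF x])
  ultimately show ?thesis unfolding G by (simp add: suminf_mult)
 qed
 ultimately show ?thesis by blast
qed

section \<open>The Pompeiu formula\<close>

subsection \<open>Integrals over the complex plane\<close>

text \<open>Dyadic domination in place of polar coordinates: the j-th terms majorise
  \<open>f\<close> where \<open>norm z\<close> is about \<open>2 ^ -j\<close> or about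
  \<open>2 ^ j\<close>. Areas \<open>4 ^ -j\<close> against values \<open>2 ^ j\<close>, and areas
  \<open>4 ^ j\<close> against values \<open>16 ^ -j\<close>, give convergent geometric
  series.\<close>

lemma nn_integral_complex_finite:
 fixes f :: "complex => real"
 assumes C: "C \<ge> 0" "!!z. z \<noteq> 0 ==> f z \<le> C / norm z" "!!z. z \<noteq> 0 ==> f z \<le> C / norm z ^ 4"
 shows "(\<integral>\<^sup>+z. ennreal (f z) \<partial>lborel) < \<infinity>"
proof -
 let ?F = "%j z :: complex. ennreal (C * 2 ^ Suc j) * indicator (cball 0 ((1 / 2) ^ j)) z + ennreal (C / 16 ^ j) * indicator (cball 0 (2 ^ Suc j)) z"
 have dyadic: "\<exists>j. ennreal (f z) \<le> ?F j z" if z: "z \<noteq> 0" for z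
 proof (cases "norm z \<le> 1")
  case True
  define n where "n = (LEAST n. (1 / 2) ^ n < norm z)"
  have n: "(1 / 2) ^ n < norm z" unfolding n_def by (rule LeastI_ex) (use real_arch_pow_inv[of "norm z" "1 / 2"] z in auto)
  obtain j where j: "n = Suc j" using n True by (cases n) auto
  have "norm z \<le> (1 / 2) ^ j" using not_less_Least[of j "%n. (1 / 2) ^ n < norm z"] j n_def by auto
  moreover have "C / norm z \<le> C * 2 ^ Suc j"
   using n C(1) z mult_left_mono[of 1 "2 ^ Suc j * norm z" C] by (simp add: j power_one_over field_simps)
  ultimately have "ennreal (f z) \<le> ?F j z" using ennreal_leI[OF order_trans[OF C(2)[OF z]]] by (simp add: add_increasing2)
  then show ?thesis ..
 next
  case False
  define n where "n = (LEAST n. norm z < 2 ^ n)"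
  have n: "norm z < 2 ^ n" unfolding n_def by (rule LeastI_ex) (use real_arch_pow[of 2 "norm z"] in auto)
  obtain j where j: "n = Suc j" using n False by (cases n) auto
  have "2 ^ j \<le> norm z" using not_less_Least[of j "%n. norm z < 2 ^ n"] j n_def by auto
  then have "(2 ^ j) ^ 4 \<le> norm z ^ 4" by (rule power_mono) simp
  then have "C / norm z ^ 4 \<le> C / 16 ^ j"
   using C(1) z by (intro divide_left_mono) (auto simp flip: power_mult simp: mult.commute[of j] power_mult)
  then have "ennreal (f z) \<le> ?F j z" using n j ennreal_leI[OF order_trans[OF C(3)[OF z]]] by (simp add: add_increasing)
  then show ?thesis ..
 qed
 have [measurable]: "cball (0 :: complex) r \<in> sets borel" for r by simp
 have "ennreal (f z) \<le> (\<Sum>j. ?F j z)" if "z \<noteq> 0" for z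
 proof -
  obtain j where j: "ennreal (f z) \<le> ?F j z" using dyadic[OF \<open>z \<noteq> 0\<close>] by blast
  also have "... \<le> (\<Sum>j. ?F j z)" using sum_le_suminf[OF summableI, of "{j}" "%j. ?F j z"] by simp
  finally show ?thesis .
 qed
 then have "(\<integral>\<^sup>+z. ennreal (f z) \<partial>lborel) \<le> (\<integral>\<^sup>+z. (\<Sum>j. ?F j z) \<partial>lborel)"
  by (intro nn_integral_mono_AE AE_I[of _ _ "{0}"]) auto
 also have "... = (\<Sum>j. \<integral>\<^sup>+z. ?F j z \<partial>lborel)"
 proof (rule nn_integral_suminf)
  show "?F j \<in> borel_measurable lborel" for j by measurable
 qed
 also have "... \<le> (\<Sum>j. ennreal (6 * pi * C * (1 / 2) ^ j))"
 proof (intro suminf_le summableI)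
  fix j :: nat
  define x where "x = (2 :: real) ^ j"
  have x: "x \<ge> 1" "16 ^ j = x ^ 4" "(1 / 2) ^ j = 1 / x"
   by (simp_all add: x_def power_one_over flip: power_mult) (simp add: mult.commute[of j] power_mult)
  have v: "emeasure lborel (cball (0 :: complex) r) = ennreal (pi * r\<^sup>2)" if "r \<ge> 0" for r
   using that by (simp add: emeasure_cball unit_ball_vol_2)
  have "(\<integral>\<^sup>+z. ?F j z \<partial>lborel) = ennreal (C * (2 * x)) * ennreal (pi * (1 / x)\<^sup>2) + ennreal (C / x ^ 4) * ennreal (pi * (2 * x)\<^sup>2)"
   using x(1) by (subst nn_integral_add, measurable) (simp add: nn_integral_cmult_indicator v x(2,3) x_def[symmetric])
  also have "... = ennreal (C * (2 * x) * (pi * (1 / x)\<^sup>2) + C / x ^ 4 * (pi * (2 * x)\<^sup>2))"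
   using C(1) x(1) by (simp flip: ennreal_mult ennreal_plus)
  also have "C * (2 * x) * (pi * (1 / x)\<^sup>2) + C / x ^ 4 * (pi * (2 * x)\<^sup>2) = 2 * pi * C / x + 4 * pi * C / x / x"
   using x(1) by (simp add: field_simps power2_eq_square power4_eq_xxxx)
  also have "4 * pi * C / x / x \<le> 4 * pi * C / x / 1" using x(1) C(1) by (intro divide_left_mono) auto
  finally show "(\<integral>\<^sup>+z. ?F j z \<partial>lborel) \<le> ennreal (6 * pi * C * (1 / 2) ^ j)"
   by (simp add: x(3) ennreal_leI add_mono mult_ac)
 qed
 also have "... = ennreal (\<Sum>j. 6 * pi * C * (1 / 2) ^ j)"
  using C(1) by (intro suminf_ennreal2 summable_mult summable_geometric) auto
 also have "... < \<infinity>" by simp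
 finally show ?thesis .
qed

text \<open>The square of \<open>1 + x \<le> exp x\<close> at \<open>x = t\<^sup>2 / 4\<close>
  supplies powers up to four, enough to compare the Gaussian, with or without division by the norm,
  with the two majorants of \<open>nn_integral_complex_finite\<close>.\<close>

lemma exp_half_square_ge: "t \<le> exp (t\<^sup>2 / 2)" "t ^ 3 \<le> 8 * exp (t\<^sup>2 / 2)" "t ^ 4 \<le> 16 * exp (t\<^sup>2 / 2)" if "t > 0" for t :: real
proof -
 define x where "x = t\<^sup>2 / 4"
 have "exp (t\<^sup>2 / 2) = (exp x)\<^sup>2" by (simp add: x_def flip: exp_double)
 also have "(1 + x)\<^sup>2 \<le> ..." by (intro power_mono exp_ge_add_one_self) (simp add: x_def)
 finally have e: "1 + 2 * x + x\<^sup>2 \<le> exp (t\<^sup>2 / 2)" by (simp add: power2_sum)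
 have t4: "t ^ 4 = 16 * x\<^sup>2" "t\<^sup>2 = 4 * x" by (simp_all add: x_def power_divide flip: power_mult)
 have x0: "x \<ge> 0" "x\<^sup>2 \<ge> 0" by (simp_all add: x_def)
 have "0 \<le> (t - 1)\<^sup>2" "0 \<le> t\<^sup>2 * (t - 1)\<^sup>2" by simp_all
 then have "2 * t \<le> t\<^sup>2 + 1" "2 * t ^ 3 \<le> t ^ 4 + t\<^sup>2"
  by (simp_all add: power2_diff algebra_simps power2_eq_square power3_eq_cube power4_eq_xxxx)
 then show "t \<le> exp (t\<^sup>2 / 2)" "t ^ 3 \<le> 8 * exp (t\<^sup>2 / 2)" "t ^ 4 \<le> 16 * exp (t\<^sup>2 / 2)"
  using e x0 t4 by linarith+
qed

lemma nn_integral_gaussian_finite: "(\<integral>\<^sup>+u. ennreal (exp (- ((norm u)\<^sup>2 / 2))) \<partial>(lborel :: complex measure)) < \<infinity>"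
proof (rule nn_integral_complex_finite[of 16])
 fix z :: complex assume "z \<noteq> 0"
 then have "norm z > 0" by simp
 note e = exp_half_square_ge[OF this]
 have "norm z \<le> 16 * exp ((norm z)\<^sup>2 / 2)" using e(1) exp_gt_zero[of "(norm z)\<^sup>2 / 2"] by linarith
 then show "exp (- ((norm z)\<^sup>2 / 2)) \<le> 16 / norm z" "exp (- ((norm z)\<^sup>2 / 2)) \<le> 16 / norm z ^ 4"
  using e(3) \<open>norm z > 0\<close> by (simp_all add: exp_minus field_simps)
qed simp

lemma nn_integral_singular_gaussian_finite:
 "(\<integral>\<^sup>+u. ennreal (exp (- ((norm u)\<^sup>2 / 2)) / norm u) \<partial>(lborel :: complex measure)) < \<infinity>"
proof (rule nn_integral_complex_finite[of 8])
 fix z :: complex assume "z \<noteq> 0"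
 then have n: "norm z > 0" by simp
 have "exp (- ((norm z)\<^sup>2 / 2)) \<le> 8" by (rule order_trans[of _ 1]) auto
 then show "exp (- ((norm z)\<^sup>2 / 2)) / norm z \<le> 8 / norm z" by (intro divide_right_mono) auto
 show "exp (- ((norm z)\<^sup>2 / 2)) / norm z \<le> 8 / norm z ^ 4"
  using exp_half_square_ge(2)[OF n] n by (simp add: exp_minus field_simps power3_eq_cube power4_eq_xxxx)
qed simp

lemma nn_integral_Cauchy_complex_finite:
 "(\<integral>\<^sup>+u. ennreal (1 / (1 + (norm u)\<^sup>2)\<^sup>2) \<partial>(lborel :: complex measure)) < \<infinity>"
proof (rule nn_integral_complex_finite[of 1])
 fix z :: complex assume z: "z \<noteq> 0"
 have "0 \<le> (norm z - 1)\<^sup>2" by simp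
 then have "norm z \<le> 1 + (norm z)\<^sup>2" by (simp add: power2_diff) (smt (verit) norm_ge_zero)
 also have "... \<le> (1 + (norm z)\<^sup>2)\<^sup>2" by (rule self_le_power) auto
 finally show "1 / (1 + (norm z)\<^sup>2)\<^sup>2 \<le> 1 / norm z" using z by (intro divide_left_mono mult_pos_pos) (auto intro!: add_pos_nonneg)
 have "(norm z ^ 2)\<^sup>2 \<le> (1 + (norm z)\<^sup>2)\<^sup>2" by (intro power_mono) auto
 then show "1 / (1 + (norm z)\<^sup>2)\<^sup>2 \<le> 1 / norm z ^ 4"
  using z by (intro divide_left_mono mult_pos_pos) (auto intro!: add_pos_nonneg simp flip: power_mult)
qed simp

subsection \<open>Integration by parts\<close>

lemma integrable_cont_supp:
 fixes F :: "'a::euclidean_space => 'b::euclidean_space"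
 assumes "continuous_on UNIV F" "!!x. norm x > \<rho> ==> F x = 0"
 shows "integrable lborel F"
proof -
 have "integrable lborel (%x. indicator (cball 0 \<rho>) x *\<^sub>R F x)"
  by (intro borel_integrable_compact compact_cball continuous_on_subset[OF assms(1)]) auto
 moreover have "(%x. indicator (cball 0 \<rho>) x *\<^sub>R F x) = F"
  using assms(2) by (fastforce simp: indicator_def)
 ultimately show ?thesis by simp
qed

lemma bounded_cont_supp:
 fixes F :: "'a::euclidean_space => 'b::real_normed_vector"
 assumes "continuous_on UNIV F" "!!x. norm x > \<rho> ==> F x = 0"
 obtains B where "B > 0" "!!x. norm (F x) \<le> B"
proof -
 have "bounded (F ` cball 0 \<rho>)"
  by (meson assms(1) compact_cball compact_continuous_image compact_imp_bounded continuous_on_subset subset_UNIV)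
 then obtain B where B: "B > 0" "!!x. norm x \<le> \<rho> ==> norm (F x) \<le> B"
  unfolding bounded_pos by auto
 have "norm (F x) \<le> B" for x
  using B(1) B(2)[of x] assms(2)[of x] by (cases "norm x \<le> \<rho>") auto
 then show ?thesis using that B(1) by blast
qed

lemma fder_outside:
 assumes "!!x. norm x > \<rho> ==> F x = 0" "norm x > \<rho>"
 shows "fder F x v = 0"
proof -
 have "open {x :: 'a. norm x > \<rho>}" by (intro open_Collect_less continuous_intros)
 then have "fder F x = fder (%x. 0) x"
  by (rule frechet_derivative_cong_open) (use assms in auto)
 then show ?thesis by simp
qed

lemma lborel_integral_translate:
 fixes f :: "'a::euclidean_space => 'b::euclidean_space"
 assumes [measurable]: "f \<in> borel_measurable borel"
 shows "(\<integral>x. f (c + x) \<partial>lborel) = (\<integral>x. f x \<partial>lborel)"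
proof -
 have "(\<integral>x. f x \<partial>distr lborel borel ((+) c)) = (\<integral>x. f (c + x) \<partial>lborel)"
  by (rule integral_distr) auto
 then show ?thesis by (simp add: lborel_distr_plus)
qed

lemma has_vector_derivative_on_segment:
 assumes "(F has_derivative D) (at (p + t *\<^sub>R y))"
 shows "((%t. F (p + t *\<^sub>R y)) has_vector_derivative D y) (at t)"
proof -
 have "((%t. p + t *\<^sub>R y) has_derivative (%s. s *\<^sub>R y)) (at t)"
  by (auto intro!: derivative_eq_intros)
 from diff_chain_at[OF this assms]
 have "((%t. F (p + t *\<^sub>R y)) has_derivative (%s. D (s *\<^sub>R y))) (at t)" by (simp add: o_def)
 then show ?thesis
  unfolding has_vector_derivative_def linear_cmul[OF has_derivative_linear[OF assms]] .
qed

subsection \<open>Differentiation under the integral sign\<close>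

lemma integral_lborel_cbox:
 fixes f :: "'a::euclidean_space => 'b::euclidean_space"
 assumes "continuous_on UNIV f" "!!w. w \<notin> cbox a b ==> f w = 0"
 shows "integrable lborel f" "(\<integral>w. f w \<partial>lborel) = integral (cbox a b) f"
proof -
 obtain \<rho> where \<rho>: "!!x. x \<in> cbox a b ==> norm x \<le> \<rho>"
  using bounded_cbox[of a b] unfolding bounded_iff by blast
 show i: "integrable lborel f"
  by (rule integrable_cont_supp[OF assms(1), of \<rho>])
    (use assms(2) \<rho> in force)
 have "integral UNIV f = integral (cbox a b) f"
  using assms(2) by (intro integral_spike_set negligible_subset[OF negligible_empty]) auto
 then show "(\<integral>w. f w \<partial>lborel) = integral (cbox a b) f"
  using integral_lborel[OF i] by simp
qed

lemma continuous_on_section: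
 assumes "continuous_on (U \<times> UNIV) (%(z, w). f z w)" "z \<in> U"
 shows "continuous_on UNIV (f z)"
proof -
 have "continuous_on UNIV (%w. (%(z, w). f z w) (z, w))"
  by (intro continuous_on_compose2[OF assms(1)] continuous_intros) (use assms(2) in auto)
 then show ?thesis by simp
qed

text \<open>The common compact support turns the Lebesgue integrals into integrals over one box,
  where the Leibniz rule for continuous derivatives applies.\<close>

lemma has_derivative_integral_parameter:
 fixes f :: "'a::euclidean_space => 'c::euclidean_space => 'b::euclidean_space"
 assumes "open U"
  and D: "!!z w. z \<in> U ==> ((%z. f z w) has_derivative f' z w) (at z)"
  and cf: "continuous_on (U \<times> UNIV) (%(z, w). f z w)"
  and cf': "!!v. continuous_on (U \<times> UNIV) (%(z, w). f' z w v)"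
  and supp: "!!z w. z \<in> U ==> norm w > \<rho> ==> f z w = 0 \<and> (\<forall>v. f' z w v = 0)"
 shows "!!z. z \<in> U ==> ((%z. \<integral>w. f z w \<partial>lborel) has_derivative (%v. \<integral>w. f' z w v \<partial>lborel)) (at z)"
  and "!!v. continuous_on U (%z. \<integral>w. f' z w v \<partial>lborel)"
  and "!!z v. z \<in> U ==> integrable lborel (%w. f' z w v)"
proof -
 obtain a b :: 'c where ab: "cball 0 \<rho> \<subseteq> cbox a b"
  using bounded_subset_cbox_symmetric[OF bounded_cball] by metis
 have out: "norm w > \<rho>" if "w \<notin> cbox a b" for w using ab that by force
 have cs: "continuous_on UNIV (f z)" "continuous_on UNIV (%w. f' z w v)" if "z \<in> U" for z v
  using continuous_on_section[OF cf that] continuous_on_section[OF cf' that] by auto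
 have eq: "(\<integral>w. f z w \<partial>lborel) = integral (cbox a b) (f z)" if "z \<in> U" for z
  by (rule integral_lborel_cbox(2)[OF cs(1)[OF that]]) (use supp that out in blast)
 have eq': "(\<integral>w. f' z w v \<partial>lborel) = integral (cbox a b) (%w. f' z w v)"
  "integrable lborel (%w. f' z w v)" if "z \<in> U" for z v
  by (rule integral_lborel_cbox[OF cs(2)[OF that]], use supp that out in blast)+
 show "integrable lborel (%w. f' z w v)" if "z \<in> U" for z v using eq'(2)[OF that] .
 show "continuous_on U (%z. \<integral>w. f' z w v \<partial>lborel)" for v
 proof (rule continuous_on_eq)
  show "continuous_on U (%z. integral (cbox a b) (%w. f' z w v))"
   by (rule integral_continuous_on_param[OF continuous_on_subset[OF cf']]) auto
 qed (simp add: eq')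
 show "((%z. \<integral>w. f z w \<partial>lborel) has_derivative (%v. \<integral>w. f' z w v \<partial>lborel)) (at z)" if z: "z \<in> U" for z
 proof -
  obtain e where e: "e > 0" "ball z e \<subseteq> U" using \<open>open U\<close> z open_contains_ball by blast
  have zb: "z \<in> ball z e" using e by simp
  \<comment> \<open>The Leibniz rule integrates the derivative as an operator, so the values in all
    directions are packed into one bounded linear map.\<close>
  define F where "F z w = Blinfun (f' z w)" for z w
  have F: "blinfun_apply (F y w) = f' y w" if "y \<in> U" for y w
   unfolding F_def using has_derivative_bounded_linear[OF D[OF that]] by (simp add: bounded_linear_Blinfun_apply)
  have cF: "continuous_on (ball z e \<times> cbox a b) (%(y, w). F y w)"
  proof (rule continuous_on_blinfun_componentwise)
   fix i :: 'a
   have "continuous_on (ball z e \<times> cbox a b) (%(y, w). f' y w i)"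
    by (rule continuous_on_subset[OF cf']) (use e in auto)
   then show "continuous_on (ball z e \<times> cbox a b) (%x. (case x of (y, w) => F y w) i)"
    by (rule continuous_on_eq) (use e in \<open>auto simp: F subset_iff\<close>)
  qed
  have "((%z. integral (cbox a b) (f z)) has_derivative blinfun_apply (integral (cbox a b) (F z))) (at z within ball z e)"
  proof (rule leibniz_rule[OF _ _ cF zb convex_ball])
   show "((%y. f y w) has_derivative blinfun_apply (F y w)) (at y within ball z e)" if "y \<in> ball z e" for y w
   proof -
    have "y \<in> U" using that e by blast
    show ?thesis unfolding F[OF \<open>y \<in> U\<close>] by (rule has_derivative_at_withinI[OF D[OF \<open>y \<in> U\<close>]])
   qed
   show "f y integrable_on cbox a b" if "y \<in> ball z e" for y
    by (rule integrable_continuous, rule continuous_on_subset[OF cs(1)]) (use that e in auto)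
  qed
  moreover have "F z integrable_on cbox a b"
  proof (rule integrable_continuous)
   have "continuous_on (cbox a b) (%w. (%(y, w). F y w) (z, w))"
    by (intro continuous_on_compose2[OF cF] continuous_intros) (use zb in auto)
   then show "continuous_on (cbox a b) (F z)" by simp
  qed
  then have "blinfun_apply (integral (cbox a b) (F z)) = (%v. integral (cbox a b) (%w. f' z w v))"
   by (intro ext) (simp only: blinfun_apply_integral F[OF z])
  ultimately have "((%z. integral (cbox a b) (f z)) has_derivative (%v. integral (cbox a b) (%w. f' z w v))) (at z)"
   using at_within_open[OF zb open_ball] by simp
  then show ?thesis
   unfolding eq'(1)[OF z]
   by (rule has_derivative_transform_within_open[OF _ \<open>open U\<close> z]) (simp add: eq)
 qed
qed

text \<open>By translation invariance the integral of \<open>F (x + t *\<^sub>R v)\<close> does not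
  depend on \<open>t\<close>; its derivative at \<open>t = 0\<close> is the integral in
  question.\<close>

lemma integral_frechet_derivative_zero:
 fixes F :: "'a::euclidean_space => 'b::euclidean_space"
 assumes F: "C1_on UNIV F" and supp: "!!x. norm x > \<rho> ==> F x = 0"
 shows "(\<integral>x. fder F x v \<partial>lborel) = 0"
proof -
 have cF: "continuous_on UNIV F" by (rule C1_on_cont[OF F])
 define D where "D t x s = s *\<^sub>R fder F (x + t *\<^sub>R v) v" for t x s
 have "((%t. \<integral>x. F (x + t *\<^sub>R v) \<partial>lborel) has_derivative (%s. \<integral>x. D 0 x s \<partial>lborel)) (at (0 :: real))"
 proof (rule has_derivative_integral_parameter(1)[of "ball 0 1" _ D])
  show "((%t. F (x + t *\<^sub>R v)) has_derivative (%s. D t x s)) (at t)" for t x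
   using has_vector_derivative_on_segment[OF C1_onD[OF F UNIV_I]] unfolding has_vector_derivative_def D_def .
  show "continuous_on (ball 0 1 \<times> UNIV) (%(t, x). F (x + t *\<^sub>R v))"
   unfolding split_beta' by (intro continuous_on_compose2[OF cF] continuous_intros) auto
  show "continuous_on (ball 0 1 \<times> UNIV) (%(t, x). D t x s)" for s
   unfolding split_beta' D_def by (intro continuous_on_compose2[OF C1_on_deriv_cont[OF F]] continuous_intros) auto
  fix t :: real and x :: 'a assume t: "t \<in> ball 0 1" and x: "norm x > \<rho> + norm v"
  have "\<bar>t\<bar> * norm v \<le> 1 * norm v" using t by (intro mult_right_mono) auto
  then have "norm (x + t *\<^sub>R v) > \<rho>"
   using x norm_triangle_ineq4[of "x + t *\<^sub>R v" "t *\<^sub>R v"] by simp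
  then show "F (x + t *\<^sub>R v) = 0 \<and> (\<forall>s. D t x s = 0)"
   using supp fder_outside[of \<rho> F, OF supp] by (simp add: D_def)
 qed auto
 moreover have "(\<integral>x. F (x + t *\<^sub>R v) \<partial>lborel) = (\<integral>x. F x \<partial>lborel)" for t
  using lborel_integral_translate[of F "t *\<^sub>R v"] borel_measurable_continuous_onI[OF cF] by (simp add: add.commute)
 ultimately have "((%t. \<integral>x. F x \<partial>lborel) has_derivative (%s. \<integral>x. D 0 x s \<partial>lborel)) (at (0 :: real))" by simp
 from fun_cong[OF has_derivative_unique[OF this has_derivative_const], of 1] show ?thesis by (simp add: D_def)
qed

subsection \<open>The formula\<close>

definition dbar1 :: "(complex => complex) => complex => complex" where
 "dbar1 f w = (fder f w 1 + \<i> * fder f w \<i>) / 2"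

lemma dbar1_eqI:
 assumes "(f has_derivative D) (at w)"
 shows "dbar1 f w = (D 1 + \<i> * D \<i>) / 2"
 using assms frechet_derivative_at unfolding dbar1_def by metis

lemma dbar1_mult:
 assumes "f differentiable (at w)" "g differentiable (at w)"
 shows "dbar1 (%x. f x * g x) w = dbar1 f w * g w + f w * dbar1 g w"
 unfolding dbar1_eqI[OF has_derivative_mult[OF assms[unfolded frechet_derivative_works]]]
 by (simp add: dbar1_def field_simps)

lemma dbar1_cnj: "(cnj has_derivative cnj) (at w)"
 by (rule bounded_linear_imp_has_derivative[OF bounded_linear_cnj])

definition cauchy_const :: real where
 "cauchy_const = (\<integral>w. 1 / (1 + (norm (w :: complex))\<^sup>2)\<^sup>2 \<partial>lborel)"

lemma integrable_Cauchy_complex: "integrable lborel (%w::complex. 1 / (1 + (norm w)\<^sup>2)\<^sup>2)"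
proof (rule integrableI_nonneg)
 show "(\<integral>\<^sup>+w. ennreal (1 / (1 + (norm w)\<^sup>2)\<^sup>2) \<partial>(lborel :: complex measure)) < \<infinity>"
  by (rule nn_integral_Cauchy_complex_finite)
qed auto

lemma cauchy_const_pos: "cauchy_const > 0"
proof -
 have p: "1 / (1 + (norm w)\<^sup>2)\<^sup>2 > 0" for w :: complex
  by (intro divide_pos_pos zero_less_power add_pos_nonneg) auto
 have "cauchy_const \<noteq> 0"
 proof
  assume "cauchy_const = 0"
  then have "AE w in lborel. 1 / (1 + (norm (w::complex))\<^sup>2)\<^sup>2 = 0"
   unfolding cauchy_const_def
   by (subst (asm) integral_nonneg_eq_0_iff_AE[OF integrable_Cauchy_complex]) auto
  then have "AE w in (lborel :: complex measure). False"
   using p by (simp add: order_less_imp_not_eq2)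
  then have "emeasure (lborel :: complex measure) UNIV = 0"
   by (simp add: AE_iff_null null_sets_def)
  then show False by simp
 qed
 moreover have "cauchy_const \<ge> 0" unfolding cauchy_const_def by (rule Bochner_Integration.integral_nonneg) simp
 ultimately show ?thesis by simp
qed

lemma integrable_inverse_norm_complex:
 "integrable lborel (%w::complex. indicator (cball 0 \<rho>) w / norm w)"
proof (rule integrableI_nonneg)
 let ?a = "\<integral>\<^sup>+w. ennreal (indicator (cball 0 \<rho>) w / norm w) \<partial>(lborel :: complex measure)"
 have "?a \<le>
   (\<integral>\<^sup>+w. ennreal (exp (\<rho>\<^sup>2 / 2)) * ennreal (exp (- ((norm w)\<^sup>2 / 2)) / norm w) \<partial>(lborel :: complex measure))"
 proof (rule nn_integral_mono)
  fix w :: complex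
  have "1 \<le> exp (\<rho>\<^sup>2 / 2) * exp (- ((norm w)\<^sup>2 / 2))" if "norm w \<le> \<rho>"
   using power_mono[OF that norm_ge_zero, of 2] by (simp flip: exp_add)
  then have "indicator (cball 0 \<rho>) w / norm w \<le> exp (\<rho>\<^sup>2 / 2) * exp (- ((norm w)\<^sup>2 / 2)) / norm w"
   by (intro divide_right_mono) (auto simp: indicator_def)
  then show "ennreal (indicator (cball 0 \<rho>) w / norm w) \<le> ennreal (exp (\<rho>\<^sup>2 / 2)) * ennreal (exp (- ((norm w)\<^sup>2 / 2)) / norm w)"
   by (simp add: ennreal_leI flip: ennreal_mult)
 qed
 also have "... = ennreal (exp (\<rho>\<^sup>2 / 2)) * (\<integral>\<^sup>+w. ennreal (exp (- ((norm w)\<^sup>2 / 2)) / norm w) \<partial>(lborel :: complex measure))"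
  by (rule nn_integral_cmult) simp
 also have "... < \<infinity>"
  using nn_integral_singular_gaussian_finite by (simp add: ennreal_mult_less_top)
 finally show "?a < \<infinity>" .
 have [measurable]: "cball (0::complex) \<rho> \<in> sets borel" by simp
 show "(%w. indicat_real (cball 0 \<rho>) w / cmod w) \<in> borel_measurable lborel" by measurable
qed auto

lemma lborel_integral_scale_complex:
 fixes f :: "complex => complex"
 assumes [measurable]: "f \<in> borel_measurable borel" and "c > 0"
 shows "(\<integral>x. f x \<partial>lborel) = of_real (c\<^sup>2) * (\<integral>x. f (c *\<^sub>R x) \<partial>lborel)"
proof -
 have "(\<integral>x. f x \<partial>lborel) = (\<integral>x. f x \<partial>density (distr lborel borel (%x. 0 + c *\<^sub>R x)) (%_. ennreal (\<bar>c\<bar> ^ DIM(complex))))"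
  using lborel_affine[of c "0::complex"] \<open>c > 0\<close> by simp
 also have "... = (\<integral>x. (\<bar>c\<bar> ^ DIM(complex)) *\<^sub>R f x \<partial>distr lborel borel (%x. 0 + c *\<^sub>R x))"
  by (rule integral_density) auto
 also have "... = (\<integral>x. (\<bar>c\<bar> ^ DIM(complex)) *\<^sub>R f (0 + c *\<^sub>R x) \<partial>lborel)"
  by (rule integral_distr) auto
 also have "... = of_real (c\<^sup>2) * (\<integral>x. f (c *\<^sub>R x) \<partial>lborel)"
  using \<open>c > 0\<close> by (simp add: scaleR_conv_of_real)
 finally show ?thesis .
qed

text \<open>The Cauchy kernel \<open>1 / w\<close> is approximated by the smooth functions
 \<open>cnj w / (\<bar>w\<bar>\<^sup>2 + \<epsilon>\<^sup>2)\<close>, whose antiholomorphic derivatives form an approximate identity up to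
 the factor \<open>cauchy_const\<close>.  Its value (which is \<open>pi\<close>) plays no role.\<close>

lemma pompeiu_at_0:
 assumes G: "C1_on UNIV G" and supp: "!!x. norm x > \<rho> ==> G x = 0"
 shows "of_real cauchy_const * G 0 = (\<integral>w. - (dbar1 G w / w) \<partial>lborel)"
proof -
 define \<epsilon> where "\<epsilon> m = 1 / real (Suc m)" for m
 have \<epsilon>: "\<epsilon> m > 0" for m by (simp add: \<epsilon>_def)
 have \<epsilon>0: "\<epsilon> \<longlonglongrightarrow> 0" unfolding \<epsilon>_def using LIMSEQ_inverse_real_of_nat by (simp add: inverse_eq_divide)
 define N where "N e w = w * cnj w + of_real (e\<^sup>2)" for e :: real and w :: complex
 have N: "N e w = of_real ((norm w)\<^sup>2 + e\<^sup>2)" for e w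
  by (simp add: N_def flip: complex_norm_square)
 have N0: "N e w \<noteq> 0" if "e > 0" for e w
  unfolding N of_real_eq_0_iff using that by (smt (verit) zero_le_power2 zero_less_power)
 define q where "q e w = cnj w / N e w" for e w
 have cN: "C1_on UNIV (N e)" for e
  unfolding N_def[abs_def]
  by (intro C1_on_add C1_on_mult C1_on_const C1_on_linear bounded_linear_cnj bounded_linear_ident)
 have Nd: "(N e has_derivative (%h. w * cnj h + h * cnj w)) (at w)" for e w
  unfolding N_def[abs_def]
  by (auto intro!: derivative_eq_intros dbar1_cnj)
 have cq: "C1_on UNIV (q e)" if "e > 0" for e
  unfolding q_def[abs_def]
  by (intro C1_on_divide C1_on_linear bounded_linear_cnj cN) (rule N0[OF that])
 have dq: "dbar1 (q e) w = of_real (e\<^sup>2) / (N e w)\<^sup>2" if "e > 0" for e w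
 proof -
  have "(q e has_derivative (%h. - cnj w * (inverse (N e w) * (w * cnj h + h * cnj w) * inverse (N e w)) + cnj h / N e w)) (at w)"
   unfolding q_def[abs_def]
   by (rule has_derivative_divide[OF dbar1_cnj Nd N0[OF that]])
  from dbar1_eqI[OF this]
  have "dbar1 (q e) w = (- cnj w * (inverse (N e w) * (w + cnj w) * inverse (N e w)) + 1 / N e w +
    \<i> * (- cnj w * (inverse (N e w) * (w * (- \<i>) + \<i> * cnj w) * inverse (N e w)) + (- \<i>) / N e w)) / 2"
   by simp
  also have "... = (N e w - w * cnj w) / (N e w)\<^sup>2"
   using N0[OF that, of w] by (simp add: field_simps power2_eq_square)
  finally show ?thesis by (simp add: N_def)
 qed
 have cG: "continuous_on UNIV G" by (rule C1_on_cont[OF G])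
 have cdG: "continuous_on UNIV (dbar1 G)"
  unfolding dbar1_def[abs_def] by (intro continuous_intros C1_on_deriv_cont[OF G]) simp
 have [measurable]: "G \<in> borel_measurable borel" "dbar1 G \<in> borel_measurable borel"
  using cG cdG by (auto intro: borel_measurable_continuous_onI)
 have dG0: "dbar1 G w = 0" if "norm w > \<rho>" for w
  unfolding dbar1_def using fder_outside[OF supp that] by simp
 obtain B where B: "B > 0" "!!w. norm (dbar1 G w) \<le> B"
  using bounded_cont_supp[OF cdG dG0] by blast
 obtain C where C: "C > 0" "!!w. norm (G w) \<le> C"
  using bounded_cont_supp[OF cG supp] by blast
 have [measurable]: "q e \<in> borel_measurable borel" if "e > 0" for e
  using C1_on_cont[OF cq[OF that]] by (rule borel_measurable_continuous_onI)
 \<comment> \<open>Integration by parts: the antiholomorphic derivative of the compactly supported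
   product \<open>G w * q e w\<close> has integral zero.\<close>
 have parts: "(\<integral>w. - (dbar1 G w * q e w) \<partial>lborel) = (\<integral>w. G w * (of_real (e\<^sup>2) / (N e w)\<^sup>2) \<partial>lborel)" if e: "e > 0" for e
 proof -
  have P: "C1_on UNIV (%w. G w * q e w)" by (intro C1_on_mult G cq e)
  have Ps: "G w * q e w = 0" if "norm w > \<rho>" for w using supp[OF that] by simp
  have dP: "dbar1 (%w. G w * q e w) w = dbar1 G w * q e w + G w * (of_real (e\<^sup>2) / (N e w)\<^sup>2)" for w
   unfolding dq[OF e, symmetric] using G cq[OF e] by (intro dbar1_mult) (auto simp: C1_on_def)
  have i1: "integrable lborel (%w. dbar1 G w * q e w)"
   by (rule integrable_cont_supp[where \<rho>=\<rho>])
     (use dG0 in \<open>auto intro!: continuous_intros cdG C1_on_cont[OF cq[OF e]]\<close>)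
  have i2: "integrable lborel (%w. G w * (of_real (e\<^sup>2) / (N e w)\<^sup>2))"
   by (rule integrable_cont_supp[where \<rho>=\<rho>])
     (use supp N0[OF e] in \<open>auto intro!: continuous_intros cG C1_on_cont[OF cN]\<close>)
  have i3: "integrable lborel (%w. fder (%w. G w * q e w) w v)" for v
   by (rule integrable_cont_supp[where \<rho>=\<rho>])
     (use fder_outside[OF Ps] in \<open>auto intro!: C1_on_deriv_cont[OF P]\<close>)
  have "(\<integral>w. dbar1 (%w. G w * q e w) w \<partial>lborel) = 0"
   unfolding dbar1_def using integral_frechet_derivative_zero[OF P Ps] i3 by simp
  then have "(\<integral>w. dbar1 G w * q e w \<partial>lborel) + (\<integral>w. G w * (of_real (e\<^sup>2) / (N e w)\<^sup>2) \<partial>lborel) = 0"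
   unfolding dP using i1 i2 by simp
  then show ?thesis by (simp add: add_eq_0_iff)
 qed
 have "(%m. \<integral>w. - (dbar1 G w * q (\<epsilon> m) w) \<partial>lborel) \<longlonglongrightarrow> (\<integral>w. - (dbar1 G w / w) \<partial>lborel)"
 proof (rule integral_dominated_convergence[where w="%w. B * (indicator (cball 0 \<rho>) w / norm w)"])
  show "integrable lborel (%w. B * (indicator (cball 0 \<rho>) w / norm (w::complex)))"
   by (intro integrable_mult_right integrable_inverse_norm_complex)
  have nz: "AE w in lborel. w \<noteq> (0::complex)" by (rule AE_I[of _ _ "{0}"]) auto
  show "AE w in lborel. (%m. - (dbar1 G w * q (\<epsilon> m) w)) \<longlonglongrightarrow> - (dbar1 G w / w)"
   using nz
  proof eventually_elim
   case (elim w)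
   have "(%m. - (dbar1 G w * (cnj w / N (\<epsilon> m) w))) \<longlonglongrightarrow> - (dbar1 G w * (cnj w / (w * cnj w + of_real (0\<^sup>2))))"
    unfolding N_def by (intro tendsto_intros \<epsilon>0) (use elim in auto)
   then show ?case using elim by (simp add: q_def)
  qed
  show "AE w in lborel. norm (- (dbar1 G w * q (\<epsilon> m) w)) \<le> B * (indicator (cball 0 \<rho>) w / norm w)" for m
   using nz
  proof eventually_elim
   case (elim w)
   have "norm (q (\<epsilon> m) w) = norm w / ((norm w)\<^sup>2 + (\<epsilon> m)\<^sup>2)"
    unfolding q_def N norm_divide norm_of_real by simp
   also have "... \<le> norm w / (norm w)\<^sup>2"
    using elim by (intro divide_left_mono) (auto intro!: mult_pos_pos add_pos_nonneg)
   finally have "norm (q (\<epsilon> m) w) \<le> 1 / norm w" using elim by (simp add: power2_eq_square)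
   then have "norm (dbar1 G w) * norm (q (\<epsilon> m) w) \<le> B * (1 / norm w)"
    using B by (intro mult_mono) auto
   then show ?case using dG0[of w] by (cases "norm w \<le> \<rho>") (auto simp: norm_mult indicator_def)
  qed
 qed (use \<epsilon> in auto)
 moreover have "(%m. \<integral>w. - (dbar1 G w * q (\<epsilon> m) w) \<partial>lborel) \<longlonglongrightarrow> of_real cauchy_const * G 0"
 proof -
  \<comment> \<open>Scaling by \<open>\<epsilon> m\<close> turns the approximate identity into a
    fixed integrable density, while \<open>G\<close> is evaluated at points that tend to 0.\<close>
  have eq: "(\<integral>w. - (dbar1 G w * q (\<epsilon> m) w) \<partial>lborel) = (\<integral>w. G (\<epsilon> m *\<^sub>R w) * of_real (1 / (1 + (norm w)\<^sup>2)\<^sup>2) \<partial>lborel)" for m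
  proof -
   have [measurable]: "(%w. G w * (of_real ((\<epsilon> m)\<^sup>2) / (N (\<epsilon> m) w)\<^sup>2)) \<in> borel_measurable borel"
    unfolding N by measurable
   have "(\<integral>w. G w * (of_real ((\<epsilon> m)\<^sup>2) / (N (\<epsilon> m) w)\<^sup>2) \<partial>lborel) =
     (\<integral>w. of_real ((\<epsilon> m)\<^sup>2) * (G (\<epsilon> m *\<^sub>R w) * (of_real ((\<epsilon> m)\<^sup>2) / (N (\<epsilon> m) (\<epsilon> m *\<^sub>R w))\<^sup>2)) \<partial>lborel)"
    unfolding integral_mult_right_zero by (rule lborel_integral_scale_complex[OF _ \<epsilon>[of m]]) measurable
   moreover have "of_real ((\<epsilon> m)\<^sup>2) * (G (\<epsilon> m *\<^sub>R w) * (of_real ((\<epsilon> m)\<^sup>2) / (N (\<epsilon> m) (\<epsilon> m *\<^sub>R w))\<^sup>2)) =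
     G (\<epsilon> m *\<^sub>R w) * of_real (1 / (1 + (norm w)\<^sup>2)\<^sup>2)" for w
   proof -
    have "N (\<epsilon> m) (\<epsilon> m *\<^sub>R w) = of_real ((\<epsilon> m)\<^sup>2 * (1 + (norm w)\<^sup>2))"
     unfolding N by (simp add: power_mult_distrib algebra_simps)
    then show ?thesis using \<epsilon>[of m] by (simp add: power2_eq_square)
   qed
   ultimately show ?thesis using parts[OF \<epsilon>] by simp
  qed
  have "(%m. \<integral>w. G (\<epsilon> m *\<^sub>R w) * of_real (1 / (1 + (norm w)\<^sup>2)\<^sup>2) \<partial>lborel) \<longlonglongrightarrow>
    (\<integral>w. G 0 * of_real (1 / (1 + (norm (w::complex))\<^sup>2)\<^sup>2) \<partial>lborel)"
  proof (rule integral_dominated_convergence[where w="%w. C * (1 / (1 + (norm w)\<^sup>2)\<^sup>2)"])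
   show "integrable lborel (%w::complex. C * (1 / (1 + (norm w)\<^sup>2)\<^sup>2))"
    by (intro integrable_mult_right integrable_Cauchy_complex)
   show "AE w in lborel. (%m. G (\<epsilon> m *\<^sub>R w) * of_real (1 / (1 + (norm w)\<^sup>2)\<^sup>2)) \<longlonglongrightarrow> G 0 * of_real (1 / (1 + (norm w)\<^sup>2)\<^sup>2)"
   proof (rule AE_I2)
    fix w :: complex
    have "(%m. \<epsilon> m *\<^sub>R w) \<longlonglongrightarrow> 0 *\<^sub>R w" by (intro tendsto_intros \<epsilon>0)
    moreover have "isCont G 0" using cG by (simp add: continuous_on_eq_continuous_at)
    ultimately have "(%m. G (\<epsilon> m *\<^sub>R w)) \<longlonglongrightarrow> G 0" using isCont_tendsto_compose[of 0 G] by simp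
    then show "(%m. G (\<epsilon> m *\<^sub>R w) * of_real (1 / (1 + (norm w)\<^sup>2)\<^sup>2)) \<longlonglongrightarrow> G 0 * of_real (1 / (1 + (norm w)\<^sup>2)\<^sup>2)"
     by (rule tendsto_mult_right)
   qed
   show "AE w in lborel. norm (G (\<epsilon> m *\<^sub>R w) * of_real (1 / (1 + (norm w)\<^sup>2)\<^sup>2)) \<le> C * (1 / (1 + (norm w)\<^sup>2)\<^sup>2)" for m
    unfolding norm_mult norm_of_real by (intro AE_I2 mult_mono C) (use C in auto)
  qed auto
  moreover have "(\<integral>w. G 0 * of_real (1 / (1 + (norm (w::complex))\<^sup>2)\<^sup>2) \<partial>lborel) = of_real cauchy_const * G 0"
   unfolding cauchy_const_def integral_mult_right_zero integral_complex_of_real by (rule mult.commute)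
  ultimately show ?thesis unfolding eq by simp
 qed
 ultimately show ?thesis using LIMSEQ_unique by blast
qed

lemma pompeiu:
 assumes F: "C1_on UNIV F" and supp: "!!x. norm x > \<rho> ==> F x = 0"
 shows "of_real cauchy_const * F z = (\<integral>w. dbar1 F w / (z - w) \<partial>lborel)"
proof -
 let ?G = "%w. F (z + w)"
 have D: "((%w. F (z + w)) has_derivative fder F (z + w)) (at w)" for w
 proof -
  have "((%w. z + w) has_derivative (%h. h)) (at w)" by (auto intro!: derivative_eq_intros)
  from diff_chain_at[OF this C1_onD[OF F UNIV_I]] show ?thesis by (simp add: o_def)
 qed
 have G: "C1_on UNIV ?G"
  by (rule C1_on_compose[OF F C1_on_add[OF C1_on_const C1_on_linear[OF bounded_linear_ident]]]) auto
 have "of_real cauchy_const * ?G 0 = (\<integral>w. - (dbar1 ?G w / w) \<partial>lborel)"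
 proof (rule pompeiu_at_0[OF G])
  show "?G w = 0" if "norm w > \<rho> + norm z" for w
   using that norm_triangle_ineq4[of "z + w" z] by (intro supp) simp
 qed
 also have "... = (\<integral>w. dbar1 F (z + w) / (z - (z + w)) \<partial>lborel)"
  unfolding dbar1_eqI[OF D] dbar1_def by simp
 also have "... = (\<integral>w. dbar1 F w / (z - w) \<partial>lborel)"
 proof (rule lborel_integral_translate)
  have "continuous_on UNIV (dbar1 F)"
   unfolding dbar1_def[abs_def] by (intro continuous_intros C1_on_deriv_cont[OF F]) simp
  then have [measurable]: "dbar1 F \<in> borel_measurable borel"
   by (rule borel_measurable_continuous_onI)
  show "(%w. dbar1 F w / (z - w)) \<in> borel_measurable borel" by measurable
 qed
 finally show ?thesis by simp
qed

section \<open>The model estimate with a Gaussian weight\<close>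

subsection \<open>Cutoff functions\<close>

text \<open>The square of the positive part is a cutoff profile with one continuous derivative,
  explicit enough to be differentiated by hand.\<close>

definition possq :: "real => real" where "possq t = (max 0 t)\<^sup>2"

lemma possq_deriv: "(possq has_field_derivative 2 * max 0 t) (at t)"
proof -
 consider "t > 0" | "t < 0" | "t = 0" by linarith
 then show ?thesis
 proof cases
  case 1
  have "((%t. t\<^sup>2) has_field_derivative 2 * max 0 t) (at t)"
   using 1 by (auto intro!: derivative_eq_intros)
  then show ?thesis
   by (rule has_field_derivative_transform_within_open[of _ _ _ "{0<..}"]) (use 1 in \<open>auto simp: possq_def\<close>)
 next
  case 2
  have "((%t. 0) has_field_derivative 2 * max 0 t) (at t)"
   using 2 by (auto intro!: derivative_eq_intros)
  then show ?thesis
   by (rule has_field_derivative_transform_within_open[of _ _ _ "{..<0}"]) (use 2 in \<open>auto simp: possq_def\<close>)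
 next
  case 3
  have "((%h. max 0 h) \<longlongrightarrow> max 0 (0::real)) (at 0)" by (intro tendsto_intros)
  moreover have "\<forall>\<^sub>F h in at 0. max 0 h = (possq (0 + h) - possq 0) / h"
   by (auto simp: eventually_at_filter possq_def max_def power2_eq_square)
  ultimately have "((%h. (possq (0 + h) - possq 0) / h) \<longlongrightarrow> 0) (at 0)"
   using tendsto_cong by force
  then show ?thesis using 3 by (simp add: DERIV_def)
 qed
qed

lemma C1_on_possq: "C1_on S possq"
 by (rule C1_on_field[OF possq_deriv]) (intro continuous_intros)

lemma possq_nonneg: "possq t \<ge> 0" by (simp add: possq_def)

lemma possq_pos: "t > 0 ==> possq t > 0" by (simp add: possq_def)

lemma possq_zero: "t \<le> 0 ==> possq t = 0" by (simp add: possq_def)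

text \<open>The denominator never vanishes, since \<open>2 - t\<close> and \<open>t - 1\<close> are
  not both nonpositive. The quotient is 1 on the unit disc and 0 beyond radius sqrt 2; the radius
  3/2 in the lemmas is a rational bound for sqrt 2.\<close>

definition cutoff :: "complex => complex" where
 "cutoff w = of_real (possq (2 - (norm w)\<^sup>2) / (possq (2 - (norm w)\<^sup>2) + possq ((norm w)\<^sup>2 - 1)))"

lemma C1_on_norm_square: "C1_on S (%x::'a::euclidean_space. (norm x)\<^sup>2)"
 unfolding power2_norm_eq_inner
 by (rule C1_onI[where f'="%x v. 2 * (x \<bullet> v)"])
   (auto intro!: derivative_eq_intros continuous_intros simp: inner_commute)

lemma cutoff_denominator_pos: "possq (2 - t) + possq (t - 1) > 0"
proof (cases "t < 2")
 case True
 then show ?thesis using possq_pos[of "2 - t"] possq_nonneg[of "t - 1"] by simp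
next
 case False
 then show ?thesis using possq_pos[of "t - 1"] possq_nonneg[of "2 - t"] by simp
qed

lemma C1_on_cutoff: "C1_on UNIV cutoff"
proof -
 have "possq (2 - (norm w)\<^sup>2) + possq ((norm w)\<^sup>2 - 1) \<noteq> 0" for w :: complex
  using cutoff_denominator_pos by (simp add: less_le)
 moreover have "C1_on UNIV (%w::complex. possq (2 - (norm w)\<^sup>2))"
  by (rule C1_on_compose[OF C1_on_possq[of UNIV] C1_on_diff[OF C1_on_const C1_on_norm_square]]) auto
 moreover have "C1_on UNIV (%w::complex. possq ((norm w)\<^sup>2 - 1))"
  by (rule C1_on_compose[OF C1_on_possq[of UNIV] C1_on_diff[OF C1_on_norm_square C1_on_const]]) auto
 ultimately show ?thesis
  unfolding cutoff_def[abs_def] by (intro C1_on_of_real C1_on_divide C1_on_add) auto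
qed

lemma cutoff_eq_1: "norm w \<le> 1 ==> cutoff w = 1"
 using cutoff_denominator_pos[of "(norm w)\<^sup>2"] power_mono[of "norm w" 1 2]
 by (simp add: cutoff_def possq_zero)

lemma cutoff_eq_0: "norm w > 3/2 ==> cutoff w = 0"
proof -
 assume "norm w > 3/2"
 then have "(norm w)\<^sup>2 \<ge> (3/2)\<^sup>2" by (intro power_mono) auto
 then have "(norm w)\<^sup>2 \<ge> 2" by (simp add: power2_eq_square)
 then show ?thesis by (simp add: cutoff_def possq_zero)
qed

lemma norm_cutoff_le: "norm (cutoff w) \<le> 1"
 unfolding cutoff_def norm_of_real
 using cutoff_denominator_pos[of "(norm w)\<^sup>2"] possq_nonneg[of "2 - (norm w)\<^sup>2"] possq_nonneg[of "(norm w)\<^sup>2 - 1"]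
 by (simp add: divide_le_eq_1)

definition cutoffR :: "real => complex => complex" where
 "cutoffR R w = cutoff ((1 / R) *\<^sub>R w)"

lemma dbar1_cutoffR:
 assumes "R > 0"
 shows "dbar1 (cutoffR R) w = (1 / R) *\<^sub>R dbar1 cutoff ((1 / R) *\<^sub>R w)"
proof -
 have "((%w. (1 / R) *\<^sub>R w) has_derivative (%h. (1 / R) *\<^sub>R h)) (at w)"
  by (auto intro!: derivative_eq_intros)
 from diff_chain_at[OF this C1_onD[OF C1_on_cutoff UNIV_I]]
 have "(cutoffR R has_derivative (%h. fder cutoff ((1 / R) *\<^sub>R w) ((1 / R) *\<^sub>R h))) (at w)"
  by (simp add: o_def cutoffR_def[abs_def])
 from dbar1_eqI[OF this] show ?thesis
  unfolding linear_cmul[OF C1_on_linear_deriv[OF C1_on_cutoff UNIV_I]] dbar1_def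
  by (simp only: mult_scaleR_right scaleR_right_distrib[symmetric]) simp
qed

lemma C1_on_cutoffR: "C1_on UNIV (cutoffR R)"
 unfolding cutoffR_def[abs_def]
 by (rule C1_on_compose[OF C1_on_cutoff C1_on_linear[OF bounded_linear_scaleR_right]]) auto

lemma cutoffR_eq_1: "R > 0 ==> norm w \<le> R ==> cutoffR R w = 1"
 unfolding cutoffR_def by (rule cutoff_eq_1) simp

lemma cutoffR_eq_0: "R > 0 ==> norm w > 3/2 * R ==> cutoffR R w = 0"
 unfolding cutoffR_def by (rule cutoff_eq_0) (simp add: field_simps)

lemma continuous_on_dbar1: "C1_on S f ==> continuous_on S (dbar1 f)"
 unfolding dbar1_def[abs_def] by (intro continuous_intros C1_on_deriv_cont) auto

lemma dbar1_cutoffR_eq_0: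
 assumes "R > 0" "norm w < R \<or> norm w > 3/2 * R"
 shows "dbar1 (cutoffR R) w = 0"
proof -
 have "open {w :: complex. norm w < R}" "open {w :: complex. norm w > 3/2 * R}"
  by (intro open_Collect_less continuous_intros)+
 then have "fder (cutoffR R) w = fder (%_. 0) w \<or>
   fder (cutoffR R) w = fder (%_. 1) w"
  using assms frechet_derivative_cong_open[of _ w "cutoffR R" "%_. 0"]
   frechet_derivative_cong_open[of _ w "cutoffR R" "%_. 1"]
   cutoffR_eq_1[OF assms(1)] cutoffR_eq_0[OF assms(1)]
  by (metis (mono_tags, lifting) less_imp_le mem_Collect_eq)
 then show ?thesis unfolding dbar1_def by auto
qed

lemma dbar1_cutoff_bounded:
 obtains B where "B > 0" "!!R w. R \<ge> 1 ==> norm (dbar1 (cutoffR R) w) \<le> B / R"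
proof -
 have "dbar1 cutoff w = 0" if "norm w > 3/2" for w
  unfolding dbar1_def using fder_outside[of "3/2" cutoff w] cutoff_eq_0 that by simp
 then obtain B where B: "B > 0" "!!w. norm (dbar1 cutoff w) \<le> B"
  using bounded_cont_supp[OF continuous_on_dbar1[OF C1_on_cutoff]] by blast
 have "norm (dbar1 (cutoffR R) w) \<le> B / R" if "R \<ge> 1" for R w
  using that B(2) by (simp add: dbar1_cutoffR divide_right_mono)
 then show ?thesis using that B(1) by blast
qed

subsection \<open>The weighted Cauchy kernel\<close>

text \<open>Obtained from the Cauchy-Pompeiu formula for
  \<open>cutoffR R w * g w * exp (cnj w * (\<zeta> - w))\<close> by collecting the terms in which
  the derivative does not fall on \<open>g\<close>. The exponential contributes a factor
  \<open>\<zeta> - w\<close>, which cancels the singularity. Where the cutoff is constantly 1 there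
  remains, up to normalisation, the Bargmann-Fock reproducing kernel times its weight.\<close>

definition bk :: "real => complex => complex => complex" where
 "bk R \<zeta> w = (dbar1 (cutoffR R) w / (\<zeta> - w) + cutoffR R w) * exp (cnj w * (\<zeta> - w))"

definition bkd :: "real => complex => complex => complex" where
 "bkd R \<zeta> w = (cnj w * (dbar1 (cutoffR R) w / (\<zeta> - w) + cutoffR R w) - dbar1 (cutoffR R) w / (\<zeta> - w)\<^sup>2) *
   exp (cnj w * (\<zeta> - w))"

text \<open>For \<open>norm \<zeta> < R\<close> the singular term is invisible: the derivative of
  the cutoff vanishes for \<open>norm w < R\<close>, so \<open>\<zeta> = w\<close> never meets it.
  Hence the kernel is holomorphic in \<open>\<zeta>\<close>, with derivative
  \<open>bkd\<close>.\<close>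

lemma bk_deriv:
 assumes "norm \<zeta> < R"
 shows "((%\<zeta>. bk R \<zeta> w) has_field_derivative bkd R \<zeta> w) (at \<zeta>)"
proof (cases "norm w < R")
 case True
 have "R > 0" using assms norm_ge_zero[of \<zeta>] by linarith
 then have "dbar1 (cutoffR R) w = 0" using True by (intro dbar1_cutoffR_eq_0) auto
 then show ?thesis
  unfolding bk_def bkd_def by (auto intro!: derivative_eq_intros)
next
 case False
 then have nz: "\<zeta> - w \<noteq> 0" using assms by auto
 define a c where "a = dbar1 (cutoffR R) w" and "c = cutoffR R w"
 have "((%\<zeta>. a / (\<zeta> - w) + c) has_field_derivative - (a / (\<zeta> - w)\<^sup>2)) (at \<zeta>)"
  using nz by (auto intro!: derivative_eq_intros simp: power2_eq_square)
 moreover have "((%\<zeta>. exp (cnj w * (\<zeta> - w))) has_field_derivative cnj w * exp (cnj w * (\<zeta> - w))) (at \<zeta>)"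
  by (auto intro!: derivative_eq_intros)
 ultimately show ?thesis
  unfolding bk_def bkd_def a_def[symmetric] c_def[symmetric]
  by (rule DERIV_cong[OF DERIV_mult]) (simp add: algebra_simps)
qed

text \<open>Two open sets suffice: where \<open>norm w < R\<close> the function is zero, and off the
  diagonal it is a quotient of continuous functions.\<close>

lemma continuous_on_bk_aux:
 assumes "R > 0"
 shows "continuous_on (ball 0 R \<times> UNIV) (%(\<zeta>, w). dbar1 (cutoffR R) w / (\<zeta> - w) ^ m)"
proof -
 let ?f = "%p. dbar1 (cutoffR R) (snd p) / (fst p - snd p) ^ m"
 let ?S = "{p :: complex \<times> complex. norm (snd p) < R}" and ?T = "{p :: complex \<times> complex. fst p \<noteq> snd p}"
 have "open ?S" by (intro open_Collect_less continuous_intros)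
 moreover have "open ?T" by (intro open_Collect_neq continuous_intros)
 moreover have "continuous_on ?S ?f"
  by (rule continuous_on_eq[of _ "%_. 0"]) (use dbar1_cutoffR_eq_0[OF assms] in auto)
 moreover have "continuous_on ?T ?f"
  by (intro continuous_intros continuous_on_compose2[OF continuous_on_dbar1[OF C1_on_cutoffR]]) auto
 ultimately have "continuous_on (?S \<union> ?T) ?f" by (rule continuous_on_open_Un)
 then have "continuous_on (ball 0 R \<times> UNIV) ?f"
  by (rule continuous_on_subset) auto
 then show ?thesis by (simp add: case_prod_beta)
qed

lemma continuous_on_cutoffR: "continuous_on S (cutoffR R)"
 using C1_on_cont[OF C1_on_cutoffR] continuous_on_subset by blast

lemma continuous_on_bk:
 assumes "R > 0"
 shows "continuous_on (ball 0 R \<times> UNIV) (%(\<zeta>, w). bk R \<zeta> w)"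
  and "continuous_on (ball 0 R \<times> UNIV) (%(\<zeta>, w). bkd R \<zeta> w)"
proof -
 note c = continuous_on_bk_aux[OF assms, of 1, unfolded case_prod_beta power_one_right]
  continuous_on_bk_aux[OF assms, of 2, unfolded case_prod_beta]
 show "continuous_on (ball 0 R \<times> UNIV) (%(\<zeta>, w). bk R \<zeta> w)"
  "continuous_on (ball 0 R \<times> UNIV) (%(\<zeta>, w). bkd R \<zeta> w)"
  unfolding bk_def bkd_def case_prod_beta
  by (intro continuous_intros c continuous_on_compose2[OF continuous_on_cutoffR]; auto)+
qed

lemma bk_eq_0:
 assumes "R > 0" "norm w > 3/2 * R"
 shows "bk R \<zeta> w = 0" "bkd R \<zeta> w = 0"
 using cutoffR_eq_0[OF assms] dbar1_cutoffR_eq_0[of R w] assms by (auto simp: bk_def bkd_def)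

lemma integrable_divide_diff:
 assumes H: "continuous_on UNIV H" and supp: "!!w. norm w > \<rho> ==> H w = 0"
 shows "integrable lborel (%w::complex. H w / (z - w) :: complex)"
proof -
 obtain B where B: "B > 0" "!!w. norm (H w) \<le> B"
  using bounded_cont_supp[OF assms] by blast
 have [measurable]: "H \<in> borel_measurable borel" using H by (rule borel_measurable_continuous_onI)
 have "integrable lborel (%w. H (z + w) / (z - (z + w)))"
 proof (rule Bochner_Integration.integrable_bound)
  show "integrable lborel (%w. B * (indicator (cball 0 (\<rho> + norm z)) w / norm (w::complex)))"
   by (intro integrable_mult_right integrable_inverse_norm_complex)
  show "AE w in lborel. norm (H (z + w) / (z - (z + w))) \<le> norm (B * (indicator (cball 0 (\<rho> + norm z)) w / norm w))"
  proof (rule AE_I2)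
   fix w
   show "norm (H (z + w) / (z - (z + w))) \<le> norm (B * (indicator (cball 0 (\<rho> + norm z)) w / norm w))"
   proof (cases "norm w \<le> \<rho> + norm z")
    case True
    then show ?thesis using B by (simp add: norm_divide divide_right_mono abs_mult)
   next
    case False
    then have "norm (z + w) > \<rho>" using norm_triangle_ineq4[of "z + w" z] by simp
    then show ?thesis using supp by simp
   qed
  qed
 qed measurable
 then have "integrable (distr lborel borel ((+) z)) (%w. H w / (z - w))"
  by (subst integrable_distr_eq) auto
 then show ?thesis by (simp add: lborel_distr_plus)
qed

text \<open>This is Pompeiu's formula for \<open>g\<close> times cutoff times exponential; the last
  two factors are 1 at \<open>w = z\<close>. The exponential is inserted because it makes the
  kernels decay like Gaussians once the weight is taken into account.\<close>

lemma cauchy_kernel_formula: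
 assumes g: "C1_on (ball 0 (2 * R)) g" and z: "norm z < R"
 shows "integrable lborel (%w. cutoffR R w * dbar1 g w * exp (cnj w * (z - w)) / (z - w))"
  and "integrable lborel (%w. g w * bk R z w)"
  and "of_real cauchy_const * g z =
   (\<integral>w. cutoffR R w * dbar1 g w * exp (cnj w * (z - w)) / (z - w) \<partial>lborel) + (\<integral>w. g w * bk R z w \<partial>lborel)"
proof -
 have R: "R > 0" using z norm_ge_zero[of z] by linarith
 have opn: "open {w :: complex. norm w > 3/2 * R}" by (intro open_Collect_less continuous_intros)
 have cov: "w \<in> ball 0 (2 * R) \<or> w \<in> {w. norm w > 3/2 * R}" for w :: complex
  using R by (auto simp: dist_norm)
 define E where "E w = exp (cnj w * (z - w))" for w
 have dE: "(E has_derivative (%h. (cnj w * (- h) + cnj h * (z - w)) * exp (cnj w * (z - w)))) (at w)" for w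
 proof -
  have "((%w. cnj w * (z - w)) has_derivative (%h. cnj w * (- h) + cnj h * (z - w))) (at w)"
   by (auto intro!: derivative_eq_intros dbar1_cnj)
  from diff_chain_at[OF this DERIV_exp[unfolded has_field_derivative_def]]
  show ?thesis unfolding E_def[abs_def] by (simp add: o_def mult.commute)
 qed
 have CE: "C1_on S E" for S
  by (rule C1_onI[OF dE]) (intro continuous_intros)
 have dbE: "dbar1 E w = (z - w) * E w" for w
  unfolding dbar1_eqI[OF dE] by (simp add: E_def field_simps)
 define F where "F w = cutoffR R w * g w * E w" for w
 have FC: "C1_on UNIV F"
 proof (rule C1_on_local)
  fix x :: complex
  have 1: "C1_on (ball 0 (2 * R)) F"
   unfolding F_def[abs_def] by (intro C1_on_mult g CE C1_on_subset[OF C1_on_cutoffR]) auto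
  have 2: "C1_on {w. norm w > 3/2 * R} F"
   by (rule C1_on_cong[OF opn C1_on_const[of _ 0]]) (auto simp: F_def cutoffR_eq_0[OF R])
  show "\<exists>U. open U \<and> x \<in> U \<and> C1_on (U \<inter> UNIV) F"
   using cov[of x] 1 2 opn open_ball[of 0 "2 * R"] by (metis Int_UNIV_right)
 qed
 have Fs: "F w = 0" if "norm w > 3/2 * R" for w using that by (simp add: F_def cutoffR_eq_0[OF R])
 have dF: "dbar1 F w = cutoffR R w * dbar1 g w * E w + g w * (dbar1 (cutoffR R) w + (z - w) * cutoffR R w) * E w" for w
 proof (cases "norm w < 2 * R")
  case True
  have d: "cutoffR R differentiable (at w)" "g differentiable (at w)" "E differentiable (at w)"
   "(%w. cutoffR R w * g w) differentiable (at w)"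
   using C1_on_cutoffR[of R] g CE[of UNIV] True by (auto simp: C1_on_def intro!: differentiable_mult)
  show ?thesis
   unfolding F_def[abs_def] dbar1_mult[OF d(4,3)] dbar1_mult[OF d(1,2)] dbE by (simp add: algebra_simps)
 next
  case False
  then have "norm w > 3/2 * R" using R by simp
  then show ?thesis
   using fder_outside[of "3/2 * R" F w] Fs cutoffR_eq_0[OF R] dbar1_cutoffR_eq_0[OF R]
   by (simp add: dbar1_def[of F])
 qed
 have "continuous_on UNIV (%w. g w * bk R z w)"
 proof -
  have 1: "continuous_on (ball 0 (2 * R)) (%w. g w * bk R z w)"
  proof (intro continuous_intros C1_on_cont[OF g])
   have "continuous_on (ball 0 (2 * R)) (%w. (%(\<zeta>, w). bk R \<zeta> w) (z, w))"
    by (intro continuous_on_compose2[OF continuous_on_bk(1)[OF R]] continuous_intros) (use z in auto)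
   then show "continuous_on (ball 0 (2 * R)) (bk R z)" by simp
  qed
  have 2: "continuous_on {w. norm w > 3/2 * R} (%w. g w * bk R z w)"
   by (rule continuous_on_eq[of _ "%_. 0"]) (auto simp: bk_eq_0[OF R])
  have "continuous_on (ball 0 (2 * R) \<union> {w. norm w > 3/2 * R}) (%w. g w * bk R z w)"
   by (rule continuous_on_open_Un[OF open_ball opn 1 2])
  then show ?thesis by (rule continuous_on_subset) (use cov in blast)
 qed
 then show i2: "integrable lborel (%w. g w * bk R z w)"
  by (rule integrable_cont_supp[where \<rho>="3/2 * R"]) (simp add: bk_eq_0[OF R])
 have i0: "integrable lborel (%w. dbar1 F w / (z - w))"
 proof (rule integrable_divide_diff[OF continuous_on_dbar1[OF FC], where \<rho>="3/2 * R"])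
  show "dbar1 F w = 0" if "norm w > 3/2 * R" for w
   unfolding dbar1_def using fder_outside[of "3/2 * R" F w] Fs that by simp
 qed
 have nz: "AE w in lborel. w \<noteq> z" by (rule AE_I[of _ _ "{z}"]) auto
 \<comment> \<open>The point \<open>w = z\<close> has to be excluded: there the quotients by
   \<open>z - w\<close> are 0 by convention and the cancellation fails.\<close>
 have eq: "AE w in lborel. dbar1 F w / (z - w) - g w * bk R z w = cutoffR R w * dbar1 g w * exp (cnj w * (z - w)) / (z - w)"
  using nz
 proof eventually_elim
  case (elim w)
  then have "z - w \<noteq> 0" by simp
  have "(a * b * e + c * (D + d * x) * e) / d - c * ((D / d + x) * e) = a * b * e / d"
   if "d \<noteq> 0" for a b c d e x D :: complex
   using that by (simp add: field_simps)
  from this[OF \<open>z - w \<noteq> 0\<close>] show ?case unfolding dF bk_def E_def .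
 qed
 let ?c = "%w. cutoffR R w * dbar1 g w * exp (cnj w * (z - w)) / (z - w)"
 have m: "?c \<in> borel_measurable lborel"
 proof -
  let ?a = "%w. cutoffR R w * dbar1 g w * exp (cnj w * (z - w))"
  have 1: "continuous_on (ball 0 (2 * R)) ?a"
   by (intro continuous_intros continuous_on_cutoffR continuous_on_dbar1[OF g])
  have 2: "continuous_on {w. norm w > 3/2 * R} (%w. cutoffR R w * dbar1 g w * exp (cnj w * (z - w)))"
   by (rule continuous_on_eq[of _ "%_. 0"]) (auto simp: cutoffR_eq_0[OF R])
  have "continuous_on (ball 0 (2 * R) \<union> {w. norm w > 3/2 * R}) (%w. cutoffR R w * dbar1 g w * exp (cnj w * (z - w)))"
   by (rule continuous_on_open_Un[OF open_ball opn 1 2])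
  then have "continuous_on UNIV ?a"
   by (rule continuous_on_subset) (use cov in blast)
  then have [measurable]: "?a \<in> borel_measurable borel"
   by (rule borel_measurable_continuous_onI)
  show ?thesis by measurable
 qed
 have id: "integrable lborel (%w. dbar1 F w / (z - w) - g w * bk R z w)"
  using i0 i2 by simp
 then show i1: "integrable lborel ?c"
  by (rule integrable_cong_AE_imp[OF _ m]) (use eq in \<open>eventually_elim, simp\<close>)
 let ?b = "\<integral>w. cutoffR R w * dbar1 g w * exp (cnj w * (z - w)) / (z - w) \<partial>lborel"
 let ?d = "\<integral>w. dbar1 F w / (z - w) - g w * bk R z w \<partial>lborel"
 have "of_real cauchy_const * g z = of_real cauchy_const * F z"
  using z by (simp add: F_def E_def cutoffR_eq_1[OF R])
 also have "... = (\<integral>w. dbar1 F w / (z - w) \<partial>lborel)" by (rule pompeiu[OF FC Fs])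
 also have "... = ?d + (\<integral>w. g w * bk R z w \<partial>lborel)"
  using i0 i2 by simp
 also have "?d =
   ?b"
  by (rule integral_cong_AE) (use id m eq in auto)
 finally show "of_real cauchy_const * g z =
   ?b + (\<integral>w. g w * bk R z w \<partial>lborel)" .
qed

subsection \<open>Operators in one complex variable\<close>

definition upd :: "complex ^ 'n::finite => 'n => complex => complex ^ 'n" where
 "upd z l w = (\<chi> i. if i = l then w else z $ i)"

text \<open>Each coordinate has its own radius, because the operators below shrink the domain in one
  coordinate at a time.\<close>

definition polydisc :: "('n::finite => real) => (complex ^ 'n) set" where
 "polydisc r = {z. \<forall>i. norm (z $ i) < r i}"

lemma upd_nth [simp]: "upd z l w $ i = (if i = l then w else z $ i)"
 by (simp add: upd_def)

lemma upd_eq: "upd z l w = z + (w - z $ l) *s axis l 1"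
 by (auto simp: vec_eq_iff axis_def)

abbreviation cube where "cube R == polydisc (%_. R)"

lemma open_polydisc: "open (polydisc r)"
proof -
 have "polydisc r = (\<Inter>i\<in>UNIV. {z. norm (z $ i) < r i})" by (auto simp: polydisc_def)
 then show ?thesis by (auto intro!: open_Collect_less continuous_intros)
qed

lemma upd_polydisc: "z \<in> polydisc (r(l := s)) ==> norm w < r l ==> upd z l w \<in> polydisc r"
 by (auto simp: polydisc_def split: if_splits)

lemma polydisc_nth: "z \<in> polydisc (r(l := s)) ==> norm (z $ l) < s"
 by (auto simp: polydisc_def dest: spec[of _ l])

lemma continuous_on_upd [continuous_intros]:
 assumes "continuous_on S f" "continuous_on S g"
 shows "continuous_on S (%x. upd (f x) l (g x))"
 unfolding upd_eq
 by (intro continuous_intros assms bounded_linear.continuous_on[OF bounded_linear_smult_vec_left])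

lemma has_derivative_upd_left: "((%z. upd z l w) has_derivative (%h. upd h l 0)) (at z)"
proof -
 have "bounded_linear (%h :: complex ^ 'a. upd h l 0)"
  by (rule linear_conv_bounded_linear[THEN iffD1]) (auto intro!: linearI simp: vec_eq_iff)
 then have "((%z. upd z l 0 + upd 0 l w) has_derivative (%h. upd h l 0)) (at z)"
  by (auto intro!: derivative_eq_intros bounded_linear_imp_has_derivative)
 moreover have "upd z l 0 + upd 0 l w = upd z l w" for z :: "complex ^ 'a" by (auto simp: vec_eq_iff)
 ultimately show ?thesis by simp
qed

lemma has_derivative_upd_right: "((%w. upd z l w) has_derivative (%h. h *s axis l 1)) (at w)"
proof -
 have "((%w. w - z $ l) has_derivative (%h. h)) (at w)" by (auto intro!: derivative_eq_intros)
 from has_derivative_add[OF has_derivative_const bounded_linear.has_derivative[OF bounded_linear_smult_vec_left this], of z]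
 show ?thesis unfolding upd_eq by simp
qed

lemma C1_on_slice:
 assumes "C1_on S g" "!!w. w \<in> T ==> upd z l w \<in> S"
 shows "C1_on T (%w. g (upd z l w))"
  and "w \<in> T ==> dbar1 (%w. g (upd z l w)) w = dbar g (upd z l w) (axis l 1)"
proof -
 have C: "C1_on T (upd z l)"
  by (rule C1_onI[OF has_derivative_upd_right]) (intro continuous_intros)
 show "C1_on T (%w. g (upd z l w))"
  by (rule C1_on_compose[OF assms(1) C]) (use assms(2) in auto)
 assume "w \<in> T"
 then have "upd z l w \<in> S" using assms(2) by auto
 from diff_chain_at[OF has_derivative_upd_right C1_onD[OF assms(1) this]]
 have "((%w. g (upd z l w)) has_derivative (%h. fder g (upd z l w) (h *s axis l 1))) (at w)"
  by (simp add: o_def)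
 from dbar1_eqI[OF this] show "dbar1 (%w. g (upd z l w)) w = dbar g (upd z l w) (axis l 1)"
  by (simp add: dbar_def)
qed

definition Pop :: "'n => real => (complex ^ 'n::finite => complex) => complex ^ 'n => complex" where
 "Pop l R g z = (\<integral>w. g (upd z l w) * bk R (z $ l) w \<partial>lborel) / of_real cauchy_const"

text \<open>The variable \<open>z $ l\<close> enters only through the kernel, which is holomorphic
  in it, and the other variables only through \<open>g\<close>; everything follows by
  differentiating under the integral.\<close>

lemma Pop_C1:
 fixes g :: "complex ^ 'n::finite => complex"
 assumes g: "C1_on (polydisc r) g" and R: "R > 0" and rl: "r l = 2 * R"
 shows "C1_on (polydisc (r(l := R))) (Pop l R g)"
  and "!!z. z \<in> polydisc (r(l := R)) ==> dbar (Pop l R g) z (axis l 1) = 0"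
  and "!!z i. z \<in> polydisc (r(l := R)) ==> i \<noteq> l ==>
   dbar (Pop l R g) z (axis i 1) = Pop l R (%z. dbar g z (axis i 1)) z"
proof -
 let ?U = "polydisc (r(l := R))"
 define f where "f z w = g (upd z l w) * bk R (z $ l) w" for z w
 \<comment> \<open>Nothing is known about \<open>g\<close> beyond radius \<open>2 * R\<close>, so
   the derivative is set to 0 there. Between \<open>3/2 * R\<close> and \<open>2 * R\<close> both
   formulas vanish, which makes the pieces fit continuously.\<close>
 define f' where "f' z w h = (if norm w < 2 * R then g (upd z l w) * (bkd R (z $ l) w * h $ l) +
   fder g (upd z l w) (upd h l 0) * bk R (z $ l) w else 0)" for z w h
 have cov: "norm w < 2 * R \<or> norm w > 3/2 * R" for w :: complex using R by auto
 have inb: "upd z l w \<in> polydisc r" if "z \<in> ?U" "norm w < 2 * R" for z w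
  using upd_polydisc[OF that(1)] that(2) rl by simp
 have zl: "norm (z $ l) < R" if "z \<in> ?U" for z using polydisc_nth[OF that] .
 have D: "((%z. f z w) has_derivative f' z w) (at z)" if z: "z \<in> ?U" for z w
 proof (cases "norm w < 2 * R")
  case True
  have 1: "((%z. g (upd z l w)) has_derivative (%h. fder g (upd z l w) (upd h l 0))) (at z)"
   using diff_chain_at[OF has_derivative_upd_left C1_onD[OF g inb[OF z True]]] by (simp add: o_def)
  have "((%z::complex ^ 'n. z $ l) has_derivative (%h. h $ l)) (at z)"
   by (intro bounded_linear_imp_has_derivative bounded_linear_vec_nth)
  from diff_chain_at[OF this bk_deriv[OF zl[OF z], unfolded has_field_derivative_def]]
  have 2: "((%z. bk R (z $ l) w) has_derivative (%h. bkd R (z $ l) w * h $ l)) (at z)"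
   by (simp add: o_def)
  show ?thesis
   unfolding f_def f'_def using has_derivative_mult[OF 1 2] True by simp
 next
  case False
  then have "norm w > 3/2 * R" using cov by blast
  then have "(%z. f z w) = (%_. 0)" by (simp add: f_def bk_eq_0[OF R] fun_eq_iff)
  then show ?thesis using False by (simp add: f'_def[abs_def])
 qed
 have op1: "open {p :: (complex ^ 'n) \<times> complex. norm (snd p) < 2 * R}"
  and op2: "open {p :: (complex ^ 'n) \<times> complex. norm (snd p) > 3/2 * R}"
  by (intro open_Collect_less continuous_intros)+
 have opU: "open (?U \<times> (UNIV :: complex set))" by (intro open_Times open_polydisc open_UNIV)
 have glue: "continuous_on (?U \<times> UNIV) F"
  if 1: "continuous_on ((?U \<times> UNIV) \<inter> {p. norm (snd p) < 2 * R}) F"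
  and 2: "!!p. fst p \<in> ?U ==> norm (snd p) > 3/2 * R ==> F p = 0" for F :: "(complex ^ 'n) \<times> complex => complex"
 proof -
  have "continuous_on ((?U \<times> UNIV) \<inter> {p. norm (snd p) > 3/2 * R}) F"
   by (rule continuous_on_eq[of _ "%_. 0"]) (use 2 in auto)
  from continuous_on_open_Un[OF _ _ 1 this]
  have "continuous_on ((?U \<times> UNIV) \<inter> {p. norm (snd p) < 2 * R} \<union> (?U \<times> UNIV) \<inter> {p. norm (snd p) > 3/2 * R}) F"
   using opU op1 op2 by (simp add: open_Int)
  then show ?thesis by (rule continuous_on_subset) (use cov in blast)
 qed
 let ?S = "(?U \<times> UNIV) \<inter> {p :: (complex ^ 'n) \<times> complex. norm (snd p) < 2 * R}"
 have cb: "continuous_on ?S (%p. bk R (fst p $ l) (snd p))" "continuous_on ?S (%p. bkd R (fst p $ l) (snd p))"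
 proof -
  have "continuous_on ?S (%p. (%(\<zeta>, w). bk R \<zeta> w) (fst p $ l, snd p))"
   "continuous_on ?S (%p. (%(\<zeta>, w). bkd R \<zeta> w) (fst p $ l, snd p))"
   by (intro continuous_on_compose2[OF continuous_on_bk(1)[OF R]] continuous_on_compose2[OF continuous_on_bk(2)[OF R]]
     continuous_intros; use zl in auto)+
  then show "continuous_on ?S (%p. bk R (fst p $ l) (snd p))" "continuous_on ?S (%p. bkd R (fst p $ l) (snd p))"
   by simp_all
 qed
 have cg: "continuous_on ?S (%p. g (upd (fst p) l (snd p)))"
  by (rule continuous_on_compose2[OF C1_on_cont[OF g]]) (auto intro!: continuous_intros inb)
 have cDg: "continuous_on ?S (%p. fder g (upd (fst p) l (snd p)) v)" for v
  by (rule continuous_on_compose2[OF C1_on_deriv_cont[OF g]]) (auto intro!: continuous_intros inb)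
 have cf: "continuous_on (?U \<times> UNIV) (%(z, w). f z w)"
  unfolding case_prod_beta
 proof (rule glue)
  show "continuous_on ?S (%p. f (fst p) (snd p))"
   unfolding f_def by (intro continuous_intros cg cb)
 qed (simp add: f_def bk_eq_0[OF R])
 have cf': "continuous_on (?U \<times> UNIV) (%(z, w). f' z w v)" for v
  unfolding case_prod_beta
 proof (rule glue)
  have "continuous_on ?S (%p. g (upd (fst p) l (snd p)) * (bkd R (fst p $ l) (snd p) * v $ l) +
    fder g (upd (fst p) l (snd p)) (upd v l 0) * bk R (fst p $ l) (snd p))"
   by (intro continuous_intros cg cb cDg)
  then show "continuous_on ?S (%p. f' (fst p) (snd p) v)"
   by (rule continuous_on_eq) (auto simp: f'_def)
 qed (auto simp: f'_def bk_eq_0[OF R])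
 have supp: "f z w = 0 \<and> (\<forall>v. f' z w v = 0)" if "norm w > 3/2 * R" for z w
  using that by (auto simp: f_def f'_def bk_eq_0[OF R])
 have L: "((%z. \<integral>w. f z w \<partial>lborel) has_derivative (%v. \<integral>w. f' z w v \<partial>lborel)) (at z)"
  "integrable lborel (%w. f' z w v)" if "z \<in> ?U" for z v
  by (rule has_derivative_integral_parameter[OF open_polydisc D cf cf' supp, where \<rho>="3/2 * R"]; (fact that)?; assumption)+
 have L2: "continuous_on ?U (%z. \<integral>w. f' z w v \<partial>lborel)" for v
  by (rule has_derivative_integral_parameter(2)[OF open_polydisc D cf cf' supp, where \<rho>="3/2 * R"]; assumption)
 have Pder: "(Pop l R g has_derivative (%h. (\<integral>w. f' z w h \<partial>lborel) / of_real cauchy_const)) (at z)" if "z \<in> ?U" for z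
  unfolding Pop_def[abs_def] f_def[symmetric]
  by (intro bounded_linear.has_derivative[OF bounded_linear_divide] L(1) that)
 show "C1_on ?U (Pop l R g)"
  by (rule C1_onI[OF Pder]) (auto intro!: continuous_intros L2 simp: less_imp_neq[OF cauchy_const_pos, symmetric])
 have dP: "dbar (Pop l R g) z h = (\<integral>w. (f' z w h + \<i> * f' z w (\<i> *s h)) / 2 \<partial>lborel) / of_real cauchy_const" if "z \<in> ?U" for z h
 proof -
  have "(\<integral>w. (f' z w h + \<i> * f' z w (\<i> *s h)) / 2 \<partial>lborel) =
    ((\<integral>w. f' z w h \<partial>lborel) + \<i> * (\<integral>w. f' z w (\<i> *s h) \<partial>lborel)) / 2"
   using L(2)[OF that] by simp
  then show ?thesis
   unfolding dbar_eqI[OF Pder[OF that]] by (simp add: add_divide_distrib mult.commute)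
 qed
 show "dbar (Pop l R g) z (axis l 1) = 0" if z: "z \<in> ?U" for z
 proof -
  have 0: "upd (axis l 1) l 0 = 0" "upd (\<i> *s axis l 1) l 0 = (0 :: complex ^ 'n)"
   by (auto simp: vec_eq_iff axis_def)
  have "f' z w (axis l 1) + \<i> * f' z w (\<i> *s axis l 1) = 0" for w
   unfolding f'_def 0 using linear_0[OF C1_on_linear_deriv[OF g inb[OF z]]]
   by (auto simp: algebra_simps)
  then show ?thesis unfolding dP[OF z] by simp
 qed
 show "dbar (Pop l R g) z (axis i 1) = Pop l R (%z. dbar g z (axis i 1)) z"
  if z: "z \<in> ?U" and "i \<noteq> l" for z i
 proof -
  have 0: "upd (axis i 1) l 0 = axis i 1" "upd (\<i> *s axis i 1) l 0 = (\<i> *s axis i 1 :: complex ^ 'n)"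
   using \<open>i \<noteq> l\<close> by (auto simp: vec_eq_iff axis_def)
  have "(f' z w (axis i 1) + \<i> * f' z w (\<i> *s axis i 1)) / 2 = dbar g (upd z l w) (axis i 1) * bk R (z $ l) w" for w
   unfolding f'_def 0 using \<open>i \<noteq> l\<close> bk_eq_0[OF R, of w] cov[of w]
   by (auto simp: algebra_simps dbar_def axis_def add_divide_distrib)
  then show ?thesis unfolding dP[OF z] Pop_def by simp
 qed
qed

subsection \<open>Gaussian \<open>L\<^sup>2\<close> bounds\<close>

text \<open>The squared norm, despite the name, in the Gaussian weight of Fock space.\<close>

definition gnorm :: "(complex ^ 'n::finite) set => (complex ^ 'n => complex) => ennreal" where
 "gnorm S g = wint S (%z. (norm (g z))\<^sup>2 * exp (- (norm z)\<^sup>2))"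

lemma nn_integral_translate:
 fixes f :: "'a::euclidean_space => ennreal"
 assumes [measurable]: "f \<in> borel_measurable borel"
 shows "(\<integral>\<^sup>+x. f (c + x) \<partial>lborel) = (\<integral>\<^sup>+x. f x \<partial>lborel)"
proof -
 have "(\<integral>\<^sup>+x. f x \<partial>distr lborel borel ((+) c)) = (\<integral>\<^sup>+x. f (c + x) \<partial>lborel)"
  by (rule nn_integral_distr) auto
 then show ?thesis by (simp add: lborel_distr_plus)
qed

lemma norm_integral_le_nn_integral:
 fixes f :: "'a => 'b::{banach, second_countable_topology}"
 shows "ennreal (norm (integral\<^sup>L M f)) \<le> (\<integral>\<^sup>+x. ennreal (norm (f x)) \<partial>M)"
 using integral_norm_bound_ennreal[of M f]
 by (cases "integrable M f") (auto simp: not_integrable_integral_eq)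

text \<open>Schur's test for convolution along the complex line through \<open>a\<close>:
  Cauchy-Schwarz with the kernel split into two square roots, then Fubini and translation
  invariance.\<close>

lemma schur_convolution:
 fixes k :: "complex => real" and G :: "complex ^ 'n::finite => ennreal"
 assumes [measurable]: "k \<in> borel_measurable borel" "G \<in> borel_measurable borel" and k: "!!u. k u \<ge> 0"
 shows "(\<integral>\<^sup>+z. (\<integral>\<^sup>+u. ennreal (k u) * G (z + u *s a) \<partial>lborel)\<^sup>2 \<partial>lborel) \<le>
  (\<integral>\<^sup>+u. ennreal (k u) \<partial>lborel)\<^sup>2 * (\<integral>\<^sup>+z. (G z)\<^sup>2 \<partial>lborel)"
proof -
 let ?K = "\<integral>\<^sup>+u. ennreal (k u) \<partial>lborel"
 let ?a = "%p :: (complex ^ 'n) \<times> complex. fst p + snd p *s a"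
 have [measurable]: "?a \<in> borel_measurable (lborel \<Otimes>\<^sub>M lborel)"
 proof -
  have "continuous_on UNIV ?a"
   by (intro continuous_intros bounded_linear.continuous_on[OF bounded_linear_smult_vec_left])
  then have "?a \<in> borel_measurable borel"
   by (rule borel_measurable_continuous_onI)
  then show ?thesis by (simp add: lborel_prod measurable_lborel1 flip: borel_prod)
 qed
 have [measurable]: "(%u. z + u *s a) \<in> borel_measurable borel" for z
  by (intro borel_measurable_continuous_onI continuous_intros bounded_linear.continuous_on[OF bounded_linear_smult_vec_left])
 have "(\<integral>\<^sup>+u. ennreal (k u) * G (z + u *s a) \<partial>lborel)\<^sup>2 \<le> ?K * (\<integral>\<^sup>+u. ennreal (k u) * (G (z + u *s a))\<^sup>2 \<partial>lborel)" for z
 proof -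
  have s: "ennreal (sqrt (k u)) * ennreal (sqrt (k u)) = ennreal (k u)" for u
   using k[of u] by (simp flip: ennreal_mult)
  have "(\<integral>\<^sup>+u. ennreal (sqrt (k u)) * (ennreal (sqrt (k u)) * G (z + u *s a)) \<partial>lborel)\<^sup>2 \<le>
    (\<integral>\<^sup>+u. (ennreal (sqrt (k u)))\<^sup>2 \<partial>lborel) * (\<integral>\<^sup>+u. (ennreal (sqrt (k u)) * G (z + u *s a))\<^sup>2 \<partial>lborel)"
   by (rule Cauchy_Schwarz_nn_integral) measurable
  then show ?thesis
   unfolding power_mult_distrib unfolding power2_eq_square[of "ennreal (sqrt _)"] s mult.assoc[symmetric] .
 qed
 then have "(\<integral>\<^sup>+z. (\<integral>\<^sup>+u. ennreal (k u) * G (z + u *s a) \<partial>lborel)\<^sup>2 \<partial>lborel) \<le>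
   (\<integral>\<^sup>+z. ?K * (\<integral>\<^sup>+u. ennreal (k u) * (G (z + u *s a))\<^sup>2 \<partial>lborel) \<partial>lborel)"
  by (intro nn_integral_mono)
 also have "... = ?K * (\<integral>\<^sup>+z. \<integral>\<^sup>+u. ennreal (k u) * (G (z + u *s a))\<^sup>2 \<partial>lborel \<partial>lborel)"
  by (rule nn_integral_cmult) measurable
 also have "(\<integral>\<^sup>+z. \<integral>\<^sup>+u. ennreal (k u) * (G (z + u *s a))\<^sup>2 \<partial>lborel \<partial>lborel) =
   (\<integral>\<^sup>+u. \<integral>\<^sup>+z. ennreal (k u) * (G (z + u *s a))\<^sup>2 \<partial>lborel \<partial>lborel)"
  by (rule lborel_pair.Fubini'[symmetric]) measurable
 also have "... = (\<integral>\<^sup>+u. ennreal (k u) * (\<integral>\<^sup>+z. (G z)\<^sup>2 \<partial>lborel) \<partial>lborel)"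
 proof (rule nn_integral_cong)
  fix u
  let ?b = "\<integral>\<^sup>+z. ennreal (k u) * (G (z + u *s a))\<^sup>2 \<partial>lborel"
  have "?b = ennreal (k u) * (\<integral>\<^sup>+z. (G (z + u *s a))\<^sup>2 \<partial>lborel)"
   by (rule nn_integral_cmult) measurable
  also have "(\<integral>\<^sup>+z. (G (z + u *s a))\<^sup>2 \<partial>lborel) = (\<integral>\<^sup>+z. (G z)\<^sup>2 \<partial>lborel)"
   using nn_integral_translate[of "%z. (G z)\<^sup>2" "u *s a"] by (simp add: add.commute)
  finally show "?b = ennreal (k u) * (\<integral>\<^sup>+z. (G z)\<^sup>2 \<partial>lborel)" .
 qed
 also have "... = ?K * (\<integral>\<^sup>+z. (G z)\<^sup>2 \<partial>lborel)"
  by (rule nn_integral_multc) measurable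
 finally show ?thesis by (simp add: power2_eq_square mult.assoc)
qed

text \<open>The exponential factor in the bound for \<open>Q\<close> moves the square root of the
  weight from one argument to the other in coordinate \<open>l\<close>, and the other coordinates
  are untouched. What is left is a convolution with \<open>k\<close>, so the constant does not
  involve the radii.\<close>

lemma gnorm_kernel_bound:
 fixes g :: "complex ^ 'n::finite => complex"
 assumes g: "continuous_on (polydisc r) g"
  and [measurable]: "k \<in> borel_measurable borel" and k: "!!u. k u \<ge> 0"
  and Q: "!!\<zeta> w. norm \<zeta> < s ==> norm (Q \<zeta> w) \<le> k (w - \<zeta>) * exp ((norm \<zeta>)\<^sup>2 / 2 - (norm w)\<^sup>2 / 2)"
  and Q0: "!!\<zeta> w. norm w \<ge> r l ==> Q \<zeta> w = 0"
  and h: "!!z. z \<in> polydisc (r(l := s)) ==> h z = (\<integral>w. g (upd z l w) * Q (z $ l) w \<partial>lborel)"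
 shows "gnorm (polydisc (r(l := s))) h \<le> (\<integral>\<^sup>+u. ennreal (k u) \<partial>lborel)\<^sup>2 * gnorm (polydisc r) g"
proof -
 let ?U = "polydisc (r(l := s))"
 define G where "G y = ennreal (norm (g y) * exp (- (norm y)\<^sup>2 / 2)) * indicator (polydisc r) y" for y
 have [measurable]: "G \<in> borel_measurable borel"
 proof -
  let ?a = "%y. ennreal (if y \<in> polydisc r then norm (g y) * exp (- (norm y)\<^sup>2 / 2) else 0)"
  have "(%y. if y \<in> polydisc r then norm (g y) * exp (- (norm y)\<^sup>2 / 2) else 0) \<in> borel_measurable borel"
   by (rule borel_measurable_continuous_on_if)
     (auto intro!: continuous_intros g borel_open[OF open_polydisc])
  then have "?a \<in> borel_measurable borel"
   by measurable
  moreover have "G = ?a"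
   by (auto simp: G_def indicator_def fun_eq_iff)
  ultimately show ?thesis by simp
 qed
 have ptw: "ennreal (norm (h z) * exp (- (norm z)\<^sup>2 / 2)) \<le> (\<integral>\<^sup>+u. ennreal (k u) * G (z + u *s axis l 1) \<partial>lborel)"
  if z: "z \<in> ?U" for z
 proof -
  let ?c = "exp (- (norm z)\<^sup>2 / 2)" and ?q = "%w. g (upd z l w) * Q (z $ l) w"
  have "ennreal (norm (\<integral>w. ?q w * of_real ?c \<partial>lborel)) \<le> (\<integral>\<^sup>+w. ennreal (norm (?q w * of_real ?c)) \<partial>lborel)"
   by (rule norm_integral_le_nn_integral)
  then have "ennreal (norm (h z) * ?c) \<le> (\<integral>\<^sup>+w. ennreal (norm (?q w) * ?c) \<partial>lborel)"
   unfolding integral_mult_left_zero h[OF z, symmetric] norm_mult norm_of_real by simp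
  also have "... \<le> (\<integral>\<^sup>+w. ennreal (k (w - z $ l)) * G (upd z l w) \<partial>lborel)"
  proof -
   have "ennreal (norm (?q w) * ?c) \<le> ennreal (k (w - z $ l)) * G (upd z l w)" for w
   proof (cases "norm w < r l")
    case True
    have zl: "norm (z $ l) < s" using polydisc_nth[OF z] .
    have split: "(norm y)\<^sup>2 = (norm (y $ l))\<^sup>2 + (\<Sum>i\<in>UNIV - {l}. (norm (y $ i))\<^sup>2)" for y :: "complex ^ 'n"
     by (simp add: norm_vec_def L2_set_def sum_nonneg sum.remove[of UNIV l])
    have "(norm z)\<^sup>2 - (norm (z $ l))\<^sup>2 = (norm (upd z l w))\<^sup>2 - (norm w)\<^sup>2"
     unfolding split[of z] split[of "upd z l w"] by simp
    then have e: "(norm (z $ l))\<^sup>2 / 2 - (norm w)\<^sup>2 / 2 + - (norm z)\<^sup>2 / 2 = - (norm (upd z l w))\<^sup>2 / 2" by (simp add: field_simps)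
    have "norm (g (upd z l w) * Q (z $ l) w) * exp (- (norm z)\<^sup>2 / 2) \<le>
      norm (g (upd z l w)) * (k (w - z $ l) * exp ((norm (z $ l))\<^sup>2 / 2 - (norm w)\<^sup>2 / 2)) * exp (- (norm z)\<^sup>2 / 2)"
     unfolding norm_mult by (intro mult_right_mono mult_left_mono Q zl) auto
    also have "... = k (w - z $ l) * (norm (g (upd z l w)) * exp (- (norm (upd z l w))\<^sup>2 / 2))"
     unfolding e[symmetric] exp_add by (simp add: mult_ac)
    finally show ?thesis
     using upd_polydisc[OF z True] k by (simp add: G_def ennreal_leI flip: ennreal_mult)
   next
    case False
    then show ?thesis by (simp add: Q0)
   qed
   then show ?thesis by (rule nn_integral_mono)
  qed
  also have "... = (\<integral>\<^sup>+u. ennreal (k (z $ l + u - z $ l)) * G (upd z l (z $ l + u)) \<partial>lborel)"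
  proof (rule nn_integral_translate[symmetric])
   have [measurable]: "upd z l \<in> borel_measurable borel"
    by (intro borel_measurable_continuous_onI continuous_intros)
   show "(%w. ennreal (k (w - z $ l)) * G (upd z l w)) \<in> borel_measurable borel" by measurable
  qed
  finally show ?thesis by (simp add: upd_eq flip: ennreal_mult)
 qed
 have "gnorm ?U h \<le> (\<integral>\<^sup>+z. (\<integral>\<^sup>+u. ennreal (k u) * G (z + u *s axis l 1) \<partial>lborel)\<^sup>2 \<partial>lborel)"
  unfolding gnorm_def
 proof (rule nn_integral_mono)
  fix z
  let ?b = "\<integral>\<^sup>+u. ennreal (k u) * G (z + u *s axis l 1) \<partial>lborel"
  show "ennreal ((norm (h z))\<^sup>2 * exp (- (norm z)\<^sup>2)) * indicator ?U z \<le> ?b\<^sup>2"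
  proof (cases "z \<in> ?U")
   case True
   have "(norm (h z))\<^sup>2 * exp (- (norm z)\<^sup>2) = (norm (h z) * exp (- (norm z)\<^sup>2 / 2))\<^sup>2"
    by (simp add: power_mult_distrib exp_double[symmetric])
   then have "ennreal ((norm (h z))\<^sup>2 * exp (- (norm z)\<^sup>2)) = (ennreal (norm (h z) * exp (- (norm z)\<^sup>2 / 2)))\<^sup>2"
    by (simp add: ennreal_power)
   also have "... \<le> ?b\<^sup>2"
    by (intro power_mono ptw True) simp
   finally show ?thesis using True by simp
  qed simp
 qed
 also have "... \<le> (\<integral>\<^sup>+u. ennreal (k u) \<partial>lborel)\<^sup>2 * (\<integral>\<^sup>+z. (G z)\<^sup>2 \<partial>lborel)"
  by (rule schur_convolution) (use k in auto)
 also have "(\<integral>\<^sup>+z. (G z)\<^sup>2 \<partial>lborel) = gnorm (polydisc r) g"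
  unfolding gnorm_def
  by (intro nn_integral_cong)
    (auto simp: G_def indicator_def ennreal_power power_mult_distrib exp_double[symmetric])
 finally show ?thesis .
qed

text \<open>Completing the square in the real part of the exponent; this is what produces
  convolution kernels.\<close>

lemma norm_exp_kernel:
 "norm (exp (cnj w * (\<zeta> - w))) = exp (- ((norm (w - \<zeta>))\<^sup>2 / 2)) * exp ((norm \<zeta>)\<^sup>2 / 2 - (norm w)\<^sup>2 / 2)"
proof -
 have "Re (cnj w * (\<zeta> - w)) = - ((norm (w - \<zeta>))\<^sup>2 / 2) + ((norm \<zeta>)\<^sup>2 / 2 - (norm w)\<^sup>2 / 2)"
  unfolding cmod_power2 by (simp add: power2_eq_square field_simps)
 then show ?thesis by (simp add: norm_exp_eq_Re flip: exp_add)
qed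

text \<open>Convolution majorants: \<open>kT\<close> for the error operator of the Cauchy formula,
  \<open>kP\<close> for \<open>Pop\<close>, where \<open>B\<close> bounds the derivative of the
  cutoff.\<close>

definition kT :: "complex => real" where "kT u = exp (- ((norm u)\<^sup>2 / 2)) / norm u / cauchy_const"

definition kP :: "real => complex => real" where
 "kP B u = (B * (exp (- ((norm u)\<^sup>2 / 2)) / norm u) + exp (- ((norm u)\<^sup>2 / 2))) / cauchy_const"

lemma kT_measurable [measurable]: "kT \<in> borel_measurable borel"
 unfolding kT_def[abs_def] by measurable

lemma kP_measurable [measurable]: "kP B \<in> borel_measurable borel"
 unfolding kP_def[abs_def] by measurable

lemma kP_finite:
 assumes "B \<ge> 0"
 shows "(\<integral>\<^sup>+u. ennreal (kP B u) \<partial>lborel) < \<infinity>"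
proof -
 let ?c = "1 / cauchy_const"
 have "(\<integral>\<^sup>+u. ennreal (kP B u) \<partial>lborel) =
  (\<integral>\<^sup>+u. ennreal (?c * B) * ennreal (exp (- ((norm u)\<^sup>2 / 2)) / norm u) + ennreal ?c * ennreal (exp (- ((norm u)\<^sup>2 / 2))) \<partial>(lborel :: complex measure))"
  unfolding kP_def using assms cauchy_const_pos
  by (intro nn_integral_cong) (simp add: ennreal_plus[symmetric] add_divide_distrib del: ennreal_plus flip: ennreal_mult)
 also have "... = ennreal (?c * B) * (\<integral>\<^sup>+u. ennreal (exp (- ((norm u)\<^sup>2 / 2)) / norm u) \<partial>(lborel :: complex measure)) +
   ennreal ?c * (\<integral>\<^sup>+u. ennreal (exp (- ((norm u)\<^sup>2 / 2))) \<partial>(lborel :: complex measure))"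
  by (subst nn_integral_add) (auto simp: nn_integral_cmult)
 also have "... < \<infinity>"
  using nn_integral_gaussian_finite nn_integral_singular_gaussian_finite
  by (simp add: ennreal_mult_less_top)
 finally show ?thesis .
qed

lemma kT_finite: "(\<integral>\<^sup>+u. ennreal (kT u) \<partial>lborel) < \<infinity>"
proof -
 have "(\<integral>\<^sup>+u. ennreal (kT u) \<partial>lborel) \<le> (\<integral>\<^sup>+u. ennreal (kP 1 u) \<partial>lborel)"
  using cauchy_const_pos
  unfolding kT_def kP_def
  by (intro nn_integral_mono ennreal_leI divide_right_mono) simp_all
 then show ?thesis using kP_finite[of 1] by simp
qed

lemma norm_sum_square_le: "(norm (x + y))\<^sup>2 \<le> 2 * (norm x)\<^sup>2 + 2 * (norm (y :: 'a::real_normed_vector))\<^sup>2"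
proof -
 have "(norm (x + y))\<^sup>2 \<le> (norm x + norm y)\<^sup>2"
  by (intro power_mono norm_triangle_ineq) auto
 also have "... \<le> 2 * (norm x)\<^sup>2 + 2 * (norm y)\<^sup>2"
  using zero_le_power2[of "norm x - norm y"] by (simp add: power2_sum power2_diff)
 finally show ?thesis .
qed

lemma gnorm_add_le:
 assumes "open S" "continuous_on S f" "continuous_on S g"
 shows "gnorm S (%z. f z + g z) \<le> 2 * gnorm S f + 2 * gnorm S g"
proof -
 let ?W = "%f z. (norm (f z))\<^sup>2 * exp (- (norm z)\<^sup>2)"
 have m: "(%z. ennreal (?W f z) * indicator S z) \<in> borel_measurable lborel" if "continuous_on S f" for f :: "complex ^ 'a => complex"
  using weighted_measurable[OF borel_open[OF assms(1)], of "?W f"] that by (simp add: continuous_intros)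
 have "?W (%z. f z + g z) z \<le> 2 * ?W f z + 2 * ?W g z" for z
  using mult_right_mono[OF norm_sum_square_le[of "f z" "g z"], of "exp (- (norm z)\<^sup>2)"] by (simp add: algebra_simps)
 then have "ennreal (?W (%z. f z + g z) z) \<le> 2 * ennreal (?W f z) + 2 * ennreal (?W g z)" for z
  using ennreal_leI by (fastforce simp: ennreal_plus ennreal_mult')
 then have "gnorm S (%z. f z + g z) \<le> (\<integral>\<^sup>+z. 2 * (ennreal (?W f z) * indicator S z) + 2 * (ennreal (?W g z) * indicator S z) \<partial>lborel)"
  unfolding gnorm_def by (intro nn_integral_mono) (auto simp: indicator_def)
 also have "... = 2 * gnorm S f + 2 * gnorm S g"
  unfolding gnorm_def using m[OF assms(2)] m[OF assms(3)] by (simp add: nn_integral_add nn_integral_cmult)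
 finally show ?thesis .
qed

lemma gnorm_mono: "S \<subseteq> T ==> gnorm S f \<le> gnorm T f"
 unfolding gnorm_def by (intro nn_integral_mono) (auto simp: indicator_def)

lemma gnorm_cong: "(!!z. z \<in> S ==> f z = g z) ==> gnorm S f = gnorm S g"
 unfolding gnorm_def by (intro nn_integral_cong) (auto simp: indicator_def)

text \<open>The derivative of the cutoff is at most \<open>B / R\<close>, hence at most
  \<open>B\<close> for \<open>R \<ge> 1\<close>, so one constant serves all \<open>R\<close>, all
  coordinates and all radii. For the second bound the Cauchy formula exhibits the difference as an
  integral operator applied to the derivative of \<open>g\<close> in coordinate
  \<open>l\<close>.\<close>

lemma Pop_bounds:
 obtains C where "C \<ge> 0"
  "!!R r l (g :: complex ^ 'n::finite => complex). R \<ge> 1 ==> r l = 2 * R ==> continuous_on (polydisc r) g ==>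
    gnorm (polydisc (r(l := R))) (Pop l R g) \<le> ennreal C * gnorm (polydisc r) g"
  "!!R r l (g :: complex ^ 'n::finite => complex). R \<ge> 1 ==> r l = 2 * R ==> C1_on (polydisc r) g ==>
    gnorm (polydisc (r(l := R))) (%z. g z - Pop l R g z) \<le> ennreal C * gnorm (polydisc r) (%z. dbar g z (axis l 1))"
proof -
 obtain B where B: "B > 0" "!!R w. R \<ge> 1 ==> norm (dbar1 (cutoffR R) w) \<le> B / R"
  using dbar1_cutoff_bounded by blast
 define IP where "IP = enn2real (\<integral>\<^sup>+u. ennreal (kP B u) \<partial>lborel)"
 define IT where "IT = enn2real (\<integral>\<^sup>+u. ennreal (kT u) \<partial>lborel)"
 have IP: "(\<integral>\<^sup>+u. ennreal (kP B u) \<partial>lborel) = ennreal IP" "IP \<ge> 0"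
  using kP_finite[of B] B by (auto simp: IP_def less_top)
 have IT: "(\<integral>\<^sup>+u. ennreal (kT u) \<partial>lborel) = ennreal IT" "IT \<ge> 0"
  using kT_finite by (auto simp: IT_def less_top)
 define C where "C = IP\<^sup>2 + IT\<^sup>2"
 have C: "C \<ge> 0" "IP\<^sup>2 \<le> C" "IT\<^sup>2 \<le> C" by (auto simp: C_def)
 let ?e = "%\<zeta> w. exp ((norm \<zeta>)\<^sup>2 / 2 - (norm w)\<^sup>2 / 2)"
 have up: "(ennreal I)\<^sup>2 * X \<le> ennreal C * X" if "I\<^sup>2 \<le> C" "I \<ge> 0" for I X
  using that by (intro mult_right_mono) (auto simp: ennreal_power ennreal_leI)
 show ?thesis
 proof (rule that[OF C(1)])
  fix R :: real and r l and g :: "complex ^ 'n => complex"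
  assume R: "R \<ge> 1" and rl: "r l = 2 * R" and g: "continuous_on (polydisc r) g"
  have R0: "R > 0" using R by simp
  have "gnorm (polydisc (r(l := R))) (Pop l R g) \<le>
    (\<integral>\<^sup>+u. ennreal (kP B u) \<partial>lborel)\<^sup>2 * gnorm (polydisc r) g"
  proof (rule gnorm_kernel_bound[OF g, where Q="%\<zeta> w. bk R \<zeta> w / of_real cauchy_const" and h="Pop l R g"])
   show "0 \<le> kP B u" for u using B cauchy_const_pos by (simp add: kP_def)
   show "bk R \<zeta> w / of_real cauchy_const = 0" if "r l \<le> norm w" for \<zeta> w
    using bk_eq_0(1)[OF R0, of w] that rl R by simp
   fix \<zeta> w :: complex assume "norm \<zeta> < R"
   have "norm (dbar1 (cutoffR R) w / (\<zeta> - w) + cutoffR R w) \<le> B / norm (w - \<zeta>) + 1"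
   proof (rule norm_triangle_le[OF add_mono])
    have "B / R \<le> B / 1" using R B by (intro divide_left_mono) auto
    then have "norm (dbar1 (cutoffR R) w) \<le> B" using B(2)[OF R, of w] by simp
    then show "norm (dbar1 (cutoffR R) w / (\<zeta> - w)) \<le> B / norm (w - \<zeta>)"
     by (simp add: norm_divide divide_right_mono norm_minus_commute)
    show "norm (cutoffR R w) \<le> 1" unfolding cutoffR_def by (rule norm_cutoff_le)
   qed
   then have "norm (bk R \<zeta> w) \<le> (B / norm (w - \<zeta>) + 1) * (exp (- ((norm (w - \<zeta>))\<^sup>2 / 2)) * ?e \<zeta> w)"
    unfolding bk_def norm_mult norm_exp_kernel by (intro mult_right_mono) auto
   then have "norm (bk R \<zeta> w / of_real cauchy_const) \<le> (B / norm (w - \<zeta>) + 1) * (exp (- ((norm (w - \<zeta>))\<^sup>2 / 2)) * ?e \<zeta> w) / cauchy_const"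
    using cauchy_const_pos by (simp add: norm_divide divide_right_mono)
   also have "... = kP B (w - \<zeta>) * ?e \<zeta> w"
    by (simp add: kP_def algebra_simps add_divide_distrib)
   finally show "norm (bk R \<zeta> w / of_real cauchy_const) \<le> kP B (w - \<zeta>) * ?e \<zeta> w" .
  qed (simp_all add: Pop_def)
  also have "... \<le> ennreal C * gnorm (polydisc r) g" unfolding IP by (rule up[OF C(2) IP(2)])
  finally show "gnorm (polydisc (r(l := R))) (Pop l R g) \<le> ennreal C * gnorm (polydisc r) g" .
 next
  fix R :: real and r l and g :: "complex ^ 'n => complex"
  assume R: "R \<ge> 1" and rl: "r l = 2 * R" and g: "C1_on (polydisc r) g"
  have R0: "R > 0" using R by simp
  define Q where "Q \<zeta> w = cutoffR R w * exp (cnj w * (\<zeta> - w)) / (\<zeta> - w) / of_real cauchy_const" for \<zeta> w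
  define h where "h z = g z - Pop l R g z" for z
  have hz: "h z = (\<integral>w. dbar g (upd z l w) (axis l 1) * Q (z $ l) w \<partial>lborel)" if z: "z \<in> polydisc (r(l := R))" for z
  proof -
   have inb: "upd z l w \<in> polydisc r" if "w \<in> ball 0 (2 * R)" for w
    using upd_polydisc[OF z] that rl by simp
   have "of_real cauchy_const * g (upd z l (z $ l)) =
     (\<integral>w. cutoffR R w * dbar1 (%w. g (upd z l w)) w * exp (cnj w * (z $ l - w)) / (z $ l - w) \<partial>lborel) +
     (\<integral>w. g (upd z l w) * bk R (z $ l) w \<partial>lborel)"
    by (rule cauchy_kernel_formula(3)[OF C1_on_slice(1)[OF g inb] polydisc_nth[OF z]])
   moreover have "upd z l (z $ l) = z" by (auto simp: vec_eq_iff)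
   moreover have "cutoffR R w * dbar1 (%w. g (upd z l w)) w * exp (cnj w * (z $ l - w)) / (z $ l - w) =
     of_real cauchy_const * (dbar g (upd z l w) (axis l 1) * Q (z $ l) w)" for w
   proof (cases "norm w < 2 * R")
    case True
    then have "dbar1 (%w. g (upd z l w)) w = dbar g (upd z l w) (axis l 1)"
     by (intro C1_on_slice(2)[OF g inb, where T="ball 0 (2*R)"]) auto
    then show ?thesis using cauchy_const_pos by (simp add: Q_def)
   next
    case False
    then have "cutoffR R w = 0" using R0 by (intro cutoffR_eq_0) auto
    then show ?thesis by (simp add: Q_def)
   qed
   moreover have "of_real cauchy_const * Pop l R g z = (\<integral>w. g (upd z l w) * bk R (z $ l) w \<partial>lborel)"
    using cauchy_const_pos by (simp add: Pop_def)
   ultimately have "of_real cauchy_const * g z =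
     (\<integral>w. of_real cauchy_const * (dbar g (upd z l w) (axis l 1) * Q (z $ l) w) \<partial>lborel) + of_real cauchy_const * Pop l R g z"
    by simp
   then show ?thesis
    unfolding integral_mult_right_zero using cauchy_const_pos
    by (simp add: h_def flip: distrib_left)
  qed
  have "gnorm (polydisc (r(l := R))) h \<le>
    (\<integral>\<^sup>+u. ennreal (kT u) \<partial>lborel)\<^sup>2 * gnorm (polydisc r) (%z. dbar g z (axis l 1))"
  proof (rule gnorm_kernel_bound[OF C1_on_dbar_cont[OF g] _ _ _ _ hz])
   show "0 \<le> kT u" for u using cauchy_const_pos by (simp add: kT_def)
   show "Q \<zeta> w = 0" if "r l \<le> norm w" for \<zeta> w
    using cutoffR_eq_0[OF R0, of w] that rl R by (simp add: Q_def)
   fix \<zeta> w :: complex assume "norm \<zeta> < R"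
   have "norm (cutoffR R w) \<le> 1" unfolding cutoffR_def by (rule norm_cutoff_le)
   then have "norm (Q \<zeta> w) \<le> 1 * (exp (- ((norm (w - \<zeta>))\<^sup>2 / 2)) * ?e \<zeta> w) / norm (\<zeta> - w) / cauchy_const"
    unfolding Q_def norm_mult norm_divide norm_exp_kernel using cauchy_const_pos
    by (simp only: norm_of_real abs_of_pos) (intro mult_right_mono divide_right_mono, auto)
   then show "norm (Q \<zeta> w) \<le> kT (w - \<zeta>) * ?e \<zeta> w"
    by (simp add: kT_def norm_minus_commute)
  qed simp_all
  also have "... \<le> ennreal C * gnorm (polydisc r) (%z. dbar g z (axis l 1))" unfolding IT by (rule up[OF C(3) IT(2)])
  finally show "gnorm (polydisc (r(l := R))) (%z. g z - Pop l R g z) \<le> ennreal C * gnorm (polydisc r) (%z. dbar g z (axis l 1))"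
   unfolding h_def[abs_def] .
 qed
qed

subsection \<open>Holomorphic approximation on polydiscs\<close>

lemma holo_on_polydiscI:
 assumes "C1_on S f" "!!z i. z \<in> S ==> dbar f z (axis i 1) = 0"
 shows "holo_on S f"
 unfolding holo_on_iff_dbar
proof safe
 fix z assume z: "z \<in> S"
 show d: "f differentiable (at z)" using assms(1) z by (simp add: C1_on_def)
 show "dbar f z v = 0" for v
  unfolding dbar_axis_sum[OF d, of v] by (simp add: assms(2)[OF z])
qed

definition split_radius :: "'n set => real => 'n => real" where
 "split_radius J R i = (if i \<in> J then R else 2 * R)"

abbreviation energy where "energy R v == \<Sum>i\<in>UNIV. gnorm (cube (2 * R)) (%z. dbar v z (axis i 1))"

text \<open>Invariant of the induction over coordinates: those in \<open>J\<close> have been treated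
  and have radius \<open>R\<close>, the others still have radius \<open>2 * R\<close>.\<close>

definition reduced :: "'n::finite set => real => ennreal => (complex ^ 'n => complex) => (complex ^ 'n => complex) => bool" where
 "reduced J R c v w \<longleftrightarrow> C1_on (polydisc (split_radius J R)) w \<and>
  (\<forall>i\<in>J. \<forall>z\<in>polydisc (split_radius J R). dbar w z (axis i 1) = 0) \<and>
  (\<forall>i. gnorm (polydisc (split_radius J R)) (%z. dbar w z (axis i 1)) \<le> c) \<and>
  gnorm (polydisc (split_radius J R)) (%z. v z - w z) \<le> c"

text \<open>Treating coordinate \<open>l\<close> by \<open>Pop\<close> kills the derivative there.
  The operator commutes with the derivatives in the other coordinates, so those already zero stay
  zero and the rest grow by a constant factor; the new contribution to the distance from
  \<open>v\<close> is bounded by the derivative just removed.\<close>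

lemma model_estimate_induct:
 fixes J :: "'n::finite set"
 shows "\<exists>C\<ge>0. \<forall>R\<ge>1. \<forall>v :: complex ^ 'n => complex. C1_on (cube (2 * R)) v --> (\<exists>w. reduced J R (ennreal C * energy R v) v w)"
  (is "\<exists>C\<ge>0. ?P J C")
 using finite[of J]
proof (induction J rule: finite_induct)
 case empty
 have "?P {} 1"
 proof (intro allI impI)
  fix R :: real and v :: "complex ^ 'n => complex"
  assume v: "C1_on (cube (2 * R)) v"
  have s: "split_radius {} R = (%_. 2 * R)" by (auto simp: split_radius_def)
  let ?N = "%i. gnorm (cube (2 * R)) (%z. dbar v z (axis i 1))"
  have "?N i \<le> ennreal 1 * (\<Sum>i\<in>UNIV. ?N i)" for i
   using member_le_sum[of i UNIV ?N] by simp
  moreover have "gnorm (cube (2 * R)) (%z. v z - v z) = 0" by (simp add: gnorm_def)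
  ultimately show "\<exists>w. reduced {} R (ennreal 1 * energy R v) v w"
   unfolding reduced_def s using v by (intro exI[of _ v] conjI allI) simp_all
 qed
 then show ?case by (intro exI[of _ 1] conjI) simp_all
next
 case (insert l J)
 then obtain C where C: "C \<ge> 0" "?P J C" by blast
 obtain c where c: "c \<ge> 0"
  "!!R r l (g :: complex ^ 'n::finite => complex). R \<ge> 1 ==> r l = 2 * R ==> continuous_on (polydisc r) g ==>
    gnorm (polydisc (r(l := R))) (Pop l R g) \<le> ennreal c * gnorm (polydisc r) g"
  "!!R r l (g :: complex ^ 'n => complex). R \<ge> 1 ==> r l = 2 * R ==> C1_on (polydisc r) g ==>
    gnorm (polydisc (r(l := R))) (%z. g z - Pop l R g z) \<le> ennreal c * gnorm (polydisc r) (%z. dbar g z (axis l 1))"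
  using Pop_bounds by blast
 \<comment> \<open>One constant for both requirements: \<open>c * C\<close> for the derivatives, and
   \<open>2 * C + 2 * (c * C)\<close> for the distance, from the triangle inequality for
   squares.\<close>
 define C' where "C' = c * C + (2 * C + 2 * (c * C))"
 have C': "C' \<ge> 0" "c * C \<le> C'" "2 * C + 2 * (c * C) \<le> C'" using c C by (auto simp: C'_def)
 have "?P (insert l J) C'"
 proof (intro allI impI)
  fix R :: real and v :: "complex ^ 'n => complex"
  assume R: "R \<ge> 1" and v: "C1_on (cube (2 * R)) v"
  have R0: "R > 0" using R by simp
  let ?r = "split_radius J R"
  let ?S = "energy R v"
  obtain w where w: "C1_on (polydisc ?r) w"
   "!!i z. i \<in> J ==> z \<in> polydisc ?r ==> dbar w z (axis i 1) = 0"
   "!!i. gnorm (polydisc ?r) (%z. dbar w z (axis i 1)) \<le> ennreal C * ?S"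
   "gnorm (polydisc ?r) (%z. v z - w z) \<le> ennreal C * ?S"
   using C(2) R v unfolding reduced_def by blast
  have rl: "?r l = 2 * R" using insert by (simp add: split_radius_def)
  have r': "split_radius (insert l J) R = ?r(l := R)" by (auto simp: split_radius_def)
  let ?U = "polydisc (?r(l := R))"
  have mono: "polydisc s \<subseteq> polydisc t" if "!!i. s i \<le> t i" for s t :: "'n => real"
   using that unfolding polydisc_def by (auto intro: less_le_trans)
  have sub: "?U \<subseteq> polydisc ?r" by (rule mono) (use R0 rl in auto)
  have sub': "polydisc ?r \<subseteq> cube (2 * R)" by (rule mono) (use R0 in \<open>auto simp: split_radius_def\<close>)
  let ?w = "Pop l R w"
  note P = Pop_C1[OF w(1) R0 rl]
  have cC: "ennreal c * X \<le> ennreal (c * C) * ?S" if "X \<le> ennreal C * ?S" for X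
   using mult_left_mono[OF that, of "ennreal c"] c(1) C(1) by (simp add: ennreal_mult mult.assoc)
  have b1: "gnorm ?U (%z. dbar ?w z (axis i 1)) \<le> ennreal (c * C) * ?S" for i
  proof (cases "i = l")
   case True
   then have "gnorm ?U (%z. dbar ?w z (axis i 1)) = gnorm ?U (%_. 0)"
    using P(2) by (intro gnorm_cong) auto
   then show ?thesis by (simp add: gnorm_def)
  next
   case False
   then have "gnorm ?U (%z. dbar ?w z (axis i 1)) =
    gnorm ?U (Pop l R (%z. dbar w z (axis i 1)))"
    using P(3) by (intro gnorm_cong) auto
   also have "... \<le> ennreal c * gnorm (polydisc ?r) (%z. dbar w z (axis i 1))"
    by (rule c(2)[OF R rl C1_on_dbar_cont[OF w(1)]])
   also have "... \<le> ennreal (c * C) * ?S" by (rule cC[OF w(3)])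
   finally show ?thesis .
  qed
  have b2: "gnorm ?U (%z. v z - ?w z) \<le> ennreal (2 * C + 2 * (c * C)) * ?S"
  proof -
   have "gnorm ?U (%z. v z - ?w z) = gnorm ?U (%z. (v z - w z) + (w z - ?w z))" by simp
   also have "... \<le> 2 * gnorm ?U (%z. v z - w z) + 2 * gnorm ?U (%z. w z - ?w z)"
    using C1_on_subset[OF v] C1_on_subset[OF w(1)] P(1) sub sub'
    by (intro gnorm_add_le open_polydisc C1_on_cont C1_on_diff) auto
   also have "... \<le> 2 * (ennreal C * ?S) + 2 * (ennreal (c * C) * ?S)"
    using order_trans[OF gnorm_mono[OF sub] w(4)] order_trans[OF c(3)[OF R rl w(1)] cC[OF w(3)]]
    by (intro add_mono mult_left_mono) auto
   also have "... = ennreal (2 * C + 2 * (c * C)) * ?S"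
    using c(1) C(1) by (simp add: ennreal_plus ennreal_mult' distrib_right mult.assoc)
   finally show ?thesis .
  qed
  have up: "ennreal D * ?S \<le> ennreal C' * ?S" if "D \<le> C'" for D
   using that by (intro mult_right_mono ennreal_leI) auto
  show "\<exists>w. reduced (insert l J) R (ennreal C' * ?S) v w"
   unfolding reduced_def r'
  proof (intro exI[of _ ?w] conjI ballI allI P(1))
   fix i z assume i: "i \<in> insert l J" and z: "z \<in> ?U"
   show "dbar ?w z (axis i 1) = 0"
   proof (cases "i = l")
    case False
    have 0: "dbar w (upd z l y) (axis i 1) * bk R (z $ l) y = 0" for y
    proof (cases "norm y < 2 * R")
     case True
     then have "upd z l y \<in> polydisc ?r" using upd_polydisc[OF z] rl by simp
     then show ?thesis using w(2)[of i] i False by simp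
    next
     case False
     then show ?thesis using R0 by (simp add: bk_eq_0)
    qed
    show ?thesis unfolding P(3)[OF z False] Pop_def 0 by simp
   qed (use P(2)[OF z] in simp)
  next
   show "gnorm ?U (%z. dbar ?w z (axis i 1)) \<le> ennreal C' * ?S" for i
    using b1 up[OF C'(2)] by (rule order_trans)
   show "gnorm ?U (%z. v z - ?w z) \<le> ennreal C' * ?S"
    using b2 up[OF C'(3)] by (rule order_trans)
  qed
 qed
 then show ?case using C'(1) by blast
qed

text \<open>The difference \<open>v z - w z\<close> has the same antiholomorphic derivative as
  \<open>v\<close>, so this is a Hormander-type estimate for the Gaussian weight, on a smaller cube
  and with a constant uniform in \<open>R\<close>.\<close>

theorem model_estimate:
 obtains C where "C \<ge> 0"
  "!!R (v :: complex ^ 'n::finite => complex). R \<ge> 1 ==> C1_on (cube (2 * R)) v ==>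
   \<exists>w. holo_on (cube R) w \<and> gnorm (cube R) (%z. v z - w z) \<le> ennreal C * energy R v"
proof -
 have s: "split_radius UNIV R = (%_. R)" for R by (auto simp: split_radius_def)
 obtain C where C: "C \<ge> 0" and *: "!!R (v :: complex ^ 'n::finite => complex). R \<ge> 1 ==> C1_on (cube (2 * R)) v ==>
   \<exists>w. reduced UNIV R (ennreal C * energy R v) v w"
  using model_estimate_induct[of "UNIV :: 'n set"] by blast
 show ?thesis
 proof (rule that[OF C])
  fix R :: real and v :: "complex ^ 'n => complex"
  assume "R \<ge> 1" "C1_on (cube (2 * R)) v"
  from *[OF this] obtain w where w: "reduced UNIV R (ennreal C * energy R v) v w" by blast
  then have "holo_on (cube R) w" unfolding reduced_def s by (intro holo_on_polydiscI) auto
  then show "\<exists>w. holo_on (cube R) w \<and> gnorm (cube R) (%z. v z - w z) \<le> ennreal C * energy R v"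
   using w unfolding reduced_def s by blast
 qed
qed

section \<open>Change of variables in complex coordinate space\<close>

text \<open>The change of variables theorem of the library is about \<open>real ^ 'k\<close> with a well-ordered index
 type \<open>'k\<close>; the type \<open>'n bit0\<close> with \<open>2 * CARD('n)\<close> elements provides one for the real
 coordinates of \<open>complex ^ 'n\<close>.\<close>

definition ridx_pair :: "'n::finite bit0 => 'n \<times> bool" where
 "ridx_pair = (SOME e. bij e)"

lemma bij_ridx_pair: "bij (ridx_pair :: 'n::finite bit0 => 'n \<times> bool)"
proof -
 have "\<exists>e :: 'n bit0 => 'n \<times> bool. bij e"
  using finite_same_card_bij[of "UNIV :: 'n bit0 set" "UNIV :: ('n \<times> bool) set"]
  by auto
 then show ?thesis unfolding ridx_pair_def by (rule someI_ex)
qed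

lemma real_basis_inner: "real_basis p \<bullet> real_basis q = (if p = q then 1 else 0)"
 by (cases p; cases q) (auto simp: real_basis_def inner_axis_axis)

lemma inj_real_basis: "inj real_basis"
 by (rule injI) (metis real_basis_inner zero_neq_one)

lemma range_real_basis: "range real_basis = (Basis :: (complex ^ 'n::finite) set)"
 unfolding Basis_vec_def real_basis_def Basis_complex_def
 by (auto simp: image_iff) metis+

definition cplx :: "real ^ ('n::finite bit0) => complex ^ 'n" where
 "cplx x = (\<Sum>i\<in>UNIV. (x $ i) *\<^sub>R real_basis (ridx_pair i))"

definition uncplx :: "complex ^ 'n::finite => real ^ ('n bit0)" where
 "uncplx z = (\<chi> i. z \<bullet> real_basis (ridx_pair i))"

lemma sum_ridx_real_basis:
 "(\<Sum>i\<in>UNIV. f (real_basis (ridx_pair i))) = (\<Sum>b\<in>(Basis :: (complex ^ 'n::finite) set). f b)"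
proof -
 have "bij_betw (real_basis \<circ> ridx_pair) (UNIV :: 'n bit0 set) (Basis :: (complex ^ 'n) set)"
  using bij_ridx_pair inj_real_basis range_real_basis
  by (metis bij_betw_def bij_betw_trans)
 from sum.reindex_bij_betw[OF this, of f] show ?thesis by simp
qed

lemma cplx_uncplx [simp]: "cplx (uncplx z) = z"
 unfolding cplx_def uncplx_def
 using sum_ridx_real_basis[of "%b. (z \<bullet> b) *\<^sub>R b"] by (simp add: euclidean_representation)

lemma cplx_inner: "cplx x \<bullet> real_basis (ridx_pair i) = x $ i"
proof -
 have "ridx_pair j = ridx_pair i \<longleftrightarrow> j = i" for j :: "'a bit0"
  using bij_ridx_pair by (metis bij_pointE)
 then show ?thesis
  unfolding cplx_def by (simp add: inner_sum_left real_basis_inner if_distrib cong: if_cong)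
qed

lemma uncplx_cplx [simp]: "uncplx (cplx x) = x"
 by (simp add: uncplx_def cplx_inner vec_eq_iff)

lemma bounded_linear_cplx: "bounded_linear cplx"
proof -
 have "linear cplx"
  by (rule linearI) (auto simp: cplx_def scaleR_left_distrib sum.distrib scaleR_right.sum)
 then show ?thesis by (simp add: linear_conv_bounded_linear)
qed

lemma bounded_linear_uncplx: "bounded_linear uncplx"
proof -
 have "linear uncplx"
  by (rule linearI) (auto simp: uncplx_def vec_eq_iff inner_add_left)
 then show ?thesis by (simp add: linear_conv_bounded_linear)
qed

lemma cplx_measurable [measurable]: "cplx \<in> borel_measurable borel"
 by (intro borel_measurable_continuous_onI linear_continuous_on bounded_linear_cplx)

text \<open>\<open>cplx\<close> identifies orthonormal coordinates, so preimages of boxes are boxes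
  of the same volume, and boxes determine Lebesgue measure.\<close>

lemma lborel_cplx: "distr lborel borel cplx = lborel"
proof (rule lborel_eqI[symmetric])
 fix l u :: "complex ^ 'n" assume le: "!!b. b \<in> Basis ==> l \<bullet> b \<le> u \<bullet> b"
 have B: "b \<in> Basis \<longleftrightarrow> (\<exists>i. b = real_basis (ridx_pair i))" for b :: "complex ^ 'n"
 proof -
  have "range (%i. real_basis (ridx_pair i)) = (Basis :: (complex ^ 'n) set)"
   using bij_ridx_pair[where 'n='n] range_real_basis[where 'n='n]
   by (metis bij_def image_image)
  then show ?thesis by blast
 qed
 have BB: "(\<forall>b\<in>Basis. P b) \<longleftrightarrow> (\<forall>i. P (real_basis (ridx_pair i)))" for P :: "complex ^ 'n => bool"
  using B by metis
 let ?a = "\<Prod>b\<in>Basis. (u - l) \<bullet> b"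
 have "cplx -` box l u = box (uncplx l) (uncplx u)"
  unfolding set_eq_iff vimage_eq mem_box(1)[of _ l u] BB cplx_inner
  by (simp add: mem_box_cart uncplx_def)
 moreover have "(\<Prod>b\<in>Basis. (uncplx u - uncplx l) \<bullet> b) = ?a"
 proof -
  have "bij_betw (real_basis \<circ> ridx_pair) (UNIV :: 'n bit0 set) (Basis :: (complex ^ 'n) set)"
   using bij_ridx_pair inj_real_basis range_real_basis
   by (metis bij_betw_def bij_betw_trans)
  from prod.reindex_bij_betw[OF this, of "%b. (u - l) \<bullet> b"]
  have "(\<Prod>i\<in>UNIV. (u - l) \<bullet> real_basis (ridx_pair i)) = ?a" by simp
  moreover have "(\<Prod>b\<in>Basis. (uncplx u - uncplx l) \<bullet> b) = (\<Prod>i\<in>UNIV. (uncplx u - uncplx l) $ i)"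
  proof -
   have "bij_betw (%i. axis i 1) UNIV (Basis :: (real ^ 'n bit0) set)"
    by (auto simp: bij_betw_def Basis_vec_def inj_on_def axis_eq_axis)
   from prod.reindex_bij_betw[OF this, of "%b. (uncplx u - uncplx l) \<bullet> b", symmetric]
   show ?thesis by (simp add: inner_axis)
  qed
  ultimately show ?thesis by (simp add: uncplx_def inner_diff_left)
 qed
 moreover have "uncplx l \<bullet> b \<le> uncplx u \<bullet> b" if "b \<in> Basis" for b
 proof -
  from that have "\<exists>i. b = axis i 1" unfolding Basis_vec_def by auto
  then obtain i where "b = axis i 1" ..
  moreover have "real_basis (ridx_pair i) \<in> (Basis :: (complex ^ 'n) set)" using B by blast
  ultimately show ?thesis using le by (simp add: uncplx_def inner_axis)
 qed
 ultimately show "emeasure (distr lborel borel cplx) (box l u) = ennreal ?a"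
  by (simp add: emeasure_distr emeasure_lborel_box)
qed simp

lemma nn_integral_cplx:
 assumes [measurable]: "f \<in> borel_measurable borel"
 shows "(\<integral>\<^sup>+z. f z \<partial>lborel) = (\<integral>\<^sup>+x. f (cplx x) \<partial>lborel)"
proof -
 have "(\<integral>\<^sup>+z. f z \<partial>lborel) = (\<integral>\<^sup>+z. f z \<partial>distr lborel borel cplx)" by (simp add: lborel_cplx)
 also have "... = (\<integral>\<^sup>+x. f (cplx x) \<partial>lborel)" by (rule nn_integral_distr) auto
 finally show ?thesis .
qed

subsection \<open>Real determinants of maps of complex coordinate space\<close>

text \<open>The index set \<open>'n \<times> bool\<close> is that of \<open>real_basis\<close>, so
  the permutations in this determinant are the ones in \<open>volume_density\<close>.\<close>

definition rdet :: "(complex ^ 'n::finite => complex ^ 'n) => real" where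
 "rdet f = det (\<chi> p q. f (real_basis p) \<bullet> real_basis q :: real ^ ('n \<times> bool) ^ ('n \<times> bool))"

lemma det_reindex:
 fixes A :: "real ^ 'b ^ 'b" and e :: "'a::finite => 'b::finite"
 assumes "bij e"
 shows "det (\<chi> i j. A $ e i $ e j :: real ^ 'a ^ 'a) = det A"
proof -
 have inv: "inv e (e x) = x" "e (inv e y) = y" for x y
  using assms by (auto simp: bij_def inv_f_f surj_f_inv_f)
 define c where "c p = e \<circ> p \<circ> inv e" for p
 have c: "map_permutation UNIV e p = c p" for p
  using assms by (simp add: map_permutation_def c_def restrict_id_def bij_def fun_eq_iff)
 have sgn: "sign (c p) = sign p" "c p permutes UNIV" if "p permutes UNIV" for p
  using sign_map_permutation[of e UNIV p] map_permutation_permutes[of e UNIV UNIV p] assms that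
  by (auto simp: c bij_def bij_betw_def)
 have "det A = (\<Sum>p | p permutes UNIV. of_int (sign (c p)) * (\<Prod>i\<in>UNIV. A $ i $ (c p) i))"
  unfolding det_def
 proof (rule sum.reindex_bij_witness[of _ c "%p. inv e \<circ> p \<circ> e"])
  fix p :: "'b => 'b" assume "p \<in> {p. p permutes UNIV}"
  then have "bij p" by (simp add: permutes_bij)
  then have "bij (inv e \<circ> p \<circ> e)" using assms by (intro bij_comp bij_imp_bij_inv)
  then show "inv e \<circ> p \<circ> e \<in> {p. p permutes UNIV}" by (auto intro: bij_imp_permutes)
  show "c (inv e \<circ> p \<circ> e) = p" by (auto simp: c_def fun_eq_iff inv)
  then show "real_of_int (sign (c (inv e \<circ> p \<circ> e))) * (\<Prod>i\<in>UNIV. A $ i $ c (inv e \<circ> p \<circ> e) i) =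
     real_of_int (sign p) * (\<Prod>i\<in>UNIV. A $ i $ p i)" by simp
 next
  fix p :: "'a => 'a" assume "p \<in> {p. p permutes UNIV}"
  then show "c p \<in> {p. p permutes UNIV}" using sgn(2) by simp
  show "inv e \<circ> c p \<circ> e = p" by (auto simp: c_def fun_eq_iff inv)
 qed
 also have "... = (\<Sum>p | p permutes UNIV. of_int (sign p) * (\<Prod>i\<in>UNIV. A $ e i $ e (p i)))"
 proof (rule sum.cong[OF refl])
  fix p :: "'a => 'a" assume "p \<in> {p. p permutes UNIV}"
  moreover have "(\<Prod>i\<in>UNIV. A $ i $ (c p) i) = (\<Prod>i\<in>UNIV. A $ e i $ e (p i))"
   using prod.reindex_bij_betw[OF assms, of "%i. A $ i $ (c p) i"] by (simp add: c_def inv)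
  ultimately show "real_of_int (sign (c p)) * (\<Prod>i\<in>UNIV. A $ i $ c p i) = real_of_int (sign p) * (\<Prod>i\<in>UNIV. A $ e i $ e (p i))"
   using sgn by simp
 qed
 finally show ?thesis unfolding det_def by simp
qed

lemma det_matrix_uncplx:
 assumes "linear f"
 shows "det (matrix (uncplx \<circ> f \<circ> cplx)) = rdet f"
proof -
 have c: "cplx (axis j 1) = real_basis (ridx_pair j)" for j
  unfolding cplx_def by (simp add: axis_def if_distrib[of "%r. r *\<^sub>R _"] cong: if_cong)
 let ?A = "\<chi> p q. f (real_basis p) \<bullet> real_basis q"
 have "matrix (uncplx \<circ> f \<circ> cplx) = transpose (\<chi> i j. ?A $ ridx_pair i $ ridx_pair j)"
  by (simp add: matrix_def transpose_def vec_eq_iff uncplx_def c)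
 then show ?thesis
  using det_reindex[OF bij_ridx_pair, of ?A] by (simp add: rdet_def)
qed

lemma nn_integral_indicator_has_integral:
 fixes f :: "'a::euclidean_space => real"
 assumes [measurable]: "f \<in> borel_measurable borel" "S \<in> sets borel" and nn: "!!x. f x \<ge> 0"
 shows "wint S f = ennreal I \<and> I \<ge> 0 \<longleftrightarrow> (f has_integral I) S"
proof
 assume *: "wint S f = ennreal I \<and> I \<ge> 0"
 have "((%x. f x * indicator S x) has_integral I) UNIV"
  by (rule nn_integral_has_integral) (use * nn in \<open>auto simp: ennreal_mult' ennreal_indicator\<close>)
 moreover have "(%x. f x * indicator S x) = (%x. if x \<in> S then f x else 0)"
  by (auto simp: fun_eq_iff)
 ultimately show "(f has_integral I) S"
  using has_integral_restrict_UNIV[of S f I] by simp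
next
 assume *: "(f has_integral I) S"
 then show "wint S f = ennreal I \<and> I \<ge> 0"
  using nn_integral_has_integral_lebesgue'[OF _ *] has_integral_nonneg[OF *] nn by auto
qed

text \<open>The theorem on gauge integrals is an equivalence for each finite value; two nonnegative
  integrals that take the same finite values agree, also when they are infinite. \<open>F\<close> is
  a Borel function on the whole space that extends the transformed integrand from
  \<open>S\<close>.\<close>

lemma nn_integral_change_of_variables_real:
 fixes f :: "real ^ 'k::{finite,wellorder} => real" and g h :: "real ^ 'k::_ => real ^ 'k::_"
 assumes "!!x. x \<in> S ==> (g has_derivative g' x) (at x)"
  and "!!y. y \<in> T ==> (h has_derivative h' y) (at y)"
  and "!!x. x \<in> S ==> g x \<in> T \<and> h (g x) = x"
  and "!!y. y \<in> T ==> h y \<in> S \<and> g (h y) = y"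
  and "!!y. y \<in> T ==> h' y \<circ> g' (h y) = id"
  and [measurable]: "f \<in> borel_measurable borel" "S \<in> sets borel" "T \<in> sets borel"
  and nn: "!!y. 0 \<le> f y"
  and F: "F \<in> borel_measurable borel" "!!x. F x \<ge> 0" "!!x. x \<in> S ==> F x = \<bar>det (matrix (g' x))\<bar> * f (g x)"
 shows "wint T f = wint S F"
proof -
 have eq: "(f has_integral I) T \<longleftrightarrow> (F has_integral I) S" for I
 proof -
  let ?a = "(%x. \<bar>det (matrix (g' x))\<bar> * f (g x)) has_integral I"
  have "?a S \<longleftrightarrow> (f has_integral I) T"
  proof (rule cov_invertible_nonneg_eq[where h=h and h'=h'])
   show "(g has_derivative g' x) (at x within S)" if "x \<in> S" for x
    by (rule has_derivative_at_withinI[OF assms(1)[OF that]])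
   show "(h has_derivative h' y) (at y within T)" if "y \<in> T" for y
    by (rule has_derivative_at_withinI[OF assms(2)[OF that]])
  qed (use assms(3-5) nn in blast)+
  moreover have "?a S \<longleftrightarrow> (F has_integral I) S"
   by (rule has_integral_cong) (simp add: F)
  ultimately show ?thesis by simp
 qed
 let ?A = "wint T f" and ?B = "wint S F"
 have *: "?A = ennreal I \<and> I \<ge> 0 \<longleftrightarrow> ?B = ennreal I \<and> I \<ge> 0" for I
 proof -
  have "?A = ennreal I \<and> I \<ge> 0 \<longleftrightarrow> (f has_integral I) T"
   by (rule nn_integral_indicator_has_integral) (use nn in auto)
  also have "... \<longleftrightarrow> (F has_integral I) S" by (rule eq)
  also have "... \<longleftrightarrow> ?B = ennreal I \<and> I \<ge> 0"
   by (rule nn_integral_indicator_has_integral[symmetric]) (use F in auto)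
  finally show ?thesis .
 qed
 show ?thesis
 proof (cases ?A rule: ennreal_cases)
  case (real r)
  then show ?thesis using *[of r] by simp
 next
  case top
  have "?B = top"
  proof (cases ?B rule: ennreal_cases)
   case (real r)
   then show ?thesis using *[of r] top by simp
  qed
  then show ?thesis using top by simp
 qed
qed

lemma nn_integral_change_of_variables_indicator:
 fixes T U :: "complex ^ 'n::finite => complex ^ 'n"
 assumes S: "open S" "open S'"
  and T: "!!x. x \<in> S ==> (T has_derivative D x) (at x)" "!!x. x \<in> S ==> T x \<in> S' \<and> U (T x) = x"
  and U: "!!y. y \<in> S' ==> (U has_derivative E y) (at y)" "!!y. y \<in> S' ==> U y \<in> S \<and> T (U y) = y"
  and J: "continuous_on S (%x. rdet (D x))"
  and [measurable]: "B \<in> sets borel"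
 shows "(\<integral>\<^sup>+y. indicator B y * indicator S' y \<partial>lborel) =
  (\<integral>\<^sup>+x. ennreal \<bar>rdet (D x)\<bar> * indicator B (T x) * indicator S x \<partial>lborel)"
proof -
 have [measurable]: "S \<in> sets borel" "S' \<in> sets borel" using S by auto
 let ?T = "uncplx \<circ> T \<circ> cplx" and ?U = "uncplx \<circ> U \<circ> cplx"
 let ?S = "cplx -` S" and ?S' = "cplx -` S'"
 have cT: "continuous_on S T"
  using T(1) by (meson continuous_at_imp_continuous_on has_derivative_continuous)
 have [measurable]: "(%x. if x \<in> S then T x else 0) \<in> borel_measurable borel"
  by (rule borel_measurable_continuous_on_if) (auto intro: cT)
 have [measurable]: "(%x. if x \<in> S then rdet (D x) else 0) \<in> borel_measurable borel"
  by (rule borel_measurable_continuous_on_if) (auto intro: J)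
 define F where "F x = \<bar>if x \<in> S then rdet (D x) else 0\<bar> * indicator B (if x \<in> S then T x else 0)" for x
 have [measurable]: "F \<in> borel_measurable borel" unfolding F_def[abs_def] by measurable
 have "wint ?S' (%y. indicator B (cplx y)) = wint ?S (%x. F (cplx x))"
 proof (rule nn_integral_change_of_variables_real[where g = ?T and g' = "%x. uncplx \<circ> D (cplx x) \<circ> cplx"
    and h = ?U and h' = "%y. uncplx \<circ> E (cplx y) \<circ> cplx"])
  note lin = bounded_linear_imp_has_derivative[OF bounded_linear_cplx] bounded_linear_imp_has_derivative[OF bounded_linear_uncplx]
  show "(?T has_derivative (uncplx \<circ> D (cplx x) \<circ> cplx)) (at x)" if "x \<in> ?S" for x
   using that by (intro diff_chain_at lin T(1)) auto
  show "(?U has_derivative (uncplx \<circ> E (cplx x) \<circ> cplx)) (at x)" if "x \<in> ?S'" for x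
   using that by (intro diff_chain_at lin U(1)) auto
  show "?T x \<in> ?S' \<and> ?U (?T x) = x" if "x \<in> ?S" for x
   using T(2) that by simp
  show "?U x \<in> ?S \<and> ?T (?U x) = x" if "x \<in> ?S'" for x
   using U(2) that by simp
  show "(uncplx \<circ> E (cplx y) \<circ> cplx) \<circ> (uncplx \<circ> D (cplx (?U y)) \<circ> cplx) = id" if "y \<in> ?S'" for y
  proof -
   have y: "cplx y \<in> S'" using that by simp
   then have u: "U (cplx y) \<in> S" "T (U (cplx y)) = cplx y" using U(2) by auto
   have "(U \<circ> T has_derivative (E (cplx y) \<circ> D (U (cplx y)))) (at (U (cplx y)))"
    using diff_chain_at[OF T(1)[OF u(1)], of U "E (cplx y)"] U(1)[OF y] u(2) by simp
   moreover have "(U \<circ> T has_derivative (%v. v)) (at (U (cplx y)))"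
    by (rule has_derivative_transform_within_open[OF has_derivative_ident S(1) u(1)]) (use T(2) in auto)
   ultimately have "E (cplx y) \<circ> D (U (cplx y)) = (%v. v)"
    by (rule has_derivative_unique)
   then show ?thesis by (auto simp: fun_eq_iff)
  qed
  show "(%y. indicator B (cplx y)) \<in> borel_measurable borel" by measurable
  show "?S \<in> sets borel" "?S' \<in> sets borel"
   by (rule measurable_sets_borel[OF cplx_measurable]; fact)+
  show "(%x. F (cplx x)) \<in> borel_measurable borel" by measurable
  show "F (cplx x) \<ge> 0" for x by (simp add: F_def)
  show "F (cplx x) = \<bar>det (matrix (uncplx \<circ> D (cplx x) \<circ> cplx))\<bar> * indicator B (cplx (?T x))" if "x \<in> ?S" for x
   using that has_derivative_linear[OF T(1)] by (simp add: F_def det_matrix_uncplx)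
 qed simp
 moreover have "indicator ?S x = (indicator S (cplx x) :: ennreal)" "indicator ?S' x = (indicator S' (cplx x) :: ennreal)" for x
  by (auto simp: indicator_def)
 ultimately have "wint S' (%y. indicator B y) = wint S F"
  by (subst (1 2) nn_integral_cplx) auto
 moreover have "ennreal (F x) * indicator S x = ennreal \<bar>rdet (D x)\<bar> * indicator B (T x) * indicator S x" for x
  by (auto simp: F_def indicator_def)
 ultimately show ?thesis by (simp add: ennreal_indicator)
qed

text \<open>The case of indicators says that \<open>density lborel (indicator S')\<close> is the
  image under \<open>T\<close> of the measure with the Jacobian as density; integrating
  \<open>F\<close> against both sides gives the general case.\<close>

theorem nn_integral_change_of_variables:
 fixes T U :: "complex ^ 'n::finite => complex ^ 'n"
 assumes S: "open S" "open S'"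
  and T: "!!x. x \<in> S ==> (T has_derivative D x) (at x)" "!!x. x \<in> S ==> T x \<in> S' \<and> U (T x) = x"
  and U: "!!y. y \<in> S' ==> (U has_derivative E y) (at y)" "!!y. y \<in> S' ==> U y \<in> S \<and> T (U y) = y"
  and J: "continuous_on S (%x. rdet (D x))"
  and [measurable]: "F \<in> borel_measurable borel"
 shows "(\<integral>\<^sup>+y. F y * indicator S' y \<partial>lborel) =
  (\<integral>\<^sup>+x. ennreal \<bar>rdet (D x)\<bar> * F (T x) * indicator S x \<partial>lborel)"
proof -
 have [measurable]: "S \<in> sets borel" "S' \<in> sets borel" using S by auto
 have cT: "continuous_on S T"
  using T(1) by (meson continuous_at_imp_continuous_on has_derivative_continuous)
 have Tm [measurable]: "(%x. if x \<in> S then T x else 0) \<in> borel_measurable borel"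
  by (rule borel_measurable_continuous_on_if) (auto intro: cT)
 have [measurable]: "(%x. if x \<in> S then rdet (D x) else 0) \<in> borel_measurable borel"
  by (rule borel_measurable_continuous_on_if) (auto intro: J)
 define T' where "T' x = (if x \<in> S then T x else 0)" for x
 define j where "j x = ennreal \<bar>if x \<in> S then rdet (D x) else 0\<bar> * indicator S x" for x
 have [measurable]: "T' \<in> borel_measurable borel" "j \<in> borel_measurable borel"
  unfolding T'_def[abs_def] j_def[abs_def] by measurable
 have "density lborel (indicator S') = distr (density lborel j) borel T'"
 proof (rule measure_eqI)
  fix B assume "B \<in> sets (density lborel (indicator S'))"
  then have [measurable]: "B \<in> sets borel" by simp
  have "emeasure (density lborel (indicator S')) B = (\<integral>\<^sup>+y. indicator B y * indicator S' y \<partial>lborel)"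
   by (simp add: emeasure_density mult.commute)
  also have "... = (\<integral>\<^sup>+x. ennreal \<bar>rdet (D x)\<bar> * indicator B (T x) * indicator S x \<partial>lborel)"
   by (rule nn_integral_change_of_variables_indicator[OF S T U J]) auto
  also have "... = (\<integral>\<^sup>+x. j x * indicator (T' -` B) x \<partial>lborel)"
   by (intro nn_integral_cong) (auto simp: j_def T'_def indicator_def)
  also have "... = emeasure (distr (density lborel j) borel T') B"
   using measurable_sets_borel[OF \<open>T' \<in> borel_measurable borel\<close> \<open>B \<in> sets borel\<close>]
   by (simp add: emeasure_distr emeasure_density)
  finally show "emeasure (density lborel (indicator S')) B = emeasure (distr (density lborel j) borel T') B" .
 qed simp
 then have "(\<integral>\<^sup>+y. F y \<partial>density lborel (indicator S')) = (\<integral>\<^sup>+y. F y \<partial>distr (density lborel j) borel T')" by simp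
 then have "(\<integral>\<^sup>+y. indicator S' y * F y \<partial>lborel) = (\<integral>\<^sup>+x. j x * F (T' x) \<partial>lborel)"
  by (simp add: nn_integral_density nn_integral_distr)
 moreover have "j x * F (T' x) = ennreal \<bar>rdet (D x)\<bar> * F (T x) * indicator S x" for x
  by (auto simp: j_def T'_def indicator_def)
 ultimately show ?thesis by (simp add: mult.commute)
qed

corollary nn_integral_linear_bij:
 fixes f g :: "complex ^ 'n::finite => complex ^ 'n"
 assumes "bounded_linear f" "bounded_linear g" "!!x. g (f x) = x" "!!x. f (g x) = x"
  and [measurable]: "F \<in> borel_measurable borel"
 shows "(\<integral>\<^sup>+y. F y \<partial>lborel) = ennreal \<bar>rdet f\<bar> * (\<integral>\<^sup>+x. F (f x) \<partial>lborel)"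
proof -
 have [measurable]: "f \<in> borel_measurable borel"
  by (intro borel_measurable_continuous_onI linear_continuous_on assms)
 have "(\<integral>\<^sup>+y. F y * indicator UNIV y \<partial>lborel) = (\<integral>\<^sup>+x. ennreal \<bar>rdet f\<bar> * F (f x) * indicator UNIV x \<partial>lborel)"
  by (rule nn_integral_change_of_variables[where U = g and E = "%_. g"])
    (use assms in \<open>auto intro: bounded_linear_imp_has_derivative\<close>)
 also have "... = ennreal \<bar>rdet f\<bar> * (\<integral>\<^sup>+x. F (f x) \<partial>lborel)"
  by (simp add: nn_integral_cmult)
 finally show ?thesis by simp
qed

section \<open>Positive forms of type (1,1)\<close>

text \<open>The sum of the forms \<open>dx\<^sub>i \<and> dy\<^sub>i\<close>, that is, the imaginary
  part of the standard Hermitian product.\<close>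

definition std_form :: "complex ^ 'n::finite => complex ^ 'n => real" where
 "std_form u v = (\<Sum>i\<in>UNIV. Im (cnj (u $ i) * v $ i))"

definition positive_form :: "(complex ^ 'n::finite => complex ^ 'n => real) => bool" where
 "positive_form om \<longleftrightarrow> bilinear om \<and> (\<forall>u v. om u v = - om v u) \<and>
   (\<forall>u v. om (\<i> *s u) (\<i> *s v) = om u v) \<and> (\<forall>u. u \<noteq> 0 --> om u (\<i> *s u) > 0)"

lemma ii_smult: "\<i> *s (\<i> *s v) = - (v :: complex ^ 'n::finite)"
 by (simp add: vec_eq_iff)

lemma std_form_i: "std_form u (\<i> *s u) = (norm u)\<^sup>2"
proof -
 have "Im (cnj (u $ i) * (\<i> *s u) $ i) = (norm (u $ i))\<^sup>2" for i
  unfolding cmod_power2 by (simp add: power2_eq_square)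
 then show ?thesis by (simp add: std_form_def norm_vec_def L2_set_def sum_nonneg)
qed

lemma bilinear_std_form: "bilinear std_form"
 unfolding bilinear_def std_form_def
 by (auto intro!: linearI simp: algebra_simps sum.distrib sum_distrib_left sum_subtractf)

lemma positive_std_form: "positive_form std_form"
 unfolding positive_form_def
proof (intro conjI allI impI)
 show "bilinear (std_form :: complex ^ 'n::finite => _)" by (rule bilinear_std_form)
 fix u v :: "complex ^ 'n"
 show "std_form u v = - std_form v u"
  unfolding std_form_def sum_negf[symmetric] by (intro sum.cong) (auto simp: algebra_simps)
 show "std_form (\<i> *s u) (\<i> *s v) = std_form u v"
  unfolding std_form_def by (intro sum.cong) (auto simp: algebra_simps)
 assume "u \<noteq> 0"
 then show "std_form u (\<i> *s u) > 0" by (simp add: std_form_i)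
qed

text \<open>\<open>om\<close> is the imaginary part of a positive definite Hermitian form
  \<open>H\<close>, conjugate linear in the first argument. The coordinates with respect to an
  \<open>H\<close>-orthonormal basis are the required \<open>f\<close>; the basis is built by
  induction over the index set.\<close>

lemma positive_form_diagonal:
 fixes om :: "complex ^ 'n::finite => complex ^ 'n => real"
 assumes "positive_form om"
 obtains f g :: "complex ^ 'n => complex ^ 'n" where "bounded_linear f" "bounded_linear g" "!!x. f (g x) = x" "!!x. g (f x) = x"
  "!!v. f (\<i> *s v) = \<i> *s f v" "!!v. g (\<i> *s v) = \<i> *s g v" "!!u v. om u v = std_form (f u) (f v)"
proof -
 have bil: "bilinear om" and skew: "!!u v. om u v = - om v u"
  and inv: "!!u v. om (\<i> *s u) (\<i> *s v) = om u v" and pos: "!!u. u \<noteq> 0 ==> om u (\<i> *s u) > 0"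
  using assms unfolding positive_form_def by blast+
 note lin = bilinear_ladd[OF bil] bilinear_radd[OF bil] bilinear_lmul[OF bil] bilinear_rmul[OF bil]
  bilinear_lneg[OF bil] bilinear_rneg[OF bil]
 have ismult: "\<i> *s (u + v) = \<i> *s u + \<i> *s v" "\<i> *s (r *\<^sub>R u) = r *\<^sub>R (\<i> *s u)" for u v :: "complex ^ 'n" and r
  by (auto simp: vec_eq_iff algebra_simps)
 define H where "H u v = Complex (om u (\<i> *s v)) (om u v)" for u v
 have om1: "om (\<i> *s u) v = - om u (\<i> *s v)" for u v
  using inv[of "\<i> *s u" v] by (simp add: ii_smult lin)
 have Hadd: "H (u + u') v = H u v + H u' v" "H u (v + v') = H u v + H u v'" for u u' v v'
  by (auto simp: H_def lin ismult complex_eq_iff)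
 have HR: "H (r *\<^sub>R u) v = r *\<^sub>R H u v" "H u (r *\<^sub>R v) = r *\<^sub>R H u v" for r u v
  by (auto simp: H_def lin ismult complex_eq_iff)
 have Hi: "H u (\<i> *s v) = \<i> * H u v" "H (\<i> *s u) v = - \<i> * H u v" for u v
  by (auto simp: H_def om1 ii_smult lin complex_eq_iff)
 have HC: "H u (c *s v) = c * H u v" "H (c *s u) v = cnj c * H u v" for c u v
  by (subst smult_complex_split, simp add: Hadd HR Hi complex_eq_iff)+
 have Hsym: "H v u = cnj (H u v)" for u v
  unfolding H_def using skew[of v u] skew[of v "\<i> *s u"] om1[of u v] by (simp add: complex_eq_iff)
 have lH: "linear (H u)" for u by (rule linearI) (auto simp: Hadd HR)
 have Hpos: "H u u = of_real (om u (\<i> *s u))" for u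
  using skew[of u u] by (simp add: H_def complex_eq_iff)
 have "\<exists>b. \<forall>i\<in>J. \<forall>j\<in>J. H (b i) (b j) = (if i = j then 1 else 0)" for J :: "'n set"
  using finite[of J]
 proof (induction J rule: finite_induct)
  case (insert l J)
  then obtain b where b: "\<forall>i\<in>J. \<forall>j\<in>J. H (b i) (b j) = (if i = j then 1 else 0)" by blast
  define Lm where "Lm u = (\<chi> j. if j \<in> J then H (b j) u else 0)" for u
  have lL: "linear Lm" by (rule linearI) (auto simp: Lm_def Hadd HR vec_eq_iff)
  \<comment> \<open>A vector orthogonal to those already found exists by dimension:
    \<open>Lm\<close> has entry 0 in position \<open>l\<close>, so it is not onto and therefore has
    a kernel.\<close>
  have "\<not> surj Lm"
  proof
   assume "surj Lm"
   then obtain u where "Lm u = axis l 1" by (metis surjD)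
   then have "Lm u $ l = 1" by simp
   then show False using insert.hyps by (simp add: Lm_def)
  qed
  then have "\<not> inj Lm" using linear_injective_imp_surjective[OF lL] by blast
  then obtain w where w: "w \<noteq> 0" "Lm w = 0"
   using linear_injective_0[OF lL] by blast
  have bw: "H (b j) w = 0" if "j \<in> J" for j
   using w(2) that by (auto simp: Lm_def vec_eq_iff split: if_splits)
  define r where "r = om w (\<i> *s w)"
  have r: "r > 0" using pos[OF w(1)] by (simp add: r_def)
  define e where "e = (1 / sqrt r) *\<^sub>R w"
  have Hw: "H w w = of_real r" by (simp only: Hpos r_def)
  have "H e e = (1 / sqrt r) *\<^sub>R (1 / sqrt r) *\<^sub>R of_real r" by (simp only: e_def HR Hw)
  then have "H e e = 1"
   using r by (simp add: scaleR_conv_of_real flip: of_real_mult)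
  moreover have "H (b j) e = 0" "H e (b j) = 0" if "j \<in> J" for j
   using bw[OF that] Hsym[of e "b j"] by (simp_all add: e_def HR)
  ultimately have "\<forall>i\<in>insert l J. \<forall>j\<in>insert l J. H ((b(l := e)) i) ((b(l := e)) j) = (if i = j then 1 else 0)"
   using b insert.hyps by auto
  then show ?case by blast
 qed simp
 from this[of UNIV] obtain b :: "'n => complex ^ 'n" where b0: "\<forall>i\<in>UNIV. \<forall>j\<in>UNIV. H (b i) (b j) = (if i = j then 1 else 0)" by blast
 have b: "H (b i) (b j) = (if i = j then 1 else 0)" for i j using b0 by simp
 define f where "f u = (\<chi> i. H (b i) u)" for u
 define g where "g y = (\<Sum>i\<in>UNIV. y $ i *s b i)" for y :: "complex ^ 'n"
 have lf: "linear f" by (rule linearI) (auto simp: f_def Hadd HR vec_eq_iff)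
 have lg: "linear g"
 proof (rule linearI)
  fix x y :: "complex ^ 'n" and c :: real
  have "(x + y) $ i *s b i = x $ i *s b i + y $ i *s b i" "(c *\<^sub>R x) $ i *s b i = c *\<^sub>R (x $ i *s b i)" for i
   by (auto simp: vec_eq_iff algebra_simps)
  then show "g (x + y) = g x + g y" "g (c *\<^sub>R x) = c *\<^sub>R g x"
   by (simp_all add: g_def sum.distrib scaleR_right.sum)
 qed
 have Hg: "H u (g y) = (\<Sum>i\<in>UNIV. y $ i * H u (b i))" for u y
  unfolding g_def linear_sum[OF lH] HC ..
 have fg: "f (g y) = y" for y
 proof -
  have "H (b j) (g y) = y $ j" for j
   unfolding Hg b by (simp add: if_distrib cong: if_cong)
  then show ?thesis by (simp add: f_def vec_eq_iff)
 qed
 have gf: "g (f x) = x" for x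
 proof -
  have "f \<circ> g = id" using fg by (auto simp: fun_eq_iff)
  then have "g \<circ> f = id" using linear_inverse_left[OF lf lg] by simp
  then show ?thesis by (auto simp: fun_eq_iff)
 qed
 have "om u v = std_form (f u) (f v)" for u v
 proof -
  have "H u v = H u (g (f v))" by (simp add: gf)
  also have "... = (\<Sum>i\<in>UNIV. H (b i) v * cnj (H (b i) u))"
   unfolding Hg using Hsym[of u] by (simp add: f_def)
  finally have "Im (H u v) = std_form (f u) (f v)"
   by (simp add: std_form_def f_def algebra_simps)
  then show ?thesis by (simp add: H_def)
 qed
 moreover have "f (\<i> *s v) = \<i> *s f v" for v by (simp add: f_def Hi vec_eq_iff)
 moreover have "g (\<i> *s v) = \<i> *s g v" for v by (metis calculation(2) fg gf)
 ultimately show ?thesis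
  using that[of f g] lf lg fg gf by (simp add: linear_conv_bounded_linear)
qed

subsection \<open>The Pfaffian sum\<close>

abbreviation pf where "pf om \<sigma> j == om (real_basis (\<sigma> (j, False))) (real_basis (\<sigma> (j, True)))"

text \<open>With n coordinates this is \<open>2 ^ n * fact n\<close> times the Pfaffian of the
  matrix of \<open>om\<close> in the basis \<open>real_basis\<close>.\<close>

definition pfaffian_sum :: "(complex ^ 'n::finite => complex ^ 'n => real) => real" where
 "pfaffian_sum om = (\<Sum>\<sigma> | \<sigma> permutes (UNIV :: ('n \<times> bool) set).
   of_int (sign \<sigma>) * (\<Prod>j\<in>UNIV. pf om \<sigma> j))"

lemma volume_density_pfaffian:
 fixes \<omega> :: "('m, 'n::finite, real) form2"
 shows "volume_density \<omega> c p = pfaffian_sum (\<omega> c p) / (2 ^ CARD('n) * fact CARD('n))"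
 unfolding volume_density_def pfaffian_sum_def ..

lemma prod_pair_bool:
 fixes F :: "'n::finite \<times> bool => 'a::comm_monoid_mult"
 shows "(\<Prod>p\<in>UNIV. F p) = (\<Prod>j\<in>UNIV. F (j, False) * F (j, True))"
proof -
 have "(\<Prod>p\<in>UNIV. F p) = (\<Prod>j\<in>UNIV. \<Prod>t\<in>UNIV. F (j, t))"
  by (simp add: prod.cartesian_product UNIV_Times_UNIV[symmetric] del: UNIV_Times_UNIV)
 then show ?thesis by (simp add: UNIV_bool)
qed

text \<open>Expanding every \<open>f (real_basis p)\<close> multilinearly gives a sum over all maps
  \<open>\<phi>\<close> of the index set. For fixed \<open>\<phi>\<close> the sum over
  \<open>\<sigma>\<close> is a determinant with rows permuted by \<open>\<phi>\<close>, or with two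
  equal rows if \<open>\<phi>\<close> is not injective.\<close>

lemma pfaffian_sum_pullback:
 fixes om :: "complex ^ 'n::finite => complex ^ 'n => real"
 assumes bil: "bilinear om"
 shows "pfaffian_sum (%u v. om (f u) (f v)) = rdet f * pfaffian_sum om"
proof -
 define M where "M p q = f (real_basis p) \<bullet> real_basis q" for p q :: "'n \<times> bool"
 define w where "w q r = om (real_basis q) (real_basis r)" for q r :: "'n \<times> bool"
 have rep: "f (real_basis p) = (\<Sum>q\<in>UNIV. M p q *\<^sub>R real_basis q)" for p
 proof -
  have "f (real_basis p) = (\<Sum>b\<in>Basis. (f (real_basis p) \<bullet> b) *\<^sub>R b)"
   by (simp add: euclidean_representation)
  also have "... = (\<Sum>q\<in>UNIV. (f (real_basis p) \<bullet> real_basis q) *\<^sub>R real_basis q)"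
   unfolding range_real_basis[symmetric] by (subst sum.reindex[OF inj_real_basis]) simp
  finally show ?thesis by (simp add: M_def)
 qed
 have om_exp: "om (f (real_basis a)) (f (real_basis b)) = (\<Sum>x\<in>UNIV. M a (fst x) * M b (snd x) * w (fst x) (snd x))" for a b
 proof -
  have "om (f (real_basis a)) (f (real_basis b)) = (\<Sum>x\<in>UNIV \<times> UNIV. om (M a (fst x) *\<^sub>R real_basis (fst x)) (M b (snd x) *\<^sub>R real_basis (snd x)))"
   unfolding rep by (subst bilinear_sum[OF bil]) (simp add: case_prod_beta)
  then show ?thesis
   by (simp add: bilinear_lmul[OF bil] bilinear_rmul[OF bil] w_def mult_ac)
 qed
 define Z where "Z \<phi> = (\<Prod>j\<in>UNIV. w (\<phi> (j, False)) (\<phi> (j, True)))" for \<phi> :: "'n \<times> bool => 'n \<times> bool"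
 have prod_exp: "(\<Prod>j\<in>UNIV. om (f (real_basis (\<sigma> (j, False)))) (f (real_basis (\<sigma> (j, True))))) =
   (\<Sum>\<phi>\<in>UNIV. (\<Prod>p\<in>UNIV. M (\<sigma> p) (\<phi> p)) * Z \<phi>)" for \<sigma> :: "'n \<times> bool => 'n \<times> bool"
 proof -
  have "(\<Prod>j\<in>UNIV. om (f (real_basis (\<sigma> (j, False)))) (f (real_basis (\<sigma> (j, True))))) =
    (\<Prod>j\<in>UNIV. \<Sum>x\<in>UNIV. M (\<sigma> (j, False)) (fst x) * M (\<sigma> (j, True)) (snd x) * w (fst x) (snd x))"
   by (simp add: om_exp)
  also have "... = (\<Sum>\<psi>\<in>PiE UNIV (%_. UNIV). \<Prod>j\<in>UNIV. M (\<sigma> (j, False)) (fst (\<psi> j)) * M (\<sigma> (j, True)) (snd (\<psi> j)) * w (fst (\<psi> j)) (snd (\<psi> j)))"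
   by (rule prod_sum_PiE) auto
  also have "... = (\<Sum>\<phi>\<in>UNIV. \<Prod>j\<in>UNIV. M (\<sigma> (j, False)) (\<phi> (j, False)) * M (\<sigma> (j, True)) (\<phi> (j, True)) * w (\<phi> (j, False)) (\<phi> (j, True)))"
   by (rule sum.reindex_bij_witness[of _ "%\<phi> j. (\<phi> (j, False), \<phi> (j, True))" "%\<psi> p. if snd p then snd (\<psi> (fst p)) else fst (\<psi> (fst p))"])
     (auto simp: fun_eq_iff PiE_def)
  also have "... = (\<Sum>\<phi>\<in>UNIV. (\<Prod>p\<in>UNIV. M (\<sigma> p) (\<phi> p)) * Z \<phi>)"
   by (simp add: Z_def prod_pair_bool prod.distrib[symmetric])
  finally show ?thesis .
 qed
 let ?A = "\<chi> p q. M q p"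
 have inner: "(\<Sum>\<sigma> | \<sigma> permutes UNIV. of_int (sign \<sigma>) * (\<Prod>p\<in>UNIV. M (\<sigma> p) (\<phi> p))) =
   (if \<phi> permutes UNIV then of_int (sign \<phi>) * rdet f else 0)" for \<phi> :: "'n \<times> bool => 'n \<times> bool"
 proof -
  have "(\<Sum>\<sigma> | \<sigma> permutes UNIV. of_int (sign \<sigma>) * (\<Prod>p\<in>UNIV. M (\<sigma> p) (\<phi> p))) = det (\<chi> p. ?A $ \<phi> p)"
   by (simp add: det_def)
  also have "... = (if \<phi> permutes UNIV then of_int (sign \<phi>) * rdet f else 0)"
  proof (cases "\<phi> permutes UNIV")
   case True
   have "rdet f = det (transpose ?A)"
    unfolding rdet_def by (rule arg_cong[of _ _ det]) (simp add: M_def transpose_def vec_eq_iff)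
   then show ?thesis using True det_permute_rows[OF True, of ?A] by simp
  next
   case False
   then have "\<not> inj \<phi>"
    using finite_UNIV_inj_surj[of \<phi>] bij_imp_permutes[of \<phi> UNIV] by (auto simp: bij_def)
   then obtain i j where "i \<noteq> j" "\<phi> i = \<phi> j" unfolding inj_def by blast
   then have "det (\<chi> p. ?A $ \<phi> p) = 0"
    by (intro det_identical_rows[of i j]) (auto simp: row_def vec_eq_iff)
   then show ?thesis using False by simp
  qed
  finally show ?thesis .
 qed
 have "pfaffian_sum (%u v. om (f u) (f v)) =
   (\<Sum>\<sigma> | \<sigma> permutes UNIV. \<Sum>\<phi>\<in>UNIV. of_int (sign \<sigma>) * (\<Prod>p\<in>UNIV. M (\<sigma> p) (\<phi> p)) * Z \<phi>)"
  unfolding pfaffian_sum_def prod_exp by (simp add: sum_distrib_left mult.assoc)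
 also have "... = (\<Sum>\<phi>\<in>UNIV. (\<Sum>\<sigma> | \<sigma> permutes UNIV. of_int (sign \<sigma>) * (\<Prod>p\<in>UNIV. M (\<sigma> p) (\<phi> p))) * Z \<phi>)"
  by (subst sum.swap) (simp add: sum_distrib_right)
 also have "... = (\<Sum>\<phi>\<in>UNIV. if \<phi> permutes UNIV then of_int (sign \<phi>) * rdet f * Z \<phi> else 0)"
  unfolding inner by (intro sum.cong) auto
 also have "... = (\<Sum>\<phi> | \<phi> permutes UNIV. of_int (sign \<phi>) * rdet f * Z \<phi>)"
  by (simp add: sum.If_cases)
 also have "... = rdet f * pfaffian_sum om"
  by (simp add: pfaffian_sum_def Z_def w_def sum_distrib_left mult_ac)
 finally show ?thesis .
qed

text \<open>Each transposition of the index type acts on two copies at once, so it becomes a product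
  of two transpositions.\<close>

lemma sign_map_prod_id:
 fixes \<tau> :: "'n::finite => 'n"
 assumes "\<tau> permutes UNIV"
 shows "sign (map_prod \<tau> id :: 'n \<times> bool => 'n \<times> bool) = 1"
 using assms finite_class.finite_UNIV
proof (induction rule: permutes_induct)
 case id
 have "map_prod id id = (id :: 'n \<times> bool => 'n \<times> bool)" by auto
 then show ?case by (simp add: id_def[symmetric])
next
 case (swap a b p)
 let ?t = "%s. Transposition.transpose (a, s) (b, s) :: 'n \<times> bool => 'n \<times> bool"
 let ?a = "map_prod p id :: 'n \<times> bool => 'n \<times> bool"
 have "map_prod (Transposition.transpose a b \<circ> p) id = ?t False \<circ> (?t True \<circ> map_prod p id)"
  by (auto simp: fun_eq_iff Transposition.transpose_def)
 moreover have "permutation ?a"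
 proof -
  have "bij p" using swap by (simp add: permutes_bij)
  then have "bij ?a"
   by (metis bij_id bij_betw_map_prod UNIV_Times_UNIV)
  then show ?thesis
   by (simp add: permutation_permutes) (metis bij_imp_permutes finite_class.finite_UNIV UNIV_I)
 qed
 ultimately have "sign (map_prod (Transposition.transpose a b \<circ> p) id :: 'n \<times> bool => 'n \<times> bool) =
   sign (?t False) * (sign (?t True) * sign ?a)"
  by (simp only: sign_compose permutation_compose permutation_swap_id)
 also have "sign ?a = 1" by fact
 also have "sign (?t False) * (sign (?t True) * 1) = 1"
  unfolding sign_swap_id by simp
 finally show ?case .
qed

text \<open>Interchanging the two entries of a pair changes the sign of the permutation and of one
  factor, so it preserves the term; this lowers the number of pairs that start with an imaginary
  basis vector. If none does, the term is zero unless \<open>\<sigma>\<close> permutes whole pairs,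
  and then it is 1.\<close>

lemma pfaffian_std_term:
 fixes \<sigma> :: "'n::finite \<times> bool => 'n \<times> bool"
 assumes "\<sigma> permutes UNIV"
 shows "of_int (sign \<sigma>) * (\<Prod>j\<in>UNIV. pf std_form \<sigma> j) \<ge> 0"
 using assms
proof (induction "card {j. snd (\<sigma> (j, False))}" arbitrary: \<sigma>)
 case 0
 have std: "std_form (real_basis (i, s)) (real_basis (i', s')) = (if i = i' then (if s = s' then 0 else if s' then 1 else - 1) else 0)" for i i' :: 'n and s s'
 proof -
  have "Im (cnj (real_basis (i, s) $ k) * real_basis (i', s') $ k) = (if k = i \<and> i = i' then (if s = s' then 0 else if s' then 1 else - 1) else 0)" for k
   by (auto simp: real_basis_def axis_def)
  then show ?thesis unfolding std_form_def by (cases "i = i'") (simp_all add: sum.delta')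
 qed
 have F: "\<not> snd (\<sigma> (j, False))" for j using 0 by auto
 show ?case
 proof (cases "\<forall>j. fst (\<sigma> (j, False)) = fst (\<sigma> (j, True)) \<and> snd (\<sigma> (j, True))")
  case True
  define \<tau> where "\<tau> j = fst (\<sigma> (j, False))" for j
  have \<sigma>: "\<sigma> = map_prod \<tau> id"
  proof
   fix p :: "'n \<times> bool"
   obtain j s where p: "p = (j, s)" by (cases p)
   show "\<sigma> p = map_prod \<tau> id p"
    unfolding p using True F by (cases s) (auto simp: \<tau>_def prod_eq_iff)
  qed
  have "inj \<tau>"
  proof (rule injI)
   fix x y assume "\<tau> x = \<tau> y"
   then have "\<sigma> (x, False) = \<sigma> (y, False)" by (simp add: \<sigma>)
   then show "x = y" using permutes_inj[OF 0(2)] by (auto dest: injD)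
  qed
  then have "\<tau> permutes UNIV"
   using finite_UNIV_inj_surj[of \<tau>] bij_imp_permutes[of \<tau> UNIV] by (auto simp: bij_def)
  then have "sign \<sigma> = 1" unfolding \<sigma> by (rule sign_map_prod_id)
  moreover have "pf std_form \<sigma> j = 1" for j
   by (simp add: \<sigma> std)
  ultimately show ?thesis by simp
 next
  case False
  then obtain j where j: "fst (\<sigma> (j, False)) \<noteq> fst (\<sigma> (j, True)) \<or> \<not> snd (\<sigma> (j, True))" by blast
  have "pf std_form \<sigma> j = 0"
   using j F[of j] std[of "fst (\<sigma> (j, False))" "snd (\<sigma> (j, False))" "fst (\<sigma> (j, True))" "snd (\<sigma> (j, True))", unfolded prod.collapse]
   by (auto split: if_splits)
  then have "(\<Prod>j\<in>UNIV. pf std_form \<sigma> j) = 0"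
   by (intro prod_zero) auto
  then show ?thesis by (simp only: mult_zero_right order_refl)
 qed
next
 case (Suc m)
 then obtain j where j: "snd (\<sigma> (j, False))"
  by (metis (mono_tags, lifting) Collect_empty_eq card.empty nat.distinct(1))
 show ?case
 proof (cases "snd (\<sigma> (j, True))")
  case True
  have std0: "std_form (real_basis (i, True)) (real_basis (i', True)) = 0" for i i' :: 'n
   unfolding std_form_def by (intro sum.neutral) (auto simp: real_basis_def axis_def)
  have "pf std_form \<sigma> j = 0"
   using j True std0[of "fst (\<sigma> (j, False))" "fst (\<sigma> (j, True))"] by (metis prod.collapse)
  then have "(\<Prod>j\<in>UNIV. pf std_form \<sigma> j) = 0"
   by (intro prod_zero) auto
  then show ?thesis by (simp only: mult_zero_right order_refl)
 next
  case F: False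
  let ?s = "\<sigma> \<circ> Transposition.transpose (j, False) (j, True)"
  have "{i. snd (\<sigma> (i, False))} = insert j {i. snd (?s (i, False))}"
   using j F by (auto simp: Transposition.transpose_def)
  moreover have "j \<notin> {i. snd (?s (i, False))}" using F by (simp add: Transposition.transpose_def)
  ultimately have "card {i. snd (\<sigma> (i, False))} = Suc (card {i. snd (?s (i, False))})" by simp
  then have c: "m = card {i. snd (?s (i, False))}" using Suc(2) by simp
  have p: "?s permutes UNIV"
   using Suc(3) by (intro permutes_compose permutes_swap_id) auto
  have sg: "sign ?s = - sign \<sigma>"
   using permutes_imp_permutation[OF finite_class.finite_UNIV Suc(3)]
   by (simp add: sign_compose permutation_swap_id sign_swap_id)
  have "(\<Prod>i\<in>UNIV. pf std_form ?s i) = pf std_form ?s j * (\<Prod>i\<in>UNIV - {j}. pf std_form ?s i)" by (rule prod.remove) auto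
  also have "(\<Prod>i\<in>UNIV - {j}. pf std_form ?s i) = (\<Prod>i\<in>UNIV - {j}. pf std_form \<sigma> i)"
   by (intro prod.cong) (auto simp: Transposition.transpose_def)
  also have "pf std_form ?s j = - pf std_form \<sigma> j"
   using positive_std_form unfolding positive_form_def by (auto simp: Transposition.transpose_def)
  also have "- pf std_form \<sigma> j * (\<Prod>i\<in>UNIV - {j}. pf std_form \<sigma> i) = - (\<Prod>i\<in>UNIV. pf std_form \<sigma> i)"
   using prod.remove[of UNIV j "pf std_form \<sigma>"] by simp
  finally show ?thesis using Suc(1)[OF c p] sg by simp
 qed
qed

lemma pfaffian_sum_std_pos: "pfaffian_sum (std_form :: complex ^ 'n::finite => _) > 0"
proof -
 let ?t = "%\<sigma> :: 'n \<times> bool => _. of_int (sign \<sigma>) * (\<Prod>j\<in>UNIV. pf std_form \<sigma> j) :: real"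
 have "std_form (real_basis (j, False)) (real_basis (j, True)) = 1" for j :: 'n
 proof -
  have "Im (cnj (real_basis (j, False) $ k) * real_basis (j, True) $ k) = (if k = j then 1 else 0)" for k
   by (auto simp: real_basis_def axis_def)
  then show ?thesis by (simp add: std_form_def)
 qed
 then have "0 < ?t id" by simp
 also have "?t id \<le> pfaffian_sum (std_form :: complex ^ 'n => _)"
  unfolding pfaffian_sum_def
  by (rule member_le_sum) (auto simp: permutes_id permutes_id[unfolded id_def] pfaffian_std_term finite_permutations)
 finally show ?thesis .
qed

text \<open>Diagonalising \<open>om\<close> only shows that the sum is nonzero, because the sign of
  \<open>rdet f\<close> is not at hand. Along the segment of positive forms from
  \<open>std_form\<close> to \<open>om\<close> the sum is continuous and never zero, so it keeps its
  sign.\<close>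

lemma pfaffian_sum_pos:
 fixes om :: "complex ^ 'n::finite => complex ^ 'n => real"
 assumes "positive_form om"
 shows "pfaffian_sum om > 0"
proof (rule ccontr)
 assume neg: "\<not> pfaffian_sum om > 0"
 define F where "F t = (%u v. (1 - t) * std_form u v + t * om u v)" for t :: real
 have pos: "positive_form (F t)" if "0 \<le> t" "t \<le> 1" for t
 proof -
  have b: "bilinear om" "bilinear (std_form :: complex ^ 'n => _)"
   using assms positive_std_form unfolding positive_form_def by blast+
  have "bilinear (F t)"
   unfolding bilinear_def F_def
   by (auto intro!: linearI simp: bilinear_ladd[OF b(1)] bilinear_radd[OF b(1)] bilinear_lmul[OF b(1)] bilinear_rmul[OF b(1)]
     bilinear_ladd[OF b(2)] bilinear_radd[OF b(2)] bilinear_lmul[OF b(2)] bilinear_rmul[OF b(2)] algebra_simps)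
  moreover have "F t u v = - F t v u" for u v
  proof -
   have "std_form u v = - std_form v u" "om u v = - om v u"
    using assms positive_std_form unfolding positive_form_def by blast+
   then show ?thesis by (simp add: F_def)
  qed
  moreover have "F t (\<i> *s u) (\<i> *s v) = F t u v" for u v
   using assms positive_std_form unfolding positive_form_def F_def by metis
  moreover have "F t u (\<i> *s u) > 0" if "u \<noteq> 0" for u
  proof -
   have "std_form u (\<i> *s u) > 0" "om u (\<i> *s u) > 0"
    using assms positive_std_form that unfolding positive_form_def by blast+
   then show ?thesis using \<open>0 \<le> t\<close> \<open>t \<le> 1\<close> unfolding F_def
    by (cases "t = 0") (auto intro: add_nonneg_pos)
  qed
  ultimately show ?thesis unfolding positive_form_def by blast
 qed
 have nz: "pfaffian_sum (F t) \<noteq> 0" if t: "0 \<le> t" "t \<le> 1" for t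
 proof -
  from positive_form_diagonal[OF pos[OF t]]
  obtain f g :: "complex ^ 'n => complex ^ 'n" where f: "bounded_linear f" "bounded_linear g" "!!x. f (g x) = x" "!!x. g (f x) = x"
   and F: "!!u v. F t u v = std_form (f u) (f v)" by metis
  have "F t = (%u v. std_form (f u) (f v))" using F by (intro ext)
  then have "pfaffian_sum (F t) = rdet f * pfaffian_sum (std_form :: complex ^ 'n => _)"
   using pfaffian_sum_pullback[OF bilinear_std_form, of f] by simp
  moreover have "rdet f \<noteq> 0"
  proof
   assume "rdet f = 0"
   then have "(\<integral>\<^sup>+y. 1 \<partial>(lborel :: (complex ^ 'n) measure)) = 0"
    using nn_integral_linear_bij[OF f(1,2,4,3), of "%_. 1"] by simp
   then show False by simp
  qed
  ultimately show ?thesis using pfaffian_sum_std_pos[where 'n='n] by simp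
 qed
 have "continuous_on {0..1} (%t. pfaffian_sum (F t))"
  unfolding pfaffian_sum_def F_def by (intro continuous_intros)
 moreover have "pfaffian_sum (F 1) \<le> 0" using neg by (simp add: F_def)
 moreover have "0 \<le> pfaffian_sum (F 0)" using pfaffian_sum_std_pos[where 'n='n] by (simp add: F_def)
 ultimately obtain t where "0 \<le> t" "t \<le> 1" "pfaffian_sum (F t) = 0"
  using IVT2'[of "%t. pfaffian_sum (F t)" 1 0 0] by auto
 then show False using nz by blast
qed

section \<open>The volume measure of a Kaehler manifold\<close>

locale kahler =
 fixes A :: "('m::t2_space, 'n::finite) chart set" and \<omega> :: "('m, 'n, real) form2"
 assumes kahler: "compact_connected_kahler_manifold A \<omega>"
begin

lemma compact_M: "compact (UNIV :: 'm set)"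
 and atlas: "complex_atlas A" and kform: "kahler_form A \<omega>"
 using kahler unfolding compact_connected_kahler_manifold_def by auto

abbreviation cimg :: "('m, 'n) chart => (complex ^ 'n) set" where "cimg c == snd c ` fst c"

lemma chartD:
 assumes "c \<in> A"
 shows "open (fst c)" "open (cimg c)" "homeomorphism (fst c) (cimg c) (snd c) (chart_inv c)"
 using atlas assms unfolding complex_atlas_def is_chart_def by auto

lemma chart_inv_left: "c \<in> A ==> x \<in> fst c ==> chart_inv c (snd c x) = x"
 using chartD(3) unfolding homeomorphism_def by blast

lemma chart_inv_right: "c \<in> A ==> z \<in> cimg c ==> snd c (chart_inv c z) = z \<and> chart_inv c z \<in> fst c"
 using chartD(3) unfolding homeomorphism_def by blast

lemma chart_continuous: "c \<in> A ==> continuous_on (fst c) (snd c)"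
 and chart_inv_continuous: "c \<in> A ==> continuous_on (cimg c) (chart_inv c)"
 using chartD(3) unfolding homeomorphism_def by blast+

lemma chart_image:
 assumes "c \<in> A" "B \<subseteq> fst c"
 shows "z \<in> snd c ` B \<longleftrightarrow> z \<in> cimg c \<and> chart_inv c z \<in> B"
proof
 assume "z \<in> snd c ` B"
 then obtain x where "x \<in> B" "z = snd c x" by blast
 then show "z \<in> cimg c \<and> chart_inv c z \<in> B" using assms chart_inv_left[OF assms(1)] by auto
next
 assume z: "z \<in> cimg c \<and> chart_inv c z \<in> B"
 then have "z = snd c (chart_inv c z)" using chart_inv_right[OF assms(1)] by simp
 then show "z \<in> snd c ` B" using z by (metis image_eqI)
qed

lemma open_chart_image:
 assumes "c \<in> A" "open W"
 shows "open (snd c ` (fst c \<inter> W))"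
proof -
 have "snd c ` (fst c \<inter> W) = cimg c \<inter> chart_inv c -` W"
  using chart_image[OF assms(1), of "fst c \<inter> W"] chart_inv_right[OF assms(1)] by auto
 then show ?thesis
  using continuous_open_preimage[OF chart_inv_continuous[OF assms(1)] chartD(2)[OF assms(1)] assms(2)] by simp
qed

lemma transition_C1:
 assumes "c \<in> A" "d \<in> A"
 shows "C1_on (snd c ` (fst c \<inter> fst d)) (transition c d)"
proof (rule C1_on_vec)
 show "C1_on (snd c ` (fst c \<inter> fst d)) (%z. transition c d z $ i)" for i
  using atlas assms unfolding complex_atlas_def
  by (intro holo_on_imp_C1_on open_chart_image chartD) auto
qed

lemma transition_complex_linear:
 assumes "c \<in> A" "d \<in> A" "z \<in> snd c ` (fst c \<inter> fst d)"
 shows "fder (transition c d) z (a *s v) = a *s fder (transition c d) z v"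
proof -
 note D = C1_onD[OF transition_C1[OF assms(1,2)] assms(3)]
 have "fder (transition c d) z (a *s v) $ i = a * fder (transition c d) z v $ i" for i
 proof -
  have "((%z. transition c d z $ i) has_derivative (%v. fder (transition c d) z v $ i)) (at z)"
   using bounded_linear.has_derivative[OF bounded_linear_vec_nth D] .
  moreover obtain D' where "((%z. transition c d z $ i) has_derivative D') (at z)" "!!a v. D' (a *s v) = a * D' v"
   using atlas assms unfolding complex_atlas_def holo_on_def by blast
  ultimately show ?thesis using has_derivative_unique by metis
 qed
 then show ?thesis by (simp add: vec_eq_iff)
qed

lemma positive_kahler:
 assumes "c \<in> A" "p \<in> fst c" shows "positive_form (\<omega> c p)"
 using kform assms unfolding kahler_form_def smooth_form2_def positive_form_def
 by (metis IntI UNIV_I)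

lemma volume_density_pos: "c \<in> A ==> p \<in> fst c ==> volume_density \<omega> c p > 0"
 by (simp add: volume_density_pfaffian pfaffian_sum_pos[OF positive_kahler])

lemma continuous_kahler:
 assumes "c \<in> A"
 shows "continuous_on (cimg c) (%z. \<omega> c (chart_inv c z) u v)"
proof -
 have "smooth_on (cimg c) (%z. \<omega> c (chart_inv c z) u v)"
  using kform assms unfolding kahler_form_def smooth_form2_def by auto
 then have "times_differentiable_on 0 (cimg c) (%z. \<omega> c (chart_inv c z) u v)"
  unfolding smooth_on_def by blast
 then show ?thesis by simp
qed

lemma continuous_volume_density:
 assumes "c \<in> A" shows "continuous_on (cimg c) (%z. volume_density \<omega> c (chart_inv c z))"
 unfolding volume_density_def
 by (intro continuous_intros continuous_kahler[OF assms]) simp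

text \<open>The pullback formula relates two positive densities, so it forces the real Jacobian of
  the transition to be positive; this is how the charts turn out to be consistently
  oriented.\<close>

lemma volume_density_transform:
 assumes "c \<in> A" "d \<in> A" "p \<in> fst c \<inter> fst d"
 shows "volume_density \<omega> c p = \<bar>rdet (change_coords c d p)\<bar> * volume_density \<omega> d p"
proof -
 have "smooth_form2 A UNIV \<omega>" using kform unfolding kahler_form_def by (rule conjunct1)
 then have "\<forall>c\<in>A. \<forall>d\<in>A. \<forall>p\<in>fst c \<inter> fst d. \<forall>u v. \<omega> c p u v = \<omega> d p (change_coords c d p u) (change_coords c d p v)"
  unfolding smooth_form2_def Int_UNIV_right by (elim conjE)
 then have "\<omega> c p u v = \<omega> d p (change_coords c d p u) (change_coords c d p v)" for u v
  using assms by blast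
 then have "\<omega> c p = (%u v. \<omega> d p (change_coords c d p u) (change_coords c d p v))"
  by (intro ext)
 moreover have "bilinear (\<omega> d p)" using positive_kahler[of d p] assms by (simp add: positive_form_def)
 ultimately have *: "pfaffian_sum (\<omega> c p) = rdet (change_coords c d p) * pfaffian_sum (\<omega> d p)"
  using pfaffian_sum_pullback[of "\<omega> d p" "change_coords c d p"] by metis
 moreover have "pfaffian_sum (\<omega> c p) > 0" "pfaffian_sum (\<omega> d p) > 0"
  using assms by (auto intro!: pfaffian_sum_pos positive_kahler simp del: split_paired_All)
 ultimately have "rdet (change_coords c d p) > 0" by (simp add: zero_less_mult_iff)
 then show ?thesis using * by (simp add: volume_density_pfaffian)
qed

definition chart_density :: "('m, 'n) chart => complex ^ 'n => ennreal" where
 "chart_density c z = ennreal (if z \<in> cimg c then volume_density \<omega> c (chart_inv c z) else 0)"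

text \<open>Off the chart image the density is zero, so the value \<open>undefined\<close> carries
  no mass.\<close>

definition chart_measure :: "('m, 'n) chart => 'm measure" where
 "chart_measure c = distr (density lborel (chart_density c)) borel (%z. if z \<in> cimg c then chart_inv c z else undefined)"

lemma chart_density_measurable [measurable]:
 assumes "c \<in> A" shows "chart_density c \<in> borel_measurable borel"
proof -
 have "(%z. if z \<in> cimg c then volume_density \<omega> c (chart_inv c z) else 0) \<in> borel_measurable borel"
  by (rule borel_measurable_continuous_on_if)
    (auto intro: borel_open chartD(2) assms continuous_volume_density)
 then show ?thesis unfolding chart_density_def[abs_def] by measurable
qed

lemma chart_inv_measurable [measurable]:
 assumes "c \<in> A"
 shows "(%z. if z \<in> cimg c then chart_inv c z else undefined) \<in> borel_measurable borel"
 by (rule borel_measurable_continuous_on_if)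
   (auto intro: borel_open chartD(2) assms chart_inv_continuous)

lemma nn_integral_chart_measure:
 assumes "c \<in> A" and [measurable]: "F \<in> borel_measurable borel"
 shows "(\<integral>\<^sup>+x. F x \<partial>chart_measure c) = (\<integral>\<^sup>+z. chart_density c z * F (chart_inv c z) \<partial>lborel)"
proof -
 note [measurable] = chart_density_measurable[OF assms(1)] chart_inv_measurable[OF assms(1)]
 have "(\<integral>\<^sup>+x. F x \<partial>chart_measure c) = (\<integral>\<^sup>+z. chart_density c z * F (if z \<in> cimg c then chart_inv c z else undefined) \<partial>lborel)"
  unfolding chart_measure_def by (simp add: nn_integral_distr nn_integral_density)
 also have "... = (\<integral>\<^sup>+z. chart_density c z * F (chart_inv c z) \<partial>lborel)"
  by (intro nn_integral_cong) (auto simp: chart_density_def)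
 finally show ?thesis .
qed

lemma sets_chart_measure [simp]: "sets (chart_measure c) = sets borel"
 by (simp add: chart_measure_def)

abbreviation chart_vol where
 "chart_vol c B == \<integral>\<^sup>+ z\<in>snd c ` B. ennreal (volume_density \<omega> c (chart_inv c z)) \<partial>lborel"

lemma emeasure_chart_measure:
 assumes "c \<in> A" "B \<in> sets borel" "B \<subseteq> fst c"
 shows "emeasure (chart_measure c) B = chart_vol c B"
proof -
 have "emeasure (chart_measure c) B = (\<integral>\<^sup>+x. indicator B x \<partial>chart_measure c)"
  using assms(2) by (simp add: nn_integral_indicator)
 also have "... = (\<integral>\<^sup>+z. chart_density c z * indicator B (chart_inv c z) \<partial>lborel)"
  by (rule nn_integral_chart_measure) (use assms in auto)
 also have "... = chart_vol c B"
  using chart_image[OF assms(1,3)]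
  by (intro nn_integral_cong) (auto simp: chart_density_def indicator_def)
 finally show ?thesis .
qed

text \<open>Change of variables under the transition map, whose Jacobian is the ratio of the two
  densities.\<close>

lemma chart_measure_overlap:
 assumes c: "c \<in> A" and d: "d \<in> A" and B: "B \<in> sets borel" "B \<subseteq> fst c \<inter> fst d"
 shows "emeasure (chart_measure c) B = emeasure (chart_measure d) B"
proof -
 let ?S = "snd c ` (fst c \<inter> fst d)" and ?S' = "snd d ` (fst d \<inter> fst c)"
 define F where "F y = chart_density d y * indicator B (if y \<in> cimg d then chart_inv d y else undefined)" for y
 have [measurable]: "F \<in> borel_measurable borel"
  unfolding F_def[abs_def] using chart_density_measurable[OF d] chart_inv_measurable[OF d] B(1) by measurable
 have em: "emeasure (chart_measure c) B = (\<integral>\<^sup>+x. chart_density c x * indicator B (chart_inv c x) \<partial>lborel)"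
  if "c \<in> A" for c
  using nn_integral_chart_measure[OF that, of "indicator B"] B(1) by simp
 have "emeasure (chart_measure d) B = (\<integral>\<^sup>+y. F y * indicator ?S' y \<partial>lborel)"
  unfolding em[OF d] using chart_image[OF d, of "fst d \<inter> fst c"] B(2)
  by (intro nn_integral_cong) (auto simp: F_def chart_density_def indicator_def)
 also have "... = (\<integral>\<^sup>+x. ennreal \<bar>rdet (fder (transition c d) x)\<bar> * F (transition c d x) * indicator ?S x \<partial>lborel)"
 proof (rule nn_integral_change_of_variables[where U = "transition d c"])
  show "open ?S" "open ?S'" using open_chart_image c d chartD by auto
  show "(transition c d has_derivative fder (transition c d) x) (at x)" if "x \<in> ?S" for x
   by (rule C1_onD[OF transition_C1[OF c d] that])
  show "(transition d c has_derivative fder (transition d c) x) (at x)" if "x \<in> ?S'" for x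
   by (rule C1_onD[OF transition_C1[OF d c] that])
  show "transition c d x \<in> ?S' \<and> transition d c (transition c d x) = x" if "x \<in> ?S" for x
   using that chart_inv_left[OF c] chart_inv_left[OF d] by (auto simp: transition_def)
  show "transition d c x \<in> ?S \<and> transition c d (transition d c x) = x" if "x \<in> ?S'" for x
   using that chart_inv_left[OF c] chart_inv_left[OF d] by (auto simp: transition_def)
  show "continuous_on ?S (%x. rdet (fder (transition c d) x))"
   unfolding rdet_def det_def
   by (intro continuous_intros) (auto intro!: continuous_intros C1_on_deriv_cont[OF transition_C1[OF c d]])
 qed simp
 also have "... = (\<integral>\<^sup>+x. chart_density c x * indicator B (chart_inv c x) \<partial>lborel)"
 proof (rule nn_integral_cong)
  fix x
  show "ennreal \<bar>rdet (fder (transition c d) x)\<bar> * F (transition c d x) * indicator ?S x =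
    chart_density c x * indicator B (chart_inv c x)"
  proof (cases "x \<in> ?S")
   case True
   then obtain p where p: "p \<in> fst c" "p \<in> fst d" "x = snd c p" by blast
   have "ennreal (volume_density \<omega> c p) = ennreal \<bar>rdet (fder (transition c d) x)\<bar> * ennreal (volume_density \<omega> d p)"
    using volume_density_transform[OF c d, of p] p volume_density_pos[OF d p(2)]
    by (simp add: change_coords_def flip: ennreal_mult)
   moreover have "chart_density c x = ennreal (volume_density \<omega> c p)" "chart_inv c x = p"
    using p chart_inv_left[OF c] by (auto simp: chart_density_def)
   moreover have "F (transition c d x) = ennreal (volume_density \<omega> d p) * indicator B p"
    using p chart_inv_left[OF c] chart_inv_left[OF d] by (auto simp: F_def chart_density_def transition_def)
   ultimately show ?thesis using True by (simp add: mult.assoc)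
  next
   case False
   then have "chart_density c x * indicator B (chart_inv c x) = 0"
    using chart_image[OF c, of "fst c \<inter> fst d"] chart_inv_right[OF c, of x] B(2)
    by (auto simp: chart_density_def indicator_def)
   then show ?thesis using False by simp
  qed
 qed
 also have "... = emeasure (chart_measure c) B" by (rule em[OF c, symmetric])
 finally show ?thesis by simp
qed

lemma finite_chart_cover:
 obtains N :: nat and c where "!!i. i < N ==> c i \<in> A" "(\<Union>i<N. fst (c i)) = UNIV"
proof -
 have "UNIV \<subseteq> \<Union>(fst ` A)" using atlas by (auto simp: complex_atlas_def)
 then obtain C where C: "C \<subseteq> A" "finite C" "UNIV \<subseteq> \<Union>(fst ` C)"
  using compactE_image[OF compact_M, of A fst] chartD(1) by metis
 obtain xs where "set xs = C" using finite_list[OF C(2)] by blast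
 then have xs: "C = (%i. xs ! i) ` {..<length xs}"
  by (simp add: set_conv_nth setcompr_eq_image lessThan_def)
 show ?thesis
  by (rule that[of "length xs" "%i. xs ! i"]) (use C xs in auto)
qed

definition is_volume_measure :: "'m measure => bool" where
 "is_volume_measure \<mu> \<longleftrightarrow> sets \<mu> = sets borel \<and>
   (\<forall>c\<in>A. \<forall>B\<in>sets borel. B \<subseteq> fst c \<longrightarrow>
    emeasure \<mu> B = chart_vol c B)"

lemma is_volume_measureD:
 assumes "is_volume_measure \<mu>" "c \<in> A" "B \<in> sets borel" "B \<subseteq> fst c"
 shows "emeasure \<mu> B = chart_vol c B"
 using assms unfolding is_volume_measure_def by blast

text \<open>\<open>volume_measure\<close> is a definite description, so existence and uniqueness
  must precede any use of it. A finite cover by charts is cut into disjoint Borel pieces: these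
  determine the measure, and the sum of the chart measures on them defines it.\<close>

lemma is_volume_measure_exists_unique: "\<exists>!\<mu>. is_volume_measure \<mu>"
proof -
 obtain N :: nat and c where c: "!!i. i < N ==> c i \<in> A" and cov: "(\<Union>i<N. fst (c i)) = UNIV"
  using finite_chart_cover by blast
 define E where "E i = fst (c i) - (\<Union>j<i. fst (c j))" for i
 have Em: "E i \<in> sets borel" if "i < N" for i
  unfolding E_def using that c chartD(1) by (intro sets.Diff sets.finite_UN borel_open) auto
 have Ecov: "\<exists>i<N. x \<in> E i" for x
 proof -
  have ex: "\<exists>i. i < N \<and> x \<in> fst (c i)" using cov by blast
  define i where "i = (LEAST i. i < N \<and> x \<in> fst (c i))"
  have "i < N \<and> x \<in> fst (c i)" unfolding i_def using ex by (rule LeastI_ex)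
  moreover have "x \<notin> fst (c j)" if "j < i" for j
   using not_less_Least[OF that[unfolded i_def]] that calculation by auto
  ultimately show ?thesis by (auto simp: E_def)
 qed
 have Edisj: "disjoint_family_on E {..<N}"
  unfolding disjoint_family_on_def
 proof (intro ballI impI)
  fix m n assume "m \<in> {..<N}" "n \<in> {..<N}" "m \<noteq> n"
  then show "E m \<inter> E n = {}"
   unfolding E_def by (cases "m < n") (auto simp: not_less)
 qed
 have split: "emeasure \<mu> B = (\<Sum>i<N. emeasure \<mu> (B \<inter> E i))" if "sets \<mu> = sets borel" "B \<in> sets borel" for \<mu> B
 proof -
  have "emeasure \<mu> (\<Union>i<N. B \<inter> E i) = (\<Sum>i<N. emeasure \<mu> (B \<inter> E i))"
  proof (rule sum_emeasure[symmetric])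
   show "disjoint_family_on (%i. B \<inter> E i) {..<N}"
    using Edisj unfolding disjoint_family_on_def by blast
  qed (use that Em in auto)
  moreover have "(\<Union>i<N. B \<inter> E i) = B" using Ecov by auto
  ultimately show ?thesis by simp
 qed
 define m where "m B = (\<Sum>i<N. emeasure (chart_measure (c i)) (B \<inter> E i))" for B
 define M where "M = measure_of UNIV (sets borel) m"
 have setsM: "sets M = sets (borel :: 'm measure)"
  unfolding M_def by (metis sets.sets_measure_of_eq space_borel)
 have Mem: "emeasure M B = m B" if "B \<in> sets borel" for B
 proof -
  have "countably_additive (sets borel) m"
  proof (rule countably_additiveI)
   fix F :: "nat => 'm set" assume F: "range F \<subseteq> sets borel" "disjoint_family F"
   have "(\<Sum>k. m (F k)) = (\<Sum>i<N. \<Sum>k. emeasure (chart_measure (c i)) (F k \<inter> E i))"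
    unfolding m_def by (rule suminf_sum) simp
   also have "... = (\<Sum>i<N. emeasure (chart_measure (c i)) (\<Union>k. F k \<inter> E i))"
   proof (intro sum.cong refl suminf_emeasure)
    fix i assume "i \<in> {..<N}"
    then show "range (%k. F k \<inter> E i) \<subseteq> sets (chart_measure (c i))"
     using F(1) Em by (auto intro!: sets.Int)
    show "disjoint_family (%k. F k \<inter> E i)"
     using F(2) by (auto simp: disjoint_family_on_def)
   qed
   also have "... = m (\<Union>k. F k)" unfolding m_def by (simp add: Int_commute flip: Int_UN_distrib)
   finally show "(\<Sum>k. m (F k)) = m (\<Union> (range F))" .
  qed
  moreover have "positive (sets borel) m" by (simp add: positive_def m_def)
  moreover have "sigma_algebra UNIV (sets (borel :: 'm measure))"
   using sets.sigma_algebra_axioms[of "borel :: 'm measure"] by simp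
  ultimately show ?thesis
   unfolding M_def by (intro emeasure_measure_of_sigma that)
 qed
 have "is_volume_measure M"
  unfolding is_volume_measure_def
 proof (intro conjI ballI impI setsM)
  fix d B assume d: "d \<in> A" and B: "B \<in> sets borel" "B \<subseteq> fst d"
  have "emeasure M B = (\<Sum>i<N. emeasure (chart_measure (c i)) (B \<inter> E i))" by (simp add: Mem B m_def)
  also have "... = (\<Sum>i<N. emeasure (chart_measure d) (B \<inter> E i))"
   using B d c Em by (intro sum.cong refl chart_measure_overlap) (auto simp: E_def)
  also have "... = emeasure (chart_measure d) B" by (rule split[symmetric]) (use B in auto)
  also have "... = chart_vol d B"
   by (rule emeasure_chart_measure[OF d B])
  finally show "emeasure M B = chart_vol d B" .
 qed
 moreover have "\<mu> = \<nu>" if \<mu>: "is_volume_measure \<mu>" and \<nu>: "is_volume_measure \<nu>" for \<mu> \<nu>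
 proof (rule measure_eqI)
  show "sets \<mu> = sets \<nu>" using \<mu> \<nu> by (simp add: is_volume_measure_def)
  fix B assume "B \<in> sets \<mu>"
  then have B: "B \<in> sets borel" using \<mu> by (simp add: is_volume_measure_def)
  have "emeasure \<mu> (B \<inter> E i) = emeasure \<nu> (B \<inter> E i)" if "i < N" for i
  proof -
   have "B \<inter> E i \<in> sets borel" "B \<inter> E i \<subseteq> fst (c i)" "c i \<in> A" using B Em c that by (auto simp: E_def)
   then show ?thesis by (simp only: is_volume_measureD[OF \<mu>] is_volume_measureD[OF \<nu>])
  qed
  then show "emeasure \<mu> B = emeasure \<nu> B"
   using split[of \<mu> B] split[of \<nu> B] \<mu> \<nu> B by (simp add: is_volume_measure_def)
 qed
 ultimately show ?thesis by blast
qed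

abbreviation vol :: "'m measure" where "vol == volume_measure A \<omega>"

lemma is_volume_measure_vol: "is_volume_measure vol"
 using theI'[OF is_volume_measure_exists_unique]
 unfolding volume_measure_def is_volume_measure_def .

lemma sets_vol [simp, measurable_cong]: "sets vol = sets borel"
 using is_volume_measure_vol by (simp add: is_volume_measure_def)

lemma space_vol [simp]: "space vol = UNIV"
 using sets_eq_imp_space_eq[OF sets_vol] by simp

lemma nn_integral_vol_chart:
 assumes c: "c \<in> A" and [measurable]: "F \<in> borel_measurable borel"
 shows "(\<integral>\<^sup>+x. F x * indicator (fst c) x \<partial>vol) =
  (\<integral>\<^sup>+z. F (chart_inv c z) * chart_density c z \<partial>lborel)"
proof -
 have [measurable]: "fst c \<in> sets borel" using chartD(1)[OF c] by simp
 have "density vol (indicator (fst c)) = chart_measure c"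
 proof (rule measure_eqI)
  fix B assume "B \<in> sets (density vol (indicator (fst c)))"
  then have B [measurable]: "B \<in> sets borel" by simp
  have "emeasure (density vol (indicator (fst c))) B = emeasure vol (B \<inter> fst c)"
   by (simp add: emeasure_density indicator_inter_arith[symmetric] Int_commute mult.commute)
  also have "... = emeasure (chart_measure c) (B \<inter> fst c)"
   using B c by (simp add: emeasure_chart_measure is_volume_measureD[OF is_volume_measure_vol])
  also have "... = emeasure (chart_measure c) B"
  proof -
   have "emeasure (chart_measure c) C = (\<integral>\<^sup>+z. chart_density c z * indicator C (chart_inv c z) \<partial>lborel)" if "C \<in> sets borel" for C
    using nn_integral_chart_measure[OF c, of "indicator C"] that by simp
   then show ?thesis
    using chart_inv_right[OF c]
    by (auto intro!: nn_integral_cong simp: chart_density_def indicator_def)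
  qed
  finally show "emeasure (density vol (indicator (fst c))) B = emeasure (chart_measure c) B" .
 qed simp
 then have "(\<integral>\<^sup>+x. F x \<partial>density vol (indicator (fst c))) = (\<integral>\<^sup>+x. F x \<partial>chart_measure c)" by simp
 then show ?thesis
  using nn_integral_chart_measure[OF c, of F] by (simp add: nn_integral_density mult.commute)
qed

lemma emeasure_vol_finite: "emeasure vol UNIV < \<infinity>"
proof -
 have loc: "\<exists>W. open W \<and> x \<in> W \<and> emeasure vol W < \<infinity>" for x
 proof -
  obtain c where c: "c \<in> A" "x \<in> fst c" using atlas unfolding complex_atlas_def by blast
  obtain r where r: "r > 0" "cball (snd c x) r \<subseteq> cimg c"
   using chartD(2)[OF c(1)] c(2) by (meson image_eqI open_contains_cball)
  let ?W = "fst c \<inter> snd c -` ball (snd c x) r"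
  have W: "open ?W" by (rule continuous_open_preimage[OF chart_continuous[OF c(1)] chartD(1)[OF c(1)] open_ball])
  have "compact ((%z. volume_density \<omega> c (chart_inv c z)) ` cball (snd c x) r)"
   by (rule compact_continuous_image[OF continuous_on_subset[OF continuous_volume_density[OF c(1)] r(2)] compact_cball])
  from compact_imp_bounded[OF this] obtain B where B0: "\<forall>y\<in>(%z. volume_density \<omega> c (chart_inv c z)) ` cball (snd c x) r. norm y \<le> B"
   unfolding bounded_iff by blast
  have B: "volume_density \<omega> c (chart_inv c z) \<le> B" if "z \<in> cball (snd c x) r" for z
  proof -
   have "norm (volume_density \<omega> c (chart_inv c z)) \<le> B" using B0 that by blast
   then show ?thesis by simp
  qed
  have "emeasure vol ?W = (\<integral>\<^sup>+z\<in>snd c ` ?W. ennreal (volume_density \<omega> c (chart_inv c z)) \<partial>lborel)"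
   using c W by (intro is_volume_measureD[OF is_volume_measure_vol]) auto
  also have "... \<le> (\<integral>\<^sup>+z. ennreal B * indicator (cball (snd c x) r) z \<partial>lborel)"
   using B by (intro nn_integral_mono) (auto simp: indicator_def ennreal_leI)
  also have "... = ennreal B * emeasure lborel (cball (snd c x) r)"
   by (simp add: nn_integral_cmult_indicator)
  also have "... < \<infinity>"
   using emeasure_bounded_finite[OF bounded_cball, of "snd c x" r] by (simp add: ennreal_mult_less_top)
  finally show ?thesis using W c(2) r(1) by (intro exI[of _ ?W]) auto
 qed
 then obtain W where W: "!!x. open (W x)" "!!x. x \<in> W x" "!!x. emeasure vol (W x) < \<infinity>" by metis
 obtain D where D: "finite D" "UNIV \<subseteq> (\<Union>x\<in>D. W x)"
  using compactE_image[OF compact_M, of UNIV W] W by (metis UNIV_I UN_iff subsetI)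
 then have "emeasure vol UNIV \<le> emeasure vol (\<Union>x\<in>D. W x)"
  using W by (intro emeasure_mono) (auto intro!: borel_open)
 also have "... \<le> (\<Sum>x\<in>D. emeasure vol (W x))"
  using W D by (intro emeasure_subadditive_finite) auto
 also have "... < \<infinity>" using W D by simp
 finally show ?thesis .
qed

lemma finite_measure_vol: "finite_measure vol"
 using emeasure_vol_finite by (intro finite_measureI) auto

end

section \<open>Holomorphic approximation at scale \<open>1 / sqrt k\<close> in a chart\<close>

definition dnorm2 :: "(complex ^ 'n::finite => complex) => complex ^ 'n => real" where
 "dnorm2 v z = (\<Sum>l\<in>UNIV. (norm (dbar v z (axis l 1)))\<^sup>2)"

lemma dnorm2_nonneg: "dnorm2 v z \<ge> 0"
 by (simp add: dnorm2_def sum_nonneg)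

lemma norm_dbar_le:
 fixes v :: "complex ^ 'n::finite => complex"
 assumes "v differentiable (at z)"
 shows "(norm (dbar v z u))\<^sup>2 \<le> (norm u)\<^sup>2 * dnorm2 v z"
proof -
 have "norm (dbar v z u) \<le> (\<Sum>l\<in>UNIV. norm (u $ l) * norm (dbar v z (axis l 1)))"
  unfolding dbar_axis_sum[OF assms, of u]
  by (rule sum_norm_le) (simp add: norm_mult)
 then have "(norm (dbar v z u))\<^sup>2 \<le> (\<Sum>l\<in>UNIV. norm (u $ l) * norm (dbar v z (axis l 1)))\<^sup>2"
  by (intro power_mono) auto
 also have "... \<le> (\<Sum>l\<in>UNIV. (norm (u $ l))\<^sup>2) * (\<Sum>l\<in>UNIV. (norm (dbar v z (axis l 1)))\<^sup>2)"
  by (rule Cauchy_Schwarz_ineq_sum)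
 finally show ?thesis by (simp add: dnorm2_def norm_vec_def L2_set_def sum_nonneg)
qed

definition approx :: "(complex ^ 'n::finite) set => (complex ^ 'n => real) => (complex ^ 'n => complex) => ennreal => bool" where
 "approx S W V c \<longleftrightarrow> (\<exists>w. holo_on S w \<and> wint S (%z. (norm (V z - w z))\<^sup>2 * W z) \<le> c)"

text \<open>The radius condition keeps the larger ball inside \<open>ball z0 (3 * r)\<close> for
  centres in \<open>cball z0 (2 * r)\<close>. The constants \<open>C\<close> and \<open>C'\<close>
  will be chosen before \<open>R\<close>, and only the least admissible \<open>k\<close> after
  it.\<close>

definition local_approx :: "(complex ^ 'n::finite) set => (complex ^ 'n => real) => complex ^ 'n => real => real => real => real => nat => bool" where
 "local_approx S H z0 r C C' R k \<longleftrightarrow> k > 0 \<and> C' * R / sqrt k \<le> r \<and> (\<forall>p\<in>cball z0 (2 * r). \<forall>V. C1_on S V \<longrightarrow>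
  approx (ball p (2 * R / sqrt k)) (%z. H z ^ k) V
   (ennreal (C / k) * wint (ball p (C' * R / sqrt k)) (%z. dnorm2 V z * H z ^ k)))"

lemma nn_integral_affine_bij:
 fixes f g :: "complex ^ 'n::finite => complex ^ 'n"
 assumes "bounded_linear f" "bounded_linear g" "!!x. f (g x) = x" "!!x. g (f x) = x"
  and [measurable]: "F \<in> borel_measurable borel"
 shows "(\<integral>\<^sup>+z. F z \<partial>lborel) = ennreal \<bar>rdet g\<bar> * (\<integral>\<^sup>+y. F (p + g y) \<partial>lborel)"
proof -
 have "(\<integral>\<^sup>+z. F z \<partial>lborel) = (\<integral>\<^sup>+z. F (p + z) \<partial>lborel)"
  by (rule nn_integral_translate[symmetric]) auto
 also have "... = ennreal \<bar>rdet g\<bar> * (\<integral>\<^sup>+y. F (p + g y) \<partial>lborel)"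
  by (rule nn_integral_linear_bij[OF assms(2,1,3,4)]) auto
 finally show ?thesis .
qed

text \<open>The model estimate is transported by the complex affine map
  \<open>z \<mapsto> f (z - p)\<close>. The Jacobian is constant and appears on both sides, so
  \<open>C\<close> is independent of \<open>f\<close>.\<close>

lemma affine_model_estimate:
 obtains C where "C \<ge> 0"
  "!!R p (f :: complex ^ 'n::finite => complex ^ 'n) g V. R \<ge> 1 ==> bounded_linear f ==> bounded_linear g ==>
   (!!x. f (g x) = x) ==> (!!x. g (f x) = x) ==> (!!v. f (\<i> *s v) = \<i> *s f v) ==> (!!v. g (\<i> *s v) = \<i> *s g v) ==>
   C1_on {z. f (z - p) \<in> cube (2 * R)} V ==>
   approx {z. f (z - p) \<in> cube R} (%z. exp (- (norm (f (z - p)))\<^sup>2)) V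
    (ennreal C * (\<Sum>i\<in>UNIV. wint {z. f (z - p) \<in> cube (2 * R)} (%z. (norm (dbar V z (g (axis i 1))))\<^sup>2 * exp (- (norm (f (z - p)))\<^sup>2))))"
proof -
 obtain C where C: "C \<ge> 0" and model: "!!R (v :: complex ^ 'n => complex). R \<ge> 1 ==> C1_on (cube (2 * R)) v ==>
   \<exists>w. holo_on (cube R) w \<and> gnorm (cube R) (%z. v z - w z) \<le>
     ennreal C * energy R v"
  using model_estimate by blast
 show ?thesis
 proof (rule that[OF C])
  fix R :: real and p and f g :: "complex ^ 'n => complex ^ 'n" and V :: "complex ^ 'n => complex"
  assume R: "R \<ge> 1" and f: "bounded_linear f" and g: "bounded_linear g"
   and fg: "!!x. f (g x) = x" and gf: "!!x. g (f x) = x"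
   and fi: "!!v. f (\<i> *s v) = \<i> *s f v" and gi: "!!v. g (\<i> *s v) = \<i> *s g v"
   and V: "C1_on {z. f (z - p) \<in> cube (2 * R)} V"
  let ?P = "%r. {z. f (z - p) \<in> cube r}" and ?e = "%z. exp (- (norm (f (z - p)))\<^sup>2)"
  have cf: "continuous_on S (%z. f (z - p))" for S
   by (intro bounded_linear.continuous_on[OF f] continuous_intros)
  have P: "?P r \<in> sets borel" for r
   using borel_open[OF open_vimage[OF open_polydisc cf]] by (simp add: vimage_def)
  have Dg: "((%y. p + g y) has_derivative g) (at y)" for y
   by (auto intro!: derivative_eq_intros bounded_linear_imp_has_derivative[OF g])
  have Df: "((%z. f (z - p)) has_derivative f) (at z)" for z
   by (rule has_derivative_eq_rhs[OF bounded_linear.has_derivative[OF f has_derivative_diff[OF has_derivative_ident has_derivative_const]]]) simp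
  have inP: "p + g y \<in> ?P r \<longleftrightarrow> y \<in> cube r" for y r by (simp add: fg)
  define v where "v y = V (p + g y)" for y
  have "C1_on (cube (2 * R)) (%y. p + g y)"
   by (intro C1_on_add C1_on_const C1_on_linear g)
  then have v: "C1_on (cube (2 * R)) v"
   unfolding v_def[abs_def] by (rule C1_on_compose[OF V]) (use inP in blast)
  have dv: "dbar v y (axis i 1) = dbar V (p + g y) (g (axis i 1))" if "y \<in> cube (2 * R)" for y i
   unfolding v_def[abs_def]
   by (rule dbar_compose[OF _ Dg gi]) (use V that inP in \<open>auto simp: C1_on_def\<close>)
  obtain w where w: "holo_on (cube R) w" and le: "gnorm (cube R) (%z. v z - w z) \<le>
     ennreal C * energy R v"
   using model[OF R v] by blast
  define W where "W z = w (f (z - p))" for z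
  have W: "holo_on (?P R) W"
   unfolding holo_on_iff_dbar
  proof (intro ballI conjI allI)
   fix z assume "z \<in> ?P R"
   then have d: "w differentiable (at (f (z - p)))" "!!u. dbar w (f (z - p)) u = 0"
    using w by (auto simp: holo_on_iff_dbar)
   show "W differentiable (at z)"
    unfolding W_def[abs_def]
    using differentiable_chain_at[of "%z. f (z - p)" z w] d(1) Df[of z] by (auto simp: o_def differentiable_def)
   show "dbar W z u = 0" for u
    unfolding W_def[abs_def] using dbar_compose[OF d(1) Df fi] d(2) by simp
  qed
  let ?j = "ennreal \<bar>rdet g\<bar>"
  have I: "wint (?P r) (%z. (norm (F z))\<^sup>2 * ?e z) = ?j * gnorm (cube r) (%y. F (p + g y))"
   if "continuous_on (?P r) F" for r and F :: "complex ^ 'n => complex"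
  proof -
   have "continuous_on (?P r) (%z. (norm (F z))\<^sup>2 * ?e z)" by (intro continuous_intros cf that)
   from nn_integral_affine_bij[OF f g fg gf weighted_measurable[OF P this], of p] show ?thesis
    unfolding gnorm_def by (simp add: fg indicator_def)
  qed
  have "wint (?P R) (%z. (norm (V z - W z))\<^sup>2 * ?e z) = ?j * gnorm (cube R) (%z. v z - w z)"
  proof (subst I)
   have "?P R \<subseteq> ?P (2 * R)" using R by (auto simp: polydisc_def) (smt (verit))
   then show "continuous_on (?P R) (%z. V z - W z)"
    by (intro continuous_on_diff continuous_on_subset[OF C1_on_cont[OF V]] holo_on_cont[OF W])
  qed (simp add: v_def W_def fg)
  also have "... \<le> ?j * (ennreal C * energy R v)"
   by (intro mult_left_mono le) simp
  also have "... = ennreal C * (\<Sum>i\<in>UNIV. ?j * gnorm (cube (2 * R)) (%z. dbar V (p + g z) (g (axis i 1))))"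
   by (simp add: gnorm_cong[OF dv, of _ "%z. z"] sum_distrib_left mult.left_commute)
  finally show "approx (?P R) ?e V (ennreal C * (\<Sum>i\<in>UNIV. wint (?P (2 * R)) (%z. (norm (dbar V z (g (axis i 1))))\<^sup>2 * ?e z)))"
   unfolding I[OF C1_on_dbar_cont[OF V]] approx_def using W by blast
 qed
qed

subsection \<open>Taylor expansion of the weight\<close>

lemma vector_derivative_bound_01:
 fixes f :: "real => 'a::real_normed_vector"
 assumes "!!t. t \<in> {0..1} ==> (f has_vector_derivative f' t) (at t)"
  and "!!t. t \<in> {0..1} ==> norm (f' t) \<le> B" and t: "t \<in> {0..1}"
 shows "norm (f t - f 0) \<le> B * t"
proof -
 have "norm (f t - f 0) \<le> B * norm (t - 0)"
 proof (rule differentiable_bound[of "{0..1}"])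
  show "(f has_derivative (%s. s *\<^sub>R f' x)) (at x within {0..1})" if "x \<in> {0..1}" for x
   using assms(1)[OF that] by (simp add: has_vector_derivative_def has_derivative_at_withinI)
  show "onorm (%s. s *\<^sub>R f' x) \<le> B" if "x \<in> {0..1}" for x
   using assms(2)[OF that] by (intro onorm_le) (metis abs_ge_zero mult.commute mult_right_mono norm_scaleR real_norm_def)
 qed (use t in auto)
 then show ?thesis using t by simp
qed

text \<open>A Hermitian line bundle in one chart: \<open>H\<close> is the squared length of the
  frame, \<open>\<Theta>\<close> the connection form, of type (1,0), and \<open>om\<close> the
  Kaehler form. Assumption \<open>dH\<close> is compatibility with the metric, and
  \<open>curv\<close> says that the curvature is -i times \<open>om\<close>.\<close>

locale weight =
 fixes S :: "(complex ^ 'n::finite) set" and H :: "complex ^ 'n => real"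
  and \<Theta> :: "complex ^ 'n => complex ^ 'n => complex"
  and om :: "complex ^ 'n => complex ^ 'n => complex ^ 'n => real"
  and z0 :: "complex ^ 'n" and r :: real
 assumes S: "open S" "cball z0 (3 * r) \<subseteq> S" "r > 0"
  and H: "!!z. z \<in> S ==> H z > 0" "continuous_on S H"
  and dH: "!!z. z \<in> S ==> ((%z. ln (H z)) has_derivative (%v. 2 * Re (\<Theta> z v))) (at z)"
  and lin: "!!z. z \<in> S ==> linear (\<Theta> z)" "!!z v. z \<in> S ==> \<Theta> z (\<i> *s v) = \<i> * \<Theta> z v"
  and C1: "!!v. C1_on S (%z. \<Theta> z v)"
  and curv: "!!z u v. z \<in> S ==> fder (%z. \<Theta> z v) z u - fder (%z. \<Theta> z u) z v = - \<i> * of_real (om z u v)"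
  and pos: "!!z. z \<in> S ==> positive_form (om z)"
begin

text \<open>The coordinate derivative of the connection form in direction \<open>u\<close>: complex
  linear in \<open>v\<close>, but only real linear in \<open>u\<close>.\<close>

definition b where "b z u v = fder (%z. \<Theta> z v) z u"

lemma b_bilinear:
 assumes z: "z \<in> S"
 shows "linear (b z u)" "linear (%u. b z u v)" "b z u (\<i> *s v) = \<i> * b z u v"
proof -
 have D: "((%z. \<Theta> z v) has_derivative (%u. b z u v)) (at z)" for v
  unfolding b_def by (rule C1_onD[OF C1 z])
 have tr: "b z u v = D u" if "((%z. F z) has_derivative D) (at z)" "!!y. y \<in> S ==> F y = \<Theta> y v" for F D v u
 proof -
  have "((%z. \<Theta> z v) has_derivative D) (at z)"
   by (rule has_derivative_transform_within_open[OF that(1) S(1) z]) (use that(2) in auto)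
  then show ?thesis using has_derivative_unique[OF D[of v]] by (metis (no_types))
 qed
 show "linear (%u. b z u v)" using has_derivative_linear[OF D] .
 show "linear (b z u)"
 proof (rule linearI)
  show "b z u (v + v') = b z u v + b z u v'" for v v'
   by (rule tr[OF has_derivative_add[OF D D]]) (simp add: linear_add[OF lin(1)])
  show "b z u (c *\<^sub>R v) = c *\<^sub>R b z u v" for c v
   by (rule tr[OF has_derivative_scaleR_right[OF D]]) (simp add: linear_cmul[OF lin(1)])
 qed
 show "b z u (\<i> *s v) = \<i> * b z u v"
  by (rule tr[OF has_derivative_mult_right[OF D]]) (simp add: lin(2))
qed

lemma b_sum:
 assumes z: "z \<in> S"
 shows "b z u v = (\<Sum>a\<in>Basis. \<Sum>a'\<in>Basis. ((u \<bullet> a) * (v \<bullet> a')) *\<^sub>R b z a a')"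
proof -
 have "b z u v = (\<Sum>a\<in>Basis. (u \<bullet> a) *\<^sub>R b z a v)"
  by (rule has_derivative_euclidean_sum[OF b_bilinear(2)[OF z]])
 also have "... = (\<Sum>a\<in>Basis. (u \<bullet> a) *\<^sub>R (\<Sum>a'\<in>Basis. (v \<bullet> a') *\<^sub>R b z a a'))"
  using has_derivative_euclidean_sum[OF b_bilinear(1)[OF z]] by (intro sum.cong refl) metis
 finally show ?thesis by (simp add: scaleR_sum_right)
qed

lemma b_continuous:
 assumes "continuous_on T f" "continuous_on T u" "continuous_on T v" "f ` T \<subseteq> S"
 shows "continuous_on T (%p. b (f p) (u p) (v p))"
proof (rule continuous_on_eq)
 have "continuous_on S (%z. b z a a')" for a a' unfolding b_def by (rule C1_on_deriv_cont[OF C1])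
 then show "continuous_on T (%p. \<Sum>a\<in>Basis. \<Sum>a'\<in>Basis. ((u p \<bullet> a) * (v p \<bullet> a')) *\<^sub>R b (f p) a a')"
  by (intro continuous_intros assms(1-3) continuous_on_compose2[OF _ assms(1,4)])
qed (use assms(4) in \<open>simp add: b_sum[symmetric] image_subset_iff\<close>)

lemma om_b: "z \<in> S ==> om z u v = Re (\<i> * (b z u v - b z v u))"
 using curv[of z v u] by (simp add: b_def)

lemma om_bilinear: "z \<in> S ==> bilinear (om z)"
 using pos unfolding positive_form_def by blast

text \<open>The form is continuous and positive on the compact set of unit vectors over the ball;
  homogeneity does the rest. The maximum with 1 in the upper bound ensures later that radii
  multiplied by \<open>sqrt M\<close> do not shrink.\<close>

lemma om_bounds:
 obtains m M where "0 < m" "m \<le> M" "1 \<le> M"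
  "!!z u. z \<in> cball z0 (3 * r) ==> m * (norm u)\<^sup>2 \<le> om z u (\<i> *s u) / 2"
  "!!z u. z \<in> cball z0 (3 * r) ==> om z u (\<i> *s u) / 2 \<le> M * (norm u)\<^sup>2"
proof -
 let ?K = "cball z0 (3 * r) \<times> sphere (0 :: complex ^ 'n) 1"
 let ?q = "%p. om (fst p) (snd p) (\<i> *s snd p) / 2"
 have K: "compact ?K" by (intro compact_Times compact_cball compact_sphere)
 have "(z0, axis undefined 1) \<in> ?K" using S(3) by simp
 then have ne: "?K \<noteq> {}" by blast
 have c: "continuous_on ?K ?q"
 proof (rule continuous_on_eq)
  show "continuous_on ?K (%p. Re (\<i> * (b (fst p) (snd p) (\<i> *s snd p) - b (fst p) (\<i> *s snd p) (snd p))) / 2)"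
   by (intro continuous_intros b_continuous bounded_linear.continuous_on[OF bounded_linear_smult_vec])
     (use S(2) in auto)
 qed (use S(2) in \<open>auto simp: om_b subset_iff\<close>)
 obtain p1 where p1: "p1 \<in> ?K" "!!p. p \<in> ?K ==> ?q p1 \<le> ?q p"
  using continuous_attains_inf[OF K ne c] by blast
 obtain p2 where p2: "p2 \<in> ?K" "!!p. p \<in> ?K ==> ?q p \<le> ?q p2"
  using continuous_attains_sup[OF K ne c] by blast
 have "fst p1 \<in> S" "snd p1 \<noteq> 0" using p1(1) S(2) by auto
 then have m: "?q p1 > 0" using pos unfolding positive_form_def by (meson half_gt_zero)
 have bounds: "?q p1 * (norm u)\<^sup>2 \<le> om z u (\<i> *s u) / 2" "om z u (\<i> *s u) / 2 \<le> max 1 (?q p2) * (norm u)\<^sup>2"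
  if z: "z \<in> cball z0 (3 * r)" for z u
 proof -
  have bil: "bilinear (om z)" using om_bilinear z S(2) by blast
  have *: "om z u (\<i> *s u) / 2 = ?q (z, sgn u) * (norm u)\<^sup>2"
  proof -
   have "u = norm u *\<^sub>R sgn u" "\<i> *s u = norm u *\<^sub>R (\<i> *s sgn u)"
    by (cases "u = 0"; auto simp: sgn_div_norm vec_eq_iff)+
   then have "om z u (\<i> *s u) = om z (norm u *\<^sub>R sgn u) (norm u *\<^sub>R (\<i> *s sgn u))" by simp
   then show ?thesis by (simp add: bilinear_lmul[OF bil] bilinear_rmul[OF bil] power2_eq_square)
  qed
  have "u \<noteq> 0 ==> (z, sgn u) \<in> ?K" using z by (simp add: norm_sgn)
  then have "u \<noteq> 0 ==> ?q p1 \<le> ?q (z, sgn u)" "u \<noteq> 0 ==> ?q (z, sgn u) \<le> max 1 (?q p2)"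
   using p1(2) p2(2) by (blast, smt (verit, best))
  then show "?q p1 * (norm u)\<^sup>2 \<le> om z u (\<i> *s u) / 2" "om z u (\<i> *s u) / 2 \<le> max 1 (?q p2) * (norm u)\<^sup>2"
   unfolding * by (cases "u = 0"; simp add: mult_right_mono)+
 qed
 show ?thesis by (rule that[OF m _ _ bounds]) (use p1(2)[OF p2(1)] in auto)
qed

text \<open>The part of \<open>b\<close> that is complex linear in both arguments contributes the real part of a
 holomorphic polynomial, which is absorbed into the frame; the rest is the Levi form.\<close>

definition G where
 "G p y = of_real (ln (H p) / 2) + \<Theta> p y + (b p y y - \<i> * b p (\<i> *s y) y) / 4"

text \<open>The curvature equation for \<open>y\<close> and \<open>\<i> *s y\<close> determines the
  part of \<open>b\<close> that is conjugate linear in the first argument. The first summand, coming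
  from the other part, is a complex quadratic polynomial in \<open>y\<close>.\<close>

lemma b_diagonal:
 assumes "p \<in> S"
 shows "b p y y = (b p y y - \<i> * b p (\<i> *s y) y) / 2 - of_real (om p y (\<i> *s y) / 2)"
proof -
 have "b p (\<i> *s y) y - b p y (\<i> *s y) = - \<i> * of_real (om p (\<i> *s y) y)"
  using curv[OF assms, of y "\<i> *s y"] by (simp add: b_def)
 moreover have "om p (\<i> *s y) y = - om p y (\<i> *s y)"
  using pos[OF assms] unfolding positive_form_def by blast
 ultimately have "b p (\<i> *s y) y = \<i> * b p y y + \<i> * of_real (om p y (\<i> *s y))"
  unfolding b_bilinear(3)[OF assms] by (simp add: algebra_simps)
 then show ?thesis by (simp add: field_simps)
qed

text \<open>The combination \<open>b p u v - \<i> * b p (\<i> *s u) v\<close> is complex linear in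
  \<open>u\<close> as well as in \<open>v\<close>.\<close>

lemma G_holo:
 assumes p: "p \<in> S"
 shows "holo_on UNIV (%z. G p (z - p))"
 unfolding holo_on_iff_dbar
proof (intro ballI)
 fix z :: "complex ^ 'n"
 let ?y = "z - p"
 have bb: "bounded_bilinear (b p)"
 proof -
  have "bilinear (b p)" unfolding bilinear_def using b_bilinear[OF p] by auto
  then show ?thesis by (simp add: bilinear_conv_bounded_bilinear)
 qed
 have dy: "((%z. z - p) has_derivative (%h. h)) (at z)" by (auto intro!: derivative_eq_intros)
 have dt: "((%z. \<Theta> p (z - p)) has_derivative (%h. \<Theta> p h)) (at z)"
  using bounded_linear.has_derivative[OF _ dy] lin(1)[OF p] by (simp add: linear_conv_bounded_linear)
 have dyi: "((%z. \<i> *s (z - p)) has_derivative (%h. \<i> *s h)) (at z)"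
  using bounded_linear.has_derivative[OF bounded_linear_smult_vec dy] .
 have db: "((%z. b p (z - p) (z - p)) has_derivative (%h. b p ?y h + b p h ?y)) (at z)"
  using bounded_bilinear.FDERIV[OF bb dy dy] .
 have dbi: "((%z. b p (\<i> *s (z - p)) (z - p)) has_derivative (%h. b p (\<i> *s ?y) h + b p (\<i> *s h) ?y)) (at z)"
  using bounded_bilinear.FDERIV[OF bb dyi dy] .
 let ?a = "%z. G p (z - p)"
 have D: "(?a has_derivative (%h. \<Theta> p h + ((b p ?y h + b p h ?y) - \<i> * (b p (\<i> *s ?y) h + b p (\<i> *s h) ?y)) / 4)) (at z)"
  unfolding G_def
  by (rule has_derivative_eq_rhs[OF has_derivative_add[OF has_derivative_add[OF has_derivative_const dt]
     bounded_linear.has_derivative[OF bounded_linear_divide has_derivative_diff[OF db has_derivative_mult_right[OF dbi]]]]])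
    simp
 have "linear (%u. b p u ?y)" using b_bilinear(2)[OF p] .
 then have neg: "b p (- u) ?y = - b p u ?y" for u using linear_neg by blast
 have "dbar ?a z v = 0" for v
  unfolding dbar_eqI[OF D] lin(2)[OF p] b_bilinear(3)[OF p] ii_smult neg
  by (simp add: field_simps)
 then show "?a differentiable (at z) \<and> (\<forall>v. dbar ?a z v = 0)"
  using D by (auto simp: differentiable_def)
qed

text \<open>\<open>\<Theta>\<close> is only C1, so the remainder is little-o of the squared norm,
  uniformly in \<open>p\<close> by uniform continuity of \<open>b\<close> on a compact set. The
  bound is integrated twice along the segment from \<open>p\<close> to \<open>p + y\<close>.\<close>

lemma taylor:
 assumes "\<epsilon> > 0"
 obtains \<delta> where "\<delta> > 0" "\<delta> \<le> r"
  "!!p y. p \<in> cball z0 (2 * r) ==> norm y \<le> \<delta> ==>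
   \<bar>ln (H (p + y)) - (2 * Re (G p y) - om p y (\<i> *s y) / 2)\<bar> \<le> \<epsilon> * (norm y)\<^sup>2"
proof -
 let ?K = "cball z0 (3 * r) \<times> sphere (0 :: complex ^ 'n) 1"
 have "uniformly_continuous_on ?K (%p. b (fst p) (snd p) (snd p))"
  by (intro compact_uniformly_continuous compact_Times compact_cball compact_sphere b_continuous continuous_intros)
    (use S(2) in auto)
 then obtain \<delta>0 where \<delta>0: "\<delta>0 > 0" "!!x x'. x \<in> ?K ==> x' \<in> ?K ==> dist x' x < \<delta>0 ==>
   dist (b (fst x') (snd x') (snd x')) (b (fst x) (snd x) (snd x)) < \<epsilon> / 2"
  using assms unfolding uniformly_continuous_on_def by (meson half_gt_zero)
 define \<delta> where "\<delta> = min (\<delta>0 / 2) r"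
 have \<delta>: "\<delta> > 0" "\<delta> \<le> r" "\<delta> < \<delta>0" using \<delta>0(1) S(3) by (auto simp: \<delta>_def)
 show ?thesis
 proof (rule that[OF \<delta>(1,2)])
  fix p y :: "complex ^ 'n" assume p: "p \<in> cball z0 (2 * r)" and y: "norm y \<le> \<delta>"
  have seg: "p + t *\<^sub>R y \<in> cball z0 (3 * r)" "dist (p + t *\<^sub>R y) p < \<delta>0" if "t \<in> {0..1}" for t
  proof -
   have ty: "norm (t *\<^sub>R y) \<le> \<delta>" using that y mult_left_le_one_le[of "norm y" t] by simp
   have "dist z0 (p + t *\<^sub>R y) \<le> dist z0 p + norm (t *\<^sub>R y)"
    by (metis dist_norm dist_triangle add_diff_cancel_left' norm_minus_commute)
   then show "p + t *\<^sub>R y \<in> cball z0 (3 * r)" using p ty \<delta>(2) by simp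
   show "dist (p + t *\<^sub>R y) p < \<delta>0" using ty \<delta>(3) by (simp add: dist_norm)
  qed
  have pK: "p \<in> cball z0 (3 * r)" using p S(3) by simp
  have pS: "p \<in> S" using pK S(2) by blast
  have segS: "p + t *\<^sub>R y \<in> S" if "t \<in> {0..1}" for t using seg(1)[OF that] S(2) by blast
  have scale: "b z y y = (norm y)\<^sup>2 *\<^sub>R b z (sgn y) (sgn y)" if "z \<in> S" for z
  proof -
   have "b z (norm y *\<^sub>R sgn y) (norm y *\<^sub>R sgn y) = (norm y)\<^sup>2 *\<^sub>R b z (sgn y) (sgn y)"
    unfolding linear_cmul[OF b_bilinear(1)[OF that]] linear_cmul[OF b_bilinear(2)[OF that]]
    by (simp add: power2_eq_square)
   then show ?thesis by (cases "y = 0") (simp_all add: sgn_div_norm)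
  qed
  have bdiff: "norm (b (p + t *\<^sub>R y) y y - b p y y) \<le> (\<epsilon> / 2) * (norm y)\<^sup>2" if t: "t \<in> {0..1}" for t
  proof (cases "y = 0")
   case False
   then have "norm (b (p + t *\<^sub>R y) (sgn y) (sgn y) - b p (sgn y) (sgn y)) \<le> \<epsilon> / 2"
    using \<delta>0(2)[of "(p, sgn y)" "(p + t *\<^sub>R y, sgn y)"] pK seg[OF t] by (simp add: norm_sgn dist_Pair_Pair dist_norm)
   from mult_right_mono[OF this, of "(norm y)\<^sup>2"] show ?thesis
    unfolding scale[OF pS] scale[OF segS[OF t]] by (simp add: mult.commute flip: scaleR_diff_right)
  qed (use linear_0[OF b_bilinear(1)] pS segS[OF t] in simp)
  \<comment> \<open>The connection form along the segment minus its linear part; its derivative is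
    the oscillation of \<open>b\<close>.\<close>
  define \<psi> where "\<psi> t = \<Theta> (p + t *\<^sub>R y) y - of_real t * b p y y" for t
  have \<psi>: "norm (\<psi> t - \<psi> 0) \<le> (\<epsilon> / 2) * (norm y)\<^sup>2 * t" if "t \<in> {0..1}" for t
  proof (rule vector_derivative_bound_01[OF _ bdiff that])
   show "(\<psi> has_vector_derivative (b (p + t *\<^sub>R y) y y - b p y y)) (at t)" if t: "t \<in> {0..1}" for t
   proof -
    have 1: "((%t. \<Theta> (p + t *\<^sub>R y) y) has_vector_derivative b (p + t *\<^sub>R y) y y) (at t)"
     unfolding b_def by (rule has_vector_derivative_on_segment[OF C1_onD[OF C1 segS[OF t]]])
    have 2: "((%t. of_real t * b p y y) has_vector_derivative b p y y) (at t)"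
     by (auto intro!: derivative_eq_intros simp: has_vector_derivative_def scaleR_conv_of_real)
    show ?thesis unfolding \<psi>_def[abs_def] by (rule has_vector_derivative_diff[OF 1 2])
   qed
  qed
  \<comment> \<open>The logarithm of the weight minus its terms of order one and two; its derivative
    is twice the real part of the increment of \<open>\<psi>\<close>.\<close>
  define \<phi> where "\<phi> t = ln (H (p + t *\<^sub>R y)) - 2 * Re (of_real t * \<Theta> p y + of_real (t\<^sup>2 / 2) * b p y y)" for t
  have "norm (\<phi> 1 - \<phi> 0) \<le> \<epsilon> * (norm y)\<^sup>2 * 1"
  proof (rule vector_derivative_bound_01)
   fix t :: real assume t: "t \<in> {0..1}"
   have 1: "((%t. ln (H (p + t *\<^sub>R y))) has_vector_derivative 2 * Re (\<Theta> (p + t *\<^sub>R y) y)) (at t)"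
    using has_vector_derivative_on_segment[OF dH[OF segS[OF t]]] .
   have 2: "((%t. 2 * Re (of_real t * \<Theta> p y + of_real (t\<^sup>2 / 2) * b p y y)) has_vector_derivative
     2 * Re (\<Theta> p y + of_real t * b p y y)) (at t)"
    unfolding has_real_derivative_iff_has_vector_derivative[symmetric]
    by (auto intro!: derivative_eq_intros simp: field_simps)
   show "(\<phi> has_vector_derivative 2 * Re (\<psi> t - \<psi> 0)) (at t)"
    unfolding \<phi>_def[abs_def]
    by (rule has_vector_derivative_eq_rhs[OF has_vector_derivative_diff[OF 1 2]]) (simp add: \<psi>_def)
   have "\<bar>Re (\<psi> t - \<psi> 0)\<bar> \<le> (\<epsilon> / 2) * (norm y)\<^sup>2 * t" using \<psi>[OF t] abs_Re_le_cmod order_trans by blast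
   also have "... \<le> (\<epsilon> / 2) * (norm y)\<^sup>2 * 1" using t assms by (intro mult_left_mono) auto
   finally show "norm (2 * Re (\<psi> t - \<psi> 0)) \<le> \<epsilon> * (norm y)\<^sup>2"
    unfolding real_norm_def abs_mult by simp
  qed simp
  moreover have "\<phi> 1 - \<phi> 0 = ln (H (p + y)) - (2 * Re (G p y) - om p y (\<i> *s y) / 2)"
  proof -
   have "Re (b p y y) = Re ((b p y y - \<i> * b p (\<i> *s y) y) / 2) - om p y (\<i> *s y) / 2"
    by (subst b_diagonal[OF pS]) simp
   then show ?thesis by (simp add: \<phi>_def G_def field_simps)
  qed
  ultimately show "\<bar>ln (H (p + y)) - (2 * Re (G p y) - om p y (\<i> *s y) / 2)\<bar> \<le> \<epsilon> * (norm y)\<^sup>2" by simp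
 qed
qed

theorem chart_estimate:
 obtains C C' where "C \<ge> 0" "C' \<ge> 2" "!!R. R \<ge> 1 ==> \<exists>k0. \<forall>k\<ge>k0. local_approx S H z0 r C C' R k"
proof -
 obtain m M where mM: "0 < m" "m \<le> M" "1 \<le> M"
  and lower: "!!z u. z \<in> cball z0 (3 * r) ==> m * (norm u)\<^sup>2 \<le> om z u (\<i> *s u) / 2"
  and upper: "!!z u. z \<in> cball z0 (3 * r) ==> om z u (\<i> *s u) / 2 \<le> M * (norm u)\<^sup>2"
  using om_bounds by blast
 obtain C0 where C0: "C0 \<ge> 0" and model: "!!R p (f :: complex ^ 'n => complex ^ 'n) g V. R \<ge> 1 ==> bounded_linear f ==> bounded_linear g ==>
   (!!x. f (g x) = x) ==> (!!x. g (f x) = x) ==> (!!v. f (\<i> *s v) = \<i> *s f v) ==> (!!v. g (\<i> *s v) = \<i> *s g v) ==>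
   C1_on {z. f (z - p) \<in> cube (2 * R)} V ==>
   approx {z. f (z - p) \<in> cube R} (%z. exp (- (norm (f (z - p)))\<^sup>2)) V
    (ennreal C0 * (\<Sum>i\<in>UNIV. wint {z. f (z - p) \<in> cube (2 * R)} (%z. (norm (dbar V z (g (axis i 1))))\<^sup>2 * exp (- (norm (f (z - p)))\<^sup>2))))"
  by (rule affine_model_estimate) blast
 define N where "N = real CARD('n)"
 have N: "N \<ge> 1" by (simp add: N_def Suc_leI)
 \<comment> \<open>In coordinates adapted to the form at the centre, the estimate is applied to
   cubes of radius \<open>2 * R * sqrt M\<close> and twice that. The larger one must fit back into a
   ball: \<open>N\<close> passes from the maximum norm to the Euclidean norm, and
   \<open>sqrt m\<close> from adapted to given coordinates.\<close>
 define C' where "C' = 4 * N * sqrt M / sqrt m"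
 have sm: "sqrt m > 0" "sqrt M / sqrt m \<ge> 1" using mM by auto
 have "4 * 1 \<le> (4 * N) * (sqrt M / sqrt m)" using N sm by (intro mult_mono) auto
 then have C'2: "C' \<ge> 2" by (simp add: C'_def)
 \<comment> \<open>The two factors \<open>exp 1\<close> come from comparing the weight with a
   Gaussian on either side of the estimate; \<open>N\<close> counts the derivatives, and
   \<open>1 / m\<close> stems from rescaling their directions.\<close>
 define C where "C = exp 1 * C0 * (N * (exp 1 / m))"
 have "C \<ge> 0" using C0 N mM by (simp add: C_def)
 then show ?thesis
 proof (rule that[OF _ C'2])
  fix R :: real assume R: "R \<ge> 1"
  \<comment> \<open>With this choice the Taylor error on a ball of radius
    \<open>C' * R / sqrt k\<close>, multiplied by \<open>k\<close>, is at most 1.\<close>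
  define \<epsilon> where "\<epsilon> = 1 / (C' * R)\<^sup>2"
  have CR: "C' * R > 0" using C'2 R by simp
  then have "\<epsilon> > 0" unfolding \<epsilon>_def by (intro divide_pos_pos zero_less_power) auto
  then obtain \<delta> where \<delta>: "\<delta> > 0" "\<delta> \<le> r"
   and tay: "!!p y. p \<in> cball z0 (2 * r) ==> norm y \<le> \<delta> ==>
    \<bar>ln (H (p + y)) - (2 * Re (G p y) - om p y (\<i> *s y) / 2)\<bar> \<le> \<epsilon> * (norm y)\<^sup>2"
   using taylor by blast
  define k0 where "k0 = nat \<lceil>(C' * R / \<delta>)\<^sup>2\<rceil> + 1"
  have "local_approx S H z0 r C C' R k" if k: "k \<ge> k0" for k
  proof -
   have k1: "k > 0" using k by (simp add: k0_def)
   define s where "s = sqrt k"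
   have s: "s > 0" "s\<^sup>2 = real k" using k1 by (auto simp: s_def)
   define q where "q = C' * R / s"
   have q\<delta>: "q \<le> \<delta>"
   proof -
    have "(C' * R / \<delta>)\<^sup>2 \<le> real k" using k unfolding k0_def by linarith
    then have "C' * R / \<delta> \<le> s" unfolding s_def by (rule real_le_rsqrt)
    then show ?thesis using \<delta>(1) s by (simp add: q_def field_simps)
   qed
   have eq2: "\<epsilon> * q\<^sup>2 = 1 / real k"
    using C'2 R s by (simp add: \<epsilon>_def q_def power_divide)
   have "approx (ball p (2 * R / s)) (%z. H z ^ k) V (ennreal (C / k) * wint (ball p q) (%z. dnorm2 V z * H z ^ k))"
    if p: "p \<in> cball z0 (2 * r)" and V: "C1_on S V" for p V
   proof -
    have pK: "p \<in> cball z0 (3 * r)" using p S(3) by simp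
    have pS: "p \<in> S" using pK S(2) by blast
    have ballS: "ball p q \<subseteq> S"
    proof
     fix z assume "z \<in> ball p q"
     then have "dist z0 z \<le> 3 * r" using p q\<delta> \<delta>(2) dist_triangle[of z0 z p] by simp
     then show "z \<in> S" using S(2) by auto
    qed
    obtain f0 g0 :: "complex ^ 'n => complex ^ 'n" where fg: "bounded_linear f0" "bounded_linear g0" "!!x. f0 (g0 x) = x" "!!x. g0 (f0 x) = x"
     "!!v. f0 (\<i> *s v) = \<i> *s f0 v" "!!v. g0 (\<i> *s v) = \<i> *s g0 v" "!!u v. om p u v = std_form (f0 u) (f0 v)"
     by (rule positive_form_diagonal[OF pos[OF pS]]) blast
    \<comment> \<open>Scaling by \<open>sqrt (k / 2)\<close> makes the squared norm of the adapted
      coordinate equal to k times \<open>om p u (\<i> *s u) / 2\<close>, the Gaussian exponent of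
      the k-th power.\<close>
    define a where "a = s / sqrt 2"
    have a: "a > 0" "a\<^sup>2 = real k / 2" using s by (simp_all add: a_def power_divide)
    define f where "f v = a *\<^sub>R f0 v" for v
    define g where "g v = (1 / a) *\<^sub>R g0 v" for v
    have sc: "\<i> *s (a *\<^sub>R v) = a *\<^sub>R (\<i> *s v)" for a and v :: "complex ^ 'n" by (simp add: vec_eq_iff)
    have fgl: "bounded_linear f" "bounded_linear g"
     unfolding f_def[abs_def] g_def[abs_def]
     by (intro bounded_linear_compose[OF bounded_linear_scaleR_right] fg)+
    have inv: "f (g x) = x" "g (f x) = x" for x
     using a by (simp_all add: f_def g_def fg linear_cmul[OF bounded_linear.linear[OF fg(1)]] linear_cmul[OF bounded_linear.linear[OF fg(2)]])
    have fi: "f (\<i> *s v) = \<i> *s f v" "g (\<i> *s v) = \<i> *s g v" for v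
     by (simp_all add: f_def g_def fg sc)
    have "(norm (f0 u))\<^sup>2 = om p u (\<i> *s u)" for u by (simp only: fg(7) fg(5) std_form_i)
    then have nf: "(norm (f u))\<^sup>2 = real k * (om p u (\<i> *s u) / 2)" for u
     by (simp add: f_def power_mult_distrib a)
    have f_up: "norm (f u) \<le> s * sqrt M * norm u" for u
     by (rule power2_le_imp_le)
       (use upper[OF pK, of u] s mM in \<open>simp_all add: nf power_mult_distrib mult.assoc mult_left_mono\<close>)
    have f_low: "s * sqrt m * norm u \<le> norm (f u)" for u
     by (rule power2_le_imp_le)
       (use lower[OF pK, of u] s mM in \<open>simp_all add: nf power_mult_distrib mult.assoc mult_left_mono\<close>)
    define R1 where "R1 = 2 * R * sqrt M"
    have "1 * 1 \<le> (2 * R) * sqrt M" using R mM by (intro mult_mono) auto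
    then have R1: "R1 \<ge> 1" by (simp add: R1_def)
    let ?P = "%t. {z. f (z - p) \<in> cube t}" and ?e = "%z. exp (- (norm (f (z - p)))\<^sup>2)"
    have sub1: "ball p (2 * R / s) \<subseteq> ?P R1"
    proof
     fix z assume "z \<in> ball p (2 * R / s)"
     then have "norm (z - p) < 2 * R / s" by (simp add: dist_norm norm_minus_commute)
     then have "s * sqrt M * norm (z - p) < s * sqrt M * (2 * R / s)"
      using s mM by (intro mult_strict_left_mono) auto
     also have "... = R1" using s by (simp add: R1_def)
     finally have "norm (f (z - p)) < R1" using f_up[of "z - p"] by simp
     then show "z \<in> ?P R1" using Finite_Cartesian_Product.norm_nth_le[of "f (z - p)"] by (auto simp: polydisc_def intro: le_less_trans)
    qed
    have sub2: "?P (2 * R1) \<subseteq> ball p q"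
    proof
     fix z assume "z \<in> ?P (2 * R1)"
     then have "norm (f (z - p) $ i) < 2 * R1" for i by (simp add: polydisc_def)
     then have "(\<Sum>i\<in>UNIV. norm (f (z - p) $ i)) < (\<Sum>i\<in>(UNIV :: 'n set). 2 * R1)"
      by (intro sum_strict_mono) auto
     moreover have "norm (f (z - p)) \<le> (\<Sum>i\<in>UNIV. norm (f (z - p) $ i))"
      unfolding norm_vec_def by (rule L2_set_le_sum) auto
     ultimately have "s * sqrt m * norm (z - p) < N * (2 * R1)"
      using f_low[of "z - p"] by (simp add: N_def)
     then have "norm (z - p) < N * (2 * R1) / (s * sqrt m)" using s sm by (simp add: field_simps)
     also have "... = q" by (simp add: q_def C'_def R1_def mult_ac)
     finally show "z \<in> ball p q" by (simp add: dist_norm norm_minus_commute)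
    qed
    have sub12: "?P R1 \<subseteq> ?P (2 * R1)" using R1 by (auto simp: polydisc_def) (smt (verit))
    \<comment> \<open>The change of frame: a nowhere vanishing holomorphic function whose squared
      modulus absorbs the pluriharmonic part of the weight.\<close>
    define E where "E z = exp (of_nat k * G p (z - p))" for z
    have E0: "E z \<noteq> 0" for z by (simp add: E_def)
    have Eh: "holo_on UNIV E"
     unfolding E_def[abs_def]
     by (rule holo_on_compose_field[OF G_holo[OF pS], of "%x. exp (of_nat k * x)" "%z. exp (of_nat k * G p (z - p)) * of_nat k"])
       (auto intro!: derivative_eq_intros)
    then have Ei: "holo_on UNIV (%z. inverse (E z))"
     by (rule holo_on_compose_field[where f'="%z. - (inverse (E z) ^ 2)"])
       (auto intro!: derivative_eq_intros simp: E0 power2_eq_square)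
    have wt: "H z ^ k \<le> exp 1 * ((norm (E z))\<^sup>2 * ?e z)" "(norm (E z))\<^sup>2 * ?e z \<le> exp 1 * H z ^ k" if z: "z \<in> ball p q" for z
    proof -
     have zS: "z \<in> S" using z ballS by blast
     have ny: "norm (z - p) \<le> q" using z by (simp add: dist_norm norm_minus_commute)
     define X where "X = 2 * Re (G p (z - p)) - om p (z - p) (\<i> *s (z - p)) / 2"
     have "\<bar>ln (H z) - X\<bar> \<le> \<epsilon> * (norm (z - p))\<^sup>2"
      using tay[OF p, of "z - p"] ny q\<delta> by (simp add: X_def)
     also have "... \<le> \<epsilon> * q\<^sup>2" using ny \<open>\<epsilon> > 0\<close> by (intro mult_left_mono power_mono) auto
     finally have "real k * \<bar>ln (H z) - X\<bar> \<le> 1" using k1 by (simp add: eq2 field_simps)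
     then have "\<bar>real k * ln (H z) - real k * X\<bar> \<le> 1" by (simp add: abs_mult flip: right_diff_distrib)
     then have a: "real k * ln (H z) \<le> 1 + real k * X" "real k * X \<le> 1 + real k * ln (H z)" by auto
     have h: "H z ^ k = exp (real k * ln (H z))" using H(1)[OF zS] by (simp add: exp_of_nat_mult)
     have "(norm (E z))\<^sup>2 = exp (2 * (real k * Re (G p (z - p))))"
      by (simp add: E_def norm_exp_eq_Re exp_double)
     then have e: "(norm (E z))\<^sup>2 * ?e z = exp (real k * X)"
      by (simp add: nf X_def algebra_simps flip: exp_add)
     show "H z ^ k \<le> exp 1 * ((norm (E z))\<^sup>2 * ?e z)" "(norm (E z))\<^sup>2 * ?e z \<le> exp 1 * H z ^ k"
      unfolding h e using a by (simp_all flip: exp_add)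
    qed
    define Vt where "Vt z = V z * E z" for z
    have VtC: "C1_on (?P (2 * R1)) Vt"
     unfolding Vt_def[abs_def]
     by (intro C1_on_mult C1_on_subset[OF V] C1_on_subset[OF holo_on_imp_C1_on[OF open_UNIV Eh]])
       (use sub2 ballS in auto)
    obtain W where W: "holo_on (?P R1) W" and Wle: "wint (?P R1) (%z. (norm (Vt z - W z))\<^sup>2 * ?e z)
     \<le> ennreal C0 * (\<Sum>i\<in>UNIV. wint (?P (2 * R1)) (%z. (norm (dbar Vt z (g (axis i 1))))\<^sup>2 * ?e z))"
     using model[OF R1 fgl inv fi VtC] unfolding approx_def by blast
    define w where "w z = W z * inverse (E z)" for z
    have wh: "holo_on (ball p (2 * R / s)) w"
     unfolding w_def[abs_def]
     by (intro holo_on_mult holo_on_subset[OF W sub1] holo_on_subset[OF Ei]) auto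
    have cf: "continuous_on T (%z. f (z - p))" for T
     by (intro bounded_linear.continuous_on[OF fgl(1)] continuous_intros)
    let ?I1 = "wint (ball p (2 * R / s)) (%z. (norm (V z - w z))\<^sup>2 * H z ^ k)"
    let ?I2 = "wint (ball p q) (%z. dnorm2 V z * H z ^ k)"
    have part1: "?I1 \<le> ennreal (exp 1) * wint (?P R1) (%z. (norm (Vt z - W z))\<^sup>2 * ?e z)"
    proof (rule wint_mono[OF _ _ _ sub1])
     show "?P R1 \<in> sets borel" using borel_open[OF open_vimage[OF open_polydisc cf]] by (simp add: vimage_def)
     show "continuous_on (?P R1) (%z. (norm (Vt z - W z))\<^sup>2 * ?e z)"
      by (intro continuous_intros cf holo_on_cont[OF W] continuous_on_subset[OF C1_on_cont[OF VtC] sub12])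
     fix z assume "z \<in> ball p (2 * R / s)"
     then have zq: "z \<in> ball p q" using sub1 sub12 sub2 by blast
     have "V z - w z = (Vt z - W z) / E z" using E0[of z] by (simp add: w_def Vt_def field_simps)
     then have "(norm (V z - w z))\<^sup>2 * H z ^ k = (norm (Vt z - W z))\<^sup>2 / (norm (E z))\<^sup>2 * H z ^ k"
      by (simp add: norm_divide power_divide)
     also have "... \<le> (norm (Vt z - W z))\<^sup>2 / (norm (E z))\<^sup>2 * (exp 1 * ((norm (E z))\<^sup>2 * ?e z))"
      by (intro mult_left_mono wt(1) zq) auto
     finally show "(norm (V z - w z))\<^sup>2 * H z ^ k \<le> exp 1 * ((norm (Vt z - W z))\<^sup>2 * ?e z)"
      using E0[of z] by (simp add: mult.left_commute)
    qed simp
    have part2: "wint (?P (2 * R1)) (%z. (norm (dbar Vt z (g (axis i 1))))\<^sup>2 * ?e z) \<le> ennreal (exp 1 / (m * k)) * ?I2" for i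
    proof (rule wint_mono[OF borel_open[OF open_ball] _ _ sub2])
     show "continuous_on (ball p q) (%z. dnorm2 V z * H z ^ k)"
      unfolding dnorm2_def
      by (intro continuous_intros continuous_on_subset[OF H(2) ballS] C1_on_dbar_cont C1_on_subset[OF V ballS])
     show "exp 1 / (m * k) \<ge> 0" using mM by simp
     have "s * sqrt m * norm (g (axis i 1)) \<le> 1" using f_low[of "g (axis i 1)"] by (simp add: inv)
     then have "(s * sqrt m * norm (g (axis i 1)))\<^sup>2 \<le> 1\<^sup>2" using s sm by (intro power_mono) auto
     then have ng: "(norm (g (axis i 1)))\<^sup>2 \<le> 1 / (m * k)"
      using s(2) mM k1 by (simp add: power_mult_distrib field_simps)
     fix z assume "z \<in> ?P (2 * R1)"
     then have zq: "z \<in> ball p q" using sub2 by blast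
     then have zS: "z \<in> S" using ballS by blast
     have dV: "V differentiable (at z)" using V zS by (simp add: C1_on_def)
     have dE: "E differentiable (at z)" "dbar E z u = 0" for u using Eh by (auto simp: holo_on_iff_dbar)
     have "(norm (dbar Vt z (g (axis i 1))))\<^sup>2 * ?e z = (norm (dbar V z (g (axis i 1))))\<^sup>2 * ((norm (E z))\<^sup>2 * ?e z)"
      unfolding Vt_def[abs_def] dbar_mult[OF dV dE(1)] dE(2) by (simp add: norm_mult power_mult_distrib)
     also have "... \<le> ((norm (g (axis i 1)))\<^sup>2 * dnorm2 V z) * (exp 1 * H z ^ k)"
      by (intro mult_mono norm_dbar_le dV wt(2) zq) (auto simp: dnorm2_nonneg)
     also have "... \<le> (1 / (m * k) * dnorm2 V z) * (exp 1 * H z ^ k)"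
      using H(1)[OF zS] by (intro mult_right_mono ng dnorm2_nonneg) auto
     finally show "(norm (dbar Vt z (g (axis i 1))))\<^sup>2 * ?e z \<le> exp 1 / (m * k) * (dnorm2 V z * H z ^ k)"
      by (simp add: mult.left_commute)
    qed
    have "?I1 \<le> ennreal (exp 1) * (ennreal C0 * (\<Sum>i\<in>(UNIV :: 'n set). ennreal (exp 1 / (m * k)) * ?I2))"
     by (rule order_trans[OF part1 mult_left_mono[OF order_trans[OF Wle mult_left_mono[OF sum_mono[OF part2]]]]]) auto
    also have "... = (ennreal (exp 1) * ennreal C0 * ennreal N * ennreal (exp 1 / (m * k))) * ?I2"
     by (simp add: N_def ennreal_of_nat_eq_real_of_nat mult.assoc)
    also have "ennreal (exp 1) * ennreal C0 * ennreal N * ennreal (exp 1 / (m * k)) = ennreal (C / k)"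
     using C0 N mM by (simp add: C_def flip: ennreal_mult)
    finally show ?thesis unfolding approx_def using wh by blast
   qed
   then show ?thesis unfolding local_approx_def using k1 q\<delta> \<delta>(2) unfolding q_def s_def by auto
  qed
  then show "\<exists>k0. \<forall>k\<ge>k0. local_approx S H z0 r C C' R k" by blast
 qed
qed

end

section \<open>Square-integrable limits of holomorphic functions\<close>

lemma holo_mean_value:
 assumes f: "holo_on (ball z \<rho>) f" and u: "norm u < \<rho>"
 shows "((%t. f (z + exp (of_real (2 * pi * t) * \<i>) *s u)) has_integral f z) {0..1}"
proof -
 let ?g = "%c. f (z + c *s u)"
 define T where "T = {c. norm (c *s u) < \<rho>}"
 have cT: "cball 0 1 \<subseteq> T"
 proof
  fix c :: complex assume "c \<in> cball 0 1"
  then have "norm c * norm u \<le> 1 * norm u" by (intro mult_right_mono) auto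
  then show "c \<in> T" using u by (simp add: T_def norm_smult_vec)
 qed
 have "?g field_differentiable (at c)" if "c \<in> T" for c
  unfolding field_differentiable_def
  using holo_on_line[OF f, of T z u c] that by (auto simp: T_def dist_norm)
 then have "?g holomorphic_on cball 0 1"
  using cT unfolding holomorphic_on_def by (meson field_differentiable_at_within subsetD)
 from Cauchy_integral_circlepath_simple[OF this, of 0]
 have "((%w. ?g w / w) has_contour_integral 2 * of_real pi * \<i> * f z) (circlepath 0 1)" by simp
 then have "((%t. ?g (exp (of_real (2 * pi * t) * \<i>)) / exp (of_real (2 * pi * t) * \<i>) *
   (2 * of_real pi * \<i> * exp (of_real (2 * pi * t) * \<i>))) has_integral 2 * of_real pi * \<i> * f z) {0..1}"
  unfolding has_contour_integral_def
  by (rule has_integral_eq[rotated]) (subst vector_derivative_circlepath01, simp_all add: circlepath mult_ac)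
 from has_integral_mult_right[OF this, of "1 / (2 * of_real pi * \<i>)"]
 show ?thesis by (simp add: field_simps)
qed

text \<open>Averaging over rotations in place of polar coordinates: the value at the centre is
  dominated by the mean over the circle through each point of the ball, and after exchanging
  integrals only the invariance of Lebesgue measure under rotations is used.\<close>

lemma holo_L2_bound:
 fixes f :: "complex ^ 'n::finite => complex"
 assumes f: "holo_on (ball z \<rho>) f"
 shows "emeasure lborel (ball (0 :: complex ^ 'n) \<rho>) * ennreal ((norm (f z))\<^sup>2) \<le>
  wint (ball z \<rho>) (%y. (norm (f y))\<^sup>2)"
proof (cases "\<rho> > 0")
 case \<rho>: True
 define e where "e t = exp (of_real (2 * pi * t) * \<i>)" for t
 have ne: "norm (e t) = 1" for t by (simp add: e_def norm_exp_eq_Re)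
 let ?B = "ball (0 :: complex ^ 'n) \<rho>"
 let ?F = "%y. ennreal ((norm (f y))\<^sup>2) * indicator (ball z \<rho>) y"
 have fc: "continuous_on (ball z \<rho>) f" by (rule holo_on_cont[OF f])
 have F [measurable]: "?F \<in> borel_measurable borel"
  by (rule weighted_measurable) (auto intro!: continuous_intros fc borel_open)
 have in_ball: "z + e t *s u \<in> ball z \<rho> \<longleftrightarrow> u \<in> ?B" for t u
  by (simp add: dist_norm norm_smult_vec ne)
 have circle: "ennreal ((norm (f z))\<^sup>2) \<le> (\<integral>\<^sup>+t. ?F (z + e t *s u) * indicator {0..1} t \<partial>lborel)" if u: "u \<in> ?B" for u
 proof -
  \<comment> \<open>The mean value formula for \<open>f * f\<close> bounds the squared modulus
    directly.\<close>
  have sq: "holo_on (ball z \<rho>) (%y. f y * f y)" by (intro holo_on_mult f)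
  have hi: "((%t. f (z + e t *s u) * f (z + e t *s u)) has_integral f z * f z) {0..1}"
   unfolding e_def by (rule holo_mean_value[OF sq]) (use u in simp)
  have c: "continuous_on {0..1} (%t. f (z + e t *s u))"
  proof (rule continuous_on_compose2[OF fc])
   show "continuous_on {0..1} (%t. z + e t *s u)"
    unfolding e_def by (intro continuous_intros bounded_linear.continuous_on[OF bounded_linear_smult_vec_left])
  qed (use in_ball u in blast)
  let ?a = "%t. norm (f (z + e t *s u) * f (z + e t *s u))"
  have ci: "(?a has_integral
    integral {0..1} ?a) {0..1}"
   by (intro integrable_integral integrable_continuous_interval continuous_intros c)
  have "norm (f z * f z) \<le> integral {0..1} ?a"
   using integral_norm_bound_integral[OF has_integral_integrable[OF hi] has_integral_integrable[OF ci]] integral_unique[OF hi] by simp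
  then have "ennreal ((norm (f z))\<^sup>2) \<le> ennreal (integral {0..1} ?a)"
   by (intro ennreal_leI) (simp add: norm_mult power2_eq_square)
  also have "... = (\<integral>\<^sup>+t. ennreal (norm (f (z + e t *s u) * f (z + e t *s u))) * indicator {0..1} t \<partial>lborel)"
   by (rule nn_integral_has_integral_lebesgue'[OF _ ci, symmetric]) auto
  also have "... = (\<integral>\<^sup>+t. ?F (z + e t *s u) * indicator {0..1} t \<partial>lborel)"
   using in_ball[of _ u] u by (intro nn_integral_cong) (simp add: norm_mult power2_eq_square indicator_def)
  finally show ?thesis .
 qed
 let ?b = "\<integral>\<^sup>+y. ?F y \<partial>lborel"
 \<comment> \<open>The rotation preserves a ball of finite positive volume, so its real determinant
   has modulus 1.\<close>
 have rot: "(\<integral>\<^sup>+u. ?F (z + e t *s u) \<partial>lborel) = ?b" for t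
 proof -
  have inv: "e t *s (inverse (e t) *s u) = u" "inverse (e t) *s (e t *s u) = u" for u :: "complex ^ 'n"
   by (auto simp: vec_eq_iff e_def)
  note aff = nn_integral_affine_bij[OF bounded_linear_smult_vec[of "inverse (e t)"] bounded_linear_smult_vec[of "e t"] inv(2,1)]
  let ?c = "%u :: complex ^ 'n. e t *s u"
  have "emeasure lborel ?B = ennreal \<bar>rdet ?c\<bar> * emeasure lborel ?B"
  proof -
   have "(\<integral>\<^sup>+u. indicator ?B u \<partial>lborel) = ennreal \<bar>rdet ?c\<bar> * (\<integral>\<^sup>+u. indicator ?B (0 + e t *s u) \<partial>lborel)"
    by (rule aff) (simp add: borel_measurable_indicator)
   moreover have "indicator ?B (0 + e t *s u) = (indicator ?B u :: ennreal)" for u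
    by (simp add: indicator_def norm_smult_vec ne)
   ultimately show ?thesis by simp
  qed
  moreover have "emeasure lborel ?B \<noteq> 0"
   using \<rho> less_imp_neq[OF unit_ball_vol_pos[of "real CARD('n) * 2"]] by (simp add: emeasure_ball)
  moreover have "emeasure lborel ?B \<noteq> top" using emeasure_bounded_finite[of ?B] by (auto simp: less_top)
  ultimately have "ennreal \<bar>rdet ?c\<bar> = 1"
   using ennreal_mult_cancel_left[of "emeasure lborel ?B" "ennreal \<bar>rdet ?c\<bar>" 1]
   by (simp add: mult.commute)
  with aff[OF F, of z] show ?thesis by simp
 qed
 have meas: "(%(u, t). ?F (z + e t *s u) * indicator {0..1} t) \<in> borel_measurable (lborel \<Otimes>\<^sub>M lborel)"
 proof -
  have "continuous_on UNIV (%p. z + e (snd p) *s fst p)"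
   unfolding e_def vector_scalar_mult_def by (intro continuous_intros)
  then have [measurable]: "(%p. z + e (snd p) *s fst p) \<in> borel_measurable (borel \<Otimes>\<^sub>M borel)"
   unfolding borel_prod by (rule borel_measurable_continuous_onI)
  have "(%p. ?F (z + e (snd p) *s fst p) * indicator {0..1} (snd p)) \<in> borel_measurable (borel \<Otimes>\<^sub>M borel)"
   by measurable
  then show ?thesis by (simp add: split_beta' cong: measurable_cong_sets)
 qed
 have "emeasure lborel ?B * ennreal ((norm (f z))\<^sup>2) = wint ?B (%u. (norm (f z))\<^sup>2)"
  by (subst nn_integral_cmult_indicator) (simp_all add: mult.commute)
 also have "... \<le> (\<integral>\<^sup>+u. (\<integral>\<^sup>+t. ?F (z + e t *s u) * indicator {0..1} t \<partial>lborel) \<partial>lborel)"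
  by (rule nn_integral_mono) (use circle in \<open>auto simp: indicator_def\<close>)
 also have "... = (\<integral>\<^sup>+t. (\<integral>\<^sup>+u. ?F (z + e t *s u) * indicator {0..1} t \<partial>lborel) \<partial>lborel)"
  using lborel_pair.Fubini'[OF meas] by simp
 also have "... = (\<integral>\<^sup>+t. ?b * indicator {0..1 :: real} t \<partial>lborel)"
 proof (rule nn_integral_cong)
  fix t :: real
  have "(%u. z + e t *s u) \<in> borel_measurable borel"
   by (intro borel_measurable_continuous_onI continuous_intros bounded_linear.continuous_on[OF bounded_linear_smult_vec])
  then have "(%u. ?F (z + e t *s u)) \<in> borel_measurable borel" by (rule measurable_compose[OF _ F])
  then show "(\<integral>\<^sup>+u. ?F (z + e t *s u) * indicator {0..1} t \<partial>lborel) = ?b * indicator {0..1} t"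
   by (subst nn_integral_multc) (auto simp: rot)
 qed
 also have "... = ?b" by (subst nn_integral_cmult_indicator) auto
 finally show ?thesis .
qed (simp add: ball_empty)

text \<open>Differences of order \<open>2 ^ -m\<close> in L2 are of that order uniformly near each
  point, by \<open>holo_L2_bound\<close>; the limit is therefore a locally uniform telescoping
  series of holomorphic functions.\<close>

lemma holo_L2_limit:
 fixes w :: "nat => complex ^ 'n::finite => complex"
 assumes w: "!!m. holo_on (ball p \<rho>) (w m)"
  and le: "!!m. wint (ball p \<rho>) (%z. (norm (w (Suc m) z - w m z))\<^sup>2) \<le> ennreal (C / 4 ^ m)"
 obtains W where "holo_on (ball p \<rho>) W" "!!z. z \<in> ball p \<rho> ==> (%m. w m z) \<longlonglongrightarrow> W z"
proof -
 let ?f = "%i z. w (Suc i) z - w i z"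
 have loc: "\<exists>d>0. \<exists>K. ball z0 d \<subseteq> ball p \<rho> \<and> (\<forall>m. \<forall>z\<in>ball z0 d. norm (?f m z) \<le> K * (1 / 2) ^ m)" if z0: "z0 \<in> ball p \<rho>" for z0
 proof -
  define d where "d = (\<rho> - dist p z0) / 2"
  have d: "d > 0" using z0 by (simp add: d_def)
  have sub: "ball z d \<subseteq> ball p \<rho>" if "z \<in> ball z0 d" for z
  proof
   fix y assume "y \<in> ball z d"
   then show "y \<in> ball p \<rho>" using that dist_triangle[of p y z0] dist_triangle[of z0 y z] by (simp add: d_def field_simps)
  qed
  define V where "V = measure lborel (ball (0 :: complex ^ 'n) d)"
  have V: "V > 0" unfolding V_def using d by (simp add: content_ball unit_ball_vol_pos)
  have bound: "norm (w (Suc m) z - w m z) \<le> sqrt (max 0 C / V) * (1 / 2) ^ m" if z: "z \<in> ball z0 d" for m z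
  proof -
   let ?a = "norm (w (Suc m) z - w m z)"
   have "ennreal (V * ?a\<^sup>2) = emeasure lborel (ball (0 :: complex ^ 'n) d) * ennreal (?a\<^sup>2)"
    using V emeasure_bounded_finite[of "ball (0 :: complex ^ 'n) d"]
    by (simp add: V_def ennreal_mult emeasure_eq_ennreal_measure less_top)
   also have "... \<le> wint (ball z d) (%y. (norm (w (Suc m) y - w m y))\<^sup>2)"
    by (rule holo_L2_bound) (intro holo_on_diff holo_on_subset[OF w sub[OF z]])
   also have "... \<le> wint (ball p \<rho>) (%y. (norm (w (Suc m) y - w m y))\<^sup>2)"
    using sub[OF z] by (intro nn_integral_mono) (auto simp: indicator_def)
   also have "... \<le> ennreal (max 0 C / 4 ^ m)"
    by (rule order_trans[OF le]) (auto intro!: ennreal_leI divide_right_mono)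
   finally have "V * ?a\<^sup>2 \<le> max 0 C / 4 ^ m" by simp
   then have "?a\<^sup>2 \<le> max 0 C / V * (1 / 4) ^ m"
    using V by (simp add: field_simps)
   also have "... = (sqrt (max 0 C / V) * (1 / 2) ^ m)\<^sup>2"
    using V by (simp add: power_mult_distrib flip: power_mult) (simp add: power_mult mult.commute[of m] power2_eq_square)
   finally show ?thesis by (rule power2_le_imp_le) (use V in simp)
  qed
  then show ?thesis using sub d by (intro exI[of _ d]) (metis centre_in_ball subset_eq)
 qed
 show ?thesis
 proof (rule that[of "%z. w 0 z + (\<Sum>i. ?f i z)"])
  show "holo_on (ball p \<rho>) (%z. w 0 z + (\<Sum>i. ?f i z))"
   unfolding holo_on_def
  proof
   fix z0 assume z0: "z0 \<in> ball p \<rho>"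
   from loc[OF this] obtain d K where d: "d > 0" "ball z0 d \<subseteq> ball p \<rho>"
    and K: "!!m z. z \<in> ball z0 d ==> norm (?f m z) \<le> K * (1 / 2) ^ m" by blast
   have "\<exists>D. ((%z. \<Sum>i. ?f i z) has_derivative D) (at z0) \<and> (\<forall>c v. D (c *s v) = c * D v)"
    by (rule holo_on_series[OF d(1) _ K]) (auto intro!: holo_on_diff holo_on_subset[OF w d(2)] summable_mult summable_geometric)
   then obtain D where D: "((%z. \<Sum>i. ?f i z) has_derivative D) (at z0)" "!!c v. D (c *s v) = c * D v" by blast
   obtain D0 where D0: "(w 0 has_derivative D0) (at z0)" "!!c v. D0 (c *s v) = c * D0 v"
    using w[of 0] z0 unfolding holo_on_def by blast
   show "\<exists>D. ((%z. w 0 z + (\<Sum>i. ?f i z)) has_derivative D) (at z0) \<and> (\<forall>c v. D (c *s v) = c * D v)"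
    by (intro exI[of _ "%v. D0 v + D v"] conjI has_derivative_add D(1) D0(1)) (simp add: D(2) D0(2) distrib_left)
  qed
  fix z assume z: "z \<in> ball p \<rho>"
  from loc[OF this] obtain d K where d: "d > 0" and K: "!!m z'. z' \<in> ball z d ==> norm (?f m z') \<le> K * (1 / 2) ^ m" by blast
  have "summable (%i. ?f i z)"
   by (rule summable_comparison_test'[where g="%m. K * (1 / 2) ^ m"]) (use K[of z] d in \<open>auto intro!: summable_mult summable_geometric\<close>)
  from tendsto_add[OF tendsto_const[of "w 0 z"] summable_LIMSEQ[OF this]]
  show "(%m. w m z) \<longlonglongrightarrow> w 0 z + (\<Sum>i. ?f i z)"
   by (simp add: sum_lessThan_telescope[of "%i. w i z"])
 qed
qed

section \<open>Separated nets\<close>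

text \<open>Volume comparison: the balls of radius \<open>\<delta> / 2\<close> around the points are
  disjoint and lie in a ball of radius \<open>(a + 1) * \<delta>\<close>.\<close>

lemma separated_card_le:
 fixes P :: "'a::euclidean_space set"
 assumes P: "finite P" "!!p q. p \<in> P ==> q \<in> P ==> p \<noteq> q ==> dist p q \<ge> \<delta>" and \<delta>: "\<delta> > 0" "a \<ge> 0"
  and near: "!!p. p \<in> P ==> dist z p \<le> a * \<delta>"
 shows "real (card P) \<le> (2 * a + 2) ^ DIM('a)"
proof -
 let ?v = "measure lborel :: 'a set => real"
 have disj: "ball p (\<delta> / 2) \<inter> ball q (\<delta> / 2) = {}" if "p \<in> P" "q \<in> P" "p \<noteq> q" for p q
  by (rule disjoint_ballI) (use P(2)[OF that] in simp)
 let ?a = "a * \<delta> + \<delta>"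
 have "real (card P) * (unit_ball_vol (DIM('a)) * (\<delta> / 2) ^ DIM('a)) = (\<Sum>p\<in>P. ?v (ball p (\<delta> / 2)))"
  using \<delta> by (simp add: content_ball)
 also have "... = ?v (\<Union>p\<in>P. ball p (\<delta> / 2))"
  by (rule measure_finite_Union[symmetric])
    (use P(1) disj emeasure_bounded_finite[OF bounded_ball] in \<open>auto simp: disjoint_family_on_def less_top\<close>)
 also have "... \<le> ?v (ball z ?a)"
 proof (rule measure_mono_fmeasurable)
  show "(\<Union>p\<in>P. ball p (\<delta> / 2)) \<subseteq> ball z ?a"
  proof safe
   fix p x assume "p \<in> P" "x \<in> ball p (\<delta> / 2)"
   then show "x \<in> ball z ?a" using near[of p] dist_triangle[of z x p] \<delta>(1) by simp
  qed
 qed (auto intro!: fmeasurableI emeasure_bounded_finite borel_open)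
 also have "... = unit_ball_vol (DIM('a)) * ?a ^ DIM('a)" using \<delta> by (simp add: content_ball)
 finally have "real (card P) * (\<delta> / 2) ^ DIM('a) \<le> ?a ^ DIM('a)"
  using unit_ball_vol_pos[of "DIM('a)"] by (simp add: mult.left_commute)
 also have "?a ^ DIM('a) = (2 * a + 2) ^ DIM('a) * (\<delta> / 2) ^ DIM('a)"
  by (simp add: algebra_simps flip: power_mult_distrib)
 finally show ?thesis using \<delta>(1) by simp
qed

text \<open>A separated subset with the largest number of points is a net, since a point far from
  all of them could be added; the volume bound keeps the numbers of points bounded.\<close>

lemma separated_net:
 fixes X :: "'a::euclidean_space set"
 assumes X: "compact X" and \<delta>: "\<delta> > 0"
 obtains P where "finite P" "P \<subseteq> X" "!!x. x \<in> X ==> \<exists>p\<in>P. dist x p < \<delta>"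
  "!!p q. p \<in> P ==> q \<in> P ==> p \<noteq> q ==> dist p q \<ge> \<delta>"
proof -
 define sep where "sep P \<longleftrightarrow> finite P \<and> P \<subseteq> X \<and> (\<forall>p\<in>P. \<forall>q\<in>P. p \<noteq> q --> dist p q \<ge> \<delta>)" for P
 obtain B where B: "B > 0" "!!x. x \<in> X ==> norm x \<le> B"
  using compact_imp_bounded[OF X] by (auto simp: bounded_pos)
 have bd: "card P \<le> nat \<lfloor>(2 * (B / \<delta>) + 2) ^ DIM('a)\<rfloor>" if "sep P" for P
 proof -
  have "real (card P) \<le> (2 * (B / \<delta>) + 2) ^ DIM('a)"
   by (rule separated_card_le[of P \<delta> _ 0]) (use that B \<delta> in \<open>auto simp: sep_def subset_iff\<close>)
  then show ?thesis by (simp add: le_nat_floor)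
 qed
 have "sep {}" by (simp add: sep_def)
 then obtain P where P: "sep P" "!!Q. sep Q ==> card Q \<le> card P"
  using ex_has_greatest_nat[of sep "{}" card] bd by (metis le_imp_less_Suc)
 show ?thesis
 proof (rule that[of P])
  show "finite P" "P \<subseteq> X" "!!p q. p \<in> P ==> q \<in> P ==> p \<noteq> q ==> dist p q \<ge> \<delta>"
   using P(1) unfolding sep_def by blast+
  fix x assume x: "x \<in> X"
  show "\<exists>p\<in>P. dist x p < \<delta>"
  proof (rule ccontr)
   assume *: "\<not> ?thesis"
   then have "sep (insert x P)" using P(1) x unfolding sep_def by (auto simp: dist_commute not_less)
   from P(2)[OF this] have "x \<in> P" using P(1) unfolding sep_def by (auto simp: card_insert_if split: if_splits)
   then show False using * \<delta> by auto
  qed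
 qed
qed

section \<open>Gluing local sections\<close>

lemma smooth_on_imp_C1_on: "smooth_on S f ==> C1_on S f"
 unfolding smooth_on_def C1_on_def by (drule spec[of _ "Suc 0"]) simp

text \<open>\<open>V\<close> is a mean of the \<open>w j\<close> in which only the indices in
  \<open>D\<close> carry weight, so it is as close to \<open>v\<close> as the \<open>w j\<close> are
  together. The second bound is meant for the derivative of a glued section, where each
  \<open>w j\<close> appears in the difference \<open>w j - V\<close>, again controlled by the
  distances to \<open>v\<close>.\<close>

lemma weighted_mean_bound:
 fixes w :: "'j => complex" and \<psi> :: "'j => real"
 assumes J: "finite J" "D \<subseteq> J" and \<psi>: "!!j. j \<in> J ==> \<psi> j \<ge> 0" "!!j. j \<in> J - D ==> \<psi> j = 0" "(\<Sum>j\<in>J. \<psi> j) \<ge> 1"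
 defines "V == (\<Sum>j\<in>J. of_real (\<psi> j) * w j) / of_real (\<Sum>j\<in>J. \<psi> j)"
 shows weighted_mean_dist: "(cmod (V - v))\<^sup>2 \<le> (\<Sum>j\<in>D. (cmod (w j - v))\<^sup>2)"
  and "!!\<delta>. (!!j. j \<in> J - D ==> \<delta> j = 0) ==> (!!j. j \<in> D ==> cmod (\<delta> j) \<le> b) ==> card D \<le> N ==> b \<ge> 0 ==>
   (cmod ((\<Sum>j\<in>J. \<delta> j * (w j - V)) / of_real (\<Sum>j\<in>J. \<psi> j)))\<^sup>2 \<le> 4 * (real N)\<^sup>2 * b\<^sup>2 * (\<Sum>j\<in>D. (cmod (w j - v))\<^sup>2)"
proof -
 let ?\<Psi> = "\<Sum>j\<in>J. \<psi> j"
 let ?E = "\<Sum>j\<in>D. (cmod (w j - v))\<^sup>2"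
 have D: "finite D" using J finite_subset by blast
 have \<Psi>D: "?\<Psi> = (\<Sum>j\<in>D. \<psi> j)" by (rule sum.mono_neutral_right) (use J \<psi>(2) in auto)
 have a: "\<psi> j / ?\<Psi> \<ge> 0" "\<psi> j / ?\<Psi> \<le> 1" if "j \<in> D" for j
  using that J \<psi>(1,3) member_le_sum[of j J \<psi>] by (auto intro!: divide_nonneg_nonneg simp: sum_nonneg)
 let ?b = "\<Sum>j\<in>D. (\<psi> j / ?\<Psi>)\<^sup>2"
 have "V - v = (\<Sum>j\<in>J. of_real (\<psi> j) * (w j - v)) / of_real ?\<Psi>"
  using \<psi>(3) by (simp add: V_def right_diff_distrib sum_subtractf diff_divide_distrib flip: sum_distrib_right of_real_sum)
 also have "(\<Sum>j\<in>J. of_real (\<psi> j) * (w j - v)) = (\<Sum>j\<in>D. of_real (\<psi> j) * (w j - v))"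
  by (rule sum.mono_neutral_right) (use J \<psi>(2) in auto)
 finally have "V - v = (\<Sum>j\<in>D. of_real (\<psi> j / ?\<Psi>) * (w j - v))"
  by (simp add: sum_divide_distrib)
 also have "cmod ... \<le> (\<Sum>j\<in>D. (\<psi> j / ?\<Psi>) * cmod (w j - v))"
  by (rule sum_norm_le) (use \<psi>(1,3) J(2) in \<open>auto simp: norm_mult norm_divide simp flip: of_real_sum\<close>)
 finally have "(cmod (V - v))\<^sup>2 \<le> (\<Sum>j\<in>D. (\<psi> j / ?\<Psi>) * cmod (w j - v))\<^sup>2" by (intro power_mono) auto
 also have "... \<le> ?b * ?E" by (rule Cauchy_Schwarz_ineq_sum)
 also have "... \<le> 1 * ?E"
 proof (intro mult_right_mono sum_nonneg)
  have "?b \<le> (\<Sum>j\<in>D. \<psi> j / ?\<Psi>)"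
   by (rule sum_mono) (use a in \<open>auto simp only: power2_eq_square intro!: mult_left_le\<close>)
  also have "... = 1" using \<Psi>D \<psi>(3) by (simp flip: sum_divide_distrib)
  finally show "?b \<le> 1" .
 qed auto
 finally show V: "(cmod (V - v))\<^sup>2 \<le> ?E" by simp
 fix \<delta> assume \<delta>: "!!j. j \<in> J - D ==> \<delta> j = 0" "!!j. j \<in> D ==> cmod (\<delta> j) \<le> b" and N: "card D \<le> N" "b \<ge> 0"
 have E: "?E \<ge> 0" by (intro sum_nonneg) simp
 have wV: "cmod (w j - V) \<le> 2 * sqrt ?E" if j: "j \<in> D" for j
 proof (rule power2_le_imp_le)
  have "(cmod (w j - v))\<^sup>2 \<le> ?E" by (rule member_le_sum[OF j _ D]) simp
  then show "(cmod (w j - V))\<^sup>2 \<le> (2 * sqrt ?E)\<^sup>2"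
   using norm_sum_square_le[of "w j - v" "v - V"] V E by (simp add: power_mult_distrib norm_minus_commute)
 qed (use E in simp)
 let ?a = "\<Sum>j\<in>J. \<delta> j * (w j - V)"
 have "?a = (\<Sum>j\<in>D. \<delta> j * (w j - V))"
  by (rule sum.mono_neutral_right) (use J \<delta>(1) in auto)
 also have "cmod ... \<le> (\<Sum>j\<in>D. b * (2 * sqrt ?E))"
  by (rule sum_norm_le) (use wV \<delta>(2) E N in \<open>auto simp: norm_mult intro!: mult_mono\<close>)
 also have "... \<le> real N * (b * (2 * sqrt ?E))" using N E by (simp add: mult_right_mono)
 finally have X: "cmod ?a \<le> real N * (b * (2 * sqrt ?E))" .
 have "cmod (?a / of_real ?\<Psi>) = cmod ?a / ?\<Psi>"
  using \<psi>(3) by (simp only: norm_divide norm_of_real)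
 also have "... \<le> cmod ?a / 1" using \<psi>(3) by (intro divide_left_mono) auto
 finally have "cmod (?a / of_real ?\<Psi>) \<le> real N * (b * (2 * sqrt ?E))" using X by simp
 then have "(cmod (?a / of_real ?\<Psi>))\<^sup>2 \<le> (real N * (b * (2 * sqrt ?E)))\<^sup>2"
  by (intro power_mono) auto
 then show "(cmod (?a / of_real ?\<Psi>))\<^sup>2 \<le> 4 * (real N)\<^sup>2 * b\<^sup>2 * ?E"
  using E by (simp add: power_mult_distrib mult_ac)
qed

text \<open>The identity that \<open>V\<close> times the sum of the \<open>\<psi> j\<close> equals
  the sum of the products \<open>\<psi> j * w j\<close> is differentiated. Regularity is asked of
  these products, because \<open>w j\<close> will be an extension by zero that jumps where
  \<open>\<psi> j\<close> vanishes.\<close>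

lemma glue_C1:
 fixes w :: "'j => complex ^ 'n::finite => complex" and \<psi> :: "'j => complex ^ 'n => real"
 assumes S: "open S" and \<psi>: "!!j. j \<in> J ==> C1_on S (\<psi> j)" "!!z. z \<in> S ==> (\<Sum>j\<in>J. \<psi> j z) \<ge> 1"
  and y: "!!j. j \<in> J ==> C1_on S (%z. of_real (\<psi> j z) * w j z)"
   "!!j z u. j \<in> J ==> z \<in> S ==> dbar (%z. of_real (\<psi> j z) * w j z) z u = dbar (%z. of_real (\<psi> j z)) z u * w j z"
  and V: "!!z. z \<in> S ==> V z = (\<Sum>j\<in>J. of_real (\<psi> j z) * w j z) / of_real (\<Sum>j\<in>J. \<psi> j z)"
 shows "C1_on S V"
  and "z \<in> S ==> dbar V z u = (\<Sum>j\<in>J. dbar (%z. of_real (\<psi> j z)) z u * (w j z - V z)) / of_real (\<Sum>j\<in>J. \<psi> j z)"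
proof -
 let ?\<Psi> = "%z. \<Sum>j\<in>J. complex_of_real (\<psi> j z)"
 have \<Psi>: "C1_on S ?\<Psi>" by (intro C1_on_sum C1_on_of_real \<psi>)
 have nz: "?\<Psi> z \<noteq> 0" if "z \<in> S" for z using \<psi>(2)[OF that] by (simp flip: of_real_sum)
 have "C1_on S (%z. (\<Sum>j\<in>J. of_real (\<psi> j z) * w j z) / ?\<Psi> z)"
  by (intro C1_on_divide C1_on_sum y \<Psi> nz)
 then show CV: "C1_on S V" by (rule C1_on_cong[OF S]) (simp add: V)
 assume z: "z \<in> S"
 have d: "?\<Psi> differentiable (at z)" "V differentiable (at z)"
  "!!j. j \<in> J ==> (%z. of_real (\<psi> j z) * w j z) differentiable (at z)"
  "!!j. j \<in> J ==> (%z. complex_of_real (\<psi> j z)) differentiable (at z)"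
  using \<Psi> CV y(1) C1_on_of_real[OF \<psi>(1)] z unfolding C1_on_def by blast+
 let ?a = "%z. \<Sum>j\<in>J. of_real (\<psi> j z) * w j z"
 let ?b = "%j. %z. of_real (\<psi> j z)"
 have "dbar (%z. ?\<Psi> z * V z) z u = dbar ?a z u"
  by (rule dbar_cong_open[OF S z]) (use nz in \<open>simp add: V\<close>)
 then have "(\<Sum>j\<in>J. dbar (?b j) z u) * V z + ?\<Psi> z * dbar V z u = (\<Sum>j\<in>J. dbar (?b j) z u * w j z)"
 proof -
  have "dbar ?\<Psi> z u = (\<Sum>j\<in>J. dbar (?b j) z u)" by (rule dbar_sum) (rule d(4))
  moreover have "dbar ?a z u = (\<Sum>j\<in>J. dbar (%z. of_real (\<psi> j z) * w j z) z u)"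
   by (rule dbar_sum) (rule d(3))
  moreover assume "dbar (%z. ?\<Psi> z * V z) z u = dbar ?a z u"
  ultimately show ?thesis unfolding dbar_mult[OF d(1,2)] using y(2)[OF _ z] by simp
 qed
 then have "?\<Psi> z * dbar V z u = (\<Sum>j\<in>J. dbar (?b j) z u * (w j z - V z))"
  by (simp add: right_diff_distrib sum_subtractf sum_distrib_right eq_diff_eq add.commute)
 then show "dbar V z u = (\<Sum>j\<in>J. dbar (?b j) z u * (w j z - V z)) / of_real (\<Sum>j\<in>J. \<psi> j z)"
  using nz[OF z] by (simp add: eq_divide_eq mult.commute)
qed

section \<open>Sections of powers of a positive line bundle\<close>

locale hermitian_bundle = kahler A \<omega>
 for A :: "('m::t2_space, 'n::finite) chart set" and \<omega> :: "('m, 'n, real) form2" +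
 fixes L :: "('m, 'i) line_bundle" and h :: "'i => 'm => real" and \<theta> :: "'i => ('m, 'n, complex) form1"
 assumes line_bundle: "holomorphic_line_bundle A L" and metric: "hermitian_metric A L h"
  and chern: "chern_connection A L h \<theta>" and curvature: "has_curvature A L \<theta> (%c p u v. - \<i> * of_real (\<omega> c p u v))"
begin

abbreviation dom where "dom == lb_dom L"
abbreviation g where "g == lb_trans L"
abbreviation Lk where "Lk k == tensor_power L k"
abbreviation cdom :: "('m, 'n) chart => 'i => (complex ^ 'n) set" where "cdom c i == snd c ` (fst c \<inter> dom i)"

lemma bundleD:
 shows dom_open: "open (dom i)" and dom_cover: "\<exists>i. x \<in> dom i"
  and g_holo: "c \<in> A ==> holo_on (snd c ` (fst c \<inter> (dom i \<inter> dom j))) (g i j \<circ> chart_inv c)"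
  and g_cocycle: "x \<in> dom i ==> x \<in> dom j ==> x \<in> dom l ==> g i j x * g j l x = g i l x"
  and g_id: "x \<in> dom i ==> g i i x = 1"
 using line_bundle unfolding holomorphic_line_bundle_def holo_fun_def by blast+

lemma metricD:
 shows h_smooth: "smooth_fun A (dom i) (h i)" and h_pos: "x \<in> dom i ==> h i x > 0"
  and h_change: "x \<in> dom i ==> x \<in> dom j ==> h j x = (cmod (g i j x))\<^sup>2 * h i x"
 using metric unfolding hermitian_metric_def by blast+

lemma cdom_open: "c \<in> A ==> open (cdom c i)"
 by (rule open_chart_image[OF _ dom_open])

lemma cdomD:
 assumes "c \<in> A" "z \<in> cdom c i"
 shows "z \<in> cimg c" "chart_inv c z \<in> fst c" "chart_inv c z \<in> dom i" "snd c (chart_inv c z) = z"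
 using assms chart_inv_left[OF assms(1)] by auto

lemma h_C1: "c \<in> A ==> C1_on (cdom c i) (%z. h i (chart_inv c z))"
 using h_smooth[of i] smooth_on_imp_C1_on unfolding smooth_fun_def comp_def by blast

lemma weight_chart:
 assumes c: "c \<in> A" and K: "cball z0 (3 * r) \<subseteq> cdom c i" "r > 0"
 shows "weight (cdom c i) (%z. h i (chart_inv c z)) (%z. \<theta> i c (chart_inv c z)) (%z. \<omega> c (chart_inv c z)) z0 r"
proof (rule weight.intro)
 have \<theta>: "smooth_form1 A (dom i) (\<theta> i)"
  using chern unfolding chern_connection_def connection_def by blast
 have ch: "\<theta> i c p (\<i> *s v) = \<i> * \<theta> i c p v \<and> of_real (ext_d0 (h i) c p v) = (\<theta> i c p v + cnj (\<theta> i c p v)) * of_real (h i p)"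
  if "p \<in> fst c" "p \<in> dom i" for p v
  using chern c that unfolding chern_connection_def by blast
 show "continuous_on (cdom c i) (%z. h i (chart_inv c z))" by (rule C1_on_cont[OF h_C1[OF c]])
 fix z assume z: "z \<in> cdom c i"
 note zD = cdomD[OF c z]
 show "h i (chart_inv c z) > 0" by (rule h_pos[OF zD(3)])
 show "linear (\<theta> i c (chart_inv c z))" using \<theta> c zD unfolding smooth_form1_def by blast
 show "\<theta> i c (chart_inv c z) (\<i> *s v) = \<i> * \<theta> i c (chart_inv c z) v" for v using ch[OF zD(2,3)] by blast
 show "positive_form (\<omega> c (chart_inv c z))" by (rule positive_kahler[OF c zD(2)])
 show "fder (%z. \<theta> i c (chart_inv c z) v) z u - fder (%z. \<theta> i c (chart_inv c z) u) z v =
   - \<i> * of_real (\<omega> c (chart_inv c z) u v)" for u v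
  using curvature[unfolded has_curvature_def, rule_format, where i=i and p="chart_inv c z", OF c, of u v] zD(2-4)
  by (simp add: ext_d1_def)
 show "((%z. ln (h i (chart_inv c z))) has_derivative (%v. 2 * Re (\<theta> i c (chart_inv c z) v))) (at z)"
 proof -
  let ?H = "%z. h i (chart_inv c z)"
  have D: "(?H has_derivative fder ?H z) (at z)" by (rule C1_onD[OF h_C1[OF c] z])
  have fr: "fder ?H z v = 2 * Re (\<theta> i c (chart_inv c z) v) * ?H z" for v
  proof -
   have "complex_of_real (fder ?H z v) = of_real (2 * Re (\<theta> i c (chart_inv c z) v) * ?H z)"
    using ch[OF zD(2,3), of v] unfolding ext_d0_def comp_def zD(4) complex_add_cnj by simp
   then show ?thesis using of_real_eq_iff by blast
  qed
  show ?thesis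
   by (rule has_derivative_eq_rhs[OF has_derivative_ln[OF h_pos[OF zD(3)] D]])
     (use h_pos[OF zD(3)] in \<open>simp add: fr fun_eq_iff\<close>)
 qed
next
 show "C1_on (cdom c i) (%z. \<theta> i c (chart_inv c z) v)" for v
  using chern c smooth_on_imp_C1_on unfolding chern_connection_def connection_def smooth_form1_def by blast
qed (use cdom_open[OF c] K in auto)

end

section \<open>Algebra, pointwise norms and regularity of sections in local frames\<close>

abbreviation sec_minus (infixl "-." 65) where "s -. t == %i x. s i x - t i x :: complex"
abbreviation sec_plus (infixl "+." 65) where "s +. t == %i x. s i x + t i x :: complex"
abbreviation sec_times (infixl "*." 70) where "f *. s == %i x. f x * s i x :: complex"

context kahler
begin

lemma transition_holo:
 assumes cd: "c \<in> A" "d \<in> A" and w: "holo_on U w" and W: "W \<subseteq> fst c \<inter> fst d" "!!x. x \<in> W ==> snd d x \<in> U"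
 shows "holo_on (snd c ` W) (%z. w (snd d (chart_inv c z)))"
 unfolding holo_on_iff_dbar
proof (intro ballI conjI allI)
 fix z assume "z \<in> snd c ` W"
 then obtain x where x: "x \<in> W" "z = snd c x" by blast
 have zc: "z \<in> snd c ` (fst c \<inter> fst d)" and zU: "transition c d z \<in> U"
  using x W chart_inv_left[OF cd(1), of x] by (auto simp: transition_def)
 note T = C1_onD[OF transition_C1[OF cd] zc]
 have wd: "w differentiable (at (transition c d z))" "!!u. dbar w (transition c d z) u = 0"
  using w zU by (auto simp: holo_on_iff_dbar)
 show "(%z. w (snd d (chart_inv c z))) differentiable (at z)"
 proof -
  have "transition c d differentiable (at z)" using T unfolding differentiable_def by blast
  from differentiable_chain_at[OF this wd(1)] show ?thesis by (simp add: o_def transition_def)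
 qed
 show "dbar (%z. w (snd d (chart_inv c z))) z u = 0" for u
  using dbar_compose[OF wd(1) T transition_complex_linear[OF cd zc]] wd(2) by (simp add: transition_def)
qed

end

context hermitian_bundle
begin

abbreviation sec :: "nat => ('m, 'i) lb_section => bool" where "sec k s == is_section (Lk k) s"

lemma sec_iff: "sec k s \<longleftrightarrow> (\<forall>i j. \<forall>x\<in>dom i \<inter> dom j. s i x = g i j x ^ k * s j x) \<and> (\<forall>i x. x \<notin> dom i --> s i x = 0)"
 by (simp only: is_section_def tensor_power_def line_bundle.select_convs)

lemma sec_change: "sec k s ==> x \<in> dom i ==> x \<in> dom j ==> s i x = g i j x ^ k * s j x"
 and sec_outside: "sec k s ==> x \<notin> dom i ==> s i x = 0"
 and secI: "(!!i j x. x \<in> dom i ==> x \<in> dom j ==> s i x = g i j x ^ k * s j x) ==> (!!i x. x \<notin> dom i ==> s i x = 0) ==> sec k s"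
 unfolding sec_iff by blast+

lemma sec_mult:
 assumes "sec k s" shows "sec k (f *. s)"
proof (rule secI)
 fix i j x assume "x \<in> dom i" "x \<in> dom j"
 from sec_change[OF assms this] show "f x * s i x = g i j x ^ k * (f x * s j x)" by (simp only: mult.left_commute)
qed (simp add: sec_outside[OF assms])

lemma sec_sum:
 assumes "!!j. j \<in> J ==> sec k (u j)" shows "sec k (%i x. \<Sum>j\<in>J. u j i x)"
proof (rule secI)
 fix i j x assume x: "x \<in> dom i" "x \<in> dom j"
 show "(\<Sum>l\<in>J. u l i x) = g i j x ^ k * (\<Sum>l\<in>J. u l j x)"
  unfolding sum_distrib_left by (rule sum.cong[OF refl sec_change[OF assms x]])
qed (simp add: sec_outside[OF assms])

lemma sec_add: "sec k s ==> sec k t ==> sec k (s +. t)"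
 using sec_sum[of "UNIV :: bool set" k "%b. if b then s else t"] by (simp add: UNIV_bool add.commute)

lemma sec_diff: "sec k s ==> sec k t ==> sec k (s -. t)"
 using sec_add[OF _ sec_mult[where f="%_. - 1"]] by simp

text \<open>The same choice as inside \<open>fibre_inner\<close>, so inner products unfold in this
  frame; \<open>ip_frame\<close> then allows any other one.\<close>

definition fr where "fr x = (SOME i. x \<in> dom i)"

lemma fr: "x \<in> dom (fr x)"
 unfolding fr_def by (rule someI_ex[OF dom_cover])

abbreviation ip where "ip k == fibre_inner (Lk k) (metric_power h k)"

definition pn where "pn k s x = h (fr x) x ^ k * (cmod (s (fr x) x))\<^sup>2"

lemma ip_eq: "ip k s t x = of_real (h (fr x) x ^ k) * s (fr x) x * cnj (t (fr x) x)"
 by (simp add: fibre_inner_def metric_power_def tensor_power_def fr_def Let_def)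

lemma ip_frame:
 assumes "sec k s" "sec k t" "x \<in> dom i"
 shows "ip k s t x = of_real (h i x ^ k) * s i x * cnj (t i x)"
proof -
 let ?j = "fr x"
 have g: "h ?j x = (cmod (g i ?j x))\<^sup>2 * h i x" by (rule h_change[OF assms(3) fr])
 have s: "s i x = g i ?j x ^ k * s ?j x" "t i x = g i ?j x ^ k * t ?j x"
  using sec_change assms fr by blast+
 have g1: "g i ?j x * g ?j i x = 1" using g_cocycle[OF assms(3) fr assms(3)] g_id[OF assms(3)] by simp
 have hi: "h i x = (cmod (g ?j i x))\<^sup>2 * h ?j x" by (rule h_change[OF fr assms(3)])
 have "complex_of_real (h i x ^ k) * (g i ?j x ^ k * cnj (g i ?j x ^ k)) = of_real (h ?j x ^ k)"
 proof -
  have "complex_of_real ((cmod (g ?j i x))\<^sup>2) = g ?j i x * cnj (g ?j i x)" by (rule complex_norm_square)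
  then have "complex_of_real (h i x) * (g i ?j x * cnj (g i ?j x)) = (g i ?j x * g ?j i x) * cnj (g i ?j x * g ?j i x) * of_real (h ?j x)"
   unfolding hi by (simp add: mult_ac)
  then have "complex_of_real (h i x) * (g i ?j x * cnj (g i ?j x)) = of_real (h ?j x)" by (simp add: g1)
  then have "(complex_of_real (h i x) * (g i ?j x * cnj (g i ?j x))) ^ k = of_real (h ?j x) ^ k" by simp
  then show ?thesis by (simp add: power_mult_distrib)
 qed
 then show ?thesis unfolding ip_eq s by (simp add: mult_ac)
qed

lemma pn_ip: "complex_of_real (pn k s x) = ip k s s x"
 unfolding ip_eq pn_def by (simp add: complex_norm_square mult.assoc flip: of_real_power)

lemma pn_frame:
 assumes "sec k s" "x \<in> dom i" shows "pn k s x = h i x ^ k * (cmod (s i x))\<^sup>2"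
proof -
 have "complex_of_real (pn k s x) = of_real (h i x ^ k * (cmod (s i x))\<^sup>2)"
  unfolding pn_ip ip_frame[OF assms(1,1,2)] by (simp add: complex_norm_square mult.assoc flip: of_real_power)
 then show ?thesis using of_real_eq_iff by blast
qed

lemma pn_nonneg: "pn k s x \<ge> 0"
 unfolding pn_def using h_pos[OF fr, of x] by simp

lemma continuous_on_charts:
 assumes W: "open W" and f: "!!c. c \<in> A ==> continuous_on (snd c ` (fst c \<inter> W)) (%z. f (chart_inv c z))"
 shows "continuous_on W f"
proof (rule continuous_at_imp_continuous_on, rule ballI)
 fix x assume x: "x \<in> W"
 obtain c where c: "c \<in> A" "x \<in> fst c" using atlas unfolding complex_atlas_def by blast
 have U: "open (fst c \<inter> W)" using W chartD(1)[OF c(1)] by blast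
 have "continuous_on (fst c \<inter> W) (%y. f (chart_inv c (snd c y)))"
  by (rule continuous_on_compose2[OF f[OF c(1)]]) (auto intro: continuous_on_subset[OF chart_continuous[OF c(1)]])
 then have "continuous_on (fst c \<inter> W) f"
  by (rule continuous_on_eq) (simp add: chart_inv_left[OF c(1)])
 then show "continuous (at x) f" using U x c(2) continuous_on_eq_continuous_at by blast
qed

lemma h_continuous: "continuous_on (dom i) (h i)"
 by (rule continuous_on_charts[OF dom_open C1_on_cont[OF h_C1]])

lemma ip_continuous:
 assumes W: "open W" and s: "sec k s" "!!i. continuous_on (W \<inter> dom i) (s i)" and t: "sec k t" "!!i. continuous_on (W \<inter> dom i) (t i)"
 shows "continuous_on W (ip k s t)"
proof (rule continuous_at_imp_continuous_on, rule ballI)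
 fix x assume x: "x \<in> W"
 let ?U = "W \<inter> dom (fr x)"
 have U: "open ?U" "x \<in> ?U" using W dom_open fr x by auto
 have "continuous_on ?U (%x'. of_real (h (fr x) x' ^ k) * s (fr x) x' * cnj (t (fr x) x'))"
  by (intro continuous_intros s t continuous_on_subset[OF h_continuous]) auto
 then have "continuous_on ?U (ip k s t)"
  by (rule continuous_on_eq) (rule ip_frame[OF s(1) t(1), symmetric], simp)
 then show "continuous (at x) (ip k s t)" using U continuous_on_eq_continuous_at by blast
qed

lemma pn_continuous:
 assumes "open W" "sec k s" "!!i. continuous_on (W \<inter> dom i) (s i)"
 shows "continuous_on W (pn k s)"
proof -
 have "continuous_on W (%x. Re (ip k s s x))" by (intro continuous_intros ip_continuous assms)
 moreover have "Re (ip k s s x) = pn k s x" for x by (simp flip: pn_ip)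
 ultimately show ?thesis by simp
qed

definition C1sec where "C1sec k s \<longleftrightarrow> sec k s \<and> (\<forall>c\<in>A. \<forall>i. C1_on (cdom c i) (%z. s i (chart_inv c z)))"

lemma C1secD:
 assumes "C1sec k s"
 shows "sec k s" "c \<in> A ==> C1_on (cdom c i) (%z. s i (chart_inv c z))" "continuous_on (dom i) (s i)"
proof -
 show "sec k s" "c \<in> A ==> C1_on (cdom c i) (%z. s i (chart_inv c z))" using assms unfolding C1sec_def by auto
 show "continuous_on (dom i) (s i)"
  by (rule continuous_on_charts[OF dom_open C1_on_cont]) (use assms in \<open>simp add: C1sec_def\<close>)
qed

lemma C1sec_diff: "C1sec k s ==> C1sec k t ==> C1sec k (s -. t)"
 unfolding C1sec_def by (simp add: sec_diff C1_on_diff)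

definition C1fun :: "('m => complex) => bool" where "C1fun f \<longleftrightarrow> (\<forall>c\<in>A. C1_on (cimg c) (%z. f (chart_inv c z)))"

lemma C1sec_mult:
 assumes "C1fun f" "C1sec k s" shows "C1sec k (f *. s)"
proof -
 have "cdom c i \<subseteq> cimg c" for c :: "('m, 'n) chart" and i by blast
 then have "C1_on (cdom c i) (%z. f (chart_inv c z) * s i (chart_inv c z))" if "c \<in> A" for c i
  using assms that unfolding C1fun_def by (intro C1_on_mult C1secD(2)[OF assms(2) that]) (blast intro: C1_on_subset)
 then show ?thesis using C1secD(1)[OF assms(2)] unfolding C1sec_def by (simp add: sec_mult)
qed

lemma C1fun_const: "C1fun (%x. a)" by (simp add: C1fun_def C1_on_const)

abbreviation H0 where "H0 k == holomorphic_sections A (Lk k)"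

lemma H0_holo: "s \<in> H0 k \<longleftrightarrow> sec k s \<and> (\<forall>c\<in>A. \<forall>i. holo_on (cdom c i) (%z. s i (chart_inv c z)))"
 unfolding holomorphic_sections_def holo_fun_def comp_def by (auto simp: tensor_power_def)

lemma H0_C1sec: "s \<in> H0 k ==> C1sec k s"
 unfolding H0_holo C1sec_def using holo_on_imp_C1_on cdom_open by blast

end

section \<open>Finite covers by coordinate balls, and comparison of the volume with Lebesgue
  measure\<close>

lemma bounded_on_compacts:
 fixes f :: "'b => 'a::topological_space => real"
 assumes "finite B" and X: "!!b. b \<in> B ==> compact (X b)" "!!b. b \<in> B ==> continuous_on (X b) (f b)"
 obtains M where "M > 0" "!!b z. b \<in> B ==> z \<in> X b ==> f b z \<le> M"
proof -
 have "bounded (\<Union>b\<in>B. f b ` X b)"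
  by (intro bounded_UN ballI compact_imp_bounded compact_continuous_image assms)
 then obtain M where M: "M > 0" "!!y. y \<in> (\<Union>b\<in>B. f b ` X b) ==> norm y \<le> M" unfolding bounded_pos by blast
 have "f b z \<le> M" if "b \<in> B" "z \<in> X b" for b z
 proof -
  have "f b z \<in> (\<Union>b\<in>B. f b ` X b)" using that by blast
  from M(2)[OF this] show ?thesis by (simp add: abs_le_iff)
 qed
 then show ?thesis using that M(1) by blast
qed

text \<open>The balls of radius \<open>rb b\<close> cover the manifold, while frames and density
  bounds are available on three times the radius. The room in between accommodates small balls
  around centres in the inner ball.\<close>

locale covered_bundle = hermitian_bundle A \<omega> L h \<theta>
 for A :: "('m::t2_space, 'n::finite) chart set" and \<omega> :: "('m, 'n, real) form2"
  and L :: "('m, 'i) line_bundle" and h :: "'i => 'm => real" and \<theta> :: "'i => ('m, 'n, complex) form1" +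
 fixes B :: "'b set" and cb :: "'b => ('m, 'n) chart" and ib :: "'b => 'i" and zb :: "'b => complex ^ 'n" and rb :: "'b => real"
  and mv Mv :: real
 assumes B: "finite B" "!!b. b \<in> B ==> cb b \<in> A" "!!b. b \<in> B ==> rb b > 0"
   "!!b. b \<in> B ==> cball (zb b) (3 * rb b) \<subseteq> cdom (cb b) (ib b)"
  and cover: "!!x. \<exists>b\<in>B. x \<in> chart_inv (cb b) ` ball (zb b) (rb b)"
  and dens: "mv > 0" "Mv > 0" "!!b z. b \<in> B ==> z \<in> cball (zb b) (3 * rb b) ==> mv \<le> volume_density \<omega> (cb b) (chart_inv (cb b) z)"
   "!!b z. b \<in> B ==> z \<in> cball (zb b) (3 * rb b) ==> volume_density \<omega> (cb b) (chart_inv (cb b) z) \<le> Mv"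
begin

abbreviation K where "K b == cball (zb b) (3 * rb b)"
abbreviation ci where "ci b == chart_inv (cb b)"
abbreviation hb where "hb k b z == h (ib b) (ci b z) ^ k"
abbreviation vb where "vb v b z == v (ib b) (ci b z)"

lemma K_cdom: "b \<in> B ==> z \<in> K b ==> z \<in> cdom (cb b) (ib b)"
 using B(4) by blast

lemma chart_to_vol:
 assumes b: "b \<in> B" and F [measurable]: "F \<in> borel_measurable borel"
 shows "(\<integral>\<^sup>+z. F (ci b z) * indicator (K b) z \<partial>lborel) \<le> ennreal (1 / mv) * (\<integral>\<^sup>+x. F x \<partial>vol)"
proof -
 have [measurable]: "chart_density (cb b) \<in> borel_measurable borel" by (rule chart_density_measurable[OF B(2)[OF b]])
 note cm = chart_inv_measurable[OF B(2)[OF b]]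
 have m: "(%z. F (ci b z) * chart_density (cb b) z) \<in> borel_measurable lborel"
 proof -
  let ?a = "%z. F (if z \<in> cimg (cb b) then ci b z else undefined) * chart_density (cb b) z"
  have "?a \<in> borel_measurable lborel"
   using cm by measurable
  also have "?a = (%z. F (ci b z) * chart_density (cb b) z)"
   by (auto simp: chart_density_def fun_eq_iff)
  finally show ?thesis .
 qed
 have "(\<integral>\<^sup>+z. F (ci b z) * indicator (K b) z \<partial>lborel) \<le> (\<integral>\<^sup>+z. ennreal (1 / mv) * (F (ci b z) * chart_density (cb b) z) \<partial>lborel)"
 proof (rule nn_integral_mono)
  fix z
  show "F (ci b z) * indicator (K b) z \<le> ennreal (1 / mv) * (F (ci b z) * chart_density (cb b) z)"
  proof (cases "z \<in> K b")
   case True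
   have "1 \<le> 1 / mv * volume_density \<omega> (cb b) (ci b z)" using dens(1) dens(3)[OF b True] by simp
   then have "ennreal 1 \<le> ennreal (1 / mv) * chart_density (cb b) z"
    using dens(1) K_cdom[OF b True] by (auto simp: chart_density_def simp flip: ennreal_mult' intro!: ennreal_leI)
   from mult_left_mono[OF this, of "F (ci b z)"] show ?thesis using True by (simp add: mult_ac)
  qed simp
 qed
 also have "... = ennreal (1 / mv) * (\<integral>\<^sup>+x. F x * indicator (fst (cb b)) x \<partial>vol)"
  unfolding nn_integral_vol_chart[OF B(2)[OF b] F] by (rule nn_integral_cmult[OF m])
 also have "... \<le> ennreal (1 / mv) * (\<integral>\<^sup>+x. F x \<partial>vol)"
  by (intro mult_left_mono nn_integral_mono) (auto simp: indicator_def)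
 finally show ?thesis .
qed

lemma vol_to_chart:
 assumes b: "b \<in> B" and F: "F \<in> borel_measurable borel" and X: "X \<subseteq> K b"
  and supp: "!!x. x \<notin> ci b ` X ==> F x = 0" and [measurable]: "(%z. F (ci b z) * indicator X z) \<in> borel_measurable lborel"
 shows "(\<integral>\<^sup>+x. F x \<partial>vol) \<le> ennreal Mv * (\<integral>\<^sup>+z. F (ci b z) * indicator X z \<partial>lborel)"
proof -
 have "(\<integral>\<^sup>+x. F x \<partial>vol) = (\<integral>\<^sup>+x. F x * indicator (fst (cb b)) x \<partial>vol)"
 proof (rule nn_integral_cong)
  fix x
  have "ci b ` X \<subseteq> fst (cb b)" using X K_cdom[OF b] cdomD(2)[OF B(2)[OF b]] by blast
  then show "F x = F x * indicator (fst (cb b)) x" using supp[of x] by (cases "x \<in> fst (cb b)") auto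
 qed
 also have "... = (\<integral>\<^sup>+z. F (ci b z) * chart_density (cb b) z \<partial>lborel)" by (rule nn_integral_vol_chart[OF B(2)[OF b] F])
 also have "... \<le> (\<integral>\<^sup>+z. ennreal Mv * (F (ci b z) * indicator X z) \<partial>lborel)"
 proof (rule nn_integral_mono)
  fix z
  show "F (ci b z) * chart_density (cb b) z \<le> ennreal Mv * (F (ci b z) * indicator X z)"
  proof (cases "z \<in> X")
   case True
   then have "chart_density (cb b) z \<le> ennreal Mv"
    using dens(4)[OF b] X dens(2) by (auto simp: chart_density_def intro!: ennreal_leI)
   from mult_left_mono[OF this, of "F (ci b z)"] show ?thesis using True by (simp add: mult.commute)
  next
   case z: False
   show ?thesis
   proof (cases "z \<in> cimg (cb b)")
    case True
    have "ci b z \<notin> ci b ` X"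
    proof
     assume "ci b z \<in> ci b ` X"
     then obtain z' where z': "z' \<in> X" "ci b z = ci b z'" by blast
     then have "z' \<in> cimg (cb b)" using X K_cdom[OF b] cdomD(1)[OF B(2)[OF b]] by blast
     then have "z = z'" using chart_inv_right[OF B(2)[OF b]] True z'(2) by metis
     then show False using z z' by blast
    qed
    then show ?thesis using supp by simp
   qed (simp add: chart_density_def)
  qed
 qed
 finally show ?thesis by (simp add: nn_integral_cmult)
qed

text \<open>The squared norm of the (0,1)-derivative, measured in the holomorphic frame and
  coordinates of each ball of the cover; points in several balls count several times.\<close>

definition E where
 "E k v = (\<Sum>b\<in>B. wint (K b) (%z. dnorm2 (vb v b) z * hb k b z))"

definition N2 where "N2 k s = (\<integral>\<^sup>+x. ennreal (pn k s x) \<partial>vol)"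

end

text \<open>The data of a partition at small scale, with the scale hidden in two numbers:
  \<open>N\<close> bounds how many balls meet at a point, \<open>Bd\<close> the derivatives of the
  weights. The closed sets \<open>F j\<close> separate the supports from the boundaries of the
  balls, so that extension by zero stays C1. The weights add up to at least 1 and are normalised by
  division in \<open>glue\<close>.\<close>

locale gluing = covered_bundle A \<omega> L h \<theta> B cb ib zb rb mv Mv
 for A :: "('m::t2_space, 'n::finite) chart set" and \<omega> :: "('m, 'n, real) form2"
  and L :: "('m, 'i) line_bundle" and h :: "'i => 'm => real" and \<theta> :: "'i => ('m, 'n, complex) form1"
  and B :: "'b set" and cb :: "'b => ('m, 'n) chart" and ib :: "'b => 'i" and zb :: "'b => complex ^ 'n" and rb :: "'b => real"
  and mv Mv :: real +
 fixes k :: nat and J :: "'j set" and bb :: "'j => 'b" and pp :: "'j => complex ^ 'n" and \<rho> :: real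
  and \<psi> :: "'j => 'm => real" and F :: "'j => 'm set" and N :: nat and Bd :: real
 assumes J: "finite J" "!!j. j \<in> J ==> bb j \<in> B" "!!j. j \<in> J ==> ball (pp j) \<rho> \<subseteq> cball (zb (bb j)) (3 * rb (bb j))"
  and \<psi>: "!!j x. j \<in> J ==> \<psi> j x \<ge> 0" "!!j c. j \<in> J ==> c \<in> A ==> C1_on (cimg c) (%z. \<psi> j (chart_inv c z))"
   "!!x. (\<Sum>j\<in>J. \<psi> j x) \<ge> 1"
  and F: "!!j. j \<in> J ==> closed (F j)" "!!j. j \<in> J ==> F j \<subseteq> chart_inv (cb (bb j)) ` ball (pp j) \<rho>"
   "!!j x. j \<in> J ==> x \<notin> F j ==> \<psi> j x = 0"
  and N: "!!x. card {j\<in>J. x \<in> chart_inv (cb (bb j)) ` ball (pp j) \<rho>} \<le> N"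
  and Bd: "Bd \<ge> 0" "!!j b z l. j \<in> J ==> b \<in> B ==> z \<in> cball (zb b) (3 * rb b) ==>
    cmod (dbar (%z. of_real (\<psi> j (chart_inv (cb b) z))) z (axis l 1)) \<le> Bd"
begin

definition D where "D j = ci (bb j) ` ball (pp j) \<rho>"

text \<open>\<open>w j\<close> is a function of the coordinates \<open>cb (bb j)\<close> and a
  coefficient in the frame \<open>ib (bb j)\<close>; the k-th power of the transition function
  rewrites it in the frame \<open>i\<close>.\<close>

definition ext where
 "ext w j i x = (if x \<in> D j \<inter> dom i then g i (ib (bb j)) x ^ k * w j (snd (cb (bb j)) x) else 0)"

definition glue where "glue w i x = (\<Sum>j\<in>J. of_real (\<psi> j x) * ext w j i x) / of_real (\<Sum>j\<in>J. \<psi> j x)"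

lemma D_sub:
 assumes j: "j \<in> J" and x: "x \<in> D j"
 shows "x \<in> fst (cb (bb j))" "x \<in> dom (ib (bb j))" "snd (cb (bb j)) x \<in> ball (pp j) \<rho>" "ci (bb j) (snd (cb (bb j)) x) = x"
proof -
 note c = B(2)[OF J(2)[OF j]]
 obtain z where z: "z \<in> ball (pp j) \<rho>" "x = ci (bb j) z" using x unfolding D_def by blast
 then have zc: "z \<in> cdom (cb (bb j)) (ib (bb j))" using J(3)[OF j] K_cdom[OF J(2)[OF j]] by blast
 note zD = cdomD[OF c zc]
 show "x \<in> fst (cb (bb j))" "x \<in> dom (ib (bb j))" "snd (cb (bb j)) x \<in> ball (pp j) \<rho>" "ci (bb j) (snd (cb (bb j)) x) = x"
  using z zD by auto
qed

lemma D_image: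
 assumes j: "j \<in> J"
 shows "ball (pp j) \<rho> \<subseteq> cdom (cb (bb j)) (ib (bb j))" "z \<in> ball (pp j) \<rho> ==> ci (bb j) z \<in> D j"
 using J(3)[OF j] K_cdom[OF J(2)[OF j]] unfolding D_def by blast+

lemma D_open:
 assumes j: "j \<in> J" shows "open (D j)"
proof -
 note c = B(2)[OF J(2)[OF j]]
 have "D j = fst (cb (bb j)) \<inter> snd (cb (bb j)) -` ball (pp j) \<rho>"
 proof (intro equalityI subsetI)
  fix x assume "x \<in> D j"
  then show "x \<in> fst (cb (bb j)) \<inter> snd (cb (bb j)) -` ball (pp j) \<rho>" using D_sub[OF j] by blast
 next
  fix x assume "x \<in> fst (cb (bb j)) \<inter> snd (cb (bb j)) -` ball (pp j) \<rho>"
  then show "x \<in> D j" unfolding D_def using chart_inv_left[OF c, of x] by (metis IntD1 IntD2 image_eqI vimage_eq)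
 qed
 then show ?thesis
  using continuous_open_preimage[OF chart_continuous[OF c] chartD(1)[OF c] open_ball] by simp
qed

lemma ext_sec:
 assumes j: "j \<in> J" shows "sec k (ext w j)"
proof (rule secI)
 fix i i' x assume x: "x \<in> dom i" "x \<in> dom i'"
 show "ext w j i x = g i i' x ^ k * ext w j i' x"
 proof (cases "x \<in> D j")
  case True
  then have "g i i' x * g i' (ib (bb j)) x = g i (ib (bb j)) x" by (intro g_cocycle x D_sub(2)[OF j])
  then show ?thesis using True x by (simp add: ext_def flip: power_mult_distrib mult.assoc)
 qed (simp add: ext_def)
qed (simp add: ext_def)

lemma ext_own:
 assumes j: "j \<in> J" and x: "x \<in> D j"
 shows "ext w j (ib (bb j)) x = w j (snd (cb (bb j)) x)"
 using D_sub(2)[OF j x] x by (simp add: ext_def g_id)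

lemma ext_holo:
 assumes j: "j \<in> J" and c: "c \<in> A" and w: "holo_on (ball (pp j) \<rho>) (w j)"
 shows "holo_on (snd c ` (fst c \<inter> (D j \<inter> dom i))) (%z. ext w j i (chart_inv c z))"
proof -
 let ?i = "ib (bb j)" and ?d = "cb (bb j)"
 let ?W = "fst c \<inter> (D j \<inter> dom i)"
 have o: "open (snd c ` ?W)" by (rule open_chart_image[OF c open_Int[OF D_open[OF j] dom_open]])
 have "holo_on (snd c ` ?W) (g i ?i \<circ> chart_inv c)"
  by (rule holo_on_subset[OF g_holo[OF c]]) (use D_sub(2)[OF j] in blast)
 then have 1: "holo_on (snd c ` ?W) (%z. g i ?i (chart_inv c z) ^ k)"
  by (intro holo_on_compose_field[where f="%x. x ^ k" and f'="%z. of_nat k * g i ?i (chart_inv c z) ^ (k - 1)"])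
    (auto intro!: derivative_eq_intros simp: comp_def)
 have 2: "holo_on (snd c ` ?W) (%z. w j (snd ?d (chart_inv c z)))"
  by (rule transition_holo[OF c B(2)[OF J(2)[OF j]] w]) (use D_sub[OF j] in auto)
 show ?thesis
  by (rule holo_on_cong[OF o holo_on_mult[OF 1 2]]) (auto simp: ext_def chart_inv_left[OF c])
qed

lemma \<psi>_outside: "j \<in> J ==> x \<notin> D j ==> \<psi> j x = 0"
 using F(2,3) unfolding D_def by blast

text \<open>Off \<open>F j\<close> the product is zero, and on \<open>D j\<close> it is a C1
  function times a holomorphic one. These two open sets cover the frame domain because
  \<open>F j\<close> is a closed subset of \<open>D j\<close>.\<close>

lemma product_C1:
 fixes i :: 'i
 assumes j: "j \<in> J" and c: "c \<in> A" and w: "holo_on (ball (pp j) \<rho>) (w j)"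
 defines "Y == %z. of_real (\<psi> j (chart_inv c z)) * ext w j i (chart_inv c z)"
 shows "C1_on (cdom c i) Y"
  and "z \<in> cdom c i ==> dbar Y z u = dbar (%z. of_real (\<psi> j (chart_inv c z))) z u * ext w j i (chart_inv c z)"
proof -
 let ?p = "%z. complex_of_real (\<psi> j (chart_inv c z))"
 let ?a = "fst c \<inter> (dom i - F j)"
 let ?b = "fst c \<inter> (D j \<inter> dom i)"
 have cov: "z \<in> snd c ` ?b \<or> z \<in> snd c ` ?a" if "z \<in> cdom c i" for z
  using that F(2)[OF j] unfolding D_def by blast
 have o: "open (snd c ` ?b)" "open (snd c ` ?a)"
  by (intro open_chart_image[OF c] open_Int D_open[OF j] dom_open open_Diff F(1)[OF j])+
 have p: "C1_on S ?p" if "S \<subseteq> cimg c" for S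
  by (intro C1_on_of_real C1_on_subset[OF \<psi>(2)[OF j c] that])
 note hol = ext_holo[where w=w and i=i, OF j c w]
 have zero: "?p y = 0" "Y y = 0" if "y \<in> snd c ` ?a" for y
 proof -
  have "chart_inv c y \<notin> F j" using that chart_inv_left[OF c] by auto
  then show "?p y = 0" "Y y = 0" using F(3)[OF j] by (simp_all add: Y_def)
 qed
 show "C1_on (cdom c i) Y"
 proof (rule C1_on_local)
  fix z assume z: "z \<in> cdom c i"
  have "C1_on (snd c ` ?b) Y"
   unfolding Y_def by (intro C1_on_mult p holo_on_imp_C1_on[OF o(1) hol]) blast
  moreover have "C1_on (snd c ` ?a) Y"
   by (rule C1_on_cong[OF o(2) C1_on_const[of _ 0]]) (simp add: zero(2))
  ultimately show "\<exists>U. open U \<and> z \<in> U \<and> C1_on (U \<inter> cdom c i) Y"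
   using cov[OF z] o C1_on_subset[OF _ Int_lower1] by metis
 qed
 assume z: "z \<in> cdom c i"
 show "dbar Y z u = dbar ?p z u * ext w j i (chart_inv c z)"
 proof (cases "z \<in> snd c ` ?b")
  case True
  have "(%z. ext w j i (chart_inv c z)) differentiable (at z)" "dbar (%z. ext w j i (chart_inv c z)) z u = 0"
   using hol True by (auto simp: holo_on_iff_dbar)
  moreover have "?p differentiable (at z)" using p[of "cimg c"] z by (auto simp: C1_on_def)
  ultimately show ?thesis unfolding Y_def by (subst dbar_mult) auto
 next
  case False
  then have z2: "z \<in> snd c ` ?a" using cov[OF z] by blast
  have "dbar Y z u = dbar (%_. 0) z u" by (rule dbar_cong_open[OF o(2) z2]) (simp add: zero(2))
  moreover have "dbar ?p z u = dbar (%_. 0) z u" by (rule dbar_cong_open[OF o(2) z2]) (simp add: zero(1))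
  ultimately show ?thesis by simp
 qed
qed

lemma
 assumes w: "!!j. j \<in> J ==> holo_on (ball (pp j) \<rho>) (w j)"
 shows glue_C1sec: "C1sec k (glue w)"
  and glue_dbar: "c \<in> A ==> z \<in> cdom c i ==> dbar (%z. glue w i (chart_inv c z)) z u =
   (\<Sum>j\<in>J. dbar (%z. of_real (\<psi> j (chart_inv c z))) z u * (ext w j i (chart_inv c z) - glue w i (chart_inv c z))) /
   of_real (\<Sum>j\<in>J. \<psi> j (chart_inv c z))"
proof -
 have "sec k (%i x. inverse (of_real (\<Sum>j\<in>J. \<psi> j x)) * (\<Sum>j\<in>J. of_real (\<psi> j x) * ext w j i x))"
  by (intro sec_mult sec_sum ext_sec)
 then have "sec k (glue w)" unfolding glue_def[abs_def] divide_inverse by (simp only: mult.commute)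
 moreover have G: "C1_on (cdom c i) (%z. glue w i (chart_inv c z))"
  "z \<in> cdom c i ==> dbar (%z. glue w i (chart_inv c z)) z u =
   (\<Sum>j\<in>J. dbar (%z. of_real (\<psi> j (chart_inv c z))) z u * (ext w j i (chart_inv c z) - glue w i (chart_inv c z))) /
   of_real (\<Sum>j\<in>J. \<psi> j (chart_inv c z))" if c: "c \<in> A" for c i z u
 proof -
  have \<psi>C: "C1_on (cdom c i) (%z. \<psi> j (chart_inv c z))" if "j \<in> J" for j
   by (rule C1_on_subset[OF \<psi>(2)[OF that c]]) blast
  note gl = glue_C1[of "cdom c i" J "%j z. \<psi> j (chart_inv c z)" "%j z. ext w j i (chart_inv c z)" "%z. glue w i (chart_inv c z)",
   OF cdom_open[OF c] \<psi>C \<psi>(3) product_C1(1)[where w=w, OF _ c w] product_C1(2)[where w=w, OF _ c w] glue_def]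
  show "C1_on (cdom c i) (%z. glue w i (chart_inv c z))" by (rule gl(1))
  show "z \<in> cdom c i ==> dbar (%z. glue w i (chart_inv c z)) z u =
   (\<Sum>j\<in>J. dbar (%z. of_real (\<psi> j (chart_inv c z))) z u * (ext w j i (chart_inv c z) - glue w i (chart_inv c z))) /
   of_real (\<Sum>j\<in>J. \<psi> j (chart_inv c z))" by (rule gl(2))
 qed
 ultimately show "C1sec k (glue w)" unfolding C1sec_def by blast
 show "c \<in> A ==> z \<in> cdom c i ==> dbar (%z. glue w i (chart_inv c z)) z u =
   (\<Sum>j\<in>J. dbar (%z. of_real (\<psi> j (chart_inv c z))) z u * (ext w j i (chart_inv c z) - glue w i (chart_inv c z))) /
   of_real (\<Sum>j\<in>J. \<psi> j (chart_inv c z))" by (rule G(2))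
qed

end

section \<open>Norm and energy of a glued section\<close>

lemma nn_integral_zero_continuous:
 fixes f :: "'a::euclidean_space => real"
 assumes S: "open S" and f: "continuous_on S f" and 0: "wint S f = 0" and z: "z \<in> S"
 shows "f z \<le> 0"
proof (rule ccontr)
 assume "\<not> f z \<le> 0"
 moreover have "open (S \<inter> f -` {0<..})" by (rule continuous_open_preimage[OF f S]) simp
 ultimately obtain e where e: "e > 0" "ball z e \<subseteq> S \<inter> f -` {0<..}"
  using z by (metis IntI greaterThan_iff not_le open_contains_ball vimageI)
 have "AE z in lborel. ennreal (f z) * indicator S z = 0"
  using 0 weighted_measurable[OF borel_open[OF S] f] by (subst (asm) nn_integral_0_iff_AE) auto
 then have "AE z' in lborel. z' \<notin> ball z e"
  by eventually_elim (use e(2) in \<open>auto simp: indicator_def subset_iff split: if_splits\<close>)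
 then have "emeasure lborel (ball z e) = 0" by (subst (asm) AE_iff_measurable[of "ball z e"]) auto
 then show False using e(1) less_imp_neq[OF unit_ball_vol_pos[of "real DIM('a)"]] by (simp add: emeasure_ball)
qed

context hermitian_bundle
begin

lemma pn_add_le:
 "pn k (s +. t) x \<le> 2 * pn k s x + 2 * pn k t x"
proof -
 have "h (fr x) x ^ k * (cmod (s (fr x) x + t (fr x) x))\<^sup>2 \<le> h (fr x) x ^ k * (2 * (cmod (s (fr x) x))\<^sup>2 + 2 * (cmod (t (fr x) x))\<^sup>2)"
  using h_pos[OF fr, of x] by (intro mult_left_mono norm_sum_square_le) simp
 then show ?thesis by (simp add: pn_def distrib_left mult.left_commute)
qed

lemma pn_minus_commute: "pn k (s -. t) x = pn k (t -. s) x"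
 by (simp add: pn_def norm_minus_commute)

end

context gluing
begin

abbreviation dev where "dev v w j z == (norm (vb v (bb j) z - w j z))\<^sup>2 * hb k (bb j) z"

definition er where "er w v j x = ennreal (pn k (ext w j -. v) x) * indicator (D j) x"

definition err where "err w v = (\<Sum>j\<in>J. \<integral>\<^sup>+x. er w v j x \<partial>vol)"

lemma ext_continuous:
 assumes j: "j \<in> J" and w: "holo_on (ball (pp j) \<rho>) (w j)"
 shows "continuous_on (D j \<inter> dom i) (ext w j i)"
 by (rule continuous_on_charts[OF open_Int[OF D_open[OF j] dom_open]])
   (rule holo_on_cont[OF ext_holo[where w=w, OF j _ w]])

lemma er_measurable:
 assumes j: "j \<in> J" and w: "holo_on (ball (pp j) \<rho>) (w j)" and v: "C1sec k v"
 shows "er w v j \<in> borel_measurable borel"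
 unfolding er_def[abs_def]
proof (rule weighted_measurable[OF borel_open[OF D_open[OF j]]])
 show "continuous_on (D j) (pn k (ext w j -. v))"
  by (rule pn_continuous[OF D_open[OF j] sec_diff[OF ext_sec[OF j] C1secD(1)[OF v]]])
    (intro continuous_on_diff ext_continuous[where w=w, OF j w] continuous_on_subset[OF C1secD(3)[OF v]] Int_lower2)
qed

lemma sum_er: "(\<Sum>j\<in>J. er w v j x) = ennreal (\<Sum>j | j \<in> J \<and> x \<in> D j. h (fr x) x ^ k * (cmod (ext w j (fr x) x - v (fr x) x))\<^sup>2)"
proof -
 have "(\<Sum>j\<in>J. er w v j x) = (\<Sum>j | j \<in> J \<and> x \<in> D j. er w v j x)"
  by (rule sum.mono_neutral_right) (use J(1) in \<open>auto simp: er_def\<close>)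
 also have "... = (\<Sum>j | j \<in> J \<and> x \<in> D j. ennreal (h (fr x) x ^ k * (cmod (ext w j (fr x) x - v (fr x) x))\<^sup>2))"
  by (intro sum.cong) (auto simp: er_def pn_def)
 finally show ?thesis using h_pos[OF fr, of x] by (subst (asm) sum_ennreal) auto
qed

lemma sum_er_frame:
 assumes v: "sec k v" and x: "x \<in> dom i"
 shows "(\<Sum>j\<in>J. er w v j x) = ennreal (h i x ^ k * (\<Sum>j | j \<in> J \<and> x \<in> D j. (cmod (ext w j i x - v i x))\<^sup>2))"
proof -
 have "h (fr x) x ^ k * (cmod (ext w j (fr x) x - v (fr x) x))\<^sup>2 = h i x ^ k * (cmod (ext w j i x - v i x))\<^sup>2"
  if "j \<in> J" for j
  using pn_frame[OF sec_diff[OF ext_sec[OF that] v] x] unfolding pn_def .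
 then have "(\<Sum>j | j \<in> J \<and> x \<in> D j. h (fr x) x ^ k * (cmod (ext w j (fr x) x - v (fr x) x))\<^sup>2) =
   (\<Sum>j | j \<in> J \<and> x \<in> D j. h i x ^ k * (cmod (ext w j i x - v i x))\<^sup>2)" by (intro sum.cong) auto
 then show ?thesis unfolding sum_er by (simp add: sum_distrib_left)
qed

lemma glue_distance: "ennreal (pn k (glue w -. v) x) \<le> (\<Sum>j\<in>J. er w v j x)"
proof -
 let ?a = "\<Sum>j | j \<in> J \<and> x \<in> D j. (cmod (ext w j (fr x) x - v (fr x) x))\<^sup>2"
 have "(cmod (glue w (fr x) x - v (fr x) x))\<^sup>2 \<le> ?a"
  unfolding glue_def by (rule weighted_mean_dist[OF J(1) _ \<psi>(1) _ \<psi>(3)]) (auto intro: \<psi>_outside)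
 then have "h (fr x) x ^ k * (cmod (glue w (fr x) x - v (fr x) x))\<^sup>2 \<le> h (fr x) x ^ k * ?a"
  using h_pos[OF fr, of x] by (intro mult_left_mono) auto
 then show ?thesis unfolding sum_er pn_def sum_distrib_left by (rule ennreal_leI)
qed

lemma dbar_\<psi>_outside:
 assumes j: "j \<in> J" and c: "c \<in> A" and z: "z \<in> cimg c" "chart_inv c z \<notin> D j"
 shows "dbar (%z. of_real (\<psi> j (chart_inv c z))) z u = 0"
proof -
 have o: "open (snd c ` (fst c \<inter> - F j))" by (rule open_chart_image[OF c open_Compl[OF F(1)[OF j]]])
 have "chart_inv c z \<notin> F j" using z(2) F(2)[OF j] unfolding D_def by blast
 then have "z \<in> snd c ` (fst c \<inter> - F j)" using chart_inv_right[OF c z(1)] by (metis ComplI IntI image_eqI)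
 then have "dbar (%z. complex_of_real (\<psi> j (chart_inv c z))) z u = dbar (%_. 0) z u"
  by (rule dbar_cong_open[OF o]) (use F(3)[OF j] chart_inv_left[OF c] in auto)
 then show ?thesis by simp
qed

text \<open>The local sections are holomorphic, so the derivative falls on the weights alone; at
  most \<open>N\<close> of them matter at a point, each with derivative at most \<open>Bd\<close>.
  Thus distances of the local sections from \<open>v\<close> control the energy of the glued
  section.\<close>

lemma glue_dnorm2:
 assumes w: "!!j. j \<in> J ==> holo_on (ball (pp j) \<rho>) (w j)" and v: "sec k v" and b: "b \<in> B" and z: "z \<in> K b"
 shows "ennreal (dnorm2 (vb (glue w) b) z * hb k b z) \<le>
  ennreal (real CARD('n) * (4 * (real N)\<^sup>2 * Bd\<^sup>2)) * (\<Sum>j\<in>J. er w v j (ci b z))"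
proof -
 note c = B(2)[OF b] and zc = K_cdom[OF b z]
 note zD = cdomD[OF c zc]
 let ?x = "ci b z" and ?i = "ib b"
 let ?S = "\<Sum>j | j \<in> J \<and> ?x \<in> D j. (cmod (ext w j ?i ?x - v ?i ?x))\<^sup>2"
 have dbg: "dbar (vb (glue w) b) z u = (\<Sum>j\<in>J. dbar (%z. of_real (\<psi> j (ci b z))) z u * (ext w j ?i ?x - glue w ?i ?x)) /
   of_real (\<Sum>j\<in>J. \<psi> j ?x)" for u
  by (rule glue_dbar[where w=w, OF w c zc])
 have "(cmod (dbar (vb (glue w) b) z (axis l 1)))\<^sup>2 \<le> 4 * (real N)\<^sup>2 * Bd\<^sup>2 * ?S" for l
  unfolding dbg unfolding glue_def[of w "?i" ?x]
 proof (rule weighted_mean_bound(2)[OF J(1) _ \<psi>(1) _ \<psi>(3)])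
  show "card {j \<in> J. ?x \<in> D j} \<le> N" using N unfolding D_def by blast
 qed (use Bd(1) Bd(2)[OF _ b z] dbar_\<psi>_outside[OF _ c zD(1)] \<psi>_outside in auto)
 then have "dnorm2 (vb (glue w) b) z \<le> (\<Sum>l\<in>(UNIV :: 'n set). 4 * (real N)\<^sup>2 * Bd\<^sup>2 * ?S)"
  unfolding dnorm2_def by (intro sum_mono)
 then have "dnorm2 (vb (glue w) b) z * hb k b z \<le> (real CARD('n) * (4 * (real N)\<^sup>2 * Bd\<^sup>2 * ?S)) * hb k b z"
  using h_pos[OF zD(3)] by (intro mult_right_mono) auto
 then have "ennreal (dnorm2 (vb (glue w) b) z * hb k b z) \<le> ennreal ((real CARD('n) * (4 * (real N)\<^sup>2 * Bd\<^sup>2)) * (hb k b z * ?S))"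
  by (intro ennreal_leI) (simp add: mult_ac)
 also have "... = ennreal (real CARD('n) * (4 * (real N)\<^sup>2 * Bd\<^sup>2)) * ennreal (hb k b z * ?S)"
  by (rule ennreal_mult') simp
 finally show ?thesis unfolding sum_er_frame[OF v zD(3)] .
qed

lemma err_integral:
 assumes w: "!!j. j \<in> J ==> holo_on (ball (pp j) \<rho>) (w j)" and v: "C1sec k v"
 shows "err w v = (\<integral>\<^sup>+x. (\<Sum>j\<in>J. er w v j x) \<partial>vol)"
 unfolding err_def by (rule nn_integral_sum[symmetric]) (use er_measurable[where w=w, OF _ w v] in simp)

lemma glue_N2:
 assumes w: "!!j. j \<in> J ==> holo_on (ball (pp j) \<rho>) (w j)" and v: "C1sec k v"
 shows "N2 k (glue w -. v) \<le> err w v"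
proof -
 have "err w v = (\<integral>\<^sup>+x. (\<Sum>j\<in>J. er w v j x) \<partial>vol)" by (rule err_integral[OF w v])
 then show ?thesis unfolding N2_def by (simp add: nn_integral_mono glue_distance)
qed

lemma glue_E:
 assumes w: "!!j. j \<in> J ==> holo_on (ball (pp j) \<rho>) (w j)" and v: "C1sec k v"
 shows "E k (glue w) \<le> ennreal (real (card B) * (real CARD('n) * (4 * (real N)\<^sup>2 * Bd\<^sup>2)) / mv) * err w v"
proof -
 let ?C = "real CARD('n) * (4 * (real N)\<^sup>2 * Bd\<^sup>2)"
 have [measurable]: "(%x. \<Sum>j\<in>J. er w v j x) \<in> borel_measurable borel"
  by (intro borel_measurable_sum er_measurable[where w=w, OF _ w v])
 have "wint (K b) (%z. dnorm2 (vb (glue w) b) z * hb k b z) \<le> ennreal (1 / mv) * (ennreal ?C * err w v)"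
  if b: "b \<in> B" for b
 proof -
  let ?a = "\<integral>\<^sup>+x. ennreal ?C * (\<Sum>j\<in>J. er w v j x) \<partial>vol"
  have "wint (K b) (%z. dnorm2 (vb (glue w) b) z * hb k b z) \<le>
   (\<integral>\<^sup>+z. (%x. ennreal ?C * (\<Sum>j\<in>J. er w v j x)) (ci b z) * indicator (K b) z \<partial>lborel)"
   using glue_dnorm2[where w=w, OF w C1secD(1)[OF v] b] by (intro nn_integral_mono) (auto simp: indicator_def)
  also have "... \<le> ennreal (1 / mv) * ?a"
   by (rule chart_to_vol[OF b]) measurable
  also have "?a = ennreal ?C * err w v"
  proof -
   have "err w v = (\<integral>\<^sup>+x. (\<Sum>j\<in>J. er w v j x) \<partial>vol)" by (rule err_integral[OF w v])
   then show ?thesis by (simp add: nn_integral_cmult)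
  qed
  finally show ?thesis .
 qed
 then have "E k (glue w) \<le> (\<Sum>b\<in>B. ennreal (1 / mv) * (ennreal ?C * err w v))"
  unfolding E_def by (rule sum_mono)
 also have "... = (ennreal (real (card B)) * ennreal (1 / mv) * ennreal ?C) * err w v"
  by (simp add: mult.assoc ennreal_of_nat_eq_real_of_nat)
 also have "ennreal (real (card B)) * ennreal (1 / mv) * ennreal ?C = ennreal (real (card B) * ?C / mv)"
  using dens(1) by (simp flip: ennreal_mult)
 finally show ?thesis .
qed

lemma er_chart:
 assumes j: "j \<in> J" and w: "holo_on (ball (pp j) \<rho>) (w j)" and v: "C1sec k v" and z: "z \<in> ball (pp j) \<rho>"
 shows "er w v j (ci (bb j) z) = ennreal (dev v w j z)"
proof -
 have c: "z \<in> cdom (cb (bb j)) (ib (bb j))" and zD: "ci (bb j) z \<in> D j" using D_image[OF j] z by auto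
 note zc = cdomD[OF B(2)[OF J(2)[OF j]] c]
 show ?thesis
  using zD unfolding er_def pn_frame[OF sec_diff[OF ext_sec[OF j] C1secD(1)[OF v]] zc(3)] ext_own[OF j zD] zc(4)
  by (simp add: norm_minus_commute mult.commute)
qed

lemma weight_measurable:
 assumes j: "j \<in> J" and w: "continuous_on (ball (pp j) \<rho>) (w j)" and v: "C1sec k v"
 shows "continuous_on (ball (pp j) \<rho>) (dev v w j)"
proof -
 note c = B(2)[OF J(2)[OF j]]
 show ?thesis
  by (intro continuous_intros w continuous_on_subset[OF C1_on_cont[OF C1secD(2)[OF v c]] D_image(1)[OF j]]
    continuous_on_subset[OF C1_on_cont[OF h_C1[OF c]] D_image(1)[OF j]])
qed

lemma err_le:
 assumes w: "!!j. j \<in> J ==> holo_on (ball (pp j) \<rho>) (w j)" and v: "C1sec k v"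
 shows "err w v \<le> ennreal Mv * (\<Sum>j\<in>J. wint (ball (pp j) \<rho>) (dev v w j))"
 unfolding err_def sum_distrib_left
proof (rule sum_mono)
 fix j assume j: "j \<in> J"
 let ?a = "%z. er w v j (ci (bb j) z) * indicator (ball (pp j) \<rho>) z"
 have eq: "?a =
  (%z. ennreal (dev v w j z) * indicator (ball (pp j) \<rho>) z)"
  using er_chart[where w=w, OF j w[OF j] v] by (auto simp: fun_eq_iff indicator_def)
 have "(\<integral>\<^sup>+x. er w v j x \<partial>vol) \<le> ennreal Mv * (\<integral>\<^sup>+z. er w v j (ci (bb j) z) * indicator (ball (pp j) \<rho>) z \<partial>lborel)"
 proof (rule vol_to_chart[OF J(2)[OF j] er_measurable[where w=w, OF j w[OF j] v] J(3)[OF j]])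
  show "?a \<in> borel_measurable lborel"
   unfolding eq using weighted_measurable[OF borel_open[OF open_ball] weight_measurable[where w=w, OF j holo_on_cont[OF w[OF j]] v]] by simp
 qed (simp add: er_def D_def)
 then show "(\<integral>\<^sup>+x. er w v j x \<partial>vol) \<le> ennreal Mv * wint (ball (pp j) \<rho>) (dev v w j)"
  unfolding eq .
qed

end

section \<open>Limits of glued sections and the contraction argument\<close>

lemma nn_integral_tendsto_le:
 fixes u :: "nat => 'a => ennreal"
 assumes "!!m. u m \<in> borel_measurable M" "!!x. (%m. u m x) \<longlonglongrightarrow> f x" "!!m. (\<integral>\<^sup>+x. u m x \<partial>M) \<le> c m" "c \<longlonglongrightarrow> l"
 shows "(\<integral>\<^sup>+x. f x \<partial>M) \<le> l"
proof -
 have "(\<integral>\<^sup>+x. f x \<partial>M) = (\<integral>\<^sup>+x. liminf (%m. u m x) \<partial>M)"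
  by (intro nn_integral_cong lim_imp_Liminf[symmetric] assms(2)) simp
 also have "... \<le> liminf (%m. \<integral>\<^sup>+x. u m x \<partial>M)" by (rule nn_integral_liminf[OF assms(1)])
 also have "... \<le> liminf c" by (rule Liminf_mono) (simp add: assms(3))
 also have "... = l" by (rule lim_imp_Liminf[OF _ assms(4)]) simp
 finally show ?thesis .
qed

context hermitian_bundle
begin

text \<open>Repeated use of \<open>|a + b|\<^sup>2 \<le> 2 |a|\<^sup>2 + 2 |b|\<^sup>2\<close>. The
  growing weights are harmless against squared differences that decay like
  \<open>4 ^ -j\<close>.\<close>

lemma pn_telescope:
 "pn k (v 0 -. v m) x \<le> (\<Sum>j<m. 2 ^ Suc j * pn k (v (Suc j) -. v j) x)"
proof (induction m arbitrary: v)
 case 0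
 show ?case by (simp add: pn_def)
next
 case (Suc m)
 have "pn k (v 0 -. v (Suc m)) x = pn k (%i x. (v 0 i x - v 1 i x) + (v 1 i x - v (Suc m) i x)) x" by simp
 also have "... \<le> 2 * pn k (v 0 -. v 1) x + 2 * pn k (v 1 -. v (Suc m)) x"
  by (rule pn_add_le)
 also have "pn k (v 1 -. v (Suc m)) x \<le> (\<Sum>j<m. 2 ^ Suc j * pn k (v (Suc (Suc j)) -. v (Suc j)) x)"
  using Suc[of "%j. v (Suc j)"] by simp
 finally show ?case
  unfolding sum.lessThan_Suc_shift by (simp add: pn_minus_commute[of k "v 0"] sum_distrib_left mult.assoc)
qed

end

context covered_bundle
begin

text \<open>The bound depends on \<open>k\<close>; it serves convergence arguments at a fixed
  \<open>k\<close> and enters no uniform constant.\<close>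

lemma weight_lower_bound:
 obtains c where "c > 0" "!!b z. b \<in> B ==> z \<in> K b ==> hb k b z \<ge> c"
proof -
 have p: "hb k b z > 0" if "b \<in> B" "z \<in> K b" for b z
  using h_pos[OF cdomD(3)[OF B(2)[OF that(1)] K_cdom[OF that]]] by simp
 have "continuous_on (K b) (%z. 1 / hb k b z)" if b: "b \<in> B" for b
  by (intro continuous_intros continuous_on_subset[OF C1_on_cont[OF h_C1[OF B(2)[OF b]]] B(4)[OF b]])
    (use p[OF b] less_irrefl in metis)
 then obtain M where M: "M > 0" "!!b z. b \<in> B ==> z \<in> K b ==> 1 / hb k b z \<le> M"
  using bounded_on_compacts[where X=K and f="%b z. 1 / hb k b z", OF B(1) compact_cball] by blast
 show ?thesis by (rule that[of "1 / M"]) (use M p in \<open>auto simp: field_simps\<close>)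
qed

end

context gluing
begin

lemma N2_measurable: "C1sec k s ==> (%x. ennreal (pn k s x)) \<in> borel_measurable borel"
proof -
 assume s: "C1sec k s"
 have "continuous_on UNIV (pn k s)"
  by (rule pn_continuous[OF open_UNIV C1secD(1)[OF s]]) (simp add: C1secD(3)[OF s])
 from weighted_measurable[OF borel_open[OF open_UNIV] this] show ?thesis by simp
qed

lemma in_chart:
 assumes j: "j \<in> J" and G: "G \<in> borel_measurable borel" "(\<integral>\<^sup>+x. G x \<partial>vol) \<le> ennreal X" "X \<ge> 0"
  and f: "!!z. z \<in> ball (pp j) \<rho> ==> ennreal (f z) \<le> G (ci (bb j) z)"
 shows "wint (ball (pp j) \<rho>) f \<le> ennreal (1 / mv * X)"
proof -
 have "wint (ball (pp j) \<rho>) f \<le> (\<integral>\<^sup>+z. G (ci (bb j) z) * indicator (K (bb j)) z \<partial>lborel)"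
  using f J(3)[OF j] by (intro nn_integral_mono) (auto simp: indicator_def)
 also have "... \<le> ennreal (1 / mv) * (\<integral>\<^sup>+x. G x \<partial>vol)" by (rule chart_to_vol[OF J(2)[OF j] G(1)])
 also have "... \<le> ennreal (1 / mv) * ennreal X" by (intro mult_left_mono G) simp
 finally show ?thesis using G(3) dens(1) by (simp only: ennreal_mult[symmetric] divide_nonneg_pos less_imp_le zero_le_one)
qed

lemma pn_chart:
 assumes s: "sec k s" and j: "j \<in> J" and z: "z \<in> ball (pp j) \<rho>"
 shows "pn k s (ci (bb j) z) = (norm (vb s (bb j) z))\<^sup>2 * hb k (bb j) z"
 using pn_frame[OF s cdomD(3)[OF B(2)[OF J(2)[OF j]]], of z "ib (bb j)"] D_image(1)[OF j] z
 by (simp add: subset_iff mult.commute)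

text \<open>The local functions stay close to \<open>v m\<close>, hence form a Cauchy sequence in L2
  and converge to holomorphic functions \<open>W j\<close>; the limit of the sections agrees with
  these locally. The shift \<open>d\<close> is 1 for the iteration and 0 for sequences that are
  holomorphic from the start.\<close>

lemma glue_limit:
 fixes w :: "nat => 'j => complex ^ 'n => complex"
 assumes w: "!!m j. j \<in> J ==> holo_on (ball (pp j) \<rho>) (w m j)" and v: "!!m. C1sec k (v m)" and C: "C \<ge> 0"
  and step: "!!m. N2 k (v (Suc m) -. v m) \<le> ennreal (C / 4 ^ m)"
  and close: "!!m j. j \<in> J ==> (\<integral>\<^sup>+x. er (w m) (v m) j x \<partial>vol) \<le> ennreal (C / 4 ^ m)"
  and glue: "!!m. glue (w m) = v (m + d)"
 obtains t where "t \<in> H0 k" "!!i x. (%m. v m i x) \<longlonglongrightarrow> t i x"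
proof -
 obtain h0 where h0: "h0 > 0" "!!b z. b \<in> B ==> z \<in> K b ==> hb k b z \<ge> h0"
  using weight_lower_bound[of k] by blast
 have em [measurable]: "er (w m) (v m) j \<in> borel_measurable borel" if "j \<in> J" for m j
  by (rule er_measurable[where w="w m", OF that w[OF that] v])
 \<comment> \<open>The way from \<open>w m j\<close> to \<open>w (Suc m) j\<close> through
   \<open>v m\<close> and \<open>v (Suc m)\<close> gives three terms with a factor 4 each; division
   by \<open>h0\<close> removes the weight.\<close>
 have cauchy: "wint (ball (pp j) \<rho>) (%z. (norm (w (Suc m) j z - w m j z))\<^sup>2) \<le> ennreal (1 / mv * (12 / h0 * C) / 4 ^ m)"
  if j: "j \<in> J" for m j
 proof -
  let ?P = "%x. ennreal (pn k (v (Suc m) -. v m) x)"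
  let ?G = "%x. ennreal (4 / h0) * (er (w (Suc m)) (v (Suc m)) j x + (?P x + er (w m) (v m) j x))"
  have vC: "C1sec k (v (Suc m) -. v m)" by (intro C1sec_diff v)
  have [measurable]: "?P \<in> borel_measurable borel" by (rule N2_measurable[OF vC])
  note [measurable] = em[OF j]
  have "C / 4 ^ Suc m \<le> C / 4 ^ m" using C by (intro divide_left_mono) auto
  then have "(\<integral>\<^sup>+x. er (w (Suc m)) (v (Suc m)) j x \<partial>vol) \<le> ennreal (C / 4 ^ m)"
   using close[OF j, of "Suc m"] order_trans ennreal_leI by blast
  then have "(\<integral>\<^sup>+x. ?G x \<partial>vol) \<le> ennreal (4 / h0) * (ennreal (C / 4 ^ m) + (ennreal (C / 4 ^ m) + ennreal (C / 4 ^ m)))"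
   using step[of m] close[OF j, of m] by (simp add: nn_integral_cmult nn_integral_add N2_def[symmetric] mult_left_mono add_mono)
  also have "... = ennreal (12 / h0 * C / 4 ^ m)" using C h0(1) by (simp flip: ennreal_mult ennreal_plus)
  finally have G: "(\<integral>\<^sup>+x. ?G x \<partial>vol) \<le> ennreal (12 / h0 * C / 4 ^ m)" .
  have "wint (ball (pp j) \<rho>) (%z. (norm (w (Suc m) j z - w m j z))\<^sup>2) \<le> ennreal (1 / mv * (12 / h0 * C / 4 ^ m))"
  proof (rule in_chart[OF j _ G])
   fix z assume z: "z \<in> ball (pp j) \<rho>"
   let ?q = "hb k (bb j) z" and ?A = "vb (v (Suc m)) (bb j) z" and ?B = "vb (v m) (bb j) z" and ?x = "w (Suc m) j z" and ?y = "w m j z"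
   have q: "h0 \<le> ?q" "?q \<ge> 0" using h0(2)[OF J(2)[OF j]] h0(1) J(3)[OF j] z by fastforce+
   have "(norm (x - y))\<^sup>2 \<le> 4 * ((norm (A - x))\<^sup>2 + ((norm (A - B))\<^sup>2 + (norm (B - y))\<^sup>2))" for x y A B :: complex
    using norm_sum_square_le[of "x - A" "A - y"] norm_sum_square_le[of "A - B" "B - y"]
    by (simp add: norm_minus_commute[of A x]) (smt (verit) zero_le_power2)
   note this[of ?x ?y ?A ?B]
   from mult_mono[OF q(1) this q(2)]
   have "(norm (?x - ?y))\<^sup>2 \<le> 4 / h0 * ((norm (?A - ?x))\<^sup>2 * ?q + ((norm (?A - ?B))\<^sup>2 * ?q + (norm (?B - ?y))\<^sup>2 * ?q))"
    using h0(1) by (simp add: field_simps)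
   then show "ennreal ((norm (?x - ?y))\<^sup>2) \<le> ?G (ci (bb j) z)"
    unfolding pn_chart[OF C1secD(1)[OF vC] j z] er_chart[where w="w m" for m, OF j w[OF j] v z]
    using h0(1) q(2) by (simp add: ennreal_leI flip: ennreal_mult ennreal_plus del: times_divide_eq_left)
  qed (use C h0(1) in auto)
  then show ?thesis by (simp add: mult_ac)
 qed
 have "\<forall>j\<in>J. \<exists>W. holo_on (ball (pp j) \<rho>) W \<and> (\<forall>z\<in>ball (pp j) \<rho>. (%m. w m j z) \<longlonglongrightarrow> W z)"
 proof
  fix j assume j: "j \<in> J"
  obtain W where "holo_on (ball (pp j) \<rho>) W" "!!z. z \<in> ball (pp j) \<rho> ==> (%m. w m j z) \<longlonglongrightarrow> W z"
   by (rule holo_L2_limit[of "pp j" \<rho> "%m. w m j", OF w[OF j] cauchy[OF j]]) blast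
  then show "\<exists>W. holo_on (ball (pp j) \<rho>) W \<and> (\<forall>z\<in>ball (pp j) \<rho>. (%m. w m j z) \<longlonglongrightarrow> W z)" by blast
 qed
 then obtain W where "\<forall>j\<in>J. holo_on (ball (pp j) \<rho>) (W j) \<and> (\<forall>z\<in>ball (pp j) \<rho>. (%m. w m j z) \<longlonglongrightarrow> W j z)"
  by (rule bchoice[THEN exE])
 then have W: "!!j. j \<in> J ==> holo_on (ball (pp j) \<rho>) (W j)"
  and lim: "!!j z. j \<in> J ==> z \<in> ball (pp j) \<rho> ==> (%m. w m j z) \<longlonglongrightarrow> W j z" by blast+
 have ext_lim: "(%m. ext (w m) j i x) \<longlonglongrightarrow> ext W j i x" if j: "j \<in> J" for j i x
  using lim[OF j D_sub(3)[OF j]] by (auto simp: ext_def intro!: tendsto_intros)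
 have \<Psi>: "complex_of_real (\<Sum>j\<in>J. \<psi> j x) \<noteq> 0" for x using \<psi>(3)[of x] by (simp del: of_real_sum)
 have glue_lim: "(%m. glue (w m) i x) \<longlonglongrightarrow> glue W i x" for i x
  unfolding glue_def by (intro tendsto_intros ext_lim \<Psi>)
 have v_lim: "(%m. v m i x) \<longlonglongrightarrow> glue W i x" for i x
  using glue_lim[of i x] unfolding glue by (rule LIMSEQ_offset)
 have C1: "C1sec k (glue W)" by (rule glue_C1sec) (rule W)
 \<comment> \<open>The integrated distance between the limit section and \<open>W j\<close> is zero
   by Fatou's lemma; the integrand is continuous, so it vanishes at every point.\<close>
 have own: "glue W i x = ext W j i x" if j: "j \<in> J" and x: "x \<in> D j" "x \<in> dom i" for j i x
 proof -
  let ?b = "bb j" and ?U = "ball (pp j) \<rho>"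
  let ?f = "dev (glue W) W j"
  have m: "(%z. ennreal (dev (v m) (w m) j z) * indicator ?U z) \<in> borel_measurable lborel" for m
   using weighted_measurable[OF borel_open[OF open_ball] weight_measurable[where w="w m", OF j holo_on_cont[OF w[OF j]] v]] by simp
  have close': "wint ?U (dev (v m) (w m) j) \<le> ennreal (1 / mv * (C / 4 ^ m))" for m
   by (rule in_chart[OF j em[OF j] close[OF j]]) (use C er_chart[where w="w m", OF j w[OF j] v] in auto)
  have "wint ?U ?f \<le> 0"
  proof (rule nn_integral_tendsto_le[OF m _ close'])
   have "(%m. 1 / mv * (C * (1 / 4) ^ m)) \<longlonglongrightarrow> 1 / mv * (C * 0)" by (intro tendsto_intros LIMSEQ_realpow_zero) auto
   then have "(%m. ennreal (1 / mv * (C / 4 ^ m))) \<longlonglongrightarrow> ennreal 0" by (intro tendsto_ennrealI) (simp add: power_one_over)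
   then show "(%m. ennreal (1 / mv * (C / 4 ^ m))) \<longlonglongrightarrow> 0" by simp
   fix z
   show "(%m. ennreal (dev (v m) (w m) j z) * indicator ?U z) \<longlonglongrightarrow> ennreal (?f z) * indicator ?U z"
   proof (cases "z \<in> ?U")
    case True
    have "(%m. ennreal (dev (v m) (w m) j z)) \<longlonglongrightarrow> ennreal (?f z)"
     by (intro tendsto_ennrealI tendsto_intros v_lim lim[OF j True])
    then show ?thesis using True by simp
   qed simp
  qed
  then have zero: "wint ?U ?f = 0" by simp
  have z: "snd (cb ?b) x \<in> ?U" "ci ?b (snd (cb ?b) x) = x" "x \<in> dom (ib ?b)" using D_sub[OF j x(1)] by auto
  have "?f (snd (cb ?b) x) \<le> 0"
   by (rule nn_integral_zero_continuous[OF open_ball weight_measurable[where w=W, OF j holo_on_cont[OF W[OF j]] C1] zero z(1)])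
  then have "(norm (glue W (ib ?b) x - W j (snd (cb ?b) x)))\<^sup>2 \<le> 0"
   unfolding z(2) using zero_less_power[OF h_pos[OF z(3)], of k] by (auto simp: mult_le_0_iff)
  then have "glue W (ib ?b) x = ext W j (ib ?b) x" using ext_own[OF j x(1)] by simp
  then show ?thesis
   using sec_change[OF C1secD(1)[OF C1] x(2) z(3)] sec_change[OF ext_sec[OF j] x(2) z(3), of W] by simp
 qed
 have "glue W \<in> H0 k"
  unfolding H0_holo
 proof (intro conjI ballI allI)
  show "sec k (glue W)" by (rule C1secD(1)[OF C1])
  fix c i assume c: "c \<in> A"
  let ?a = "%z. glue W i (chart_inv c z)"
  show "holo_on (cdom c i) ?a"
   unfolding holo_on_def
  proof
   fix z assume z: "z \<in> cdom c i"
   note zD = cdomD[OF c z]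
   have "\<exists>j\<in>J. \<psi> j (chart_inv c z) \<noteq> 0" using \<psi>(3)[of "chart_inv c z"] by (metis not_one_le_zero sum.neutral)
   then obtain j where j: "j \<in> J" "chart_inv c z \<in> D j" using \<psi>_outside by blast
   let ?O = "snd c ` (fst c \<inter> (D j \<inter> dom i))"
   have "open ?O" by (rule open_chart_image[OF c open_Int[OF D_open[OF j(1)] dom_open]])
   then have "holo_on ?O ?a"
    by (rule holo_on_cong[OF _ ext_holo[where w=W, OF j(1) c W[OF j(1)]]]) (use own[OF j(1)] chart_inv_left[OF c] in auto)
   moreover have "z \<in> ?O" using j(2) zD by (metis IntI image_eqI)
   ultimately show "\<exists>D. (?a has_derivative D) (at z) \<and> (\<forall>c v. D (c *s v) = c * D v)"
    unfolding holo_on_def by blast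
  qed
 qed
 then show ?thesis using v_lim that by blast
qed

text \<open>Gluing the restrictions of a holomorphic section returns that section with no error, so
  this is \<open>glue_limit\<close> with \<open>d = 0\<close>.\<close>

lemma H0_complete:
 assumes s: "!!m. s m \<in> H0 k" and cauchy: "!!m. N2 k (s (Suc m) -. s m) \<le> ennreal (C / 4 ^ m)" and C: "C \<ge> 0"
 obtains t where "t \<in> H0 k" "!!i x. (%m. s m i x) \<longlonglongrightarrow> t i x"
proof -
 define w where "w m j = vb (s m) (bb j)" for m j
 have sec: "sec k (s m)" for m using s H0_holo by blast
 have w: "holo_on (ball (pp j) \<rho>) (w m j)" if j: "j \<in> J" for m j
  unfolding w_def by (rule holo_on_subset[OF _ D_image(1)[OF j]]) (use s[of m] B(2)[OF J(2)[OF j]] in \<open>simp add: H0_holo\<close>)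
 have own: "ext (w m) j i x = s m i x" if "j \<in> J" "x \<in> D j" for m j i x
  using that sec_change[OF sec[of m], of x i "ib (bb j)"] sec_outside[OF sec[of m], of x i] D_sub[OF that(1), of x]
  by (cases "x \<in> dom i") (simp_all add: ext_def w_def)
 have "glue (w m) i x = s (m + 0) i x" for m i x
 proof -
  have "of_real (\<psi> j x) * ext (w m) j i x = of_real (\<psi> j x) * s m i x" if "j \<in> J" for j
   using own[OF that] \<psi>_outside[OF that, of x] by (cases "x \<in> D j") auto
  then have "(\<Sum>j\<in>J. of_real (\<psi> j x) * ext (w m) j i x) = of_real (\<Sum>j\<in>J. \<psi> j x) * s m i x"
   unfolding of_real_sum sum_distrib_right by (rule sum.cong[OF refl])
  moreover have "complex_of_real (\<Sum>j\<in>J. \<psi> j x) \<noteq> 0" using \<psi>(3)[of x] by (simp del: of_real_sum)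
  ultimately show ?thesis by (simp add: glue_def)
 qed
 then have glue: "glue (w m) = s (m + 0)" for m by (intro ext)
 have er: "er (w m) (s m) j x = 0" if "j \<in> J" for m j x
  using own[OF that] by (auto simp: er_def pn_def indicator_def)
 show ?thesis
  by (rule glue_limit[where w=w, OF w H0_C1sec[OF s] C cauchy _ glue]) (use er C in \<open>auto intro: that\<close>)
qed

lemma N2_limit:
 assumes v: "!!m. C1sec k (v m)" and step: "!!m. N2 k (v (Suc m) -. v m) \<le> ennreal (r / 4 ^ m)" and r: "r \<ge> 0"
  and t: "!!i x. (%m. v m i x) \<longlonglongrightarrow> t i x"
 shows "N2 k (v 0 -. t) \<le> ennreal (4 * r)"
 unfolding N2_def
proof (rule nn_integral_tendsto_le)
 let ?P = "%m x. ennreal (pn k (v (Suc m) -. v m) x)"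
 have [measurable]: "?P j \<in> borel_measurable vol" for j using N2_measurable[OF C1sec_diff[OF v v]] by simp
 show "(%x. ennreal (pn k (v 0 -. v m) x)) \<in> borel_measurable vol" for m
  using N2_measurable[OF C1sec_diff[OF v v]] by simp
 show "(%m. ennreal (pn k (v 0 -. v m) x)) \<longlonglongrightarrow> ennreal (pn k (v 0 -. t) x)" for x
  unfolding pn_def by (intro tendsto_ennrealI tendsto_intros t)
 show "(\<integral>\<^sup>+x. ennreal (pn k (v 0 -. v m) x) \<partial>vol) \<le> ennreal (4 * r)" for m
 proof -
  have "(\<integral>\<^sup>+x. ennreal (pn k (v 0 -. v m) x) \<partial>vol) \<le> (\<integral>\<^sup>+x. (\<Sum>j<m. ennreal (2 ^ Suc j) * ?P j x) \<partial>vol)"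
  proof (rule nn_integral_mono)
   fix x
   have "ennreal (pn k (v 0 -. v m) x) \<le> ennreal (\<Sum>j<m. 2 ^ Suc j * pn k (v (Suc j) -. v j) x)"
    by (rule ennreal_leI[OF pn_telescope])
   also have "... = (\<Sum>j<m. ennreal (2 ^ Suc j * pn k (v (Suc j) -. v j) x))"
    by (rule sum_ennreal[symmetric]) (simp add: pn_nonneg)
   also have "... = (\<Sum>j<m. ennreal (2 ^ Suc j) * ?P j x)"
    by (intro sum.cong refl ennreal_mult') simp
   finally show "ennreal (pn k (v 0 -. v m) x) \<le> (\<Sum>j<m. ennreal (2 ^ Suc j) * ?P j x)" .
  qed
  also have "... = (\<Sum>j<m. ennreal (2 ^ Suc j) * N2 k (v (Suc j) -. v j))"
   unfolding N2_def by (subst nn_integral_sum, measurable, intro sum.cong refl nn_integral_cmult) measurable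
  also have "... \<le> (\<Sum>j<m. ennreal (2 ^ Suc j) * ennreal (r / 4 ^ j))" by (intro sum_mono mult_left_mono step) simp
  also have "... = (\<Sum>j<m. ennreal (2 * r * (1 / 2) ^ j))"
  proof (intro sum.cong refl)
   fix j
   have "(4 :: real) ^ j = 2 ^ j * 2 ^ j" by (simp flip: power_mult_distrib)
   then have "2 ^ Suc j * (r / 4 ^ j) = 2 * r * (1 / 2) ^ j" by (simp add: power_one_over field_simps)
   then show "ennreal (2 ^ Suc j) * ennreal (r / 4 ^ j) = ennreal (2 * r * (1 / 2) ^ j)"
    using r by (simp only: ennreal_mult[symmetric] zero_le_power zero_le_numeral divide_nonneg_nonneg)
  qed
  also have "... = ennreal (2 * r * (\<Sum>j<m. (1 / 2) ^ j))"
   using r by (simp only: sum_distrib_left) (intro sum_ennreal, simp)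
  also have "... \<le> ennreal (2 * r * 2)"
  proof (intro ennreal_leI mult_left_mono)
   show "(\<Sum>j<m. (1 / 2) ^ j) \<le> (2 :: real)" by (subst sum_gp_strict) auto
  qed (use r in auto)
  finally show ?thesis by simp
 qed
qed simp

text \<open>One round of local approximation and gluing multiplies the energy by at most 1/4, so
  local errors and corrections decay geometrically, as \<open>glue_limit\<close> asks. The factor 4
  in the result is the weighted sum of corrections in \<open>N2_limit\<close>.\<close>

theorem iterate:
 assumes approx: "!!v. C1sec k v ==> \<exists>w. (\<forall>j\<in>J. holo_on (ball (pp j) \<rho>) (w j)) \<and> err w v \<le> ennreal a * E k v"
  and a: "a \<ge> 0" "real (card B) * (real CARD('n) * (4 * (real N)\<^sup>2 * Bd\<^sup>2)) / mv * a \<le> 1 / 4"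
  and v0: "C1sec k v0" "E k v0 \<le> ennreal e" "e \<ge> 0"
 shows "\<exists>t\<in>H0 k. N2 k (v0 -. t) \<le> ennreal (4 * a * e)"
proof -
 let ?c = "real (card B) * (real CARD('n) * (4 * (real N)\<^sup>2 * Bd\<^sup>2)) / mv"
 have c: "?c \<ge> 0" using dens(1) by simp
 obtain Wf where Wf: "!!v j. C1sec k v ==> j \<in> J ==> holo_on (ball (pp j) \<rho>) (Wf v j)"
  "!!v. C1sec k v ==> err (Wf v) v \<le> ennreal a * E k v"
 proof -
  have "\<forall>v\<in>{v. C1sec k v}. \<exists>w. (\<forall>j\<in>J. holo_on (ball (pp j) \<rho>) (w j)) \<and> err w v \<le> ennreal a * E k v" using approx by blast
  then obtain Wf where "\<forall>v\<in>{v. C1sec k v}. (\<forall>j\<in>J. holo_on (ball (pp j) \<rho>) (Wf v j)) \<and> err (Wf v) v \<le> ennreal a * E k v"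
   by (rule bchoice[THEN exE])
  then show ?thesis by (intro that) blast+
 qed
 define v where "v m = ((%v. glue (Wf v)) ^^ m) v0" for m
 define w where "w m = Wf (v m)" for m
 have v_Suc: "v (Suc m) = glue (w m)" for m by (simp add: v_def w_def)
 have vC: "C1sec k (v m)" for m
 proof (induction m)
  case (Suc m)
  show ?case unfolding v_Suc w_def by (rule glue_C1sec) (rule Wf(1)[OF Suc])
 qed (simp add: v_def v0)
 have w: "holo_on (ball (pp j) \<rho>) (w m j)" if "j \<in> J" for m j unfolding w_def by (rule Wf(1)[OF vC that])
 have E_le: "E k (v m) \<le> ennreal (e / 4 ^ m)" for m
 proof (induction m)
  case (Suc m)
  have "E k (v (Suc m)) \<le> ennreal ?c * err (w m) (v m)" unfolding v_Suc by (rule glue_E[OF w vC])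
  also have "... \<le> ennreal ?c * (ennreal a * ennreal (e / 4 ^ m))"
   unfolding w_def by (intro mult_left_mono order_trans[OF Wf(2)[OF vC]] Suc) auto
  also have "... = ennreal (?c * a * (e / 4 ^ m))" using c a v0(3) by (simp add: mult.assoc flip: ennreal_mult del: times_divide_eq_left times_divide_eq_right)
  also have "... \<le> ennreal (1 / 4 * (e / 4 ^ m))" using a(2) v0(3) by (intro ennreal_leI mult_right_mono) auto
  finally show ?case by simp
 qed (simp add: v_def v0)
 have err_r: "err (w m) (v m) \<le> ennreal (a * e / 4 ^ m)" for m
 proof -
  have "err (w m) (v m) \<le> ennreal a * ennreal (e / 4 ^ m)"
   unfolding w_def by (rule order_trans[OF Wf(2)[OF vC] mult_left_mono[OF E_le]]) simp
  then show ?thesis using a(1) v0(3) by (simp flip: ennreal_mult)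
 qed
 have er_r: "(\<integral>\<^sup>+x. er (w m) (v m) j x \<partial>vol) \<le> ennreal (a * e / 4 ^ m)" if "j \<in> J" for m j
  by (rule order_trans[OF _ err_r[of m]]) (use J(1) that in \<open>auto simp: err_def intro!: member_le_sum\<close>)
 have N2_r: "N2 k (v (Suc m) -. v m) \<le> ennreal (a * e / 4 ^ m)" for m
  unfolding v_Suc by (rule order_trans[OF glue_N2[OF w vC] err_r])
 have ae: "a * e \<ge> 0" using a(1) v0(3) by simp
 obtain t where t: "t \<in> H0 k" "!!i x. (%m. v m i x) \<longlonglongrightarrow> t i x"
  by (rule glue_limit[where w=w and v=v and d=1, OF w vC ae N2_r er_r]) (use v_Suc that in auto)
 have "N2 k (v 0 -. t) \<le> ennreal (4 * (a * e))" by (rule N2_limit[OF vC N2_r ae t(2)])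
 then show ?thesis using t(1) by (auto simp: v_def mult.assoc)
qed

end

section \<open>Partitions of unity at scale \<open>1 / sqrt k\<close>\<close>

context hermitian_bundle
begin

lemma cover_exists:
 obtains B cb ib zb rb mv Mv where "covered_bundle A \<omega> L h \<theta> (B :: 'm set) cb ib zb rb mv Mv"
proof -
 have "\<forall>x. \<exists>c i r. c \<in> A \<and> x \<in> fst c \<and> x \<in> dom i \<and> r > 0 \<and> cball (snd c x) (3 * r) \<subseteq> cdom c i"
 proof
  fix x
  obtain c where c: "c \<in> A" "x \<in> fst c" using atlas unfolding complex_atlas_def by blast
  obtain i where i: "x \<in> dom i" using dom_cover by blast
  then have "snd c x \<in> cdom c i" using c(2) by blast
  then obtain r where "r > 0" "cball (snd c x) r \<subseteq> cdom c i"
   using cdom_open[OF c(1), of i] unfolding open_contains_cball by blast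
  then show "\<exists>c i r. c \<in> A \<and> x \<in> fst c \<and> x \<in> dom i \<and> r > 0 \<and> cball (snd c x) (3 * r) \<subseteq> cdom c i"
   using c i by (intro exI[of _ c] exI[of _ i] exI[of _ "r / 3"]) auto
 qed
 then obtain cb where "\<forall>x. \<exists>i r. cb x \<in> A \<and> x \<in> fst (cb x) \<and> x \<in> dom i \<and> r > 0 \<and> cball (snd (cb x) x) (3 * r) \<subseteq> cdom (cb x) i"
  by (rule choice[THEN exE])
 then obtain ib where "\<forall>x. \<exists>r. cb x \<in> A \<and> x \<in> fst (cb x) \<and> x \<in> dom (ib x) \<and> r > 0 \<and> cball (snd (cb x) x) (3 * r) \<subseteq> cdom (cb x) (ib x)"
  by (rule choice[THEN exE])
 then obtain rb where "\<forall>x. cb x \<in> A \<and> x \<in> fst (cb x) \<and> x \<in> dom (ib x) \<and> rb x > 0 \<and> cball (snd (cb x) x) (3 * rb x) \<subseteq> cdom (cb x) (ib x)"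
  by (rule choice[THEN exE])
 then have d: "!!x. cb x \<in> A" "!!x. x \<in> fst (cb x)" "!!x. rb x > 0"
  "!!x. cball (snd (cb x) x) (3 * rb x) \<subseteq> cdom (cb x) (ib x)" by blast+
 let ?U = "%x. fst (cb x) \<inter> snd (cb x) -` ball (snd (cb x) x) (rb x)"
 have U: "open (?U x)" for x
  by (rule continuous_open_preimage[OF chart_continuous[OF d(1)] chartD(1)[OF d(1)] open_ball])
 have "UNIV \<subseteq> (\<Union>x. ?U x)" using d(2,3) by auto
 then obtain B where B: "finite B" "UNIV \<subseteq> (\<Union>x\<in>B. ?U x)"
  by (rule compactE_image[OF compact_M, of UNIV ?U, OF U]) blast
 let ?K = "%b. cball (snd (cb b) b) (3 * rb b)" and ?d = "%b z. volume_density \<omega> (cb b) (chart_inv (cb b) z)"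
 have K: "?K b \<subseteq> cimg (cb b)" for b using d(4) by blast
 have c: "continuous_on (?K b) (?d b)" for b by (rule continuous_on_subset[OF continuous_volume_density[OF d(1)] K])
 have p: "?d b z > 0" if "z \<in> ?K b" for b z
  using volume_density_pos[OF d(1)] chart_inv_right[OF d(1)] K that by blast
 have c': "continuous_on (?K b) (%z. 1 / ?d b z)" for b by (intro continuous_intros c) (use p less_irrefl in metis)
 obtain M where M: "M > 0" "!!b z. b \<in> B ==> z \<in> ?K b ==> ?d b z \<le> M"
  using bounded_on_compacts[where X="?K" and f="?d", OF B(1) compact_cball c] by blast
 obtain m where m: "m > 0" "!!b z. b \<in> B ==> z \<in> ?K b ==> 1 / ?d b z \<le> m"
  using bounded_on_compacts[where X="?K" and f="%b z. 1 / ?d b z", OF B(1) compact_cball c'] by blast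
 have "covered_bundle A \<omega> L h \<theta> B cb ib (%x. snd (cb x) x) rb (1 / m) M"
 proof (unfold_locales, goal_cases)
  case (5 x)
  obtain b where b: "b \<in> B" "x \<in> ?U b" using B(2) by blast
  then have "chart_inv (cb b) (snd (cb b) x) = x" using chart_inv_left[OF d(1)] by blast
  then show ?case using b by (metis IntD2 image_eqI vimage_eq)
 next
  case (8 b z)
  then show ?case using m(1) m(2)[OF 8] p[OF 8(2)] by (simp add: pos_divide_le_eq mult.commute)
 qed (use B d M m in auto)
 then show ?thesis by (rule that)
qed

end

text \<open>At least 1 within distance \<open>\<delta>\<close>, and zero beyond
  \<open>sqrt 2 * \<delta>\<close>, hence beyond \<open>3/2 * \<delta>\<close>.\<close>

definition bump :: "real => 'a::real_inner => 'a => real" where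
 "bump \<delta> p z = possq (2 - (norm (z - p))\<^sup>2 / \<delta>\<^sup>2)"

lemma bump_nonneg: "bump \<delta> p z \<ge> 0" by (simp add: bump_def possq_nonneg)

lemma bump_zero:
 assumes "\<delta> > 0" "dist p z \<ge> 3 / 2 * \<delta>" shows "bump \<delta> p z = 0"
proof -
 have "(3 / 2 * \<delta>)\<^sup>2 \<le> (norm (z - p))\<^sup>2" using assms by (intro power_mono) (auto simp: dist_norm norm_minus_commute)
 then have "9 * \<delta>\<^sup>2 \<le> 4 * (norm (z - p))\<^sup>2" by (simp add: power_mult_distrib power_divide)
 moreover have "\<delta>\<^sup>2 \<ge> 0" by simp
 ultimately have "2 * \<delta>\<^sup>2 \<le> (norm (z - p))\<^sup>2" by linarith
 then show ?thesis unfolding bump_def using assms(1) by (intro possq_zero) (simp add: le_divide_eq)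
qed

lemma bump_ge_1:
 assumes "\<delta> > 0" "dist z p < \<delta>" shows "bump \<delta> p z \<ge> 1"
proof -
 have "(norm (z - p))\<^sup>2 \<le> \<delta>\<^sup>2" using assms by (intro power_mono) (auto simp: dist_norm)
 then have "2 - (norm (z - p))\<^sup>2 / \<delta>\<^sup>2 \<ge> 1" using assms(1) by (simp add: divide_le_eq)
 then show ?thesis unfolding bump_def possq_def by (metis max.absorb2 one_le_power order_trans zero_le_one)
qed

lemma bump_deriv:
 "(bump \<delta> p has_derivative (%v. 2 * max 0 (2 - (norm (z - p))\<^sup>2 / \<delta>\<^sup>2) * (- (2 * ((z - p) \<bullet> v) / \<delta>\<^sup>2)))) (at z)"
proof -
 have "((%z. 2 - (norm (z - p))\<^sup>2 / \<delta>\<^sup>2) has_derivative (%v. - (2 * ((z - p) \<bullet> v) / \<delta>\<^sup>2))) (at z)"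
 proof -
  have "((%z. (norm (z - p))\<^sup>2) has_derivative (%v. 2 * ((z - p) \<bullet> v))) (at z)"
   unfolding power2_norm_eq_inner by (auto intro!: derivative_eq_intros simp: inner_commute)
  from has_derivative_diff[OF has_derivative_const bounded_linear.has_derivative[OF bounded_linear_divide this]]
  show ?thesis by simp
 qed
 from has_derivative_compose[OF this possq_deriv[unfolded has_field_derivative_def]]
 show ?thesis by (simp add: bump_def[abs_def])
qed

lemma C1_bump: "C1_on S (bump \<delta> (p :: 'a::euclidean_space))"
 by (rule C1_onI[OF bump_deriv], unfold divide_inverse) (intro continuous_intros)

lemma bump_deriv_bound:
 assumes "\<delta> > 0"
 shows "\<bar>2 * max 0 (2 - (norm (z - p))\<^sup>2 / \<delta>\<^sup>2) * (- (2 * ((z - p) \<bullet> v) / \<delta>\<^sup>2))\<bar> \<le> 16 / \<delta> * norm v"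
proof (cases "2 - (norm (z - p))\<^sup>2 / \<delta>\<^sup>2 > 0")
 case True
 then have "(norm (z - p))\<^sup>2 < 2 * \<delta>\<^sup>2" using assms by (simp add: divide_less_eq)
 moreover have "\<delta>\<^sup>2 \<ge> 0" by simp
 ultimately have "(norm (z - p))\<^sup>2 \<le> 4 * \<delta>\<^sup>2" by linarith
 then have "(norm (z - p))\<^sup>2 \<le> (2 * \<delta>)\<^sup>2" by (simp add: power_mult_distrib)
 then have n: "norm (z - p) \<le> 2 * \<delta>" by (rule power2_le_imp_le) (use assms in simp)
 have "max 0 (2 - (norm (z - p))\<^sup>2 / \<delta>\<^sup>2) \<le> 2" by simp
 moreover have "\<bar>2 * ((z - p) \<bullet> v) / \<delta>\<^sup>2\<bar> \<le> 4 / \<delta> * norm v"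
 proof -
  have "\<bar>(z - p) \<bullet> v\<bar> \<le> (2 * \<delta>) * norm v"
   by (rule order_trans[OF Cauchy_Schwarz_ineq2]) (intro mult_right_mono n norm_ge_zero)
  then have "2 * \<bar>(z - p) \<bullet> v\<bar> / \<delta>\<^sup>2 \<le> 2 * ((2 * \<delta>) * norm v) / \<delta>\<^sup>2" by (intro divide_right_mono mult_left_mono) auto
  then show ?thesis using assms by (simp add: abs_mult power2_eq_square)
 qed
 ultimately have "(2 * max 0 (2 - (norm (z - p))\<^sup>2 / \<delta>\<^sup>2)) * \<bar>2 * ((z - p) \<bullet> v) / \<delta>\<^sup>2\<bar> \<le> (2 * 2) * (4 / \<delta> * norm v)"
  by (intro mult_mono) auto
 then show ?thesis by (simp add: abs_mult)
qed (use assms in \<open>simp add: max_def\<close>)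

lemma dbar_bump_bound:
 fixes p :: "complex ^ 'n::finite"
 assumes "\<delta> > 0"
 shows "cmod (dbar (%z. of_real (bump \<delta> p z)) z v) \<le> 16 / \<delta> * norm v"
proof -
 let ?D = "%v. 2 * max 0 (2 - (norm (z - p))\<^sup>2 / \<delta>\<^sup>2) * (- (2 * ((z - p) \<bullet> v) / \<delta>\<^sup>2))"
 have "((%z. complex_of_real (bump \<delta> p z)) has_derivative (%v. of_real (?D v))) (at z)"
  by (rule has_derivative_of_real[OF bump_deriv])
 from dbar_eqI[OF this, of v]
 have "cmod (dbar (%z. of_real (bump \<delta> p z)) z v) = cmod (of_real (?D v) + \<i> * of_real (?D (\<i> *s v))) / 2" by (simp only: norm_divide) simp
 also have "... \<le> (\<bar>?D v\<bar> + \<bar>?D (\<i> *s v)\<bar>) / 2"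
  by (intro divide_right_mono order_trans[OF norm_triangle_ineq]) (simp_all only: norm_mult norm_of_real norm_ii mult_1)
 also have "... \<le> (16 / \<delta> * norm v + 16 / \<delta> * norm (\<i> *s v)) / 2"
  by (intro divide_right_mono add_mono bump_deriv_bound[OF assms]) simp
 finally show ?thesis by (simp add: norm_smult_vec)
qed

section \<open>Bump functions moved to the manifold, and the weights of a fine net\<close>

context covered_bundle
begin

lemma transition_bound:
 obtains M where "M \<ge> 0" "!!b b' z l. b \<in> B ==> b' \<in> B ==> z \<in> K b ==> ci b z \<in> ci b' ` K b' ==>
  norm (fder (transition (cb b) (cb b')) z (axis l 1)) \<le> M"
proof -
 define X where "X = (%(b, b', l :: 'n). K b \<inter> ci b -` (ci b' ` K b'))"
 define f where "f = (%(b, b', l) z. norm (fder (transition (cb b) (cb b')) z (axis l 1)))"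
 have X: "compact (X (b, b', l)) \<and> continuous_on (X (b, b', l)) (f (b, b', l))" if b: "b \<in> B" "b' \<in> B" for b b' l
 proof -
  have cont: "continuous_on (K a) (ci a)" if "a \<in> B" for a
   by (rule continuous_on_subset[OF chart_inv_continuous[OF B(2)[OF that]]]) (use K_cdom[OF that] in blast)
  have "closed (ci b' ` K b')" by (intro compact_imp_closed compact_continuous_image cont b compact_cball)
  then have "closed (K b \<inter> ci b -` (ci b' ` K b'))" by (intro continuous_closed_preimage cont b closed_cball)
  then have "compact (K b \<inter> (K b \<inter> ci b -` (ci b' ` K b')))" by (intro compact_Int_closed compact_cball)
  then have "compact (X (b, b', l))" by (simp add: X_def)
  moreover have "X (b, b', l) \<subseteq> snd (cb b) ` (fst (cb b) \<inter> fst (cb b'))"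
  proof
   fix z assume z: "z \<in> X (b, b', l)"
   then have zb: "z \<in> cdom (cb b) (ib b)" using K_cdom[OF b(1)] unfolding X_def by blast
   obtain z' where "z' \<in> K b'" "ci b z = ci b' z'" using z unfolding X_def by blast
   then have "ci b z \<in> fst (cb b')" using cdomD(2)[OF B(2)[OF b(2)] K_cdom[OF b(2)]] by metis
   then show "z \<in> snd (cb b) ` (fst (cb b) \<inter> fst (cb b'))" using cdomD(2,4)[OF B(2)[OF b(1)] zb] by (metis IntI image_eqI)
  qed
  then have "continuous_on (X (b, b', l)) (f (b, b', l))"
   unfolding f_def prod.case
   by (intro continuous_on_norm continuous_on_subset[OF C1_on_deriv_cont[OF transition_C1[OF B(2)[OF b(1)] B(2)[OF b(2)]]]])
  ultimately show ?thesis ..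
 qed
 obtain M where M: "M > 0" "!!q z. q \<in> B \<times> B \<times> UNIV ==> z \<in> X q ==> f q z \<le> M"
  by (rule bounded_on_compacts[of "B \<times> B \<times> UNIV" X f]) (use B(1) X in auto)
 show ?thesis
 proof (rule that[of M])
  fix b b' z l assume "b \<in> B" "b' \<in> B" "z \<in> K b" "ci b z \<in> ci b' ` K b'"
  then show "norm (fder (transition (cb b) (cb b')) z (axis l 1)) \<le> M"
   using M(2)[of "(b, b', l)" z] by (simp add: X_def f_def)
 qed (use M in simp)
qed

end

context covered_bundle
begin

lemma K_image_compact: "b \<in> B ==> X \<subseteq> K b ==> compact X ==> compact (ci b ` X)"
 using chart_inv_continuous[OF B(2)] K_cdom cdomD(1)[OF B(2)]
 by (intro compact_continuous_image) (blast intro: continuous_on_subset)+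

lemma inv_image_iff:
 assumes b: "b \<in> B" and X: "X \<subseteq> K b"
 shows "x \<in> ci b ` X \<longleftrightarrow> x \<in> fst (cb b) \<and> snd (cb b) x \<in> X"
proof
 assume "x \<in> ci b ` X"
 then obtain z where z: "z \<in> X" "x = ci b z" by blast
 then show "x \<in> fst (cb b) \<and> snd (cb b) x \<in> X" using cdomD[OF B(2)[OF b] K_cdom[OF b], of z] X by auto
next
 assume "x \<in> fst (cb b) \<and> snd (cb b) x \<in> X"
 then show "x \<in> ci b ` X" using chart_inv_left[OF B(2)[OF b], of x] by (metis image_eqI)
qed

definition cbump :: "real => 'b \<times> (complex ^ 'n) => 'm => real" where
 "cbump \<delta> j x = (if x \<in> fst (cb (fst j)) then bump \<delta> (snd j) (snd (cb (fst j)) x) else 0)"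

text \<open>On the overlap of the charts the function is a bump composed with the transition, and
  off the image of the closed ball of radius \<open>3/2 * \<delta>\<close> it is zero; these
  descriptions cover the chart. By the chain rule the scale enters the derivative only as
  \<open>16 / \<delta>\<close>.\<close>

lemma cbump_C1:
 assumes b: "fst j \<in> B" and c: "c \<in> A" and \<delta>: "\<delta> > 0" and F: "cball (snd j) (3 / 2 * \<delta>) \<subseteq> K (fst j)"
 shows "C1_on (cimg c) (%z. cbump \<delta> j (chart_inv c z))"
  and "b' \<in> B ==> c = cb b' ==> z \<in> K b' ==> (chart_inv c z \<in> ci (fst j) ` K (fst j) ==>
    norm (fder (transition c (cb (fst j))) z (axis l 1)) \<le> M) ==> M \<ge> 0 ==>
   cmod (dbar (%z. of_real (cbump \<delta> j (chart_inv c z))) z (axis l 1)) \<le> 16 / \<delta> * M"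
proof -
 let ?d = "cb (fst j)" and ?F = "ci (fst j) ` cball (snd j) (3 / 2 * \<delta>)"
 note d = B(2)[OF b]
 have Fc: "closed ?F" by (intro compact_imp_closed K_image_compact b F compact_cball)
 let ?b = "fst c \<inter> fst ?d"
 have o: "open (snd c ` (fst c \<inter> - ?F))" "open (snd c ` ?b)"
  by (intro open_chart_image[OF c] open_Compl Fc chartD(1)[OF d])+
 have zero: "cbump \<delta> j (chart_inv c y) = 0" if "y \<in> snd c ` (fst c \<inter> - ?F)" for y
 proof -
  have "chart_inv c y \<notin> ?F" using that chart_inv_left[OF c] by auto
  then show ?thesis using bump_zero[OF \<delta>, of "snd j"] inv_image_iff[OF b F, of "chart_inv c y"] unfolding cbump_def by force
 qed
 have own: "cbump \<delta> j (chart_inv c y) = bump \<delta> (snd j) (transition c ?d y)" if "y \<in> snd c ` ?b" for y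
  using that chart_inv_left[OF c] by (auto simp: cbump_def transition_def)
 have cov: "z \<in> snd c ` (fst c \<inter> - ?F) \<or> z \<in> snd c ` ?b" if "z \<in> cimg c" for z
  using that inv_image_iff[OF b F] by blast
 let ?a = "%z. cbump \<delta> j (chart_inv c z)"
 show "C1_on (cimg c) ?a"
 proof (rule C1_on_local)
  fix z assume z: "z \<in> cimg c"
  have "C1_on (snd c ` (fst c \<inter> - ?F)) ?a"
   by (rule C1_on_cong[OF o(1) C1_on_const[of _ 0]]) (simp add: zero)
  moreover have "C1_on (snd c ` ?b) ?a"
   by (rule C1_on_cong[OF o(2) C1_on_compose[OF C1_bump[of UNIV] transition_C1[OF c d]]]) (auto simp: own)
  ultimately show "\<exists>U. open U \<and> z \<in> U \<and> C1_on (U \<inter> cimg c) ?a"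
   using cov[OF z] o C1_on_subset[OF _ Int_lower1] by metis
 qed
 assume b': "b' \<in> B" "c = cb b'" "z \<in> K b'" and M: "chart_inv c z \<in> ci (fst j) ` K (fst j) ==>
    norm (fder (transition c ?d) z (axis l 1)) \<le> M" "M \<ge> 0"
 have zc: "z \<in> cimg c" using K_cdom[OF b'(1,3)] b'(2) by blast
 show "cmod (dbar (%z. of_real (cbump \<delta> j (chart_inv c z))) z (axis l 1)) \<le> 16 / \<delta> * M"
 proof (cases "chart_inv c z \<in> ?F")
  case True
  then have zd: "z \<in> snd c ` ?b"
   using inv_image_iff[OF b F] chart_inv_right[OF c zc] by (metis IntI image_eqI)
  have "dbar (%z. of_real (cbump \<delta> j (chart_inv c z))) z (axis l 1) =
    dbar (%z. complex_of_real (bump \<delta> (snd j) (transition c ?d z))) z (axis l 1)"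
   by (rule dbar_cong_open[OF o(2) zd]) (simp add: own)
  also have "... = dbar (%z. complex_of_real (bump \<delta> (snd j) z)) (transition c ?d z) (fder (transition c ?d) z (axis l 1))"
   by (rule dbar_compose[OF _ C1_onD[OF transition_C1[OF c d] zd] transition_complex_linear[OF c d zd]])
     (use C1_on_of_real[OF C1_bump[of UNIV]] in \<open>auto simp: C1_on_def\<close>)
  also have "cmod ... \<le> 16 / \<delta> * norm (fder (transition c ?d) z (axis l 1))"
   by (rule dbar_bump_bound[OF \<delta>])
  also have "... \<le> 16 / \<delta> * M" using M(1) True F \<delta> by (intro mult_left_mono) auto
  finally show ?thesis .
 next
  case False
  then have "z \<in> snd c ` (fst c \<inter> - ?F)" using chart_inv_right[OF c zc] by (metis ComplI IntI image_eqI)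
  then have "dbar (%z. complex_of_real (cbump \<delta> j (chart_inv c z))) z (axis l 1) = dbar (%_. 0) z (axis l 1)"
   by (rule dbar_cong_open[OF o(1)]) (simp add: zero)
  then show ?thesis using M(2) \<delta> by simp
 qed
qed

text \<open>Bumps are at least 1 on the balls of radius \<open>\<delta>\<close> around net points,
  vanish beyond \<open>3/2 * \<delta>\<close>, and are glued on balls of radius
  \<open>2 * \<delta>\<close>. Volume comparison with \<open>a = 2\<close> gives at most 6 to the
  real dimension of these balls at a point in each chart.\<close>

lemma grid_gluing:
 assumes \<delta>: "\<delta> > 0" "!!b. b \<in> B ==> \<delta> \<le> rb b"
  and P: "!!b. b \<in> B ==> finite (P b)" "!!b. b \<in> B ==> P b \<subseteq> cball (zb b) (rb b)"
   "!!b x. b \<in> B ==> x \<in> cball (zb b) (rb b) ==> \<exists>p\<in>P b. dist x p < \<delta>"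
   "!!b p q. b \<in> B ==> p \<in> P b ==> q \<in> P b ==> p \<noteq> q ==> dist p q \<ge> \<delta>"
  and M: "M \<ge> 0" "!!b b' z l. b \<in> B ==> b' \<in> B ==> z \<in> K b ==> ci b z \<in> ci b' ` K b' ==>
   norm (fder (transition (cb b) (cb b')) z (axis l 1)) \<le> M"
 shows "gluing A \<omega> L h \<theta> B cb ib zb rb mv Mv (Sigma B P) fst snd (2 * \<delta>) (cbump \<delta>)
  (%j. ci (fst j) ` cball (snd j) (3 / 2 * \<delta>)) (card B * 6 ^ DIM(complex ^ 'n)) (16 / \<delta> * M)"
proof -
 have ballK: "ball p (2 * \<delta>) \<subseteq> K b" if "b \<in> B" "p \<in> P b" for b p
 proof
  fix z assume "z \<in> ball p (2 * \<delta>)"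
  then show "z \<in> K b" using P(2)[OF that(1)] that(2) \<delta>(2)[OF that(1)] dist_triangle[of "zb b" z p] by auto
 qed
 have cball_ball: "cball p (3 / 2 * \<delta>) \<subseteq> ball p (2 * \<delta>)" for p :: "complex ^ 'n" using \<delta>(1) by auto
 have jF: "fst j \<in> B" "snd j \<in> P (fst j)" "cball (snd j) (3 / 2 * \<delta>) \<subseteq> K (fst j)" if "j \<in> Sigma B P" for j
 proof -
  show j: "fst j \<in> B" "snd j \<in> P (fst j)" using that by auto
  show "cball (snd j) (3 / 2 * \<delta>) \<subseteq> K (fst j)" by (rule order_trans[OF cball_ball ballK[OF j]])
 qed
 show ?thesis
 proof (rule gluing.intro[OF covered_bundle_axioms], rule gluing_axioms.intro, goal_cases)
  case 1
  show ?case using B(1) P(1) by (rule finite_SigmaI)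
 next
  case (4 j x)
  show ?case by (simp add: cbump_def bump_nonneg)
 next
  case (5 j c)
  then show ?case by (intro cbump_C1(1) jF \<delta>)
 next
  case (6 x)
  obtain b where b: "b \<in> B" "x \<in> ci b ` ball (zb b) (rb b)" using cover by blast
  then have x: "x \<in> fst (cb b)" "snd (cb b) x \<in> ball (zb b) (rb b)"
   using inv_image_iff[OF b(1), of "ball (zb b) (rb b)" x] B(3)[OF b(1)] by (auto simp: subset_iff)
  then obtain p where p: "p \<in> P b" "dist (snd (cb b) x) p < \<delta>" using P(3)[OF b(1), of "snd (cb b) x"] by auto
  have "1 \<le> cbump \<delta> (b, p) x" using bump_ge_1[OF \<delta>(1) p(2)] x by (simp add: cbump_def)
  also have "... \<le> (\<Sum>j\<in>Sigma B P. cbump \<delta> j x)"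
   using b p B(1) P(1) by (intro member_le_sum) (auto simp: cbump_def bump_nonneg)
  finally show ?case .
 next
  case (7 j)
  then show ?case by (intro compact_imp_closed K_image_compact jF compact_cball)
 next
  case (9 j x)
  note j = jF(1,3)[OF 9(1)]
  show ?case using 9(2) bump_zero[OF \<delta>(1), of "snd j"] inv_image_iff[OF j, of x] unfolding cbump_def by force
 next
  case (10 x)
  let ?S = "%b. {p \<in> P b. x \<in> ci b ` ball p (2 * \<delta>)}"
  have "card (?S b) \<le> 6 ^ DIM(complex ^ 'n)" if b: "b \<in> B" for b
  proof -
   have "real (card (?S b)) \<le> (2 * 2 + 2) ^ DIM(complex ^ 'n)"
   proof (rule separated_card_le[where z="snd (cb b) x" and \<delta>=\<delta>])
    fix p assume "p \<in> ?S b"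
    then show "dist (snd (cb b) x) p \<le> 2 * \<delta>" using inv_image_iff[OF b ballK[OF b], of p x] by (auto simp: dist_commute)
   qed (use P(1,4)[OF b] \<delta> in auto)
   then have "real (card (?S b)) \<le> real (6 ^ DIM(complex ^ 'n))" by simp
   then show ?thesis by (simp only: of_nat_le_iff)
  qed
  moreover have "{j \<in> Sigma B P. x \<in> ci (fst j) ` ball (snd j) (2 * \<delta>)} = Sigma B ?S" by auto
  moreover have "card (Sigma B ?S) = (\<Sum>b\<in>B. card (?S b))" using B(1) P(1) by (intro card_SigmaI) auto
  ultimately show ?case using sum_bounded_above[of B "%b. card (?S b)" "6 ^ DIM(complex ^ 'n)"] by simp
 next
  case (12 j b z l)
  show ?case
   by (rule cbump_C1(2)[OF jF(1)[OF 12(1)] B(2)[OF 12(2)] \<delta>(1) jF(3)[OF 12(1)] 12(2) refl 12(3) M(2)[OF 12(2) jF(1)[OF 12(1)] 12(3)] M(1)])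
 next
  case (2 j)
  then show ?case by (rule jF)
 next
  case (3 j)
  then show ?case by (intro ballK jF)
 next
  case (8 j)
  show ?case by (intro image_mono cball_ball)
 next
  case 11
  show ?case using \<delta>(1) M(1) by simp
 qed
qed

end

section \<open>Summation of the local estimates and choice of the constants\<close>

context covered_bundle
begin

text \<open>The number of balls through a point is bounded independently of \<open>\<delta>\<close>,
  so the local energies add up to a multiple of the total energy that is uniform in
  \<open>k\<close>.\<close>

lemma overlap:
 assumes P: "finite P" "!!p q. p \<in> P ==> q \<in> P ==> p \<noteq> q ==> dist p q \<ge> \<delta>" "\<delta> > 0" "c \<ge> 0"
  and K: "!!p. p \<in> P ==> ball p (c * \<delta>) \<subseteq> K b" and f: "continuous_on (K b) f"
 shows "(\<Sum>p\<in>P. wint (ball p (c * \<delta>)) f) \<le> ennreal ((2 * c + 2) ^ DIM(complex ^ 'n)) * wint (K b) f"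
proof -
 let ?C = "ennreal ((2 * c + 2) ^ DIM(complex ^ 'n))"
 have "(\<Sum>p\<in>P. wint (ball p (c * \<delta>)) f) = (\<integral>\<^sup>+z. (\<Sum>p\<in>P. ennreal (f z) * indicator (ball p (c * \<delta>)) z) \<partial>lborel)"
  using weighted_measurable[OF borel_open[OF open_ball] continuous_on_subset[OF f K]]
  by (intro nn_integral_sum[symmetric]) simp
 also have "... \<le> (\<integral>\<^sup>+z. ?C * (ennreal (f z) * indicator (K b) z) \<partial>lborel)"
 proof (rule nn_integral_mono)
  fix z
  let ?Q = "{p \<in> P. z \<in> ball p (c * \<delta>)}"
  have "(\<Sum>p\<in>P. ennreal (f z) * indicator (ball p (c * \<delta>)) z) = (\<Sum>p\<in>?Q. ennreal (f z))"
   by (rule sum.mono_neutral_cong_right) (use P(1) in \<open>auto simp: indicator_def\<close>)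
  also have "... = ennreal (real (card ?Q)) * ennreal (f z)" by (simp add: ennreal_of_nat_eq_real_of_nat)
  also have "... \<le> ?C * (ennreal (f z) * indicator (K b) z)"
  proof (cases "?Q = {}")
   case False
   then have z: "z \<in> K b" using K by blast
   have "real (card ?Q) \<le> (2 * c + 2) ^ DIM(complex ^ 'n)"
    by (rule separated_card_le[where z=z and \<delta>=\<delta>]) (use P in \<open>auto simp: dist_commute\<close>)
   then show ?thesis using z by (simp add: mult_right_mono ennreal_leI del: DIM_cart)
  next
   case True
   then show ?thesis by (simp only: card.empty of_nat_0 ennreal_0 mult_zero_left zero_le)
  qed
  finally show "(\<Sum>p\<in>P. ennreal (f z) * indicator (ball p (c * \<delta>)) z) \<le> ?C * (ennreal (f z) * indicator (K b) z)" .
 qed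
 also have "... = ?C * wint (K b) f"
  by (rule nn_integral_cmult) (use weighted_measurable[OF borel_closed[OF closed_cball] f] in simp)
 finally show ?thesis .
qed

lemma energy_continuous:
 assumes v: "C1sec k v" and b: "b \<in> B"
 shows "continuous_on (K b) (%z. dnorm2 (vb v b) z * hb k b z)"
 unfolding dnorm2_def
 by (intro continuous_intros continuous_on_subset[OF C1_on_cont[OF h_C1[OF B(2)[OF b]]] B(4)[OF b]]
   C1_on_dbar_cont C1_on_subset[OF C1secD(2)[OF v B(2)[OF b]] B(4)[OF b]])

abbreviation local_est where
 "local_est b == local_approx (cdom (cb b) (ib b)) (%z. h (ib b) (ci b z)) (zb b) (rb b)"

lemma local_est:
 assumes b: "b \<in> B"
 shows "\<exists>C C'. C \<ge> 0 \<and> C' \<ge> 2 \<and> (\<forall>R\<ge>1. \<exists>k0. \<forall>k\<ge>k0. local_est b C C' R k)"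
proof -
 interpret W: weight "cdom (cb b) (ib b)" "%z. h (ib b) (ci b z)" "%z. \<theta> (ib b) (cb b) (ci b z)" "%z. \<omega> (cb b) (ci b z)" "zb b" "rb b"
  by (rule weight_chart[OF B(2)[OF b] B(4)[OF b] B(3)[OF b]])
 show ?thesis by (rule W.chart_estimate) blast
qed

theorem approximation:
 obtains C k0 where "C \<ge> 0" "k0 > 0"
  "!!k v e. k \<ge> k0 ==> C1sec k v ==> 0 \<le> e ==> E k v \<le> ennreal e ==>
   \<exists>t\<in>H0 k. N2 k (v -. t) \<le> ennreal (C / real k * e)"
  "!!k s D. k \<ge> k0 ==> (!!m. s m \<in> H0 k) ==> (!!m. N2 k (s (Suc m) -. s m) \<le> ennreal (D / 4 ^ m)) ==> 0 \<le> D ==>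
   \<exists>t\<in>H0 k. \<forall>i x. (%m. s m i x) \<longlonglongrightarrow> t i x"
proof -
 obtain M where M: "M \<ge> 0" "!!b b' z l. b \<in> B ==> b' \<in> B ==> z \<in> K b ==> ci b z \<in> ci b' ` K b' ==>
  norm (fder (transition (cb b) (cb b')) z (axis l 1)) \<le> M" by (rule transition_bound) blast
 have "\<forall>b\<in>B. \<exists>C C'. C \<ge> 0 \<and> C' \<ge> 2 \<and> (\<forall>R\<ge>1. \<exists>k0. \<forall>k\<ge>k0. local_est b C C' R k)" using local_est by blast
 then obtain Cb where "\<forall>b\<in>B. \<exists>C'. Cb b \<ge> 0 \<and> C' \<ge> 2 \<and> (\<forall>R\<ge>1. \<exists>k0. \<forall>k\<ge>k0. local_est b (Cb b) C' R k)"
  by (rule bchoice[THEN exE])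
 then obtain Cb' where Cb: "\<forall>b\<in>B. Cb b \<ge> 0 \<and> Cb' b \<ge> 2 \<and> (\<forall>R\<ge>1. \<exists>k0. \<forall>k\<ge>k0. local_est b (Cb b) (Cb' b) R k)"
  by (rule bchoice[THEN exE])
 define Nc where "Nc b = (2 * Cb' b + 2) ^ DIM(complex ^ 'n)" for b
 have Nc0: "Nc b \<ge> 0" if "b \<in> B" for b using Cb that by (auto simp: Nc_def)
 \<comment> \<open>\<open>Ct / k\<close> will bound the local errors by the energy: local constants
   times the overlap of the enlarged balls times the upper density bound.\<close>
 define Ct where "Ct = Mv * (\<Sum>b\<in>B. Cb b * Nc b)"
 have sumC: "(\<Sum>b\<in>B. Cb b * Nc b) \<ge> 0" using Cb Nc0 by (intro sum_nonneg) auto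
 have Ct0: "Ct \<ge> 0" unfolding Ct_def using dens(2) sumC by simp
 define N where "N = card B * 6 ^ DIM(complex ^ 'n)"
 \<comment> \<open>With derivatives of size \<open>16 * M / \<delta>\<close> and
   \<open>\<delta> = R / sqrt k\<close>, the gluing factor times \<open>Ct / k\<close> becomes
   \<open>\<kappa> / R\<^sup>2\<close>: the powers of \<open>k\<close> cancel.\<close>
 define \<kappa> where "\<kappa> = real (card B) * (real CARD('n) * (4 * (real N)\<^sup>2 * (16 * M)\<^sup>2)) / mv * Ct"
 have \<kappa>0: "\<kappa> \<ge> 0" unfolding \<kappa>_def using Ct0 dens(1) by simp
 \<comment> \<open>Neither \<open>Ct\<close> nor \<open>\<kappa>\<close> involves \<open>R\<close>,
   so \<open>R\<close> can be taken large enough for the contraction factor 1/4.\<close>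
 define R where "R = max 1 (sqrt (4 * \<kappa>))"
 have R: "R \<ge> 1" by (simp add: R_def)
 have R2: "4 * \<kappa> \<le> R\<^sup>2"
 proof -
  have "(sqrt (4 * \<kappa>))\<^sup>2 \<le> R\<^sup>2" using \<kappa>0 by (intro power_mono) (auto simp: R_def)
  then show ?thesis using \<kappa>0 by simp
 qed
 have "\<forall>b\<in>B. \<exists>k0. \<forall>k\<ge>k0. local_est b (Cb b) (Cb' b) R k" using Cb R by blast
 then obtain kb where kb: "\<forall>b\<in>B. \<forall>k\<ge>kb b. local_est b (Cb b) (Cb' b) R k" by (rule bchoice[THEN exE])
 \<comment> \<open>Only here does \<open>k\<close> have to be large, depending on \<open>R\<close>,
   in each of the finitely many charts; the entry 1 keeps \<open>k\<close> positive.\<close>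
 define k0 where "k0 = Max (insert 1 (kb ` B))"
 have est: "local_est b (Cb b) (Cb' b) R k" if "b \<in> B" "k \<ge> k0" for b k
 proof -
  have "kb b \<le> k0" unfolding k0_def using that B(1) by (intro Max_ge) auto
  then show ?thesis using kb that by auto
 qed
 have k0: "k0 > 0" unfolding k0_def using B(1) by (subst Max_gr_iff) auto
 let ?gl = "%\<delta> P. gluing A \<omega> L h \<theta> B cb ib zb rb mv Mv (Sigma B P) fst snd (2 * \<delta>) (cbump \<delta>)
   (%j. ci (fst j) ` cball (snd j) (3 / 2 * \<delta>)) N (16 / \<delta> * M)"
 have grid: "\<exists>\<delta> P. \<delta> = R / sqrt k \<and> ?gl \<delta> P \<and>
   (\<forall>b\<in>B. finite (P b) \<and> P b \<subseteq> cball (zb b) (rb b) \<and> (\<forall>p\<in>P b. \<forall>q\<in>P b. p \<noteq> q --> dist p q \<ge> \<delta>))"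
  if k: "k \<ge> k0" for k
 proof -
  define \<delta> where "\<delta> = R / sqrt k"
  have \<delta>: "\<delta> > 0" using k k0 R by (simp add: \<delta>_def)
  have \<delta>r: "\<delta> \<le> rb b" if b: "b \<in> B" for b
  proof -
   have "Cb' b * R / sqrt k \<le> rb b" using est[OF b k] unfolding local_approx_def by blast
   moreover have "1 * \<delta> \<le> Cb' b * \<delta>" using Cb b \<delta> by (intro mult_right_mono) auto
   ultimately show ?thesis by (simp add: \<delta>_def)
  qed
  let ?net = "%b P. finite P \<and> P \<subseteq> cball (zb b) (rb b) \<and> (\<forall>x\<in>cball (zb b) (rb b). \<exists>p\<in>P. dist x p < \<delta>) \<and>
    (\<forall>p\<in>P. \<forall>q\<in>P. p \<noteq> q --> dist p q \<ge> \<delta>)"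
  have "\<forall>b\<in>B. \<exists>P. ?net b P"
  proof
   fix b
   show "\<exists>P. ?net b P"
    by (rule separated_net[OF compact_cball[of "zb b" "rb b"] \<delta>]) blast
  qed
  then obtain P where P: "\<forall>b\<in>B. ?net b (P b)" by (rule bchoice[THEN exE])
  have "?gl \<delta> P"
   unfolding N_def by (rule grid_gluing[OF \<delta> \<delta>r]) (use P M in blast)+
  then show ?thesis using P \<delta>_def by blast
 qed
 show ?thesis
 proof (rule that[of "4 * Ct" k0])
  show "4 * Ct \<ge> 0" using Ct0 by simp
  show "k0 > 0" by (rule k0)
  fix k s and D :: real assume k: "k \<ge> k0" and s: "!!m. s m \<in> H0 k" "!!m. N2 k (s (Suc m) -. s m) \<le> ennreal (D / 4 ^ m)" "0 \<le> D"
  obtain \<delta> P where "?gl \<delta> P" using grid[OF k] by blast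
  then interpret gl: gluing A \<omega> L h \<theta> B cb ib zb rb mv Mv k "Sigma B P" fst snd "2 * \<delta>" "cbump \<delta>"
   "%j. ci (fst j) ` cball (snd j) (3 / 2 * \<delta>)" N "16 / \<delta> * M" .
  show "\<exists>t\<in>H0 k. \<forall>i x. (%m. s m i x) \<longlonglongrightarrow> t i x"
   by (rule gl.H0_complete[where s=s, OF s]) blast
 next
  fix k v and e :: real assume k: "k \<ge> k0" and v: "C1sec k v" "0 \<le> e" "E k v \<le> ennreal e"
  have kp: "real k > 0" using k k0 by simp
  obtain \<delta> P where \<delta>: "\<delta> = R / sqrt k" and glu: "?gl \<delta> P"
   and P: "!!b. b \<in> B ==> finite (P b)" "!!b. b \<in> B ==> P b \<subseteq> cball (zb b) (rb b)"
    "!!b p q. b \<in> B ==> p \<in> P b ==> q \<in> P b ==> p \<noteq> q ==> dist p q \<ge> \<delta>" using grid[OF k] by blast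
  interpret gl: gluing A \<omega> L h \<theta> B cb ib zb rb mv Mv k "Sigma B P" fst snd "2 * \<delta>" "cbump \<delta>"
   "%j. ci (fst j) ` cball (snd j) (3 / 2 * \<delta>)" N "16 / \<delta> * M" by (rule glu)
  have \<delta>0: "\<delta> > 0" using kp R by (simp add: \<delta>)
  have "\<exists>t\<in>H0 k. N2 k (v -. t) \<le> ennreal (4 * (Ct / k) * e)"
  proof (rule gl.iterate[OF _ _ _ v(1,3,2)])
   show "Ct / real k \<ge> 0" using Ct0 by simp
   have "(16 / \<delta> * M)\<^sup>2 = (16 * M)\<^sup>2 * k / R\<^sup>2"
    using kp by (simp add: \<delta> power_mult_distrib power_divide)
   then have "real (card B) * (real CARD('n) * (4 * (real N)\<^sup>2 * (16 / \<delta> * M)\<^sup>2)) / mv * (Ct / k) = \<kappa> / R\<^sup>2"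
    using kp by (simp add: \<kappa>_def mult_ac)
   also have "... \<le> 1 / 4" using R2 R by (simp add: divide_le_eq)
   finally show "real (card B) * (real CARD('n) * (4 * (real N)\<^sup>2 * (16 / \<delta> * M)\<^sup>2)) / mv * (Ct / k) \<le> 1 / 4" .
   fix u assume u: "C1sec k u"
   let ?e = "%b z. dnorm2 (vb u b) z * hb k b z"
   let ?b = "%j. wint (ball (snd j) (Cb' (fst j) * \<delta>)) (?e (fst j))"
   let ?a = "%j. ball (snd j) (2 * \<delta>)"
   have "approx (?a j) (hb k (fst j)) (vb u (fst j)) (ennreal (Cb (fst j) / k) * ?b j)"
    if "j \<in> Sigma B P" for j
   proof -
    have j: "fst j \<in> B" "snd j \<in> P (fst j)" using that by auto
    have "snd j \<in> cball (zb (fst j)) (2 * rb (fst j))" using P(2)[OF j(1)] j(2) B(3)[OF j(1)] by auto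
    then show ?thesis
     using est[OF j(1) k] C1secD(2)[OF u B(2)[OF j(1)]] unfolding local_approx_def \<delta> times_divide_eq_right by blast
   qed
   then have "\<forall>j\<in>Sigma B P. \<exists>w. holo_on (?a j) w \<and>
     wint (?a j) (%z. (norm (vb u (fst j) z - w z))\<^sup>2 * hb k (fst j) z) \<le> ennreal (Cb (fst j) / k) * ?b j"
    unfolding approx_def by blast
   then obtain w where w: "\<forall>j\<in>Sigma B P. holo_on (?a j) (w j) \<and>
     wint (?a j) (%z. (norm (vb u (fst j) z - w j z))\<^sup>2 * hb k (fst j) z) \<le> ennreal (Cb (fst j) / k) * ?b j"
    by (rule bchoice[THEN exE])
   have "gl.err w u \<le> ennreal Mv * (\<Sum>j\<in>Sigma B P. ennreal (Cb (fst j) / k) *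
     ?b j)"
    by (rule order_trans[OF gl.err_le[where w=w, OF _ u] mult_left_mono[OF sum_mono]]) (use w in auto)
   also have "... = ennreal Mv * (\<Sum>b\<in>B. ennreal (Cb b / k) * (\<Sum>p\<in>P b. wint (ball p (Cb' b * \<delta>)) (?e b)))"
   proof -
    have "(\<Sum>j\<in>Sigma B P. ennreal (Cb (fst j) / k) * ?b j) =
     (\<Sum>b\<in>B. \<Sum>p\<in>P b. ennreal (Cb b / k) * wint (ball p (Cb' b * \<delta>)) (?e b))"
     by (subst sum.Sigma) (use B(1) P(1) in \<open>auto simp: split_beta\<close>)
    then show ?thesis by (simp only: sum_distrib_left[of "ennreal (Cb b / k)" for b])
   qed
   also have "... \<le> ennreal Mv * (\<Sum>b\<in>B. ennreal (Cb b / k) * (ennreal (Nc b) * E k u))"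
   proof (intro mult_left_mono sum_mono)
    fix b assume b: "b \<in> B"
    have "(\<Sum>p\<in>P b. wint (ball p (Cb' b * \<delta>)) (?e b)) \<le>
      ennreal (Nc b) * wint (K b) (?e b)"
     unfolding Nc_def
    proof (rule overlap[OF P(1)[OF b] P(3)[OF b] \<delta>0 _ _ energy_continuous[OF u b]])
     show "Cb' b \<ge> 0" using Cb b by force
     fix p assume p: "p \<in> P b"
     have "Cb' b * \<delta> \<le> rb b" using est[OF b k] unfolding local_approx_def \<delta> by simp
     moreover have "dist (zb b) p \<le> rb b" using P(2)[OF b] p by auto
     ultimately show "ball p (Cb' b * \<delta>) \<subseteq> K b"
      using B(3)[OF b] by (simp add: ball_subset_cball_iff dist_commute)
    qed
    also have "... \<le> ennreal (Nc b) * E k u"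
     unfolding E_def using b B(1) by (intro mult_left_mono member_le_sum) auto
    finally show "(\<Sum>p\<in>P b. wint (ball p (Cb' b * \<delta>)) (?e b)) \<le> ennreal (Nc b) * E k u" .
   qed auto
   also have "... = ennreal (Ct / k) * E k u"
   proof -
    have "(\<Sum>b\<in>B. ennreal (Cb b / k) * (ennreal (Nc b) * E k u)) = (\<Sum>b\<in>B. ennreal (Cb b / k * Nc b)) * E k u"
     unfolding sum_distrib_right
     by (intro sum.cong refl, subst ennreal_mult) (use Cb Nc0 in \<open>auto simp only: mult.assoc divide_nonneg_nonneg of_nat_0_le_iff\<close>)
    also have "(\<Sum>b\<in>B. ennreal (Cb b / k * Nc b)) = ennreal (\<Sum>b\<in>B. Cb b / k * Nc b)"
     using Cb Nc0 by (intro sum_ennreal) auto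
    also have "(\<Sum>b\<in>B. Cb b / k * Nc b) = (\<Sum>b\<in>B. Cb b * Nc b) / k" by (simp add: sum_divide_distrib)
    finally show ?thesis using dens(2) sumC by (simp add: Ct_def ennreal_mult'[symmetric] flip: mult.assoc)
   qed
   finally show "\<exists>w. (\<forall>j\<in>Sigma B P. holo_on (?a j) (w j)) \<and> gl.err w u \<le> ennreal (Ct / real k) * E k u"
    using w by blast
  qed
  then show "\<exists>t\<in>H0 k. N2 k (v -. t) \<le> ennreal (4 * Ct / real k * e)" by simp
 qed
qed

end

section \<open>The orthogonal projection\<close>

text \<open>The choice \<open>\<epsilon> = b / a\<close> would give the product; it is perturbed to
  stay positive, and \<open>a = 0\<close> is treated with a large \<open>\<epsilon>\<close>. This
  turns a pointwise inequality into the Cauchy-Schwarz inequality for integrals.\<close>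

lemma le_mult_if_le_weighted_mean:
 fixes x a b :: real
 assumes "a \<ge> 0" "b \<ge> 0" and le: "!!\<epsilon>. \<epsilon> > 0 ==> x \<le> (\<epsilon> * a\<^sup>2 + b\<^sup>2 / \<epsilon>) / 2"
 shows "x \<le> a * b"
proof (rule field_le_epsilon)
 fix e :: real assume e: "e > 0"
 show "x \<le> a * b + e"
 proof (cases "a = 0")
  case True
  define q where "q = b\<^sup>2 / e + 1"
  have q: "q > 0" using e by (auto simp: q_def intro!: add_nonneg_pos)
  have "b\<^sup>2 \<le> e * q" using e by (simp add: q_def field_simps)
  then have "b\<^sup>2 / q \<le> e" using q by (simp add: pos_divide_le_eq)
  then show ?thesis using le[OF q] True e by simp
 next
  case False
  then have a: "a > 0" using assms(1) by simp
  define d where "d = b / a + 2 * e / a\<^sup>2"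
  have d: "d > 0" using a e assms(2) by (auto simp: d_def intro!: add_nonneg_pos)
  have "b\<^sup>2 / d \<le> b\<^sup>2 / (b / a)" if "b > 0" using that a e d by (intro divide_left_mono mult_pos_pos) (auto simp: d_def)
  then have "b\<^sup>2 / d \<le> a * b" using assms(2) by (cases "b = 0") (auto simp: power2_eq_square mult.commute)
  moreover have "d * a\<^sup>2 = a * b + 2 * e" using a by (simp add: d_def field_simps power2_eq_square)
  ultimately show ?thesis using le[OF d] by simp
 qed
qed

context hermitian_bundle
begin

abbreviation inner where "inner k == L2_inner vol (Lk k) (metric_power h k)"

definition sq where "sq k s = (\<integral>x. pn k s x \<partial>vol)"

lemma integrable_continuous_vol:
 fixes F :: "'m => 'a::{banach, second_countable_topology}"
 assumes "continuous_on UNIV F" shows "integrable vol F"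
proof -
 interpret finite_measure vol by (rule finite_measure_vol)
 obtain C where "!!x. norm (F x) \<le> C"
  using compact_imp_bounded[OF compact_continuous_image[OF assms compact_M]] unfolding bounded_iff by auto
 moreover have "F \<in> borel_measurable vol" using borel_measurable_continuous_onI[OF assms] by simp
 ultimately show ?thesis by (intro integrable_const_bound) auto
qed

lemma ip_integrable: "C1sec k s ==> C1sec k t ==> integrable vol (ip k s t)"
 by (intro integrable_continuous_vol ip_continuous) (auto dest: C1secD)

lemma pn_cont: "C1sec k s ==> continuous_on UNIV (pn k s)"
 by (intro pn_continuous) (auto dest: C1secD)

lemma pn_integrable: "C1sec k s ==> integrable vol (pn k s)"
 by (intro integrable_continuous_vol pn_cont)

lemma sq_nonneg: "sq k s \<ge> 0"
 unfolding sq_def by (intro Bochner_Integration.integral_nonneg pn_nonneg)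

lemma nn_integral_pn: "C1sec k s ==> (\<integral>\<^sup>+x. ennreal (pn k s x) \<partial>vol) = ennreal (sq k s)"
 unfolding sq_def by (intro nn_integral_eq_integral pn_integrable) (simp_all add: pn_nonneg)

lemma inner_self: "C1sec k s ==> inner k s s = of_real (sq k s)"
 by (simp add: L2_inner_def sq_def flip: pn_ip)

lemma inner_diff:
 assumes "C1sec k s" "C1sec k t" "C1sec k u"
 shows inner_diff_left: "inner k (s -. t) u = inner k s u - inner k t u"
  and inner_diff_right: "inner k u (s -. t) = inner k u s - inner k u t"
proof -
 have "ip k (s -. t) u x = ip k s u x - ip k t u x" "ip k u (s -. t) x = ip k u s x - ip k u t x" for x
  by (simp_all add: ip_eq algebra_simps)
 then show "inner k (s -. t) u = inner k s u - inner k t u" "inner k u (s -. t) = inner k u s - inner k u t"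
  using assms by (simp_all add: L2_inner_def ip_integrable)
qed

lemma inner_mult: "inner k (f *. s) t = inner k s (%i x. cnj (f x) * t i x)"
 by (simp add: L2_inner_def ip_eq mult_ac)

lemma inner_cnj: "inner k s t = cnj (inner k t s)"
proof -
 have "ip k s t x = cnj (ip k t s x)" for x by (simp add: ip_eq mult_ac)
 then show ?thesis by (simp add: L2_inner_def)
qed

lemma sq_expand:
 assumes w: "C1sec k w" and u: "C1sec k u"
 shows "sq k (%i x. w i x - a * u i x) = sq k w - 2 * Re (cnj a * inner k w u) + (cmod a)\<^sup>2 * sq k u"
proof -
 have "pn k (%i x. w i x - a * u i x) x = pn k w x - 2 * Re (cnj a * ip k w u x) + (cmod a)\<^sup>2 * pn k u x" for x
 proof -
  have "(cmod (y - a * z))\<^sup>2 = (cmod y)\<^sup>2 - 2 * Re (cnj a * (y * cnj z)) + (cmod a)\<^sup>2 * (cmod z)\<^sup>2" for y z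
   unfolding cmod_power2 by (simp add: power2_eq_square algebra_simps)
  then have id: "(cmod (y - a * z))\<^sup>2 = (cmod y)\<^sup>2 - 2 * Re (cnj a * (y * cnj z)) + (cmod a)\<^sup>2 * (cmod z)\<^sup>2" for y z .
  have e: "Re (cnj a * (of_real r * y * cnj z)) = r * Re (cnj a * (y * cnj z))" for r y z
   by (simp add: algebra_simps)
  show ?thesis unfolding pn_def ip_eq id e by (simp only: right_diff_distrib distrib_left mult_ac)
 qed
 moreover define q where "q x = Re (cnj a * ip k w u x)" for x
 ultimately have "pn k (%i x. w i x - a * u i x) = (%x. pn k w x - 2 * q x + (cmod a)\<^sup>2 * pn k u x)" by (simp add: fun_eq_iff)
 moreover have "integrable vol q"
  unfolding q_def using ip_integrable[OF w u] by simp
 moreover have "(\<integral>x. q x \<partial>vol) = Re (cnj a * inner k w u)"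
  unfolding q_def L2_inner_def using ip_integrable[OF w u] by (subst integral_Re) simp_all
 ultimately show ?thesis unfolding sq_def using pn_integrable[OF w] pn_integrable[OF u] by simp
qed

lemma sq_parallelogram:
 assumes w: "C1sec k w" and u: "C1sec k u"
 shows "sq k (w -. u) + sq k (w +. u) = 2 * sq k w + 2 * sq k u"
 using sq_expand[OF w u, of 1] sq_expand[OF w u, of "- 1"] by simp

lemma sq_scale: "sq k (%i x. a * s i x) = (cmod a)\<^sup>2 * sq k s"
 by (simp add: sq_def pn_def norm_mult power_mult_distrib mult.left_commute)

lemma inner_Cauchy_Schwarz:
 assumes s: "C1sec k s" and t: "C1sec k t"
 shows "cmod (inner k s t) \<le> sqrt (sq k s) * sqrt (sq k t)"
proof (rule le_mult_if_le_weighted_mean)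
 fix \<epsilon> :: real assume e: "\<epsilon> > 0"
 have pt: "cmod (ip k s t x) \<le> (\<epsilon> * pn k s x + pn k t x / \<epsilon>) / 2" for x
 proof -
  let ?y = "cmod (s (fr x) x)" and ?z = "cmod (t (fr x) x)"
  have "0 \<le> (\<epsilon> * ?y - ?z)\<^sup>2 / \<epsilon>" using e by simp
  then have "?y * ?z \<le> (\<epsilon> * ?y\<^sup>2 + ?z\<^sup>2 / \<epsilon>) / 2" using e by (simp add: power2_eq_square field_simps)
  from mult_left_mono[OF this, of "h (fr x) x ^ k"] h_pos[OF fr, of x]
  show ?thesis by (simp add: ip_eq pn_def norm_mult norm_power algebra_simps add_divide_distrib)
 qed
 have "cmod (inner k s t) \<le> (\<integral>x. cmod (ip k s t x) \<partial>vol)"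
  unfolding L2_inner_def by (rule integral_norm_bound)
 also have "... \<le> (\<integral>x. (\<epsilon> * pn k s x + pn k t x / \<epsilon>) / 2 \<partial>vol)"
  using pt pn_integrable[OF s] pn_integrable[OF t] ip_integrable[OF s t] by (intro integral_mono) auto
 also have "... = (\<epsilon> * sq k s + sq k t / \<epsilon>) / 2"
  unfolding sq_def using pn_integrable[OF s] pn_integrable[OF t] by simp
 finally show "cmod (inner k s t) \<le> (\<epsilon> * (sqrt (sq k s))\<^sup>2 + (sqrt (sq k t))\<^sup>2 / \<epsilon>) / 2" by (simp add: sq_nonneg)
qed (simp_all add: sq_nonneg)

lemma sq_zero:
 assumes s: "C1sec k s" and 0: "sq k s = 0" shows "s i x = 0"
proof (cases "x \<in> dom i")
 case False
 then show ?thesis by (rule sec_outside[OF C1secD(1)[OF s]])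
next
 case True
 obtain c where c: "c \<in> A" "x \<in> fst c" using atlas unfolding complex_atlas_def by blast
 let ?f = "%z. pn k s (chart_inv c z) * volume_density \<omega> c (chart_inv c z)"
 have F: "(%x. ennreal (pn k s x)) \<in> borel_measurable borel"
  using borel_measurable_continuous_onI[OF pn_cont[OF s]] by simp
 have "wint (cimg c) ?f = (\<integral>\<^sup>+z. ennreal (pn k s (chart_inv c z)) * chart_density c z \<partial>lborel)"
  by (intro nn_integral_cong) (simp add: chart_density_def indicator_def ennreal_mult' pn_nonneg)
 also have "... = (\<integral>\<^sup>+x. ennreal (pn k s x) * indicator (fst c) x \<partial>vol)" by (rule nn_integral_vol_chart[OF c(1) F, symmetric])
 also have "... \<le> (\<integral>\<^sup>+x. ennreal (pn k s x) \<partial>vol)" by (intro nn_integral_mono) (simp add: indicator_def)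
 also have "... = 0" using nn_integral_pn[OF s] 0 by simp
 finally have z: "wint (cimg c) ?f = 0" by simp
 have "?f (snd c x) \<le> 0"
 proof (rule nn_integral_zero_continuous[OF chartD(2)[OF c(1)] _ z])
  have "continuous_on (cimg c) (%z. pn k s (chart_inv c z))"
   by (rule continuous_on_compose2[OF pn_cont[OF s] chart_inv_continuous[OF c(1)]]) simp
  then show "continuous_on (cimg c) ?f" by (intro continuous_on_mult continuous_volume_density[OF c(1)])
 qed (use c in blast)
 then have "pn k s x \<le> 0" using volume_density_pos[OF c] chart_inv_left[OF c] by (simp add: mult_le_0_iff)
 then show ?thesis
  using zero_less_power[OF h_pos[OF True], of k] unfolding pn_frame[OF C1secD(1)[OF s] True] by (auto simp: mult_le_0_iff)
qed

lemma H0_add: "s \<in> H0 k ==> t \<in> H0 k ==> (s +. t) \<in> H0 k"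
 and H0_scale: "s \<in> H0 k ==> (%i x. a * s i x) \<in> H0 k"
proof -
 have const: "holo_on S (%z. a)" for S :: "(complex ^ 'n) set" and a by (simp add: holo_on_iff_dbar)
 show sc: "(%i x. a * s i x) \<in> H0 k" if "s \<in> H0 k" for a s
  using that unfolding H0_holo by (simp add: sec_mult holo_on_mult const)
 show "(s +. t) \<in> H0 k" if s: "s \<in> H0 k" and t: "t \<in> H0 k"
  unfolding H0_holo
 proof (intro conjI ballI allI)
  show "sec k (s +. t)" using s t unfolding H0_holo by (intro sec_add) auto
  fix c i assume c: "c \<in> A"
  have "holo_on (cdom c i) (%z. s i (chart_inv c z) - - 1 * t i (chart_inv c z))"
   using s t c unfolding H0_holo by (intro holo_on_diff holo_on_mult const) auto
  then show "holo_on (cdom c i) (%z. s i (chart_inv c z) + t i (chart_inv c z))" by simp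
 qed
qed

lemma H0_diff: "s \<in> H0 k ==> t \<in> H0 k ==> (s -. t) \<in> H0 k"
 using H0_add[OF _ H0_scale[of t k "- 1"]] by simp

lemma H0_zero: "(%i x. 0) \<in> H0 k"
proof -
 have "(%z. 0 :: complex) differentiable (at z)" for z :: "complex ^ 'n" by simp
 then show ?thesis unfolding H0_holo by (auto simp: holo_on_iff_dbar intro!: secI)
qed

text \<open>The form of completeness that a minimising sequence with defects \<open>4 ^ -m\<close>
  requires. It is a property of a single \<open>k\<close> because it is derived from the gluing
  construction, which is available for large \<open>k\<close>.\<close>

definition complete_level where
 "complete_level k \<longleftrightarrow> (\<forall>s D. (\<forall>m. s m \<in> H0 k) --> (\<forall>m. sq k (s (Suc m) -. s m) \<le> D / 4 ^ m) \<longrightarrow>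
  (\<exists>t\<in>H0 k. \<forall>i x. (%m. s m i x) \<longlonglongrightarrow> t i x))"

text \<open>A minimising sequence is Cauchy by the parallelogram law, its limit attains the distance
  by Fatou's lemma, and minimality gives orthogonality. Uniqueness is included because the
  projection is a definite description.\<close>

lemma projection_exists:
 assumes k: "complete_level k" and v: "C1sec k v"
 shows "\<exists>!t. t \<in> H0 k \<and> (\<forall>u\<in>H0 k. inner k (v -. t) u = 0)"
proof -
 define d where "d = (INF t\<in>H0 k. sq k (v -. t))"
 have bdd: "bdd_below ((%t. sq k (v -. t)) ` H0 k)" by (intro bdd_belowI[of _ 0]) (auto simp: sq_nonneg)
 have d_le: "d \<le> sq k (v -. t)" if "t \<in> H0 k" for t unfolding d_def by (rule cINF_lower[OF bdd that])
 have "\<forall>m. \<exists>t. t \<in> H0 k \<and> sq k (v -. t) < d + 1 / 4 ^ m"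
 proof
  fix m :: nat
  have "\<exists>t\<in>H0 k. sq k (v -. t) < d + 1 / 4 ^ m"
   unfolding cINF_less_iff[OF ex_in_conv[THEN iffD1, OF exI, OF H0_zero] bdd, symmetric] d_def[symmetric] by simp
  then show "\<exists>t. t \<in> H0 k \<and> sq k (v -. t) < d + 1 / 4 ^ m" by blast
 qed
 then obtain s where "\<forall>m. s m \<in> H0 k \<and> sq k (v -. s m) < d + 1 / 4 ^ m" by (rule choice[THEN exE])
 then have s: "!!m. s m \<in> H0 k" "!!m. sq k (v -. s m) < d + 1 / 4 ^ m" by auto
 note sC = H0_C1sec[OF s(1)]
 have "sq k (s (Suc m) -. s m) \<le> 4 / 4 ^ m" for m
 proof -
  let ?a = "%i x. v i x - s m i x" and ?b = "%i x. v i x - s (Suc m) i x"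
  let ?h = "%i x. (1 / 2) * (s m i x + s (Suc m) i x)"
  have "sq k (?a -. ?b) + sq k (?a +. ?b) = 2 * sq k ?a + 2 * sq k ?b"
   by (intro sq_parallelogram C1sec_diff v sC)
  moreover have "sq k (?a +. ?b) = 4 * sq k (v -. ?h)"
  proof -
   have "(?a +. ?b) = (%i x. 2 * (v i x - ?h i x))" by (auto simp: fun_eq_iff field_simps)
   then show ?thesis by (simp only: sq_scale) simp
  qed
  moreover have "d \<le> sq k (v -. ?h)" by (intro d_le H0_scale H0_add s)
  moreover have "sq k (?a -. ?b) = sq k (s (Suc m) -. s m)" by simp
  moreover have "1 / (4 :: real) ^ Suc m \<le> 1 / 4 ^ m" by (intro divide_left_mono) auto
  moreover have "(4 :: real) / 4 ^ m = 4 * (1 / 4 ^ m)" by simp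
  ultimately show ?thesis using s(2)[of m] s(2)[of "Suc m"] by linarith
 qed
 then obtain t where t: "t \<in> H0 k" "!!i x. (%m. s m i x) \<longlonglongrightarrow> t i x"
  using k s(1) unfolding complete_level_def by blast
 have tC: "C1sec k t" by (rule H0_C1sec[OF t(1)])
 let ?w = "%i x. v i x - t i x"
 have wC: "C1sec k ?w" by (intro C1sec_diff v tC)
 have "d \<ge> 0" unfolding d_def by (rule cINF_greatest) (use H0_zero sq_nonneg in auto)
 have "(\<integral>\<^sup>+x. ennreal (pn k ?w x) \<partial>vol) \<le> ennreal d"
 proof (rule nn_integral_tendsto_le)
  show "(%x. ennreal (pn k (v -. s m) x)) \<in> borel_measurable vol" for m
   using borel_measurable_continuous_onI[OF pn_cont[OF C1sec_diff[OF v sC]]] by simp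
  show "(%m. ennreal (pn k (v -. s m) x)) \<longlonglongrightarrow> ennreal (pn k ?w x)" for x
   unfolding pn_def by (intro tendsto_ennrealI tendsto_intros t(2))
  show "(\<integral>\<^sup>+x. ennreal (pn k (v -. s m) x) \<partial>vol) \<le> ennreal (d + (1 / 4) ^ m)" for m
   using s(2)[of m] by (simp add: nn_integral_pn C1sec_diff v sC ennreal_leI power_one_over)
  have "(%m. d + (1 / 4) ^ m) \<longlonglongrightarrow> d + 0" by (intro tendsto_intros LIMSEQ_realpow_zero) auto
  then show "(%m. ennreal (d + (1 / 4) ^ m)) \<longlonglongrightarrow> ennreal d" by (intro tendsto_ennrealI) simp
 qed
 then have dw: "sq k ?w \<le> d" using \<open>d \<ge> 0\<close> by (simp add: nn_integral_pn wC)
 have orth: "inner k ?w u = 0" if u: "u \<in> H0 k" for u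
 proof (rule ccontr)
  let ?c = "inner k ?w u"
  assume c: "?c \<noteq> 0"
  \<comment> \<open>Small enough that moving \<open>t\<close> in direction \<open>u\<close> by
    \<open>\<epsilon>\<close> times the inner product decreases the distance: the quadratic term
    stays below the linear one.\<close>
  define \<epsilon> where "\<epsilon> = 1 / (1 + sq k u)"
  have e: "\<epsilon> > 0" "\<epsilon> * sq k u < 1" using sq_nonneg[of k u] by (auto simp: \<epsilon>_def divide_less_eq)
  have "sq k ?w \<le> sq k (%i x. ?w i x - of_real \<epsilon> * ?c * u i x)"
  proof -
   have "(%i x. t i x + of_real \<epsilon> * ?c * u i x) \<in> H0 k" by (intro H0_add H0_scale t u)
   from d_le[OF this] dw show ?thesis by (simp add: algebra_simps)
  qed
  also have "... = sq k ?w - 2 * Re (cnj (of_real \<epsilon> * ?c) * ?c) + (cmod (of_real \<epsilon> * ?c))\<^sup>2 * sq k u"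
   by (rule sq_expand[OF wC H0_C1sec[OF u]])
  also have "Re (cnj (of_real \<epsilon> * ?c) * ?c) = \<epsilon> * (cmod ?c)\<^sup>2"
   unfolding cmod_power2 by (simp add: power2_eq_square algebra_simps)
  also have "(cmod (of_real \<epsilon> * ?c))\<^sup>2 * sq k u = (\<epsilon> * (cmod ?c)\<^sup>2) * (\<epsilon> * sq k u)"
   by (simp add: norm_mult power_mult_distrib power2_eq_square)
  finally have "2 * (\<epsilon> * (cmod ?c)\<^sup>2) \<le> (\<epsilon> * (cmod ?c)\<^sup>2) * (\<epsilon> * sq k u)" by simp
  moreover have "(\<epsilon> * (cmod ?c)\<^sup>2) * (\<epsilon> * sq k u) \<le> (\<epsilon> * (cmod ?c)\<^sup>2) * 1" using e by (intro mult_left_mono) auto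
  moreover have "\<epsilon> * (cmod ?c)\<^sup>2 > 0" using e c by simp
  ultimately show False by simp
 qed
 show ?thesis
 proof (rule ex1I[of _ t])
  show "t \<in> H0 k \<and> (\<forall>u\<in>H0 k. inner k ?w u = 0)" using t(1) orth by blast
  fix t' assume t': "t' \<in> H0 k \<and> (\<forall>u\<in>H0 k. inner k (v -. t') u = 0)"
  let ?e = "%i x. t' i x - t i x"
  have eH: "?e \<in> H0 k" using t' t(1) by (intro H0_diff) auto
  have tC': "C1sec k t'" using t' H0_C1sec by blast
  have "inner k (%i x. ?w i x - (v i x - t' i x)) ?e = inner k ?w ?e - inner k (v -. t') ?e"
   by (intro inner_diff_left wC C1sec_diff v tC' tC)
  also have "... = 0" using orth[OF eH] t' eH by simp
  finally have "sq k ?e = 0" using inner_self[OF H0_C1sec[OF eH]] by simp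
  then show "t' = t" using sq_zero[OF H0_C1sec[OF eH]] by (auto simp: fun_eq_iff)
 qed
qed

end

section \<open>Products of Toeplitz operators\<close>

context hermitian_bundle
begin

abbreviation Top where "Top k f == berezin_toeplitz A \<omega> L h k f"

lemma Top:
 assumes k: "complete_level k" and f: "C1fun f" and s: "s \<in> H0 k"
 shows Top_H0: "Top k f s \<in> H0 k"
  and Top_orth: "u \<in> H0 k ==> inner k (f *. s -. Top k f s) u = 0"
  and Top_unique: "t \<in> H0 k ==> (!!u. u \<in> H0 k ==> inner k (f *. s -. t) u = 0) ==> Top k f s = t"
proof -
 note ex1 = projection_exists[OF k C1sec_mult[OF f H0_C1sec[OF s]]]
 have eq: "Top k f s = (THE t. t \<in> H0 k \<and> (\<forall>u\<in>H0 k. inner k (f *. s -. t) u = 0))"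
  unfolding berezin_toeplitz_def toeplitz_def holo_projection_def ..
 note th = theI'[OF ex1, folded eq]
 show "Top k f s \<in> H0 k" using th by (rule conjunct1)
 show "u \<in> H0 k ==> inner k (f *. s -. Top k f s) u = 0" using conjunct2[OF th] by (rule bspec)
 show "Top k f s = t" if "t \<in> H0 k" "!!u. u \<in> H0 k ==> inner k (f *. s -. t) u = 0"
  unfolding eq by (rule the1_equality[OF ex1]) (intro conjI ballI that)
qed

lemma Top_diff:
 assumes k: "complete_level k" and f: "C1fun f" and s: "s \<in> H0 k" and t: "t \<in> H0 k"
 shows "Top k f (s -. t) = (Top k f s -. Top k f t)"
proof (rule Top_unique[OF k f H0_diff[OF s t] H0_diff[OF Top_H0[OF k f s] Top_H0[OF k f t]]])
 fix u assume u: "u \<in> H0 k"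
 have C: "C1sec k (f *. s -. Top k f s)" if "s \<in> H0 k" for s
  by (intro C1sec_diff C1sec_mult f H0_C1sec Top_H0 k that)
 let ?a = "%i x. f x * (s i x - t i x) - (Top k f s i x - Top k f t i x)"
 have "?a =
   (%i x. (f x * s i x - Top k f s i x) - (f x * t i x - Top k f t i x))" by (simp add: fun_eq_iff algebra_simps)
 then show "inner k ?a u = 0"
  using inner_diff_left[OF C[OF s] C[OF t] H0_C1sec[OF u]] Top_orth[OF k f s u] Top_orth[OF k f t u] by simp
qed

lemma Top_closest:
 assumes k: "complete_level k" and f: "C1fun f" and s: "s \<in> H0 k" and t: "t \<in> H0 k"
 shows "sq k (f *. s -. Top k f s) \<le> sq k (f *. s -. t)"
proof -
 let ?w = "%i x. f x * s i x - Top k f s i x" and ?u = "%i x. Top k f s i x - t i x"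
 have u: "?u \<in> H0 k" by (intro H0_diff Top_H0 k f s t)
 have w: "C1sec k ?w" by (intro C1sec_diff C1sec_mult f H0_C1sec Top_H0 k s)
 have "sq k (%i x. ?w i x - (- 1) * ?u i x) = sq k ?w + sq k ?u"
  using sq_expand[OF w H0_C1sec[OF u], of "- 1"] Top_orth[OF k f s u] by simp
 then show ?thesis using sq_nonneg[of k ?u] by simp
qed

lemma C1fun_mult: "C1fun f ==> C1fun f' ==> C1fun (%x. f x * f' x)"
 unfolding C1fun_def by (simp add: C1_on_mult)

lemma C1fun_cnj: "C1fun f ==> C1fun (%x. cnj (f x))"
 unfolding C1fun_def by (auto intro!: C1_on_compose[OF C1_on_linear[OF bounded_linear_cnj, of UNIV]])

text \<open>Since \<open>T\<^sub>f T\<^sub>g s - T\<^sub>f\<^sub>g s\<close> is the projection of \<open>f (T\<^sub>g s - g s)\<close>, its product with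
 \<open>u\<close> pairs the defect of \<open>g s\<close> with the defect of \<open>cnj f u\<close>, and each is small.\<close>

lemma Top_product:
 assumes k: "complete_level k" and f: "C1fun f" and f': "C1fun f'" and s: "s \<in> H0 k" and ab: "a \<ge> 0" "b \<ge> 0"
  and a: "!!s. s \<in> H0 k ==> sq k (f' *. s -. Top k f' s) \<le> a * sq k s"
  and b: "!!s. s \<in> H0 k ==> sq k (%i x. cnj (f x) * s i x - Top k (%x. cnj (f x)) s i x) \<le> b * sq k s"
 shows "sq k (%i x. Top k f (Top k f' s) i x - Top k (%x. f x * f' x) s i x) \<le> a * b * sq k s"
proof -
 let ?t = "Top k f' s" and ?p = "Top k (%x. f x * f' x) s" and ?cf = "%x. cnj (f x)"
 define u where "u = (Top k f ?t -. ?p)"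
 have tH: "?t \<in> H0 k" by (rule Top_H0[OF k f' s])
 have TH: "Top k f ?t \<in> H0 k" "?p \<in> H0 k" by (intro Top_H0 k f tH C1fun_mult f' s)+
 have u: "u \<in> H0 k" unfolding u_def by (intro H0_diff TH)
 have uC: "C1sec k u" by (rule H0_C1sec[OF u])
 have cf: "C1fun ?cf" by (rule C1fun_cnj[OF f])
 let ?w = "%i x. f' x * s i x - ?t i x" and ?c = "%i x. ?cf x * u i x"
 have wC: "C1sec k ?w" by (intro C1sec_diff C1sec_mult f' H0_C1sec s tH)
 have cC: "C1sec k ?c" "C1sec k (Top k ?cf u)" by (intro C1sec_mult cf uC H0_C1sec Top_H0 k u)+
 have ftC: "C1sec k (f *. ?t)" "C1sec k (%i x. (f x * f' x) * s i x)"
  by (intro C1sec_mult C1fun_mult f f' H0_C1sec tH s)+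
 let ?a = "%i x. (f x * ?t i x - Top k f ?t i x) - ((f x * f' x) * s i x - ?p i x)"
 have "inner k ?a u = 0"
  using inner_diff_left[OF C1sec_diff[OF ftC(1) H0_C1sec[OF TH(1)]] C1sec_diff[OF ftC(2) H0_C1sec[OF TH(2)]] uC]
   Top_orth[OF k f tH u] Top_orth[OF k C1fun_mult[OF f f'] s u] by simp
 moreover have "?a =
   (%i x. (- f x) * ?w i x - u i x)" by (simp add: u_def fun_eq_iff algebra_simps)
 ultimately have "inner k (%i x. (- f x) * ?w i x) u = inner k u u"
  using inner_diff_left[OF C1sec_mult[OF C1fun_mult[OF C1fun_const[of "- 1"] f] wC] uC uC] by simp
 then have "of_real (sq k u) = inner k ?w (%i x. - 1 * ?c i x)"
  using inner_mult[of k "%x. - f x" ?w u] by (simp add: inner_self[OF uC])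
 also have "... = cnj (- 1) * inner k ?w ?c"
  by (subst (1 2) inner_cnj) (simp add: inner_mult[of k "%_. - 1"] L2_inner_def ip_eq)
 \<comment> \<open>\<open>?w\<close> is orthogonal to holomorphic sections, so the projection of
   \<open>?c\<close> may be subtracted; this brings in the second defect.\<close>
 also have "inner k ?w ?c = inner k ?w (?c -. Top k ?cf u)"
  using inner_diff_right[OF cC wC] Top_orth[OF k f' s Top_H0[OF k cf u]] by simp
 finally have "cmod (of_real (sq k u)) = cmod (inner k ?w (?c -. Top k ?cf u))" by (simp add: norm_mult)
 then have "sq k u = cmod (inner k ?w (?c -. Top k ?cf u))" using sq_nonneg[of k u] by simp
 also have "... \<le> sqrt (sq k ?w) * sqrt (sq k (?c -. Top k ?cf u))"
  by (intro inner_Cauchy_Schwarz wC C1sec_diff cC)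
 also have "... \<le> sqrt (a * sq k s) * sqrt (b * sq k u)"
  by (intro mult_mono real_sqrt_le_mono a b s u) (simp_all add: ab sq_nonneg)
 also have "... = sqrt (a * b * sq k s) * sqrt (sq k u)" by (simp add: real_sqrt_mult mult_ac)
 finally have le: "sq k u \<le> sqrt (a * b * sq k s) * sqrt (sq k u)" .
 have "sqrt (sq k u) \<le> sqrt (a * b * sq k s)"
 proof (cases "sq k u = 0")
  case False
  then have pos: "sqrt (sq k u) > 0" using sq_nonneg[of k u] by simp
  have "sqrt (sq k u) * sqrt (sq k u) \<le> sqrt (a * b * sq k s) * sqrt (sq k u)" using le sq_nonneg[of k u] by simp
  then show ?thesis using pos by (rule mult_right_le_imp_le)
 qed (simp add: ab sq_nonneg)
 then show ?thesis by (simp add: u_def)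
qed

lemma sq_add_le:
 assumes "C1sec k s" "C1sec k t"
 shows "sq k (s -. t) \<le> 2 * sq k s + 2 * sq k t"
 using sq_parallelogram[OF assms] sq_nonneg[of k "%i x. s i x + t i x"] by simp

text \<open>For holomorphic \<open>s\<close> the derivative of \<open>f *. s\<close> falls on
  \<open>f\<close> alone, so its energy is at most a constant times \<open>sq k s\<close>, with no
  power of \<open>k\<close>. \<open>cov.approximation\<close> gives a holomorphic section within the
  claimed distance, and the projection is at least as close.\<close>

theorem toeplitz_approximation:
 obtains k0 where "k0 > 0" "!!k. k \<ge> k0 ==> complete_level k"
  "!!f. C1fun f ==> \<exists>C\<ge>0. \<forall>k\<ge>k0. \<forall>s\<in>H0 k. sq k (f *. s -. Top k f s) \<le> C / k * sq k s"
proof -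
 obtain B cb ib zb rb mv Mv where "covered_bundle A \<omega> L h \<theta> (B :: 'm set) cb ib zb rb mv Mv"
  by (rule cover_exists)
 then interpret cov: covered_bundle A \<omega> L h \<theta> B cb ib zb rb mv Mv .
 obtain C k0 where C: "C \<ge> 0" and k0: "k0 > 0"
  and app: "!!k v e. k \<ge> k0 ==> C1sec k v ==> 0 \<le> e ==> cov.E k v \<le> ennreal e ==>
   \<exists>t\<in>H0 k. cov.N2 k (v -. t) \<le> ennreal (C / real k * e)"
  and comp: "!!k s D. k \<ge> k0 ==> (!!m. s m \<in> H0 k) ==> (!!m. cov.N2 k (s (Suc m) -. s m) \<le> ennreal (D / 4 ^ m)) ==> 0 \<le> D ==>
   \<exists>t\<in>H0 k. \<forall>i x. (%m. s m i x) \<longlonglongrightarrow> t i x"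
  by (rule cov.approximation) (assumption | rule that | blast)+
 have N2: "cov.N2 k s = ennreal (sq k s)" if "C1sec k s" for k s
  unfolding cov.N2_def by (rule nn_integral_pn[OF that])
 have complete: "complete_level k" if k: "k \<ge> k0" for k
  unfolding complete_level_def
 proof (intro allI impI)
  fix s D assume s: "\<forall>m. s m \<in> H0 k" and D: "\<forall>m. sq k (s (Suc m) -. s m) \<le> D / 4 ^ m"
  show "\<exists>t\<in>H0 k. \<forall>i x. (%m. s m i x) \<longlonglongrightarrow> t i x"
  proof (rule comp[OF k])
   show "s m \<in> H0 k" for m using s by blast
   show "cov.N2 k (s (Suc m) -. s m) \<le> ennreal (D / 4 ^ m)" for m
    by (subst N2) (use s D in \<open>auto intro!: C1sec_diff[OF H0_C1sec H0_C1sec] ennreal_leI\<close>)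
   show "0 \<le> D" using D[rule_format, of 0] sq_nonneg[of k "%i x. s (Suc 0) i x - s 0 i x"] by simp
  qed
 qed
 show ?thesis
 proof (rule that[OF k0 complete])
  fix f assume f: "C1fun f"
  have "continuous_on (cov.K b) (dnorm2 (%z. f (cov.ci b z)))" if b: "b \<in> B" for b
  proof -
   have fb: "C1_on (cimg (cb b)) (%z. f (cov.ci b z))" using f cov.B(2)[OF b] unfolding C1fun_def by blast
   have "cov.K b \<subseteq> cimg (cb b)" using cov.B(4)[OF b] by blast
   then show ?thesis unfolding dnorm2_def by (intro continuous_intros C1_on_dbar_cont C1_on_subset[OF fb])
  qed
  then obtain c where c: "c > 0" "!!b z. b \<in> B ==> z \<in> cov.K b ==> dnorm2 (%z. f (cov.ci b z)) z \<le> c"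
   using bounded_on_compacts[where X="cov.K" and f="%b. dnorm2 (%z. f (cov.ci b z))", OF cov.B(1) compact_cball] by metis
  define cs where "cs = real (card B) * (c / mv)"
  have cs: "cs \<ge> 0" unfolding cs_def using c cov.dens(1) by simp
  have E_le: "cov.E k (f *. s) \<le> ennreal (cs * sq k s)" if s: "s \<in> H0 k" for k s
  proof -
   have sC: "C1sec k s" by (rule H0_C1sec[OF s])
   have meas: "(%x. ennreal (pn k s x)) \<in> borel_measurable borel" using borel_measurable_continuous_onI[OF pn_cont[OF sC]] by simp
   have "wint (cov.K b) (%z. dnorm2 (cov.vb (f *. s) b) z * cov.hb k b z) \<le>
     ennreal (c / mv * sq k s)" if b: "b \<in> B" for b
   proof -
    have "wint (cov.K b) (%z. dnorm2 (cov.vb (f *. s) b) z * cov.hb k b z) \<le>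
     (\<integral>\<^sup>+z. (%x. ennreal c * ennreal (pn k s x)) (cov.ci b z) * indicator (cov.K b) z \<partial>lborel)"
    proof (rule nn_integral_mono)
     fix z
     show "ennreal (dnorm2 (cov.vb (f *. s) b) z * cov.hb k b z) * indicator (cov.K b) z \<le>
      (%x. ennreal c * ennreal (pn k s x)) (cov.ci b z) * indicator (cov.K b) z"
     proof (cases "z \<in> cov.K b")
      case True
      note zc = cov.K_cdom[OF b True]
      note zD = cdomD[OF cov.B(2)[OF b] zc]
      have d: "(%z. f (cov.ci b z)) differentiable (at z)" "cov.vb s b differentiable (at z)" "!!u. dbar (cov.vb s b) z u = 0"
       using f cov.B(2)[OF b] zD(1) s zc unfolding C1fun_def C1_on_def H0_holo holo_on_iff_dbar by blast+
      have "dnorm2 (cov.vb (f *. s) b) z = dnorm2 (%z. f (cov.ci b z)) z * (cmod (cov.vb s b z))\<^sup>2"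
       unfolding dnorm2_def dbar_mult[OF d(1,2)] d(3) by (simp add: norm_mult power_mult_distrib sum_distrib_right)
      also have "... * cov.hb k b z \<le> c * (cmod (cov.vb s b z))\<^sup>2 * cov.hb k b z"
       using c(2)[OF b True] h_pos[OF zD(3)] by (intro mult_right_mono) auto
      finally have "dnorm2 (cov.vb (f *. s) b) z * cov.hb k b z \<le> c * pn k s (cov.ci b z)"
       unfolding pn_frame[OF C1secD(1)[OF sC] zD(3)] by (simp add: mult_ac)
      then have "ennreal (dnorm2 (cov.vb (f *. s) b) z * cov.hb k b z) \<le> ennreal c * ennreal (pn k s (cov.ci b z))"
       using c b by (subst ennreal_mult[symmetric]) (auto intro: ennreal_leI simp: pn_nonneg)
      then show ?thesis using True by simp
     qed simp
    qed
    also have "... \<le> ennreal (1 / mv) * (\<integral>\<^sup>+x. ennreal c * ennreal (pn k s x) \<partial>vol)"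
     by (rule cov.chart_to_vol[OF b]) (use meas in simp)
    also have "(\<integral>\<^sup>+x. ennreal c * ennreal (pn k s x) \<partial>vol) = ennreal c * ennreal (sq k s)"
     using meas nn_integral_pn[OF sC] by (simp add: nn_integral_cmult)
    also have "ennreal (1 / mv) * (ennreal c * ennreal (sq k s)) = ennreal (c / mv * sq k s)"
     using c b cov.dens(1) by (simp add: sq_nonneg flip: ennreal_mult)
    finally show ?thesis .
   qed
   then have "cov.E k (f *. s) \<le> (\<Sum>b\<in>B. ennreal (c / mv * sq k s))" unfolding cov.E_def by (rule sum_mono)
   also have "... = ennreal (\<Sum>b\<in>B. c / mv * sq k s)" using c cov.dens(1) by (intro sum_ennreal) (simp add: sq_nonneg)
   also have "(\<Sum>b\<in>B. c / mv * sq k s) = cs * sq k s" by (simp add: cs_def)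
   finally show ?thesis .
  qed
  have "sq k (f *. s -. Top k f s) \<le> C * cs / k * sq k s" if k: "k \<ge> k0" and s: "s \<in> H0 k" for k s
  proof -
   have fs: "C1sec k (f *. s)" by (rule C1sec_mult[OF f H0_C1sec[OF s]])
   obtain t where t: "t \<in> H0 k" "cov.N2 k (f *. s -. t) \<le> ennreal (C / k * (cs * sq k s))"
    using app[OF k fs _ E_le[OF s]] cs sq_nonneg[of k s] by auto
   then have "sq k (f *. s -. t) \<le> C / k * (cs * sq k s)"
    using C cs sq_nonneg[of k s] by (simp add: N2 C1sec_diff fs H0_C1sec)
   with Top_closest[OF complete[OF k] f s t(1)] show ?thesis by simp
  qed
  then show "\<exists>C\<ge>0. \<forall>k\<ge>k0. \<forall>s\<in>H0 k. sq k (f *. s -. Top k f s) \<le> C / k * sq k s"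
   using C cs by (intro exI[of _ "C * cs"]) auto
 qed
qed

end

section \<open>Generalized commutators\<close>

text \<open>Interpolates between the plain product of consecutive pairs, \<open>r = 0\<close>, and
  the product of their commutators, \<open>r = n\<close>. Operators are numbered from 1, pairs from
  0.\<close>

definition pair_op :: "(nat => ('i => 'm => complex) => 'i => 'm => complex) => (nat => nat) => nat => nat =>
  ('i => 'm => complex) => 'i => 'm => complex" where
 "pair_op T \<sigma> r l s = (if l < r
   then (T (\<sigma> (2 * l + 1)) (T (\<sigma> (2 * l + 2)) s) -. T (\<sigma> (2 * l + 2)) (T (\<sigma> (2 * l + 1)) s))
   else T (\<sigma> (2 * l + 1)) (T (\<sigma> (2 * l + 2)) s))"

lemma foldr_pairs: "foldr (%j. T (\<sigma> j)) [1..<Suc (2 * n)] s = foldr (pair_op T \<sigma> 0) [0..<n] s"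
proof (induction n arbitrary: s)
 case (Suc n)
 have "[1..<Suc (2 * Suc n)] = [1..<Suc (2 * n)] @ [2 * n + 1, 2 * n + 2]"
  by (simp add: upt_rec[of "2 * n + 1"] upt_rec[of "2 * n + 2"])
 then show ?case using Suc[of "T (\<sigma> (2 * n + 1)) (T (\<sigma> (2 * n + 2)) s)"] by (simp add: pair_op_def)
qed simp

lemma foldr_closed: "(!!l s. l \<in> set ls ==> s \<in> H ==> G l s \<in> H) ==> s \<in> H ==> foldr G ls s \<in> H"
 by (induction ls) auto

lemma foldr_additive:
 assumes H: "!!l s. l \<in> set ls ==> s \<in> H ==> G l s \<in> H"
  and G: "!!l s t. l \<in> set ls ==> s \<in> H ==> t \<in> H ==> G l (s -. t) = (%i x. G l s i x - G l t i x :: complex)"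
  and st: "s \<in> H" "t \<in> H"
 shows "foldr G ls (s -. t) = (foldr G ls s -. foldr G ls t)"
 using H G
proof (induction ls)
 case (Cons l ls)
 have "foldr G ls s \<in> H" "foldr G ls t \<in> H" by (intro foldr_closed Cons.prems(1) st; simp)+
 moreover have "foldr G ls (s -. t) = (foldr G ls s -. foldr G ls t)"
  by (rule Cons.IH) (use Cons.prems in auto)
 ultimately show ?case using Cons.prems(2)[of l "foldr G ls s" "foldr G ls t"] by simp
qed simp

text \<open>Exchanging the two entries of pair \<open>r\<close> is a transposition, so it reverses
  the sign in the sum over all \<open>\<sigma>\<close>; replacing the product of this pair by its
  commutator therefore doubles the sum.\<close>

lemma commutator_pairing:
 assumes T: "!!j s. j \<in> {1..2 * n} ==> s \<in> H ==> T j s \<in> H"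
  and add: "!!j s t. j \<in> {1..2 * n} ==> s \<in> H ==> t \<in> H ==> T j (s -. t) = (T j s -. T j t)"
  and diff: "!!s t. s \<in> H ==> t \<in> H ==> (s -. t) \<in> H"
  and s: "s \<in> H" and r: "r \<le> n"
 shows "2 ^ r * (\<Sum>\<sigma> | \<sigma> permutes {1..2 * n}. of_int (sign \<sigma>) * foldr (pair_op T \<sigma> 0) [0..<n] s i x) =
  (\<Sum>\<sigma> | \<sigma> permutes {1..2 * n}. of_int (sign \<sigma>) * foldr (pair_op T \<sigma> r) [0..<n] s i x)"
 using r
proof (induction r)
 case (Suc r)
 let ?P = "{\<sigma>. \<sigma> permutes {1..2 * n}}"
 let ?Q = "%r \<sigma>. foldr (pair_op T \<sigma> r) [0..<n] s i x"
 define \<tau> where "\<tau> = Transposition.transpose (2 * r + 1) (2 * r + 2)"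
 have \<tau>: "\<tau> permutes {1..2 * n}" unfolding \<tau>_def using Suc.prems by (intro permutes_swap_id) auto
 have ne: "2 * r + 1 \<noteq> 2 * r + 2" by simp
 have split: "[0..<n] = [0..<r] @ r # [Suc r..<n]"
  using Suc.prems upt_add_eq_append[of 0 r "n - r"] by (simp add: upt_conv_Cons)
 have pos: "\<sigma> (2 * l + 1) \<in> {1..2 * n}" "\<sigma> (2 * l + 2) \<in> {1..2 * n}" if "\<sigma> \<in> ?P" "l < n" for \<sigma> l
  using that permutes_in_image[of \<sigma> "{1..2 * n}"] by auto
 have pair: "pair_op T \<sigma> q l u \<in> H"
  "pair_op T \<sigma> q l (u -. v) = (pair_op T \<sigma> q l u -. pair_op T \<sigma> q l v)"
  if "\<sigma> \<in> ?P" "l < n" "u \<in> H" "v \<in> H" for \<sigma> q l u v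
  using pos[OF that(1,2)] that(3,4) T by (auto simp: pair_op_def add diff fun_eq_iff intro!: diff)
 have step: "?Q (Suc r) \<sigma> = ?Q r \<sigma> - ?Q r (\<sigma> \<circ> \<tau>)" if \<sigma>: "\<sigma> \<in> ?P" for \<sigma>
 proof -
  have fx: "\<tau> (2 * l + 1) = 2 * l + 1" "\<tau> (2 * l + 2) = 2 * l + 2" if "l \<noteq> r" for l
   using that by (auto simp: \<tau>_def Transposition.transpose_def)
  have op: "pair_op T (\<sigma> \<circ> \<tau>) r l = pair_op T \<sigma> r l" "pair_op T \<sigma> (Suc r) l = pair_op T \<sigma> r l" if "l \<noteq> r" for l
   using fx[OF that] that by (auto simp: pair_op_def fun_eq_iff less_Suc_eq)
  let ?c = "pair_op T \<sigma> r"
  have same: "foldr (pair_op T (\<sigma> \<circ> \<tau>) r) ls u = foldr ?c ls u"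
   "foldr (pair_op T \<sigma> (Suc r)) ls u = foldr ?c ls u" if "r \<notin> set ls" for ls u
  proof -
   have ne: "l \<noteq> r" if "l \<in> set ls" for l using that \<open>r \<notin> set ls\<close> by blast
   show "foldr (pair_op T (\<sigma> \<circ> \<tau>) r) ls u = foldr ?c ls u"
    by (intro foldr_cong refl) (simp only: op(1)[OF ne])
   show "foldr (pair_op T \<sigma> (Suc r)) ls u = foldr ?c ls u"
    by (intro foldr_cong refl) (simp only: op(2)[OF ne])
  qed
  define y where "y = foldr ?c [Suc r..<n] s"
  have yH: "y \<in> H" unfolding y_def by (rule foldr_closed) (use pair \<sigma> s in auto)
  let ?a = "T (\<sigma> (2 * r + 1)) (T (\<sigma> (2 * r + 2)) y)" and ?b = "T (\<sigma> (2 * r + 2)) (T (\<sigma> (2 * r + 1)) y)"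
  have ab: "?a \<in> H" "?b \<in> H" using pos[OF \<sigma>, of r] Suc.prems T yH by auto
  have "?Q (Suc r) \<sigma> = foldr ?c [0..<r] (?a -. ?b) i x"
   unfolding split by (simp add: same y_def[symmetric]) (simp add: pair_op_def)
  also have "... = foldr ?c [0..<r] ?a i x - foldr ?c [0..<r] ?b i x"
   by (subst foldr_additive[where H=H]) (use pair \<sigma> ab Suc.prems in auto)
  also have "foldr ?c [0..<r] ?a i x = ?Q r \<sigma>"
   unfolding split by (simp add: y_def[symmetric]) (simp add: pair_op_def)
  also have "foldr ?c [0..<r] ?b i x = ?Q r (\<sigma> \<circ> \<tau>)"
   unfolding split by (simp add: same y_def[symmetric]) (simp add: pair_op_def \<tau>_def)
  finally show ?thesis .
 qed
 have "(\<Sum>\<sigma>\<in>?P. of_int (sign \<sigma>) * ?Q r (\<sigma> \<circ> \<tau>)) = (\<Sum>\<sigma>\<in>?P. - (of_int (sign \<sigma>) * ?Q r \<sigma>))"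
 proof (rule sum.reindex_bij_witness[of _ "%\<sigma>. \<sigma> \<circ> \<tau>" "%\<sigma>. \<sigma> \<circ> \<tau>"])
  have tt: "(\<sigma> \<circ> \<tau>) \<circ> \<tau> = \<sigma>" for \<sigma> :: "nat => nat" by (simp add: \<tau>_def fun_eq_iff)
  fix \<sigma> assume \<sigma>: "\<sigma> \<in> ?P"
  show "\<sigma> \<circ> \<tau> \<circ> \<tau> = \<sigma>" "\<sigma> \<circ> \<tau> \<circ> \<tau> = \<sigma>" by (rule tt)+
  show "\<sigma> \<circ> \<tau> \<in> ?P" "\<sigma> \<circ> \<tau> \<in> ?P" using \<sigma> \<tau> by (auto intro: permutes_compose)
  have "permutation \<sigma>" "permutation \<tau>" using \<sigma> \<tau> permutation_permutes by (metis finite_atLeastAtMost mem_Collect_eq)+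
  then have "sign (\<sigma> \<circ> \<tau>) = - sign \<sigma>" using ne by (simp add: sign_compose \<tau>_def sign_swap_id)
  then show "- (of_int (sign (\<sigma> \<circ> \<tau>)) * ?Q r (\<sigma> \<circ> \<tau>)) = of_int (sign \<sigma>) * ?Q r (\<sigma> \<circ> \<tau>)" by simp
 qed
 then have "(\<Sum>\<sigma>\<in>?P. of_int (sign \<sigma>) * ?Q (Suc r) \<sigma>) = 2 * (\<Sum>\<sigma>\<in>?P. of_int (sign \<sigma>) * ?Q r \<sigma>)"
  by (simp add: step right_diff_distrib sum_subtractf sum_negf)
 then show ?case using Suc by simp
qed simp

context hermitian_bundle
begin

lemma H0_sum: "(!!j. j \<in> J ==> u j \<in> H0 k) ==> (%i x. \<Sum>j\<in>J. u j i x) \<in> H0 k"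
 by (induction J rule: infinite_finite_induct) (auto intro: H0_add H0_zero)

lemma sq_sum_le:
 assumes J: "finite J" and u: "!!j. j \<in> J ==> C1sec k (u j)" and s: "C1sec k (%i x. \<Sum>j\<in>J. u j i x)"
 shows "sq k (%i x. \<Sum>j\<in>J. u j i x) \<le> real (card J) * (\<Sum>j\<in>J. sq k (u j))"
proof -
 have "pn k (%i x. \<Sum>j\<in>J. u j i x) x \<le> real (card J) * (\<Sum>j\<in>J. pn k (u j) x)" for x
 proof -
  have "(cmod (\<Sum>j\<in>J. u j (fr x) x))\<^sup>2 \<le> (\<Sum>j\<in>J. 1 * cmod (u j (fr x) x))\<^sup>2"
   by (intro power_mono sum_norm_le) auto
  also have "... \<le> (\<Sum>j\<in>J. 1\<^sup>2) * (\<Sum>j\<in>J. (cmod (u j (fr x) x))\<^sup>2)" by (rule Cauchy_Schwarz_ineq_sum)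
  finally have "(cmod (\<Sum>j\<in>J. u j (fr x) x))\<^sup>2 \<le> real (card J) * (\<Sum>j\<in>J. (cmod (u j (fr x) x))\<^sup>2)" by simp
  from mult_left_mono[OF this, of "h (fr x) x ^ k"] h_pos[OF fr, of x]
  show ?thesis by (simp add: pn_def sum_distrib_left mult.left_commute)
 qed
 then have "sq k (%i x. \<Sum>j\<in>J. u j i x) \<le> (\<integral>x. real (card J) * (\<Sum>j\<in>J. pn k (u j) x) \<partial>vol)"
  unfolding sq_def by (intro integral_mono pn_integrable s) (auto intro!: pn_integrable u)
 also have "... = real (card J) * (\<Sum>j\<in>J. sq k (u j))"
  unfolding sq_def by (simp add: pn_integrable u)
 finally show ?thesis .
qed

text \<open>After pairing, every term is a product of \<open>n\<close> commutators, each of operator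
  norm at most \<open>2 * D / k\<close>; the number of permutations enters the constant through the
  sum.\<close>

theorem generalized_commutator_bound:
 assumes f: "!!j. j \<in> {1..2 * n} ==> C1fun (f j)"
 shows "\<exists>C k0. C \<ge> 0 \<and> (\<forall>k\<ge>k0. k > 0 \<and> (\<forall>s\<in>H0 k.
  generalized_commutator (2 * n) (%j. Top k (f j)) s \<in> H0 k \<and>
  sq k (generalized_commutator (2 * n) (%j. Top k (f j)) s) \<le> (C / real k ^ n)\<^sup>2 * sq k s))"
proof -
 obtain k0 where k0: "k0 > 0" and comp: "!!k. k \<ge> k0 ==> complete_level k"
  and app: "!!f. C1fun f ==> \<exists>C\<ge>0. \<forall>k\<ge>k0. \<forall>s\<in>H0 k. sq k (f *. s -. Top k f s) \<le> C / k * sq k s"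
  by (rule toeplitz_approximation) blast
 have "\<forall>f\<in>{f. C1fun f}. \<exists>C. C \<ge> 0 \<and> (\<forall>k\<ge>k0. \<forall>s\<in>H0 k. sq k (f *. s -. Top k f s) \<le> C / k * sq k s)"
  using app by blast
 then obtain a where "\<forall>f\<in>{f. C1fun f}. a f \<ge> 0 \<and> (\<forall>k\<ge>k0. \<forall>s\<in>H0 k. sq k (f *. s -. Top k f s) \<le> a f / k * sq k s)"
  by (rule bchoice[THEN exE])
 then have a: "!!f. C1fun f ==> a f \<ge> 0"
  "!!f k s. C1fun f ==> k \<ge> k0 ==> s \<in> H0 k ==> sq k (f *. s -. Top k f s) \<le> a f / k * sq k s"
  by auto
 let ?J = "{1..2 * n}" and ?cf = "%j x. cnj (f j x)"
 \<comment> \<open>One bound for the defect constants of all the functions and of their conjugates,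
   since the product estimate involves both kinds.\<close>
 define D where "D = (\<Sum>j\<in>?J. a (f j) + a (?cf j))"
 have a0: "a (f j) \<ge> 0" "a (?cf j) \<ge> 0" if "j \<in> ?J" for j using a(1) f[OF that] C1fun_cnj by auto
 then have D0: "D \<ge> 0" unfolding D_def by (intro sum_nonneg add_nonneg_nonneg)
 have D: "a (f j) \<le> D" "a (?cf j) \<le> D" if "j \<in> ?J" for j
  using member_le_sum[of j ?J "%j. a (f j) + a (?cf j)"] a0 that unfolding D_def by fastforce+
 have defect: "sq k (g *. s -. Top k g s) \<le> D / k * sq k s" if "C1fun g" "a g \<le> D" "k \<ge> k0" "s \<in> H0 k" for g k s
  using a(2)[OF that(1,3,4)] mult_right_mono[OF divide_right_mono[OF that(2), of k] sq_nonneg] by (meson of_nat_0_le_iff order_trans)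
 have comm: "sq k (Top k (f j) (Top k (f l) s) -. Top k (f l) (Top k (f j) s)) \<le> (2 * D / k)\<^sup>2 * sq k s"
  if k: "k \<ge> k0" and j: "j \<in> ?J" and l: "l \<in> ?J" and s: "s \<in> H0 k" for k j l s
 proof -
  note kc = comp[OF k]
  let ?p = "%j l. Top k (%x. f j x * f l x) s"
  have prod: "sq k (Top k (f j) (Top k (f l) s) -. ?p j l) \<le> D / k * (D / k) * sq k s"
   "C1sec k (Top k (f j) (Top k (f l) s) -. ?p j l)" if j: "j \<in> ?J" and l: "l \<in> ?J" for j l
  proof -
   show "sq k (Top k (f j) (Top k (f l) s) -. ?p j l) \<le> D / k * (D / k) * sq k s"
    by (rule Top_product[OF kc f[OF j] f[OF l] s _ _ defect[OF f[OF l] D(1)[OF l] k] defect[OF C1fun_cnj[OF f[OF j]] D(2)[OF j] k]])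
      (use D0 in auto)
   show "C1sec k (Top k (f j) (Top k (f l) s) -. ?p j l)"
    by (intro C1sec_diff H0_C1sec Top_H0 kc f j l s C1fun_mult)
  qed
  \<comment> \<open>Both products approximate the Toeplitz operator of the same function, so the
    commutator is the difference of two errors of norm at most \<open>D / k\<close>.\<close>
  have "?p l j = ?p j l" by (simp add: mult.commute)
  with sq_add_le[OF prod(2)[OF j l] prod(2)[OF l j]] prod(1)[OF j l] prod(1)[OF l j]
  show ?thesis by (simp add: power2_eq_square)
 qed
 let ?P = "{\<sigma>. \<sigma> permutes ?J}"
 have P: "finite ?P" by (simp add: finite_permutations)
 have main: "generalized_commutator (2 * n) (%j. Top k (f j)) s \<in> H0 k \<and>
  sq k (generalized_commutator (2 * n) (%j. Top k (f j)) s) \<le> (real (card ?P) * (2 * D) ^ n / real k ^ n)\<^sup>2 * sq k s"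
  if k: "k \<ge> k0" and s: "s \<in> H0 k" for k s
 proof -
  let ?T = "%j. Top k (f j)" and ?G = "generalized_commutator (2 * n) (%j. Top k (f j)) s"
  let ?q = "(2 * D / real k)\<^sup>2"
  note kc = comp[OF k]
  have iter: "foldr (pair_op ?T \<sigma> n) ls u \<in> H0 k \<and> sq k (foldr (pair_op ?T \<sigma> n) ls u) \<le> ?q ^ length ls * sq k u"
   if \<sigma>: "\<sigma> \<in> ?P" and ls: "set ls \<subseteq> {..<n}" and u: "u \<in> H0 k" for \<sigma> ls u
   using ls
  proof (induction ls)
   case (Cons l ls)
   then have l: "l < n" and IH: "foldr (pair_op ?T \<sigma> n) ls u \<in> H0 k" "sq k (foldr (pair_op ?T \<sigma> n) ls u) \<le> ?q ^ length ls * sq k u" by auto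
   have p: "\<sigma> (2 * l + 1) \<in> ?J" "\<sigma> (2 * l + 2) \<in> ?J" using \<sigma> l permutes_in_image[of \<sigma> ?J] by auto
   let ?y = "foldr (pair_op ?T \<sigma> n) ls u"
   have "pair_op ?T \<sigma> n l ?y \<in> H0 k" using l p IH(1) by (auto simp: pair_op_def intro!: H0_diff Top_H0 kc f)
   moreover have "sq k (pair_op ?T \<sigma> n l ?y) \<le> ?q * sq k ?y" using comm[OF k p IH(1)] l by (simp add: pair_op_def)
   moreover have "?q * sq k ?y \<le> ?q * (?q ^ length ls * sq k u)" using IH(2) D0 by (intro mult_left_mono) auto
   ultimately show ?case by (simp add: mult.assoc)
  qed (use u in simp)
  let ?Q = "%\<sigma>. foldr (pair_op ?T \<sigma> n) [0..<n] s"
  let ?S = "%i x. \<Sum>\<sigma>\<in>?P. of_int (sign \<sigma>) * ?Q \<sigma> i x"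
  have QH: "?Q \<sigma> \<in> H0 k" "sq k (?Q \<sigma>) \<le> ?q ^ n * sq k s" if "\<sigma> \<in> ?P" for \<sigma> using iter[OF that _ s, of "[0..<n]"] by (simp_all add: atLeast0LessThan)
  have SH: "?S \<in> H0 k" by (intro H0_sum H0_scale QH)
  have G: "?G = (%i x. (1 / 2 ^ n) * ?S i x)"
  proof (intro ext)
   fix i x
   have "2 ^ n * ?G i x = ?S i x"
    unfolding generalized_commutator_def foldr_pairs[of ?T]
    by (rule commutator_pairing[where H="H0 k"]) (auto intro!: Top_H0 Top_diff H0_diff kc f s)
   then show "?G i x = (1 / 2 ^ n) * ?S i x" by (simp add: field_simps)
  qed
  \<comment> \<open>The factor \<open>1 / 2 ^ n\<close> left by the pairing is at most 1 and is
    dropped.\<close>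
  have "sq k ?G \<le> sq k ?S"
  proof -
   have "sq k ?G = (cmod (1 / 2 ^ n))\<^sup>2 * sq k ?S" unfolding G by (rule sq_scale)
   also have "... \<le> 1 * sq k ?S" by (intro mult_right_mono sq_nonneg) (simp add: norm_divide norm_power power_divide)
   finally show ?thesis by simp
  qed
  also have "... \<le> real (card ?P) * (\<Sum>\<sigma>\<in>?P. sq k (%i x. of_int (sign \<sigma>) * ?Q \<sigma> i x))"
   by (intro sq_sum_le P H0_C1sec H0_scale QH SH)
  also have "... \<le> real (card ?P) * (\<Sum>\<sigma>\<in>?P. ?q ^ n * sq k s)"
  proof (intro mult_left_mono sum_mono)
   fix \<sigma> assume \<sigma>: "\<sigma> \<in> ?P"
   have "cmod (of_int (sign \<sigma>)) = 1" by (simp add: sign_def)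
   then show "sq k (%i x. of_int (sign \<sigma>) * ?Q \<sigma> i x) \<le> ?q ^ n * sq k s" unfolding sq_scale using QH(2)[OF \<sigma>] by simp
  qed simp
  also have "... = (real (card ?P) * (2 * D) ^ n / real k ^ n)\<^sup>2 * sq k s"
   by (simp add: power_divide power_mult_distrib power2_eq_square) (simp flip: power_mult_distrib)
  finally have "sq k ?G \<le> (real (card ?P) * (2 * D) ^ n / real k ^ n)\<^sup>2 * sq k s" .
  moreover have "?G \<in> H0 k" unfolding G by (rule H0_scale[OF SH])
  ultimately show ?thesis by blast
 qed
 show ?thesis
  using main k0 D0 by (intro exI[of _ "real (card ?P) * (2 * D) ^ n"] exI[of _ k0]) auto
qed

end

theorem proposition3p5:
  fixes A :: "('m::t2_space, 'n::finite) chart set"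
    and \<omega> :: "('m, 'n, real) form2"
    and L :: "('m, 'i) line_bundle"
    and h :: "'i \<Rightarrow> 'm \<Rightarrow> real"
    and \<theta> :: "'i \<Rightarrow> ('m, 'n, complex) form1"
    and f :: "nat \<Rightarrow> 'm \<Rightarrow> complex"
  assumes "compact_connected_kahler_manifold A \<omega>"
    and "integral_class A (\<lambda>c p u v. \<omega> c p u v / (2 * pi))"
    and "holomorphic_line_bundle A L"
    and "hermitian_metric A L h"
    and "chern_connection A L h \<theta>"
    and "has_curvature A L \<theta> (\<lambda>c p u v. - \<i> * of_real (\<omega> c p u v))"
    and "\<forall>j\<in>{1..2 * CARD('n)}. f j \<in> smooth_functions A"
  shows "(\<lambda>k. L2_operator_norm A (volume_measure A \<omega>) (tensor_power L k) (metric_power h k)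
                (generalized_commutator (2 * CARD('n)) (\<lambda>j. berezin_toeplitz A \<omega> L h k (f j))))
         \<in> O(\<lambda>k. 1 / real k ^ CARD('n))"
proof -
 interpret hermitian_bundle A \<omega> L h \<theta>
  by (intro hermitian_bundle.intro kahler.intro hermitian_bundle_axioms.intro assms)
 have f: "C1fun (f j)" if "j \<in> {1..2 * CARD('n)}" for j
  unfolding C1fun_def
 proof
  fix c assume "c \<in> A"
  then have "smooth_on (cimg c) (%z. f j (chart_inv c z))"
   using assms(7) that unfolding smooth_functions_def smooth_fun_def comp_def Int_UNIV_right by blast
  then show "C1_on (cimg c) (%z. f j (chart_inv c z))" by (rule smooth_on_imp_C1_on)
 qed
 let ?G = "%k. generalized_commutator (2 * CARD('n)) (%j. Top k (f j))"
 let ?N = "%k. L2_operator_norm A vol (Lk k) (metric_power h k) (?G k)"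
 obtain C k0 where C: "C \<ge> 0" and bound: "!!k. k \<ge> k0 ==> k > 0"
  "!!k s. k \<ge> k0 ==> s \<in> H0 k ==> ?G k s \<in> H0 k"
  "!!k s. k \<ge> k0 ==> s \<in> H0 k ==> sq k (?G k s) \<le> (C / real k ^ CARD('n))\<^sup>2 * sq k s"
  using generalized_commutator_bound[where f=f and n="CARD('n)", OF f] by blast
 have norm: "L2_norm vol (Lk k) (metric_power h k) s = sqrt (sq k s)" if "s \<in> H0 k" for k s
  unfolding L2_norm_def inner_self[OF H0_C1sec[OF that]] by simp
 have "norm (?N k) \<le> C * norm (1 / real k ^ CARD('n))" if k: "k \<ge> k0" for k
 proof -
  let ?X = "{s \<in> H0 k. L2_norm vol (Lk k) (metric_power h k) s \<le> 1}"
  let ?B = "C / real k ^ CARD('n)"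
  have B: "?B \<ge> 0" using C by simp
  have le: "L2_norm vol (Lk k) (metric_power h k) (?G k s) \<le> ?B" if s: "s \<in> ?X" for s
  proof -
   have sH: "s \<in> H0 k" and s1: "sqrt (sq k s) \<le> 1" using s norm by auto
   have "sqrt (sq k (?G k s)) \<le> sqrt (?B\<^sup>2 * sq k s)" using bound(3)[OF k sH] by (rule real_sqrt_le_mono)
   also have "... = ?B * sqrt (sq k s)" unfolding real_sqrt_mult using C by simp
   also have "... \<le> ?B * 1" by (intro mult_left_mono s1 B)
   finally show ?thesis unfolding norm[OF bound(2)[OF k sH]] by simp
  qed
  \<comment> \<open>The zero section makes the index set of the supremum nonempty.\<close>
  have z: "(%i x. 0) \<in> ?X" using H0_zero[of k] norm[OF H0_zero] by (simp add: sq_def pn_def)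
  have "?N k \<le> ?B"
   unfolding L2_operator_norm_def by (rule cSUP_least) (use z le in blast)+
  \<comment> \<open>The Landau bound concerns the absolute value, so the supremum must also be shown
    nonnegative; this uses that its values are bounded above.\<close>
  moreover have "0 \<le> ?N k"
  proof -
   have "0 \<le> L2_norm vol (Lk k) (metric_power h k) (?G k (%i x. 0))"
    unfolding norm[OF bound(2)[OF k H0_zero]] by (simp add: sq_nonneg)
   also have "... \<le> ?N k"
    unfolding L2_operator_norm_def by (rule cSUP_upper[OF z]) (use le in \<open>auto intro!: bdd_aboveI[of _ ?B]\<close>)
   finally show ?thesis .
  qed
  ultimately show ?thesis by simp
 qed
 then show ?thesis by (intro bigoI[of _ C] eventually_sequentiallyI[of k0]) blast
qed

end
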